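(* Let $\Gamma\backslash G$ be a compact almost abelian solvmanifold endowed with a left-invariant complex structure $J$. Assume that the compact complex manifold $(\Gamma\backslash G,J)$ admits an SKT metric and admits a balanced metric. Then $(\Gamma\backslash G,J)$ admits a Kähler metric as well.
   Context: A Lie algebra is almost abelian if it contains an abelian ideal of codimension one. A compact almost abelian solvmanifold is the compact quotient $\Gamma\backslash G$ of a simply connected Lie group $G$ with almost abelian Lie algebra by a lattice (discrete co-compact subgroup) $\Gamma$. A complex structure on $\Gamma\backslash G$ is left-invariant if it is induced by a left-invariant complex structure on $G$. A Hermitian metric with fundamental form $\omega=g(J\cdot,\cdot)$ on a complex manifold of complex dimension $n$ is called balanced if $d\omega^{n-1}=0$, SKT (strong Kähler with torsion, or pluriclosed) if $\partial\overline\partial\omega=0$, and Kähler if $d\omega=0$. The SKT, balanced and Kähler metrics are not required to be left-invariant. *)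

theory Defs
  imports
    "HOL-Analysis.Analysis"
    "HOL-Library.Function_Algebras"
    "HOL-Combinatorics.Permutations"
    "HOL-Algebra.Coset"
begin

section \<open>Smooth manifolds\<close>

text \<open>For \<open>f\<close> of class \<open>C\<^sup>k\<close> on an open set \<open>S\<close>; \<open>k + 1\<close> times differentiable means
  differentiable with all directional derivatives of class \<open>C\<^sup>k\<close>.\<close>

primrec Ck_on :: "nat \<Rightarrow> 'a::euclidean_space set \<Rightarrow> ('a \<Rightarrow> 'b::real_normed_vector) \<Rightarrow> bool" where
  "Ck_on 0 S f \<longleftrightarrow> continuous_on S f"
| "Ck_on (Suc k) S f \<longleftrightarrow> (\<forall>x\<in>S. f differentiable (at x)) \<and>
     (\<forall>v. Ck_on k S (\<lambda>x. frechet_derivative f (at x) v))"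

definition smooth_on :: "'a::euclidean_space set \<Rightarrow> ('a \<Rightarrow> 'b::real_normed_vector) \<Rightarrow> bool" where
  "smooth_on S f \<longleftrightarrow> (\<forall>k. Ck_on k S f)"

text \<open>A chart is a pair of its domain and its coordinate map into the model space \<open>'e\<close>.
  The atlas is not required to be maximal.\<close>

record ('a, 'e) charted =
  mtop :: "'a topology"
  atlas :: "('a set \<times> ('a \<Rightarrow> 'e)) set"

definition points :: "('a, 'e) charted \<Rightarrow> 'a set" where
  "points M = topspace (mtop M)"

definition smooth_manifold :: "('a, 'e::euclidean_space) charted \<Rightarrow> bool" where
  "smooth_manifold M \<longleftrightarrow>
     Hausdorff_space (mtop M) \<and> second_countable (mtop M) \<and>
     (\<Union>(U, \<phi>)\<in>atlas M. U) = points M \<and>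
     (\<forall>(U, \<phi>)\<in>atlas M. openin (mtop M) U \<and> open (\<phi> ` U) \<and>
        homeomorphic_map (subtopology (mtop M) U) (top_of_set (\<phi> ` U)) \<phi>) \<and>
     (\<forall>(U, \<phi>)\<in>atlas M. \<forall>(V, \<psi>)\<in>atlas M. smooth_on (\<phi> ` (U \<inter> V)) (\<psi> \<circ> inv_into U \<phi>))"

definition smooth_map ::
  "('a, 'd::euclidean_space) charted \<Rightarrow> ('b, 'e::euclidean_space) charted \<Rightarrow> ('a \<Rightarrow> 'b) \<Rightarrow> bool" where
  "smooth_map M N f \<longleftrightarrow> continuous_map (mtop M) (mtop N) f \<and>
     (\<forall>(U, \<phi>)\<in>atlas M. \<forall>(V, \<psi>)\<in>atlas N.
        smooth_on (\<phi> ` {x \<in> U. f x \<in> V}) (\<psi> \<circ> f \<circ> inv_into U \<phi>))"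

definition prod_charted :: "('a, 'd) charted \<Rightarrow> ('b, 'e) charted \<Rightarrow> ('a \<times> 'b, 'd \<times> 'e) charted" where
  "prod_charted M N = \<lparr>mtop = prod_topology (mtop M) (mtop N),
     atlas = {(U \<times> V, map_prod \<phi> \<psi>) | U \<phi> V \<psi>. (U, \<phi>) \<in> atlas M \<and> (V, \<psi>) \<in> atlas N}\<rparr>"

text \<open>The ring \<open>C\<^sup>\<infinity>(M, \<complex>)\<close>. Functions are extended by \<open>0\<close> outside of \<open>M\<close>, so that
  equality of functions on the type is equality on \<open>M\<close>. Throughout, sums and products of functions
  (and sums of vector fields) are the pointwise ones.\<close>

definition smooth_funs :: "('a, 'e::euclidean_space) charted \<Rightarrow> ('a \<Rightarrow> complex) set" where
  "smooth_funs M = {f. (\<forall>x. x \<notin> points M \<longrightarrow> f x = 0) \<and>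
     (\<forall>(U, \<phi>)\<in>atlas M. smooth_on (\<phi> ` U) (f \<circ> inv_into U \<phi>))}"


section \<open>Vector fields\<close>

text \<open>Sections of the complexified tangent bundle, as complex derivations of \<open>C\<^sup>\<infinity>(M, \<complex>)\<close>;
  ordinary (real) vector fields are those preserving real-valued functions. A vector field is
  set to \<open>0\<close> on functions outside \<open>C\<^sup>\<infinity>(M, \<complex>)\<close>.\<close>

type_synonym 'a vfield = "('a \<Rightarrow> complex) \<Rightarrow> ('a \<Rightarrow> complex)"

definition vector_fields :: "('a, 'e::euclidean_space) charted \<Rightarrow> 'a vfield set" where
  "vector_fields M = {X.
     (\<forall>f\<in>smooth_funs M. X f \<in> smooth_funs M) \<and>
     (\<forall>f. f \<notin> smooth_funs M \<longrightarrow> X f = 0) \<and>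
     (\<forall>f\<in>smooth_funs M. \<forall>g\<in>smooth_funs M. X (f + g) = X f + X g) \<and>
     (\<forall>c. \<forall>f\<in>smooth_funs M. X ((\<lambda>_. c) * f) = (\<lambda>_. c) * X f) \<and>
     (\<forall>f\<in>smooth_funs M. \<forall>g\<in>smooth_funs M. X (f * g) = X f * g + f * X g)}"

definition real_fields :: "('a, 'e::euclidean_space) charted \<Rightarrow> 'a vfield set" where
  "real_fields M = {X \<in> vector_fields M. \<forall>f\<in>smooth_funs M. range f \<subseteq> \<real> \<longrightarrow> range (X f) \<subseteq> \<real>}"

definition fmult :: "('a \<Rightarrow> complex) \<Rightarrow> 'a vfield \<Rightarrow> 'a vfield" where
  "fmult h X = (\<lambda>f. h * X f)"

definition cscale :: "complex \<Rightarrow> 'a vfield \<Rightarrow> 'a vfield" where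
  "cscale c X = fmult (\<lambda>_. c) X"

definition bracket :: "'a vfield \<Rightarrow> 'a vfield \<Rightarrow> 'a vfield" where
  "bracket X Y = (\<lambda>f. X (Y f) - Y (X f))"


section \<open>Differential forms\<close>

text \<open>A complex-valued \<open>k\<close>-form is an alternating \<open>C\<^sup>\<infinity>(M, \<complex>)\<close>-multilinear map sending \<open>k\<close>
  vector fields \<open>X 0, \<dots>, X (k - 1)\<close> to a function; entries of \<open>X\<close> from \<open>k\<close> on are irrelevant.\<close>

type_synonym 'a form = "(nat \<Rightarrow> 'a vfield) \<Rightarrow> 'a \<Rightarrow> complex"

definition vanishes :: "('a, 'e::euclidean_space) charted \<Rightarrow> nat \<Rightarrow> 'a form \<Rightarrow> bool" where
  "vanishes M k \<alpha> \<longleftrightarrow> (\<forall>X. (\<forall>i<k. X i \<in> vector_fields M) \<longrightarrow> \<alpha> X = 0)"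

definition omit :: "nat \<Rightarrow> (nat \<Rightarrow> 'b) \<Rightarrow> nat \<Rightarrow> 'b" where
  "omit i X = (\<lambda>l. if l < i then X l else X (Suc l))"

text \<open>Exterior derivative of a \<open>k\<close>-form, by the invariant (Koszul) formula.\<close>

definition ext_d :: "nat \<Rightarrow> 'a form \<Rightarrow> 'a form" where
  "ext_d k \<alpha> = (\<lambda>X x.
     (\<Sum>i\<le>k. (-1) ^ i * X i (\<alpha> (omit i X)) x) +
     (\<Sum>j\<le>k. \<Sum>i<j. (-1) ^ (i + j) *
        \<alpha> (case_nat (bracket (X i) (X j)) (omit i (omit j X))) x))"

text \<open>Exterior product of a \<open>p\<close>-form and a \<open>q\<close>-form.\<close>

definition wedge :: "nat \<Rightarrow> nat \<Rightarrow> 'a form \<Rightarrow> 'a form \<Rightarrow> 'a form" where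
  "wedge p q \<alpha> \<beta> = (\<lambda>X x.
     (\<Sum>\<sigma> | \<sigma> permutes {..<p + q}.
        of_int (sign \<sigma>) * \<alpha> (\<lambda>i. X (\<sigma> i)) x * \<beta> (\<lambda>i. X (\<sigma> (p + i))) x) / (fact p * fact q))"

text \<open>The power \<open>\<omega>\<^sup>m\<close> of a 2-form; \<open>\<omega>\<^sup>0\<close> is the constant function \<open>1\<close> on \<open>M\<close>.\<close>

primrec wedge_power :: "('a, 'e) charted \<Rightarrow> 'a form \<Rightarrow> nat \<Rightarrow> 'a form" where
  "wedge_power M \<omega> 0 = (\<lambda>X. indicator (points M))"
| "wedge_power M \<omega> (Suc m) = wedge 2 (2 * m) \<omega> (wedge_power M \<omega> m)"


section \<open>Complex structures\<close>

text \<open>An almost complex structure is a real \<open>C\<^sup>\<infinity>\<close>-linear endomorphism of the vector fields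
  (extended complex linearly) squaring to \<open>-1\<close>; a complex structure is an integrable one,
  i.e. one with vanishing Nijenhuis tensor.\<close>

definition complex_structure :: "('a, 'e::euclidean_space) charted \<Rightarrow> ('a vfield \<Rightarrow> 'a vfield) \<Rightarrow> bool" where
  "complex_structure M J \<longleftrightarrow>
     (\<forall>X\<in>vector_fields M. J X \<in> vector_fields M) \<and>
     (\<forall>X\<in>real_fields M. J X \<in> real_fields M) \<and>
     (\<forall>X\<in>vector_fields M. \<forall>Y\<in>vector_fields M. J (X + Y) = J X + J Y) \<and>
     (\<forall>h\<in>smooth_funs M. \<forall>X\<in>vector_fields M. J (fmult h X) = fmult h (J X)) \<and>
     (\<forall>X\<in>vector_fields M. J (J X) = - X) \<and>
     (\<forall>X\<in>vector_fields M. \<forall>Y\<in>vector_fields M.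
        bracket (J X) (J Y) - J (bracket (J X) Y) - J (bracket X (J Y)) - bracket X Y = 0)"

definition part10 :: "('a vfield \<Rightarrow> 'a vfield) \<Rightarrow> 'a vfield \<Rightarrow> 'a vfield" where
  "part10 J X = cscale (1/2) (X - cscale \<i> (J X))"

definition part01 :: "('a vfield \<Rightarrow> 'a vfield) \<Rightarrow> 'a vfield \<Rightarrow> 'a vfield" where
  "part01 J X = cscale (1/2) (X + cscale \<i> (J X))"

text \<open>The component of type \<open>(p, q)\<close> of a \<open>(p + q)\<close>-form: decompose every argument into its
  parts of type \<open>(1, 0)\<close> and \<open>(0, 1)\<close>, expand, and keep the summands in which exactly
  \<open>p\<close> arguments are of type \<open>(1, 0)\<close>.\<close>

definition type_part :: "('a vfield \<Rightarrow> 'a vfield) \<Rightarrow> nat \<Rightarrow> nat \<Rightarrow> 'a form \<Rightarrow> 'a form" where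
  "type_part J p q \<alpha> = (\<lambda>X x.
     \<Sum>S | S \<subseteq> {..<p + q} \<and> card S = p.
       \<alpha> (\<lambda>i. if i \<in> S then part10 J (X i) else part01 J (X i)) x)"

text \<open>The Dolbeault operators \<open>\<partial>\<close> and \<open>\<partial>\<close>-bar on \<open>k\<close>-forms.\<close>

definition del :: "('a vfield \<Rightarrow> 'a vfield) \<Rightarrow> nat \<Rightarrow> 'a form \<Rightarrow> 'a form" where
  "del J k \<alpha> = (\<lambda>X x. \<Sum>p\<le>k.
     type_part J (p + 1) (k - p) (ext_d k (type_part J p (k - p) \<alpha>)) X x)"

definition delbar :: "('a vfield \<Rightarrow> 'a vfield) \<Rightarrow> nat \<Rightarrow> 'a form \<Rightarrow> 'a form" where
  "delbar J k \<alpha> = (\<lambda>X x. \<Sum>p\<le>k.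
     type_part J p (k - p + 1) (ext_d k (type_part J p (k - p) \<alpha>)) X x)"


section \<open>Hermitian metrics\<close>

text \<open>Riemannian metrics, extended complex bilinearly, for which \<open>J\<close> is orthogonal.
  A vector field \<open>X\<close> is nonzero at \<open>x\<close> iff \<open>X f x \<noteq> 0\<close> for some \<open>f\<close>.\<close>

definition hermitian_metric ::
  "('a, 'e::euclidean_space) charted \<Rightarrow> ('a vfield \<Rightarrow> 'a vfield) \<Rightarrow>
   ('a vfield \<Rightarrow> 'a vfield \<Rightarrow> 'a \<Rightarrow> complex) \<Rightarrow> bool" where
  "hermitian_metric M J g \<longleftrightarrow>
     (\<forall>X\<in>vector_fields M. \<forall>Y\<in>vector_fields M. g X Y \<in> smooth_funs M) \<and>
     (\<forall>X\<in>real_fields M. \<forall>Y\<in>real_fields M. range (g X Y) \<subseteq> \<real>) \<and>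
     (\<forall>X\<in>vector_fields M. \<forall>Y\<in>vector_fields M. g X Y = g Y X) \<and>
     (\<forall>X\<in>vector_fields M. \<forall>Y\<in>vector_fields M. \<forall>Z\<in>vector_fields M. g (X + Y) Z = g X Z + g Y Z) \<and>
     (\<forall>h\<in>smooth_funs M. \<forall>X\<in>vector_fields M. \<forall>Y\<in>vector_fields M. g (fmult h X) Y = h * g X Y) \<and>
     (\<forall>X\<in>real_fields M. \<forall>x\<in>points M. (\<exists>f\<in>smooth_funs M. X f x \<noteq> 0) \<longrightarrow> Re (g X X x) > 0) \<and>
     (\<forall>X\<in>vector_fields M. \<forall>Y\<in>vector_fields M. g (J X) (J Y) = g X Y)"

definition fundamental_form ::
  "('a vfield \<Rightarrow> 'a vfield) \<Rightarrow> ('a vfield \<Rightarrow> 'a vfield \<Rightarrow> 'a \<Rightarrow> complex) \<Rightarrow> 'a form" where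
  "fundamental_form J g = (\<lambda>X. g (J (X 0)) (X 1))"

definition kaehler_metric ::
  "('a, 'e::euclidean_space) charted \<Rightarrow> ('a vfield \<Rightarrow> 'a vfield) \<Rightarrow>
   ('a vfield \<Rightarrow> 'a vfield \<Rightarrow> 'a \<Rightarrow> complex) \<Rightarrow> bool" where
  "kaehler_metric M J g \<longleftrightarrow> hermitian_metric M J g \<and> vanishes M 3 (ext_d 2 (fundamental_form J g))"

definition SKT_metric ::
  "('a, 'e::euclidean_space) charted \<Rightarrow> ('a vfield \<Rightarrow> 'a vfield) \<Rightarrow>
   ('a vfield \<Rightarrow> 'a vfield \<Rightarrow> 'a \<Rightarrow> complex) \<Rightarrow> bool" where
  "SKT_metric M J g \<longleftrightarrow> hermitian_metric M J g \<and>
     vanishes M 4 (del J 3 (delbar J 2 (fundamental_form J g)))"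

text \<open>Here \<open>n\<close> is the complex dimension of \<open>M\<close>.\<close>

definition balanced_metric ::
  "nat \<Rightarrow> ('a, 'e::euclidean_space) charted \<Rightarrow> ('a vfield \<Rightarrow> 'a vfield) \<Rightarrow>
   ('a vfield \<Rightarrow> 'a vfield \<Rightarrow> 'a \<Rightarrow> complex) \<Rightarrow> bool" where
  "balanced_metric n M J g \<longleftrightarrow> hermitian_metric M J g \<and>
     vanishes M (2 * (n - 1) + 1)
       (ext_d (2 * (n - 1)) (wedge_power M (fundamental_form J g) (n - 1)))"


section \<open>Lie groups and their compact quotients\<close>

definition lie_group ::
  "'g::{t2_space, second_countable_topology} monoid \<Rightarrow> ('g, 'e::euclidean_space) charted \<Rightarrow> bool" where
  "lie_group G M \<longleftrightarrow> group G \<and> carrier G = UNIV \<and>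
     smooth_manifold M \<and> mtop M = euclidean \<and>
     smooth_map (prod_charted M M) M (\<lambda>(x, y). x \<otimes>\<^bsub>G\<^esub> y) \<and>
     smooth_map M M (\<lambda>x. inv\<^bsub>G\<^esub> x)"

text \<open>Push-forward of a vector field under the left translation by \<open>a\<close>.\<close>

definition left_push :: "'g monoid \<Rightarrow> 'g \<Rightarrow> 'g vfield \<Rightarrow> 'g vfield" where
  "left_push G a X = (\<lambda>f. X (f \<circ> (\<lambda>x. a \<otimes>\<^bsub>G\<^esub> x)) \<circ> (\<lambda>x. inv\<^bsub>G\<^esub> a \<otimes>\<^bsub>G\<^esub> x))"

definition lie_algebra :: "'g monoid \<Rightarrow> ('g, 'e::euclidean_space) charted \<Rightarrow> 'g vfield set" where
  "lie_algebra G M = {X \<in> real_fields M. \<forall>a\<in>carrier G. left_push G a X = X}"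

text \<open>The real Lie algebra \<open>L\<close> of vector fields has an abelian ideal \<open>I\<close> of codimension one
  (\<open>L\<close> is the direct sum of \<open>I\<close> and the line through \<open>Z\<close>).\<close>

definition almost_abelian :: "'a vfield set \<Rightarrow> bool" where
  "almost_abelian L \<longleftrightarrow> (\<exists>I\<subseteq>L.
     0 \<in> I \<and> (\<forall>X\<in>I. \<forall>Y\<in>I. X + Y \<in> I) \<and> (\<forall>c::real. \<forall>X\<in>I. cscale (of_real c) X \<in> I) \<and>
     (\<forall>X\<in>L. \<forall>Y\<in>I. bracket X Y \<in> I) \<and>
     (\<forall>X\<in>I. \<forall>Y\<in>I. bracket X Y = 0) \<and>
     (\<exists>Z\<in>L - I. \<forall>X\<in>L. \<exists>c::real. X - cscale (of_real c) Z \<in> I))"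

definition left_invariant_complex_structure ::
  "'g monoid \<Rightarrow> ('g, 'e::euclidean_space) charted \<Rightarrow> ('g vfield \<Rightarrow> 'g vfield) \<Rightarrow> bool" where
  "left_invariant_complex_structure G M J \<longleftrightarrow> complex_structure M J \<and>
     (\<forall>a\<in>carrier G. \<forall>X\<in>vector_fields M. J (left_push G a X) = left_push G a (J X))"

definition quotient_topology :: "'a topology \<Rightarrow> ('a \<Rightarrow> 'b) \<Rightarrow> 'b topology" where
  "quotient_topology X p =
     topology (\<lambda>V. V \<subseteq> p ` topspace X \<and> openin X {x \<in> topspace X. p x \<in> V})"

lemma openin_quotient_topology:
  "openin (quotient_topology X p) V \<longleftrightarrow> V \<subseteq> p ` topspace X \<and> openin X {x \<in> topspace X. p x \<in> V}"
proof -
  have "istopology (\<lambda>V. V \<subseteq> p ` topspace X \<and> openin X {x \<in> topspace X. p x \<in> V})"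
    unfolding istopology_def
  proof (intro conjI allI impI)
    fix S T
    assume "S \<subseteq> p ` topspace X \<and> openin X {x \<in> topspace X. p x \<in> S}"
      and "T \<subseteq> p ` topspace X \<and> openin X {x \<in> topspace X. p x \<in> T}"
    moreover have "{x \<in> topspace X. p x \<in> S \<inter> T}
        = {x \<in> topspace X. p x \<in> S} \<inter> {x \<in> topspace X. p x \<in> T}" by auto
    ultimately show "S \<inter> T \<subseteq> p ` topspace X" "openin X {x \<in> topspace X. p x \<in> S \<inter> T}"
      by auto
  next
    fix \<K>
    assume *: "\<forall>K\<in>\<K>. K \<subseteq> p ` topspace X \<and> openin X {x \<in> topspace X. p x \<in> K}"
    then show "\<Union>\<K> \<subseteq> p ` topspace X" by auto
    have "{x \<in> topspace X. p x \<in> \<Union>\<K>} = (\<Union>K\<in>\<K>. {x \<in> topspace X. p x \<in> K})" by auto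
    with * show "openin X {x \<in> topspace X. p x \<in> \<Union>\<K>}" by auto
  qed
  then show ?thesis
    by (simp add: quotient_topology_def topology_inverse')
qed

lemma topspace_quotient_topology: "topspace (quotient_topology X p) = p ` topspace X"
proof
  show "topspace (quotient_topology X p) \<subseteq> p ` topspace X"
    using openin_quotient_topology[of X p "topspace (quotient_topology X p)"] by simp
  have "{x \<in> topspace X. p x \<in> p ` topspace X} = topspace X" by auto
  then have "openin (quotient_topology X p) (p ` topspace X)"
    by (simp add: openin_quotient_topology)
  then show "p ` topspace X \<subseteq> topspace (quotient_topology X p)"
    by (rule openin_subset)
qed

lemma quotient_map_quotient_topology: "quotient_map X (quotient_topology X p) p"
  unfolding quotient_map_def
  by (auto simp: topspace_quotient_topology openin_quotient_topology)

text \<open>The quotient \<open>\<Gamma>\<setminus>G\<close>, whose points are the cosets \<open>\<Gamma>x\<close>. Its charts are the charts of \<open>G\<close>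
  restricted to open sets on which the projection is injective.\<close>

definition coset_proj :: "'g monoid \<Rightarrow> 'g set \<Rightarrow> 'g \<Rightarrow> 'g set" where
  "coset_proj G \<Gamma> x = \<Gamma> #>\<^bsub>G\<^esub> x"

definition quotient_manifold ::
  "'g monoid \<Rightarrow> 'g set \<Rightarrow> ('g, 'e) charted \<Rightarrow> ('g set, 'e) charted" where
  "quotient_manifold G \<Gamma> M = \<lparr>mtop = quotient_topology (mtop M) (coset_proj G \<Gamma>),
     atlas = {(coset_proj G \<Gamma> ` U, \<phi> \<circ> inv_into U (coset_proj G \<Gamma>)) | U V \<phi>.
       (V, \<phi>) \<in> atlas M \<and> U \<subseteq> V \<and> openin (mtop M) U \<and> inj_on (coset_proj G \<Gamma>) U}\<rparr>"

definition uniform_lattice ::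
  "'g::topological_space monoid \<Rightarrow> ('g, 'e) charted \<Rightarrow> 'g set \<Rightarrow> bool" where
  "uniform_lattice G M \<Gamma> \<longleftrightarrow> subgroup \<Gamma> G \<and> discrete \<Gamma> \<and> compact_space (mtop (quotient_manifold G \<Gamma> M))"

text \<open>The vector field \<open>X'\<close> on \<open>G\<close> projects to the vector field \<open>X\<close> on \<open>\<Gamma>\<setminus>G\<close>.\<close>

definition projects_to ::
  "'g monoid \<Rightarrow> 'g set \<Rightarrow> ('g, 'e::euclidean_space) charted \<Rightarrow> 'g vfield \<Rightarrow> 'g set vfield \<Rightarrow> bool" where
  "projects_to G \<Gamma> M X' X \<longleftrightarrow>
     (\<forall>f\<in>smooth_funs (quotient_manifold G \<Gamma> M). X' (f \<circ> coset_proj G \<Gamma>) = X f \<circ> coset_proj G \<Gamma>)"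

text \<open>\<open>J\<close> is a complex structure on \<open>\<Gamma>\<setminus>G\<close> induced by a left-invariant one on \<open>G\<close>; since every
  vector field on \<open>\<Gamma>\<setminus>G\<close> lifts to \<open>G\<close>, the relation determines \<open>J\<close> on vector fields.\<close>

definition invariant_complex_structure_on_quotient ::
  "'g monoid \<Rightarrow> 'g set \<Rightarrow> ('g, 'e::euclidean_space) charted \<Rightarrow> ('g set vfield \<Rightarrow> 'g set vfield) \<Rightarrow> bool" where
  "invariant_complex_structure_on_quotient G \<Gamma> M J \<longleftrightarrow>
     complex_structure (quotient_manifold G \<Gamma> M) J \<and>
     (\<exists>J'. left_invariant_complex_structure G M J' \<and>
        (\<forall>X'\<in>vector_fields M. \<forall>X\<in>vector_fields (quotient_manifold G \<Gamma> M).
           projects_to G \<Gamma> M X' X \<longrightarrow> projects_to G \<Gamma> M (J' X') (J X)))"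

end

theory Submission
  imports Defs "HOL-Real_Asymp.Real_Asymp"
begin

text \<open>The group \<open>G\<close> is solvable, so by the Markov--Kakutani argument the bounded functions on it carry a
  mean that is invariant under right translations. Restricted to smooth functions on the compact quotient
  it vanishes on derivatives along left-invariant fields, and hence commutes with the Koszul formula:
  averaging a Hermitian metric or a power of its fundamental form produces left-invariant tensors which
  satisfy the same closedness equations. No Haar measure is needed.

  Let \<open>\<nn>\<close> be the abelian ideal, \<open>\<nn>\<^sub>1 = \<nn> \<inter> j\<nn>\<close> and \<open>B = ad Z\<close> for \<open>Z\<close> complementary to \<open>\<nn>\<close>; integrability
  makes \<open>B\<close> commute with \<open>j\<close> on \<open>\<nn>\<^sub>1\<close>. The balanced condition says that \<open>B\<close> is trace free on \<open>\<nn>\<^sub>1\<close> and has an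
  eigenvector \<open>v\<close> in \<open>\<nn> - \<nn>\<^sub>1\<close>, \<open>B v = a v\<close>. The SKT condition, evaluated on \<open>v, u\<close> of type \<open>(1,0)\<close> and
  \<open>v, w\<close> of type \<open>(0,1)\<close>, reads
  \<open>g(B\<^sup>2u,w) + 2g(Bu,Bw) + g(u,B\<^sup>2w) + a (g(Bu,w) + g(u,Bw)) = 0\<close>.
  Summing over an orthonormal basis \<open>u = w = u\<^sub>i\<close> of \<open>\<nn>\<^sub>1\<close>, the sum of the squares \<open>(g(Bu\<^sub>i,u\<^sub>l) + g(Bu\<^sub>l,u\<^sub>i))\<^sup>2\<close>
  vanishes, so \<open>B\<close> is skew on \<open>\<nn>\<^sub>1\<close>. Then the left-invariant metric that extends \<open>g\<close> on \<open>\<nn>\<^sub>1\<close> and makes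
  \<open>v, jv\<close> orthonormal and orthogonal to \<open>\<nn>\<^sub>1\<close> is Kaehler.\<close>


section \<open>Smooth functions\<close>

text \<open>Vector fields are derivations of the ring of global functions, so local facts are
  reached only through bump functions and Hadamard's lemma. What they yield is a global frame of the
  quotient with smooth coefficient functions, in which all tensors are computed. Right translations
  matter because left-invariant fields generate them and they act on the cosets
  \<open>\<Gamma> x\<close>. Solvability enters through \<open>Ad\<close>: its matrix coefficients
  solve linear systems that have unique solutions on the connected group, and this puts commutators
  into kernels of \<open>Ad\<close>. The balanced equation is not linear in the metric; therefore
  the power of the fundamental form is averaged and not the metric, and the result is used merely as
  an alternating form on the ideal. It does not average out on \<open>n1\<close>, since on a fixed
  basis it has no zero and hence one sign. The SKT and the balanced metric are unrelated and meet in
  \<open>B\<close> alone: the trace and the eigenvector found with one are used in an orthonormal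
  basis of the other.\<close>

abbreviation D :: "('a::real_normed_vector \<Rightarrow> 'b::real_normed_vector) \<Rightarrow> 'a \<Rightarrow> 'a \<Rightarrow> 'b"
  where "D f x \<equiv> frechet_derivative f (at x)"

lemma D_has_derivative: "f differentiable (at x) \<Longrightarrow> (f has_derivative D f x) (at x)"
  by (simp add: frechet_derivative_works)

lemma D_eqI: "(f has_derivative f') (at x) \<Longrightarrow> D f x = f'"
  using frechet_derivative_at by force

lemma D_cong:
  assumes "open S" "x \<in> S" "\<And>y. y \<in> S \<Longrightarrow> f y = g y"
  shows "D f x = D g x"
proof -
  have "(f has_derivative f') (at x) \<longleftrightarrow> (g has_derivative f') (at x)" for f'
    using has_derivative_transform_within_open[OF _ assms(1,2)] assms(3) by metis
  then show ?thesis unfolding frechet_derivative_def by simp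
qed

lemma differentiable_cong_open:
  assumes "open S" "x \<in> S" "\<And>y. y \<in> S \<Longrightarrow> f y = g y"
  shows "f differentiable (at x) \<longleftrightarrow> g differentiable (at x)"
proof -
  have "(f has_derivative f') (at x) \<longleftrightarrow> (g has_derivative f') (at x)" for f'
    using has_derivative_transform_within_open[OF _ assms(1,2)] assms(3) by metis
  then show ?thesis unfolding differentiable_def by simp
qed

lemma D_expand:
  fixes f :: "'a::euclidean_space \<Rightarrow> 'b::real_normed_vector"
  assumes "f differentiable (at x)"
  shows "D f x v = (\<Sum>b\<in>Basis. (v \<bullet> b) *\<^sub>R D f x b)"
proof -
  interpret linear "D f x" using assms by (rule linear_frechet_derivative)
  have "D f x v = D f x (\<Sum>b\<in>Basis. (v \<bullet> b) *\<^sub>R b)" by (simp add: euclidean_representation)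
  then show ?thesis by (simp add: sum scaleR)
qed

lemma D_add: "f differentiable (at x) \<Longrightarrow> D f x (v + w) = D f x v + D f x w"
  by (simp add: linear_add linear_frechet_derivative)

lemma D_scale: "f differentiable (at x) \<Longrightarrow> D f x (c *\<^sub>R v) = c *\<^sub>R D f x v"
  by (simp add: linear_scale linear_frechet_derivative)

lemma D_comp:
  assumes "f differentiable (at x)" "g differentiable (at (f x))"
  shows "D (\<lambda>x. g (f x)) x v = D g (f x) (D f x v)" "(\<lambda>x. g (f x)) differentiable (at x)"
proof -
  have "((\<lambda>x. g (f x)) has_derivative (\<lambda>v. D g (f x) (D f x v))) (at x)"
    using has_derivative_compose[OF D_has_derivative[OF assms(1)] D_has_derivative[OF assms(2)]] .
  then show "D (\<lambda>x. g (f x)) x v = D g (f x) (D f x v)" "(\<lambda>x. g (f x)) differentiable (at x)"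
    by (auto simp: D_eqI differentiable_def)
qed

text \<open>Derivatives in \<open>Ck_on\<close> are taken at \<open>x\<close> in the whole space and
  not within \<open>S\<close>; openness of \<open>S\<close> is what lets agreement on
  \<open>S\<close> carry over to them.\<close>

lemma Ck_on_cong:
  assumes "open S" "\<And>x. x \<in> S \<Longrightarrow> f x = g x"
  shows "Ck_on k S f \<longleftrightarrow> Ck_on k S g"
  using assms(2)
proof (induction k arbitrary: f g)
  case 0 then show ?case using continuous_on_cong by force
next
  case (Suc k)
  have "D f x v = D g x v" if "x \<in> S" for x v
    using D_cong[OF assms(1) that, of f g] Suc.prems by simp
  then have "Ck_on k S (\<lambda>x. D f x v) \<longleftrightarrow> Ck_on k S (\<lambda>x. D g x v)" for v
    by (intro Suc.IH) auto
  moreover have "f differentiable (at x) \<longleftrightarrow> g differentiable (at x)" if "x \<in> S" for x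
    using differentiable_cong_open[OF assms(1) that, of f g] Suc.prems by simp
  ultimately show ?case by simp
qed

lemma Ck_on_subset: "Ck_on k S f \<Longrightarrow> T \<subseteq> S \<Longrightarrow> Ck_on k T f"
proof (induction k arbitrary: f)
  case 0 then show ?case using continuous_on_subset by auto
qed auto

lemma Ck_on_local:
  assumes "\<And>x. x \<in> S \<Longrightarrow> \<exists>T. open T \<and> x \<in> T \<and> Ck_on k T f"
  shows "Ck_on k S f"
  using assms
proof (induction k arbitrary: f)
  case 0
  have "continuous (at x) f" if "x \<in> S" for x
    using 0[OF that] continuous_on_eq_continuous_at by auto
  then show ?case by (auto simp: continuous_at_imp_continuous_on)
next
  case (Suc k)
  have "f differentiable (at x)" if "x \<in> S" for x using Suc.prems[OF that] by auto
  moreover have "Ck_on k S (\<lambda>x. D f x v)" for v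
    using Suc.prems by (intro Suc.IH) fastforce
  ultimately show ?case by simp
qed

lemma Ck_on_Suc: "Ck_on (Suc k) S f \<Longrightarrow> Ck_on k S f"
proof (induction k arbitrary: f)
  case 0 then show ?case
    by (auto intro!: continuous_at_imp_continuous_on differentiable_imp_continuous_within)
next
  case (Suc k) then show ?case by (metis Ck_on.simps(2))
qed

lemma Ck_on_const: "Ck_on k S (\<lambda>x. c)"
proof (induction k arbitrary: c)
  case (Suc k)
  then show ?case by simp
qed simp

lemma Ck_on_add:
  assumes "open S"
  shows "Ck_on k S f \<Longrightarrow> Ck_on k S g \<Longrightarrow> Ck_on k S (\<lambda>x. f x + g x)"
proof (induction k arbitrary: f g)
  case 0 then show ?case by (simp add: continuous_on_add)
next
  case (Suc k)
  have d: "((\<lambda>x. f x + g x) has_derivative (\<lambda>v. D f x v + D g x v)) (at x)" if "x \<in> S" for x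
    using Suc.prems that by (auto intro!: has_derivative_add D_has_derivative)
  have "Ck_on k S (\<lambda>x. D f x v + D g x v)" for v using Suc by simp
  then have "Ck_on k S (\<lambda>x. D (\<lambda>x. f x + g x) x v)" for v
    by (subst Ck_on_cong[OF \<open>open S\<close> D_eqI[OF d, THEN fun_cong]])
  then show ?case using d by (auto simp: differentiable_def)
qed

lemma Ck_on_sum:
  assumes "open S" "finite A" "\<And>i. i \<in> A \<Longrightarrow> Ck_on k S (f i)"
  shows "Ck_on k S (\<lambda>x. \<Sum>i\<in>A. f i x)"
  using assms(2,3) by (induction A) (auto intro: Ck_on_const Ck_on_add[OF assms(1)])

lemma Ck_on_linear:
  assumes "open S" "bounded_linear h"
  shows "Ck_on k S f \<Longrightarrow> Ck_on k S (\<lambda>x. h (f x))"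
proof (induction k arbitrary: f)
  case 0 then show ?case using assms by (simp add: linear_continuous_on_compose bounded_linear.continuous_on)
next
  case (Suc k)
  have d: "((\<lambda>x. h (f x)) has_derivative (\<lambda>v. h (D f x v))) (at x)" if "x \<in> S" for x
    using Suc.prems that by (auto intro!: bounded_linear.has_derivative[OF assms(2)] D_has_derivative)
  have "Ck_on k S (\<lambda>x. h (D f x v))" for v using Suc by simp
  then have "Ck_on k S (\<lambda>x. D (\<lambda>x. h (f x)) x v)" for v
    by (subst Ck_on_cong[OF \<open>open S\<close> D_eqI[OF d, THEN fun_cong]])
  then show ?case using d by (auto simp: differentiable_def)
qed

lemma Ck_on_bilinear:
  assumes "open S" "bounded_bilinear h"
  shows "Ck_on k S f \<Longrightarrow> Ck_on k S g \<Longrightarrow> Ck_on k S (\<lambda>x. h (f x) (g x))"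
proof (induction k arbitrary: f g)
  case 0 then show ?case using assms by (simp add: bounded_bilinear.continuous_on)
next
  case (Suc k)
  have d: "((\<lambda>x. h (f x) (g x)) has_derivative (\<lambda>v. h (f x) (D g x v) + h (D f x v) (g x))) (at x)"
    if "x \<in> S" for x
    using Suc.prems that by (auto intro!: bounded_bilinear.FDERIV[OF assms(2)] D_has_derivative)
  have "Ck_on k S f" "Ck_on k S g" using Suc.prems Ck_on_Suc by blast+
  then have "Ck_on k S (\<lambda>x. h (f x) (D g x v) + h (D f x v) (g x))" for v
    using Suc by (intro Ck_on_add[OF assms(1)]) auto
  then have "Ck_on k S (\<lambda>x. D (\<lambda>x. h (f x) (g x)) x v)" for v
    by (subst Ck_on_cong[OF \<open>open S\<close> D_eqI[OF d, THEN fun_cong]])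
  then show ?case using d by (auto simp: differentiable_def)
qed

lemma Ck_on_compose:
  fixes f :: "'a::euclidean_space \<Rightarrow> 'b::euclidean_space"
  assumes "open S" "open T" "f ` S \<subseteq> T"
  shows "Ck_on k S f \<Longrightarrow> Ck_on k T g \<Longrightarrow> Ck_on k S (\<lambda>x. g (f x))"
proof (induction k arbitrary: g)
  case 0 then show ?case using assms by (auto intro: continuous_on_compose2)
next
  case (Suc k)
  have df: "f differentiable (at x)" and dg: "g differentiable (at (f x))" if "x \<in> S" for x
    using Suc.prems that assms by auto
  \<comment> \<open>The direction \<open>D f x v\<close> moves with \<open>x\<close>, whereas the
    induction hypothesis speaks about derivatives of \<open>g\<close> in a fixed direction; hence
    the chain rule is expanded over the basis.\<close>
  have e: "D (\<lambda>x. g (f x)) x v = (\<Sum>b\<in>Basis. (D f x v \<bullet> b) *\<^sub>R D g (f x) b)" if "x \<in> S" for x v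
    using D_comp[OF df dg] D_expand[OF dg] that by metis
  have "Ck_on k S (\<lambda>x. (D f x v \<bullet> b) *\<^sub>R D g (f x) b)" for v b
  proof (rule Ck_on_bilinear[OF assms(1) bounded_bilinear_scaleR])
    show "Ck_on k S (\<lambda>x. D f x v \<bullet> b)"
      using Suc.prems by (intro Ck_on_linear[OF assms(1) bounded_linear_inner_left]) simp
    show "Ck_on k S (\<lambda>x. D g (f x) b)"
      using Suc.prems Suc.IH[of "\<lambda>y. D g y b"] Ck_on_Suc[of k S f] by simp
  qed
  then have "Ck_on k S (\<lambda>x. \<Sum>b\<in>Basis. (D f x v \<bullet> b) *\<^sub>R D g (f x) b)" for v
    by (intro Ck_on_sum[OF assms(1)]) auto
  then have "Ck_on k S (\<lambda>x. D (\<lambda>x. g (f x)) x v)" for v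
    by (subst Ck_on_cong[OF assms(1) e])
  then show ?case using D_comp(2)[OF df dg] by simp
qed

text \<open>A coinductive form of smoothness. For the converse each \<open>Ck_on k\<close> is
  reached from \<open>Ck_on (Suc k)\<close>, which also yields the continuity that the right-hand
  side leaves implicit.\<close>

lemma smooth_on_iff_D:
  "smooth_on S f \<longleftrightarrow> (\<forall>x\<in>S. f differentiable (at x)) \<and> (\<forall>v. smooth_on S (\<lambda>x. D f x v))"
proof
  assume a: "smooth_on S f"
  then have "Ck_on (Suc k) S f" for k unfolding smooth_on_def by blast
  then show "(\<forall>x\<in>S. f differentiable (at x)) \<and> (\<forall>v. smooth_on S (\<lambda>x. D f x v))"
    by (auto simp: smooth_on_def)
next
  assume a: "(\<forall>x\<in>S. f differentiable (at x)) \<and> (\<forall>v. smooth_on S (\<lambda>x. D f x v))"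
  then have "Ck_on (Suc k) S f" for k by (auto simp: smooth_on_def)
  then show "smooth_on S f" unfolding smooth_on_def using Ck_on_Suc by blast
qed

lemma smooth_on_differentiable: "smooth_on S f \<Longrightarrow> x \<in> S \<Longrightarrow> f differentiable (at x)"
  using smooth_on_iff_D by blast

lemma smooth_on_D: "smooth_on S f \<Longrightarrow> smooth_on S (\<lambda>x. D f x v)"
  using smooth_on_iff_D by blast

lemma smooth_on_continuous_on: "smooth_on S f \<Longrightarrow> continuous_on S f"
  unfolding smooth_on_def by (metis Ck_on.simps(1))

lemma smooth_on_cong: "open S \<Longrightarrow> (\<And>x. x \<in> S \<Longrightarrow> f x = g x) \<Longrightarrow> smooth_on S f \<longleftrightarrow> smooth_on S g"
  unfolding smooth_on_def using Ck_on_cong by blast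

lemma smooth_on_subset: "smooth_on S f \<Longrightarrow> T \<subseteq> S \<Longrightarrow> smooth_on T f"
  unfolding smooth_on_def using Ck_on_subset by blast

lemma smooth_on_local:
  "(\<And>x. x \<in> S \<Longrightarrow> \<exists>T. open T \<and> x \<in> T \<and> smooth_on T f) \<Longrightarrow> smooth_on S f"
  unfolding smooth_on_def by (meson Ck_on_local)

lemma smooth_on_const: "smooth_on S (\<lambda>x. c)"
  unfolding smooth_on_def using Ck_on_const by blast

lemma smooth_on_add:
  "open S \<Longrightarrow> smooth_on S f \<Longrightarrow> smooth_on S g \<Longrightarrow> smooth_on S (\<lambda>x. f x + g x)"
  unfolding smooth_on_def using Ck_on_add by blast

lemma smooth_on_sum:
  "open S \<Longrightarrow> finite A \<Longrightarrow> (\<And>i. i \<in> A \<Longrightarrow> smooth_on S (f i)) \<Longrightarrow> smooth_on S (\<lambda>x. \<Sum>i\<in>A. f i x)"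
  unfolding smooth_on_def by (auto intro!: Ck_on_sum)

lemma smooth_on_linear:
  "open S \<Longrightarrow> bounded_linear h \<Longrightarrow> smooth_on S f \<Longrightarrow> smooth_on S (\<lambda>x. h (f x))"
  unfolding smooth_on_def using Ck_on_linear by blast

lemma smooth_on_bilinear:
  "open S \<Longrightarrow> bounded_bilinear h \<Longrightarrow> smooth_on S f \<Longrightarrow> smooth_on S g \<Longrightarrow> smooth_on S (\<lambda>x. h (f x) (g x))"
  unfolding smooth_on_def using Ck_on_bilinear by blast

lemmas smooth_on_mult = smooth_on_bilinear[OF _ bounded_bilinear_mult]
lemmas smooth_on_scaleR = smooth_on_bilinear[OF _ bounded_bilinear_scaleR]

lemma smooth_on_compose:
  fixes f :: "'a::euclidean_space \<Rightarrow> 'b::euclidean_space"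
  shows "open S \<Longrightarrow> open T \<Longrightarrow> f ` S \<subseteq> T \<Longrightarrow> smooth_on S f \<Longrightarrow> smooth_on T g \<Longrightarrow> smooth_on S (\<lambda>x. g (f x))"
  unfolding smooth_on_def using Ck_on_compose by blast

lemma smooth_on_id: "smooth_on S (\<lambda>x. x)"
  by (subst smooth_on_iff_D) (auto intro: smooth_on_const)

lemma smooth_on_bounded_linear: "open S \<Longrightarrow> bounded_linear h \<Longrightarrow> smooth_on S h"
  using smooth_on_linear[OF _ _ smooth_on_id, of S h] by simp

lemma smooth_on_Pair:
  assumes "open S" "smooth_on S f" "smooth_on S g"
  shows "smooth_on S (\<lambda>x. (f x, g x))"
proof -
  have b1: "bounded_linear (\<lambda>u::'b. (u, 0::'c))" and b2: "bounded_linear (\<lambda>u::'c. (0::'b, u))"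
    by (auto intro: bounded_linear_Pair bounded_linear_ident bounded_linear_zero)
  have "smooth_on S (\<lambda>x. (f x, 0) + (0, g x))"
    using smooth_on_linear[OF assms(1) b1 assms(2)] smooth_on_linear[OF assms(1) b2 assms(3)]
    by (intro smooth_on_add[OF assms(1)])
  then show ?thesis by simp
qed

lemma smooth_on_componentwise:
  fixes f :: "'a::euclidean_space \<Rightarrow> 'b::euclidean_space"
  assumes "open S" "\<And>b. b \<in> Basis \<Longrightarrow> smooth_on S (\<lambda>x. f x \<bullet> b)"
  shows "smooth_on S f"
proof -
  have "smooth_on S (\<lambda>x. \<Sum>b\<in>Basis. (f x \<bullet> b) *\<^sub>R b)"
    using assms by (intro smooth_on_sum smooth_on_scaleR smooth_on_const) auto
  then show ?thesis by (simp add: euclidean_representation)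
qed

text \<open>The derivative of a curve with velocity \<open>a\<close> is
  \<open>\<lambda>r. r *\<^sub>R a\<close>; a bound on the velocity becomes the bound that
  \<open>differentiable_bound\<close> asks for.\<close>

lemma onorm_scaleR_le:
  assumes "norm a \<le> K"
  shows "onorm (\<lambda>r::real. r *\<^sub>R a) \<le> K"
proof (rule onorm_bound)
  show "0 \<le> K" using assms norm_ge_zero order_trans by blast
  show "norm (r *\<^sub>R a) \<le> K * norm r" for r :: real
    using mult_right_mono[OF assms abs_ge_zero[of r]] by (simp add: mult.commute)
qed

text \<open>Both orders of differentiation are limits of the same second difference quotient.\<close>

lemma second_difference_estimate:
  fixes f :: "'a::euclidean_space \<Rightarrow> 'b::real_normed_vector"
  assumes S: "open S" "x \<in> S" and f: "smooth_on S f" and e: "e > 0"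
  shows "\<exists>\<delta>>0. \<forall>h. 0 < h \<and> h < \<delta> \<longrightarrow>
    norm (f (x + h *\<^sub>R u + h *\<^sub>R v) - f (x + h *\<^sub>R u) - f (x + h *\<^sub>R v) + f x
      - h\<^sup>2 *\<^sub>R D (\<lambda>y. D f y u) x v) \<le> e * h\<^sup>2"
proof -
  define G where "G = (\<lambda>y. D f y u)"
  define H where "H = (\<lambda>y. D G y v)"
  have G: "smooth_on S G" unfolding G_def by (rule smooth_on_D[OF f])
  have H: "smooth_on S H" unfolding H_def by (rule smooth_on_D[OF G])
  have "continuous (at x) H"
    using smooth_on_continuous_on[OF H] S continuous_on_eq_continuous_at by blast
  then obtain d1 where d1: "d1 > 0" "\<And>y. dist y x < d1 \<Longrightarrow> dist (H y) (H x) < e"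
    using e unfolding continuous_at_eps_delta by blast
  obtain d2 where d2: "d2 > 0" "ball x d2 \<subseteq> S" using S open_contains_ball by blast
  \<comment> \<open>Every \<open>x + s u + t v\<close> with \<open>s, t \<le> h < \<delta>\<close>
    stays within \<open>min d1 d2\<close> of \<open>x\<close>; the 1 keeps the denominator positive
    when \<open>u\<close> and \<open>v\<close> are 0.\<close>
  define \<delta> where "\<delta> = min d1 d2 / (norm u + norm v + 1)"
  have pos: "norm u + norm v + 1 > 0" by (simp add: add_nonneg_pos)
  have "\<delta> > 0" unfolding \<delta>_def using d1 d2 pos by simp
  have near: "x + s *\<^sub>R u + t *\<^sub>R v \<in> S \<and> norm (H (x + s *\<^sub>R u + t *\<^sub>R v) - H x) \<le> e"
    if "0 \<le> s" "s \<le> h" "0 \<le> t" "t \<le> h" "h < \<delta>" for s t h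
  proof -
    have "norm (s *\<^sub>R u + t *\<^sub>R v) \<le> s * norm u + t * norm v"
      using that norm_triangle_ineq[of "s *\<^sub>R u" "t *\<^sub>R v"] by simp
    also have "\<dots> \<le> h * norm u + h * norm v"
      using that by (intro add_mono mult_right_mono) auto
    also have "\<dots> \<le> h * (norm u + norm v + 1)" using that by (simp add: algebra_simps)
    also have "\<dots> < \<delta> * (norm u + norm v + 1)" using that pos by (intro mult_strict_right_mono) auto
    also have "\<dots> = min d1 d2" unfolding \<delta>_def using pos by simp
    finally have "dist (x + s *\<^sub>R u + t *\<^sub>R v) x < min d1 d2" by (simp add: dist_norm add.assoc)
    then have "x + s *\<^sub>R u + t *\<^sub>R v \<in> ball x d2" "dist (x + s *\<^sub>R u + t *\<^sub>R v) x < d1"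
      by (simp_all add: dist_commute)
    then show ?thesis using d1(2) d2(2) by (metis dist_norm less_imp_le subsetD)
  qed
  have "norm (f (x + h *\<^sub>R u + h *\<^sub>R v) - f (x + h *\<^sub>R u) - f (x + h *\<^sub>R v) + f x - h\<^sup>2 *\<^sub>R H x) \<le> e * h\<^sup>2"
    if h: "0 < h" "h < \<delta>" for h
  proof -
    \<comment> \<open>The mean value inequality along \<open>v\<close> produces one factor
      \<open>h\<close>; applied again along \<open>u\<close>, to \<open>\<phi>\<close> below, it
      produces the second.\<close>
    have inner: "norm (G (x + s *\<^sub>R u + h *\<^sub>R v) - G (x + s *\<^sub>R u) - h *\<^sub>R H x) \<le> e * h"
      if s: "0 \<le> s" "s \<le> h" for s
    proof -
      define \<psi> where "\<psi> = (\<lambda>t. G (x + s *\<^sub>R u + t *\<^sub>R v) - t *\<^sub>R H x)"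
      have d: "(\<psi> has_derivative (\<lambda>r. r *\<^sub>R (H (x + s *\<^sub>R u + t *\<^sub>R v) - H x))) (at t within {0..h})"
        if "t \<in> {0..h}" for t
      proof -
        have dG: "G differentiable (at (x + s *\<^sub>R u + t *\<^sub>R v))"
          using smooth_on_differentiable[OF G] near[OF s, of t] that h by auto
        have "((\<lambda>t. x + s *\<^sub>R u + t *\<^sub>R v) has_derivative (\<lambda>r. r *\<^sub>R v)) (at t within {0..h})"
          by (auto intro!: derivative_eq_intros)
        from has_derivative_compose[OF this D_has_derivative[OF dG]]
        have "((\<lambda>t. G (x + s *\<^sub>R u + t *\<^sub>R v)) has_derivative (\<lambda>r. r *\<^sub>R H (x + s *\<^sub>R u + t *\<^sub>R v)))
            (at t within {0..h})"
          using D_scale[OF dG] by (simp add: H_def)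
        then show ?thesis unfolding \<psi>_def
          by (auto intro!: derivative_eq_intros simp: scaleR_diff_right)
      qed
      have "norm (\<psi> h - \<psi> 0) \<le> e * norm (h - 0)"
      proof (rule differentiable_bound[OF _ d])
        fix t assume t: "t \<in> {0..h}"
        show "onorm (\<lambda>r. r *\<^sub>R (H (x + s *\<^sub>R u + t *\<^sub>R v) - H x)) \<le> e"
          using near[OF s, of t] t h by (intro onorm_scaleR_le) auto
      qed (use h in auto)
      then show ?thesis unfolding \<psi>_def using h by (simp add: algebra_simps)
    qed
    define \<phi> where "\<phi> = (\<lambda>s. f (x + s *\<^sub>R u + h *\<^sub>R v) - f (x + s *\<^sub>R u) - s *\<^sub>R (h *\<^sub>R H x))"
    have d: "(\<phi> has_derivative (\<lambda>r. r *\<^sub>R (G (x + s *\<^sub>R u + h *\<^sub>R v) - G (x + s *\<^sub>R u) - h *\<^sub>R H x)))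
        (at s within {0..h})" if "s \<in> {0..h}" for s
    proof -
      have df: "f differentiable (at (x + s *\<^sub>R u + h *\<^sub>R v))" "f differentiable (at (x + s *\<^sub>R u))"
        using smooth_on_differentiable[OF f] near[of s h h] near[of s h 0] that h by auto
      have "((\<lambda>s. x + s *\<^sub>R u + h *\<^sub>R v) has_derivative (\<lambda>r. r *\<^sub>R u)) (at s within {0..h})"
        "((\<lambda>s. x + s *\<^sub>R u) has_derivative (\<lambda>r. r *\<^sub>R u)) (at s within {0..h})"
        by (auto intro!: derivative_eq_intros)
      from has_derivative_compose[OF this(1) D_has_derivative[OF df(1)]]
        has_derivative_compose[OF this(2) D_has_derivative[OF df(2)]]
      have "((\<lambda>s. f (x + s *\<^sub>R u + h *\<^sub>R v)) has_derivative (\<lambda>r. r *\<^sub>R G (x + s *\<^sub>R u + h *\<^sub>R v))) (at s within {0..h})"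
        "((\<lambda>s. f (x + s *\<^sub>R u)) has_derivative (\<lambda>r. r *\<^sub>R G (x + s *\<^sub>R u))) (at s within {0..h})"
        using D_scale[OF df(1)] D_scale[OF df(2)] by (simp_all add: G_def)
      then show ?thesis unfolding \<phi>_def
        by (auto intro!: derivative_eq_intros simp: scaleR_diff_right)
    qed
    have "norm (\<phi> h - \<phi> 0) \<le> (e * h) * norm (h - 0)"
    proof (rule differentiable_bound[OF _ d])
      fix s assume s: "s \<in> {0..h}"
      show "onorm (\<lambda>r. r *\<^sub>R (G (x + s *\<^sub>R u + h *\<^sub>R v) - G (x + s *\<^sub>R u) - h *\<^sub>R H x)) \<le> e * h"
        using inner[of s] s by (intro onorm_scaleR_le) auto
    qed (use h in auto)
    then show ?thesis unfolding \<phi>_def using h by (simp add: algebra_simps power2_eq_square)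
  qed
  then show ?thesis using \<open>\<delta> > 0\<close> unfolding H_def G_def by blast
qed

lemma D_D_commute:
  fixes f :: "'a::euclidean_space \<Rightarrow> 'b::real_normed_vector"
  assumes S: "open S" "x \<in> S" and f: "smooth_on S f"
  shows "D (\<lambda>y. D f y u) x v = D (\<lambda>y. D f y v) x u"
proof (rule ccontr)
  assume ne: "\<not> ?thesis"
  let ?A = "D (\<lambda>y. D f y u) x v" and ?B = "D (\<lambda>y. D f y v) x u"
  \<comment> \<open>Both estimates concern the same second difference, so \<open>?A\<close> and
    \<open>?B\<close> differ by at most \<open>2 * e\<close>; dividing by 3 makes this a
    contradiction.\<close>
  define e where "e = norm (?A - ?B) / 3"
  have e: "e > 0" using ne by (simp add: e_def)
  obtain d1 where d1: "d1 > 0" and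
    1: "\<And>h. 0 < h \<and> h < d1 \<Longrightarrow> norm (f (x + h *\<^sub>R u + h *\<^sub>R v) - f (x + h *\<^sub>R u) - f (x + h *\<^sub>R v) + f x - h\<^sup>2 *\<^sub>R ?A) \<le> e * h\<^sup>2"
    using second_difference_estimate[OF S f e, of u v] by blast
  obtain d2 where d2: "d2 > 0" and
    2: "\<And>h. 0 < h \<and> h < d2 \<Longrightarrow> norm (f (x + h *\<^sub>R v + h *\<^sub>R u) - f (x + h *\<^sub>R v) - f (x + h *\<^sub>R u) + f x - h\<^sup>2 *\<^sub>R ?B) \<le> e * h\<^sup>2"
    using second_difference_estimate[OF S f e, of v u] by blast
  define h where "h = min d1 d2 / 2"
  have h: "0 < h" "h < d1" "h < d2" using d1 d2 by (auto simp: h_def)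
  let ?\<Delta> = "f (x + h *\<^sub>R u + h *\<^sub>R v) - f (x + h *\<^sub>R u) - f (x + h *\<^sub>R v) + f x"
  have n1: "norm (?\<Delta> - h\<^sup>2 *\<^sub>R ?A) \<le> e * h\<^sup>2" using 1[of h] h by simp
  have n2: "norm (?\<Delta> - h\<^sup>2 *\<^sub>R ?B) \<le> e * h\<^sup>2" using 2[of h] h by (simp add: algebra_simps)
  have "h\<^sup>2 *\<^sub>R (?A - ?B) = (?\<Delta> - h\<^sup>2 *\<^sub>R ?B) - (?\<Delta> - h\<^sup>2 *\<^sub>R ?A)"
    by (simp add: algebra_simps)
  then have "norm (h\<^sup>2 *\<^sub>R (?A - ?B)) \<le> e * h\<^sup>2 + e * h\<^sup>2"
    using order_trans[OF norm_triangle_ineq4 add_mono[OF n2 n1]] by (simp only:)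
  then have "norm (?A - ?B) * h\<^sup>2 \<le> (2 * e) * h\<^sup>2" by (simp add: mult.commute)
  then have "norm (?A - ?B) \<le> 2 * e" using h by simp
  then show False using e by (simp add: e_def)
qed


section \<open>Bump functions and Hadamard's lemma\<close>

text \<open>The classical flat function is the case \<open>n = 0\<close>. The powers of
  \<open>1/t\<close> are included because the derivative of one member is a combination of two other
  members, which lets smoothness be an induction with \<open>n\<close> arbitrary.\<close>

definition flat :: "nat \<Rightarrow> real \<Rightarrow> real" where
  "flat n t = (if t > 0 then (1/t) ^ n * exp (- (1/t)) else 0)"

lemma flat_div_tendsto_0: "((\<lambda>h. flat n h / h) \<longlongrightarrow> 0) (at 0)"
proof -
  have "((\<lambda>h::real. (1/h) ^ n * exp (- (1/h)) / h) \<longlongrightarrow> 0) (at_right 0)"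
    by real_asymp
  then have r: "((\<lambda>h. flat n h / h) \<longlongrightarrow> 0) (at_right 0)"
    by (rule filterlim_cong[OF refl refl, THEN iffD1, rotated])
      (auto simp: flat_def eventually_at_filter)
  have l: "((\<lambda>h. flat n h / h) \<longlongrightarrow> 0) (at_left 0)"
    by (rule filterlim_cong[OF refl refl, THEN iffD1, rotated, of "\<lambda>_. 0"])
      (auto simp: flat_def eventually_at_filter)
  from l r show ?thesis by (simp add: filterlim_split_at)
qed

lemma flat_deriv: "(flat n has_field_derivative (flat (n + 2) t - of_nat n * flat (n + 1) t)) (at t)"
proof -
  consider "t > 0" | "t < 0" | "t = 0" by linarith
  then show ?thesis
  proof cases
    case 1
    have "((\<lambda>t. (1/t) ^ n * exp (- (1/t))) has_field_derivative
      (1/t) ^ (n + 2) * exp (- (1/t)) - of_nat n * ((1/t) ^ (n + 1) * exp (- (1/t)))) (at t)"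
    proof -
      have i: "((\<lambda>t. 1/t) has_field_derivative - ((1/t) ^ 2)) (at t)"
        using 1 by (auto intro!: derivative_eq_intros simp: power2_eq_square)
      have e: "((\<lambda>t. exp (- (1/t))) has_field_derivative exp (- (1/t)) * (- (- ((1/t) ^ 2)))) (at t)"
        by (intro DERIV_fun_exp DERIV_minus i)
      have alg: "of_nat n * (- (w ^ 2) * w ^ (n - Suc 0)) * z + z * (- (- (w ^ 2))) * w ^ n
          = w ^ (n + 2) * z - of_nat n * (w ^ (n + 1) * z)" for w z :: real
        by (cases n) (simp_all add: power2_eq_square algebra_simps)
      show ?thesis using DERIV_mult[OF DERIV_power[OF i, of n] e] unfolding alg .
    qed
    then have "((\<lambda>t. (1/t) ^ n * exp (- (1/t))) has_field_derivative
      (flat (n + 2) t - of_nat n * flat (n + 1) t)) (at t)"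
      using 1 by (simp add: flat_def)
    then show ?thesis
      by (rule has_field_derivative_transform_within_open[of _ _ _ "{0<..}"]) (use 1 in \<open>auto simp: flat_def\<close>)
  next
    case 2
    have "((\<lambda>t. 0) has_field_derivative (flat (n + 2) t - of_nat n * flat (n + 1) t)) (at t)"
      using 2 by (simp add: flat_def)
    then show ?thesis
      by (rule has_field_derivative_transform_within_open[of _ _ _ "{..<0}"]) (use 2 in \<open>auto simp: flat_def\<close>)
  next
    case 3
    have "(flat n has_field_derivative 0) (at 0)"
      using flat_div_tendsto_0[of n] by (simp add: DERIV_def flat_def)
    then show ?thesis using 3 by (simp add: flat_def)
  qed
qed

lemma smooth_on_flat: "smooth_on UNIV (flat n)"
proof -
  have "Ck_on k UNIV (flat n)" for k
  proof (induction k arbitrary: n)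
    case 0 show ?case
      using DERIV_isCont[OF flat_deriv] by (simp add: continuous_on_eq_continuous_at)
  next
    case (Suc k)
    have d: "(flat n has_derivative (\<lambda>v. (flat (n + 2) t - of_nat n * flat (n + 1) t) * v)) (at t)" for t
      using flat_deriv[of n t] by (simp add: has_field_derivative_def)
    have "Ck_on k UNIV (\<lambda>t. (flat (n + 2) t + (- of_nat n) * flat (n + 1) t) * v)" for v
      by (intro Ck_on_bilinear[OF _ bounded_bilinear_mult] Ck_on_add Ck_on_const Suc.IH) auto
    then have "Ck_on k UNIV (\<lambda>t. D (flat n) t v)" for v
      by (simp add: D_eqI[OF d])
    then show ?case using d by (auto simp: differentiable_def)
  qed
  then show ?thesis by (simp add: smooth_on_def)
qed

text \<open>\<open>flat 0\<close> is nested so as to become constant for \<open>t \<ge> 1\<close>.\<close>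

definition step :: "real \<Rightarrow> real" where
  "step t = exp 1 * flat 0 (1 - exp 1 * flat 0 (1 - t))"

lemma step_1: "t \<ge> 1 \<Longrightarrow> step t = 1"
  by (simp add: step_def flat_def flip: exp_add)

text \<open>The factor \<open>exp 1\<close> normalises \<open>flat 0\<close> to the value 1 at 1.
  For \<open>t \<le> 0\<close> the inner term is at least 1, so the outer \<open>flat\<close>
  receives a nonpositive argument.\<close>

lemma step_0: assumes "t \<le> 0" shows "step t = 0"
proof -
  have "1 / (1 - t) \<le> 1" using assms by simp
  then have "1 \<le> exp (1 + - (1 / (1 - t)))" by simp
  then have "1 \<le> exp 1 * exp (- (1 / (1 - t)))" by (simp only: exp_add)
  then show ?thesis using assms by (simp add: step_def flat_def)
qed

lemma smooth_on_step: "smooth_on UNIV step"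
proof -
  have "smooth_on UNIV (\<lambda>t. 1 + (-1) * t :: real)"
    by (intro smooth_on_add smooth_on_mult smooth_on_const smooth_on_id) auto
  from smooth_on_compose[OF _ _ _ this smooth_on_flat[of 0]]
  have "smooth_on UNIV (\<lambda>t. flat 0 (1 + (-1) * t))" by simp
  then have "smooth_on UNIV (\<lambda>t. 1 + (- exp 1) * flat 0 (1 + (-1) * t))"
    by (intro smooth_on_add smooth_on_mult smooth_on_const) auto
  from smooth_on_compose[OF _ _ _ this smooth_on_flat[of 0]]
  have "smooth_on UNIV (\<lambda>t. flat 0 (1 + (- exp 1) * flat 0 (1 + (-1) * t)))" by simp
  then have "smooth_on UNIV (\<lambda>t. exp 1 * flat 0 (1 + (- exp 1) * flat 0 (1 + (-1) * t)))"
    by (intro smooth_on_mult smooth_on_const) auto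
  then show ?thesis by (simp add: step_def[abs_def])
qed

text \<open>The squared distance keeps the argument of \<open>step\<close> smooth at the centre. The
  argument is 0 at distance \<open>r\<close> and 3/2 at distance \<open>r / 2\<close>, hence more
  than 1 on the half ball.\<close>

definition bump :: "'a::euclidean_space \<Rightarrow> real \<Rightarrow> 'a \<Rightarrow> real" where
  "bump x r y = step (2 - 2 * ((y - x) \<bullet> (y - x)) / r\<^sup>2)"

lemma smooth_on_bump: "smooth_on UNIV (bump x r)"
proof -
  have "smooth_on UNIV (\<lambda>y. y + (- x))" by (intro smooth_on_add smooth_on_const smooth_on_id) auto
  then have "smooth_on UNIV (\<lambda>y. 2 + (- 2 / r\<^sup>2) * ((y + (- x)) \<bullet> (y + (- x))))"
    by (intro smooth_on_add smooth_on_mult smooth_on_const smooth_on_bilinear[OF _ bounded_bilinear_inner] smooth_on_id) auto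
  from smooth_on_compose[OF _ _ _ this smooth_on_step] show ?thesis
    by (simp add: bump_def[abs_def])
qed

lemma bump_outside: assumes "r > 0" "y \<notin> ball x r" shows "bump x r y = 0"
proof -
  have "r \<le> norm (y - x)" using assms by (simp add: dist_norm norm_minus_commute)
  then have "r\<^sup>2 \<le> (y - x) \<bullet> (y - x)"
    using power_mono[of r "norm (y - x)" 2] assms by (simp add: power2_norm_eq_inner)
  then show ?thesis unfolding bump_def using assms by (intro step_0) (simp add: field_simps)
qed

lemma bump_inside: assumes "r > 0" "y \<in> ball x (r / 2)" shows "bump x r y = 1"
proof -
  have "norm (y - x) \<le> r / 2" using assms by (simp add: dist_norm norm_minus_commute)
  then have "(y - x) \<bullet> (y - x) \<le> (r / 2)\<^sup>2"
    using power_mono[of "norm (y - x)" "r / 2" 2] assms by (simp add: power2_norm_eq_inner)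
  also have "\<dots> \<le> r\<^sup>2 / 2" by (simp add: power_divide)
  finally show ?thesis unfolding bump_def using assms by (intro step_1) (simp add: field_simps)
qed

text \<open>Differentiation under the integral sign brings out a factor \<open>t\<close> from the
  chain rule; the weight \<open>t ^ j\<close> is carried along so that the induction reproduces the
  same kind of integral.\<close>

lemma smooth_on_ray_integral:
  fixes F :: "'a::euclidean_space \<Rightarrow> 'b::euclidean_space"
  assumes F: "smooth_on (ball x r) F"
  shows "smooth_on (ball x r) (\<lambda>y. integral {0..1} (\<lambda>t::real. t ^ j *\<^sub>R F (x + t *\<^sub>R (y - x))))"
proof -
  have inb: "x + t *\<^sub>R (y - x) \<in> ball x r" if "y \<in> ball x r" "t \<in> {0..1}" for t y
  proof -
    have "\<bar>t\<bar> * norm (y - x) \<le> 1 * norm (y - x)" using that by (intro mult_right_mono) auto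
    then show ?thesis using that by (simp add: dist_norm norm_minus_commute)
  qed
  have cont: "continuous_on (ball x r \<times> {0..1}) (\<lambda>(y, t). t ^ j *\<^sub>R G (x + t *\<^sub>R (y - x)))"
    if "continuous_on (ball x r) G" for G :: "'a \<Rightarrow> 'b" and j
    unfolding split_beta
    by (intro continuous_intros continuous_on_compose2[OF that]) (use inb in auto)
  have cont1: "continuous_on {0..1} (\<lambda>t. t ^ j *\<^sub>R G (x + t *\<^sub>R (y - x)))"
    if "continuous_on (ball x r) G" "y \<in> ball x r" for G :: "'a \<Rightarrow> 'b" and j y
    by (intro continuous_intros continuous_on_compose2[OF that(1)]) (use inb that in auto)
  have *: "Ck_on k (ball x r) (\<lambda>y. integral {0..1} (\<lambda>t::real. t ^ j *\<^sub>R F (x + t *\<^sub>R (y - x))))" for k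
    using F
  proof (induction k arbitrary: F j)
    case 0
    show ?case
      using integral_continuous_on_param[of "ball x r" 0 1 "\<lambda>y t. t ^ j *\<^sub>R F (x + t *\<^sub>R (y - x))"]
        cont[OF smooth_on_continuous_on[OF 0]] by simp
  next
    case (Suc k)
    define I where "I = (\<lambda>y. integral {0..1} (\<lambda>t::real. t ^ j *\<^sub>R F (x + t *\<^sub>R (y - x))))"
    define L where "L = (\<lambda>y (t::real). Blinfun (\<lambda>v. t ^ Suc j *\<^sub>R D F (x + t *\<^sub>R (y - x)) v))"
    have dF: "F differentiable (at (x + t *\<^sub>R (y - x)))" if "y \<in> ball x r" "t \<in> {0..1}" for y t
      using smooth_on_differentiable[OF Suc.prems inb[OF that]] .
    have L: "blinfun_apply (L y t) = (\<lambda>v. t ^ Suc j *\<^sub>R D F (x + t *\<^sub>R (y - x)) v)"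
      if "y \<in> ball x r" "t \<in> {0..1}" for y t
      unfolding L_def
      by (rule bounded_linear_Blinfun_apply)
        (intro bounded_linear_const_scaleR has_derivative_bounded_linear[OF D_has_derivative[OF dF[OF that]]])
    have contD: "continuous_on (ball x r) (\<lambda>z. D F z v)" for v
      using smooth_on_continuous_on[OF smooth_on_D[OF Suc.prems]] .
    have "continuous_on (ball x r \<times> {0..1}) (\<lambda>(y, t). L y t)"
    proof (rule continuous_on_blinfun_componentwise)
      fix i :: 'a
      show "continuous_on (ball x r \<times> {0..1}) (\<lambda>z. blinfun_apply (case z of (y, t) \<Rightarrow> L y t) i)"
        using cont[OF contD, of "Suc j" i]
        by (rule continuous_on_cong[THEN iffD1, rotated 2]) (auto simp: L)
    qed
    then have cL: "continuous_on (ball x r \<times> cbox 0 1) (\<lambda>(y, t). L y t)" by simp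
    have dI: "(I has_derivative (\<lambda>v. integral {0..1} (\<lambda>t. t ^ Suc j *\<^sub>R D F (x + t *\<^sub>R (y - x)) v))) (at y)"
      if y: "y \<in> ball x r" for y
    proof -
      have "((\<lambda>z. integral (cbox 0 1) (\<lambda>t::real. t ^ j *\<^sub>R F (x + t *\<^sub>R (z - x)))) has_derivative
          integral (cbox 0 1) (L y)) (at y within ball x r)"
      proof (rule leibniz_rule[OF _ _ cL y convex_ball])
        fix z t assume z: "z \<in> ball x r" and t: "t \<in> cbox 0 (1::real)"
        have "((\<lambda>z. x + t *\<^sub>R (z - x)) has_derivative (\<lambda>v. t *\<^sub>R v)) (at z within ball x r)"
          by (auto intro!: derivative_eq_intros)
        from has_derivative_compose[OF this D_has_derivative[OF dF]] z t
        have "((\<lambda>z. F (x + t *\<^sub>R (z - x))) has_derivative (\<lambda>v. D F (x + t *\<^sub>R (z - x)) (t *\<^sub>R v))) (at z within ball x r)"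
          by simp
        then have "((\<lambda>z. t ^ j *\<^sub>R F (x + t *\<^sub>R (z - x))) has_derivative
          (\<lambda>v. t ^ j *\<^sub>R D F (x + t *\<^sub>R (z - x)) (t *\<^sub>R v))) (at z within ball x r)"
          by (intro derivative_intros)
        then show "((\<lambda>z. t ^ j *\<^sub>R F (x + t *\<^sub>R (z - x))) has_derivative blinfun_apply (L z t)) (at z within ball x r)"
          using L[of z t] z t D_scale[OF dF] by (simp add: mult.commute)
      next
        fix z assume z: "z \<in> ball x r"
        show "(\<lambda>t::real. t ^ j *\<^sub>R F (x + t *\<^sub>R (z - x))) integrable_on cbox 0 1"
          using cont1[OF smooth_on_continuous_on[OF Suc.prems] z] by (simp add: integrable_continuous_real)
      qed
      moreover have "blinfun_apply (integral (cbox 0 1) (L y)) =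
          (\<lambda>v. integral {0..1} (\<lambda>t. t ^ Suc j *\<^sub>R D F (x + t *\<^sub>R (y - x)) v))"
      proof
        fix v
        have "Pair y ` {0..1} \<subseteq> ball x r \<times> cbox 0 (1::real)" using y by (auto simp: image_subset_iff)
        then have "continuous_on {0..1} (L y)"
          using continuous_on_compose2[OF cL continuous_on_Pair[OF continuous_on_const continuous_on_id], of y "{0..1}"]
          by auto
        then have "L y integrable_on {0..1}" by (rule integrable_continuous_real)
        then have "blinfun_apply (integral {0..1} (L y)) v = integral {0..1} (\<lambda>t. blinfun_apply (L y t) v)"
          by (subst blinfun_apply_integral) auto
        also have "\<dots> = integral {0..1} (\<lambda>t. t ^ Suc j *\<^sub>R D F (x + t *\<^sub>R (y - x)) v)"
          using L[OF y] by (intro integral_cong) simp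
        finally show "blinfun_apply (integral (cbox 0 1) (L y)) v =
          integral {0..1} (\<lambda>t. t ^ Suc j *\<^sub>R D F (x + t *\<^sub>R (y - x)) v)" by simp
      qed
      ultimately show ?thesis using y by (simp add: I_def at_within_open[OF y])
    qed
    have "Ck_on k (ball x r) (\<lambda>y. D I y v)" for v
      by (rule Ck_on_cong[OF open_ball D_eqI[OF dI, THEN fun_cong], THEN iffD2])
        (assumption | rule Suc.IH[OF smooth_on_D[OF Suc.prems]])+
    moreover have "\<forall>y\<in>ball x r. I differentiable (at y)" using dI differentiable_def by blast
    ultimately show ?case unfolding I_def[symmetric] by simp
  qed
  then show ?thesis by (simp add: smooth_on_def)
qed

text \<open>The fundamental theorem of calculus along the ray from \<open>x\<close> to
  \<open>y\<close>. The coefficients \<open>H b\<close> have to be smooth functions, because a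
  derivation will be applied to each product by the Leibniz rule.\<close>

lemma hadamard:
  fixes F :: "'a::euclidean_space \<Rightarrow> 'b::euclidean_space"
  assumes F: "smooth_on (ball x r) F"
  obtains H where "\<And>b. smooth_on (ball x r) (H b)" "\<And>b. r > 0 \<Longrightarrow> H b x = D F x b"
    "\<And>y. y \<in> ball x r \<Longrightarrow> F y = F x + (\<Sum>b\<in>Basis. ((y - x) \<bullet> b) *\<^sub>R H b y)"
proof
  let ?H = "\<lambda>b y. integral {0..1} (\<lambda>t::real. t ^ 0 *\<^sub>R D F (x + t *\<^sub>R (y - x)) b)"
  show "smooth_on (ball x r) (?H b)" for b
    by (rule smooth_on_ray_integral[OF smooth_on_D[OF F]])
  show "?H b x = D F x b" for b by simp
  fix y assume y: "y \<in> ball x r"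
  have inb: "x + t *\<^sub>R (y - x) \<in> ball x r" if "t \<in> {0..1}" for t
  proof -
    have "\<bar>t\<bar> * norm (y - x) \<le> 1 * norm (y - x)" using that by (intro mult_right_mono) auto
    then show ?thesis using y by (simp add: dist_norm norm_minus_commute)
  qed
  have dF: "F differentiable (at (x + t *\<^sub>R (y - x)))" if "t \<in> {0..1}" for t
    using smooth_on_differentiable[OF F inb[OF that]] .
  have "((\<lambda>t. F (x + t *\<^sub>R (y - x))) has_vector_derivative D F (x + t *\<^sub>R (y - x)) (y - x)) (at t within {0..1})"
    if t: "t \<in> {0..1}" for t
  proof -
    have "((\<lambda>t. x + t *\<^sub>R (y - x)) has_derivative (\<lambda>s. s *\<^sub>R (y - x))) (at t within {0..1})"
      by (auto intro!: derivative_eq_intros)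
    from has_derivative_compose[OF this D_has_derivative[OF dF[OF t]]] show ?thesis
      using D_scale[OF dF[OF t]] by (simp add: has_vector_derivative_def)
  qed
  from fundamental_theorem_of_calculus[OF _ this]
  have "((\<lambda>t. D F (x + t *\<^sub>R (y - x)) (y - x)) has_integral (F y - F x)) {0..1}" by simp
  then have "F y - F x = integral {0..1} (\<lambda>t. D F (x + t *\<^sub>R (y - x)) (y - x))"
    by (simp add: integral_unique)
  also have "\<dots> = integral {0..1} (\<lambda>t. \<Sum>b\<in>Basis. ((y - x) \<bullet> b) *\<^sub>R D F (x + t *\<^sub>R (y - x)) b)"
    by (intro integral_cong D_expand dF)
  also have "\<dots> = (\<Sum>b\<in>Basis. ((y - x) \<bullet> b) *\<^sub>R integral {0..1} (\<lambda>t. D F (x + t *\<^sub>R (y - x)) b))"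
  proof -
    have "continuous_on {0..1} (\<lambda>t. D F (x + t *\<^sub>R (y - x)) b)" for b
      by (intro continuous_on_compose2[OF smooth_on_continuous_on[OF smooth_on_D[OF F]]] continuous_intros)
        (use inb in auto)
    then have "(\<lambda>t. D F (x + t *\<^sub>R (y - x)) b) integrable_on {0..1}" for b
      by (rule integrable_continuous_real)
    then show ?thesis by (subst integral_sum) (auto intro: integrable_cmul)
  qed
  finally show "F y = F x + (\<Sum>b\<in>Basis. ((y - x) \<bullet> b) *\<^sub>R ?H b y)"
    by (simp add: algebra_simps)
qed


section \<open>Manifolds and vector fields\<close>

lemma sum_fun_apply: "(\<Sum>i\<in>A. f i) x = (\<Sum>i\<in>A. f i x)"
  by (induction A rule: infinite_finite_induct) auto

locale manifold =
  fixes N :: "('a, 'e::euclidean_space) charted"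
  assumes hausdorff: "Hausdorff_space (mtop N)"
    and charts_cover: "(\<Union>(U, \<phi>)\<in>atlas N. U) = points N"
    and chart: "(U, \<phi>) \<in> atlas N \<Longrightarrow> openin (mtop N) U \<and> open (\<phi> ` U) \<and>
        homeomorphic_map (subtopology (mtop N) U) (top_of_set (\<phi> ` U)) \<phi>"
    and transition: "(U, \<phi>) \<in> atlas N \<Longrightarrow> (V, \<psi>) \<in> atlas N \<Longrightarrow> smooth_on (\<phi> ` (U \<inter> V)) (\<psi> \<circ> inv_into U \<phi>)"

lemma smooth_manifold_imp_manifold: "smooth_manifold N \<Longrightarrow> manifold N"
  unfolding smooth_manifold_def manifold_def by (auto 4 3)

section \<open>Charts and the ring of smooth functions\<close>

context manifold begin

lemma chart_ex: "x \<in> points N \<Longrightarrow> \<exists>U \<phi>. (U, \<phi>) \<in> atlas N \<and> x \<in> U"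
  unfolding charts_cover[symmetric] by auto

lemma points_topspace: "points N = topspace (mtop N)"
  by (simp add: points_def)

lemma smooth_funsD:
  "f \<in> smooth_funs N \<Longrightarrow> x \<notin> points N \<Longrightarrow> f x = 0"
  "f \<in> smooth_funs N \<Longrightarrow> (U, \<phi>) \<in> atlas N \<Longrightarrow> smooth_on (\<phi> ` U) (\<lambda>y. f (inv_into U \<phi> y))"
  unfolding smooth_funs_def by (auto simp: o_def)

context
  fixes U \<phi> assumes c: "(U, \<phi>) \<in> atlas N"
begin

lemma chart_openin: "openin (mtop N) U" and chart_open_image: "open (\<phi> ` U)"
  using chart[OF c] by auto

lemma chart_subset: "U \<subseteq> points N"
  using chart_openin openin_subset points_topspace by metis

lemma chart_homeomorphic: "homeomorphic_map (subtopology (mtop N) U) (top_of_set (\<phi> ` U)) \<phi>"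
  using chart[OF c] by auto

lemma topspace_chart: "topspace (subtopology (mtop N) U) = U"
  using chart_openin openin_subset by (auto simp: topspace_subtopology)

lemma chart_inj: "inj_on \<phi> U"
  using homeomorphic_imp_injective_map[OF chart_homeomorphic] topspace_chart by simp

lemma chart_inv: "x \<in> U \<Longrightarrow> inv_into U \<phi> (\<phi> x) = x"
  and chart_inv_in: "y \<in> \<phi> ` U \<Longrightarrow> inv_into U \<phi> y \<in> U"
  and chart_inv_right: "y \<in> \<phi> ` U \<Longrightarrow> \<phi> (inv_into U \<phi> y) = y"
  by (simp_all add: chart_inj inv_into_into f_inv_into_f)

lemma chart_image_open: assumes "openin (mtop N) W" "W \<subseteq> U" shows "open (\<phi> ` W)"
proof -
  have "openin (subtopology (mtop N) U) W"
    using assms openin_subtopology_Int2[of "mtop N" W U] by (simp add: Int_absorb1)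
  then have "openin (top_of_set (\<phi> ` U)) (\<phi> ` W)"
    using homeomorphic_map_openness[OF chart_homeomorphic] assms topspace_chart by auto
  then show ?thesis using chart_open_image openin_open_eq by blast
qed

lemma chart_preimage_open: assumes "open S" shows "openin (mtop N) {x \<in> U. \<phi> x \<in> S}"
proof -
  have "continuous_map (subtopology (mtop N) U) euclidean \<phi>"
    using homeomorphic_imp_continuous_map[OF chart_homeomorphic] continuous_map_into_fulltopology by blast
  then have "openin (subtopology (mtop N) U) {x \<in> topspace (subtopology (mtop N) U). \<phi> x \<in> S}"
    using assms openin_continuous_map_preimage by (metis open_openin)
  then show ?thesis using chart_openin openin_open_subtopology unfolding topspace_chart by blast
qed

text \<open>By the Hausdorff property a compact piece of a chart is closed in the whole manifold.
  Its complement is therefore open, and functions supported in the piece extend smoothly by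
  0.\<close>

lemma chart_compact_closedin: assumes "compact K" "K \<subseteq> \<phi> ` U" shows "closedin (mtop N) (inv_into U \<phi> ` K)"
proof -
  obtain \<psi> where \<psi>: "homeomorphic_maps (subtopology (mtop N) U) (top_of_set (\<phi> ` U)) \<phi> \<psi>"
    using chart_homeomorphic homeomorphic_map_maps by blast
  then have "continuous_map (top_of_set (\<phi> ` U)) (subtopology (mtop N) U) \<psi>"
    by (simp add: homeomorphic_maps_def)
  then have "continuous_map (top_of_set (\<phi> ` U)) (mtop N) \<psi>"
    using continuous_map_into_fulltopology by blast
  moreover have "compactin (top_of_set (\<phi> ` U)) K"
    using assms by (simp add: compactin_subtopology)
  ultimately have "compactin (mtop N) (\<psi> ` K)" by (rule image_compactin[rotated])
  moreover have "\<psi> y = inv_into U \<phi> y" if y: "y \<in> K" for y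
  proof -
    obtain x where "x \<in> U" "y = \<phi> x" using y assms by blast
    then show ?thesis using \<psi> chart_inv topspace_chart by (simp add: homeomorphic_maps_def)
  qed
  ultimately have "compactin (mtop N) (inv_into U \<phi> ` K)" by (metis image_cong)
  then show ?thesis using hausdorff compactin_imp_closedin by blast
qed

end

text \<open>\<open>smooth_funs\<close> tests all charts; composing with a transition map reduces
  this to one conveniently chosen chart, and a small neighbourhood in it, around each point.\<close>

lemma smooth_funsI:
  assumes "\<And>x. x \<notin> points N \<Longrightarrow> f x = 0"
    and loc: "\<And>x. x \<in> points N \<Longrightarrow> \<exists>U \<phi> W. (U, \<phi>) \<in> atlas N \<and> openin (mtop N) W \<and> x \<in> W \<and> W \<subseteq> U \<and>
      smooth_on (\<phi> ` W) (\<lambda>y. f (inv_into U \<phi> y))"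
  shows "f \<in> smooth_funs N"
proof -
  have "smooth_on (\<eta> ` V) (\<lambda>y. f (inv_into V \<eta> y))" if V: "(V, \<eta>) \<in> atlas N" for V \<eta>
  proof (rule smooth_on_local)
    fix y assume "y \<in> \<eta> ` V"
    then obtain x where x: "x \<in> V" "y = \<eta> x" by blast
    then have "x \<in> points N" using chart_subset[OF V] by auto
    then obtain U \<phi> W where U: "(U, \<phi>) \<in> atlas N" and W: "openin (mtop N) W" "x \<in> W" "W \<subseteq> U"
      and sm: "smooth_on (\<phi> ` W) (\<lambda>y. f (inv_into U \<phi> y))" using loc by blast
    have o: "openin (mtop N) (W \<inter> V)" using W chart_openin[OF V] by blast
    have op: "open (\<eta> ` (W \<inter> V))" by (rule chart_image_open[OF V o]) simp
    have "W \<inter> V \<subseteq> V \<inter> U" using W by auto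
    from smooth_on_subset[OF transition[OF V U] image_mono[OF this]]
    have "smooth_on (\<eta> ` (W \<inter> V)) (\<lambda>y. \<phi> (inv_into V \<eta> y))" by (simp add: o_def)
    moreover have "(\<lambda>y. \<phi> (inv_into V \<eta> y)) ` (\<eta> ` (W \<inter> V)) \<subseteq> \<phi> ` W"
      using chart_inv[OF V] by auto
    ultimately have "smooth_on (\<eta> ` (W \<inter> V)) (\<lambda>y. f (inv_into U \<phi> (\<phi> (inv_into V \<eta> y))))"
      using smooth_on_compose[OF op chart_image_open[OF U W(1,3)] _ _ sm] by blast
    then have "smooth_on (\<eta> ` (W \<inter> V)) (\<lambda>y. f (inv_into V \<eta> y))"
      by (rule smooth_on_cong[OF op, THEN iffD1, rotated])
        (use chart_inv[OF U] chart_inv[OF V] W in auto)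
    then show "\<exists>T. open T \<and> y \<in> T \<and> smooth_on T (\<lambda>y. f (inv_into V \<eta> y))"
      using op x W by blast
  qed
  then show ?thesis using assms(1) by (auto simp: smooth_funs_def o_def)
qed

lemma smooth_funs_zero: "0 \<in> smooth_funs N" "(\<lambda>_. 0) \<in> smooth_funs N"
  by (auto simp: smooth_funs_def o_def zero_fun_def intro: smooth_on_const)

lemma smooth_funs_indicator: "indicator (points N) \<in> smooth_funs N"
proof (rule smooth_funsI)
  fix x assume x: "x \<in> points N"
  then obtain U \<phi> where U: "(U, \<phi>) \<in> atlas N" "x \<in> U" using chart_ex by blast
  have "smooth_on (\<phi> ` U) (\<lambda>y. indicator (points N) (inv_into U \<phi> y) :: complex)"
    using smooth_on_const[of "\<phi> ` U" "1::complex"]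
    by (rule smooth_on_cong[OF chart_open_image[OF U(1)], THEN iffD1, rotated])
      (use chart_inv_in[OF U(1)] chart_subset[OF U(1)] in \<open>auto simp: indicator_def\<close>)
  then show "\<exists>U \<phi> W. (U, \<phi>) \<in> atlas N \<and> openin (mtop N) W \<and> x \<in> W \<and> W \<subseteq> U \<and>
      smooth_on (\<phi> ` W) (\<lambda>y. indicator (points N) (inv_into U \<phi> y) :: complex)"
    using U chart_openin[OF U(1)] by blast
qed simp

lemma smooth_funs_add: "f \<in> smooth_funs N \<Longrightarrow> g \<in> smooth_funs N \<Longrightarrow> f + g \<in> smooth_funs N"
  unfolding smooth_funs_def by (auto simp: o_def intro!: smooth_on_add chart_open_image)

lemma smooth_funs_mult: "f \<in> smooth_funs N \<Longrightarrow> g \<in> smooth_funs N \<Longrightarrow> f * g \<in> smooth_funs N"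
  unfolding smooth_funs_def by (auto simp: o_def intro!: smooth_on_mult chart_open_image)

lemma smooth_funs_scale: "f \<in> smooth_funs N \<Longrightarrow> (\<lambda>_. c) * f \<in> smooth_funs N"
  unfolding smooth_funs_def by (auto simp: o_def intro!: smooth_on_mult smooth_on_const chart_open_image)

lemma smooth_funs_uminus: "f \<in> smooth_funs N \<Longrightarrow> - f \<in> smooth_funs N"
  using smooth_funs_scale[of f "-1"] by (simp add: fun_eq_iff times_fun_def fun_Compl_def)

lemma smooth_funs_diff: "f \<in> smooth_funs N \<Longrightarrow> g \<in> smooth_funs N \<Longrightarrow> f - g \<in> smooth_funs N"
  using smooth_funs_add[OF _ smooth_funs_uminus, of f g] by simp

lemma smooth_funs_sum: "finite A \<Longrightarrow> (\<And>i. i \<in> A \<Longrightarrow> f i \<in> smooth_funs N) \<Longrightarrow> sum f A \<in> smooth_funs N"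
  by (induction A rule: finite_induct) (auto intro: smooth_funs_zero smooth_funs_add)

lemma smooth_funs_continuous: assumes f: "f \<in> smooth_funs N" shows "continuous_map (mtop N) euclidean f"
proof (rule pasting_lemma[where I = "atlas N" and T = fst and f = "\<lambda>_. f"])
  fix i assume i: "i \<in> atlas N"
  obtain U \<phi> where U: "i = (U, \<phi>)" by (cases i)
  with i have c: "(U, \<phi>) \<in> atlas N" by simp
  show "openin (mtop N) (fst i)" using chart_openin[OF c] U by simp
  have "continuous_map (top_of_set (\<phi> ` U)) euclidean (\<lambda>y. f (inv_into U \<phi> y))"
    using smooth_on_continuous_on[OF smooth_funsD(2)[OF f c]] by simp
  from continuous_map_compose[OF homeomorphic_imp_continuous_map[OF chart_homeomorphic[OF c]] this]
  have "continuous_map (subtopology (mtop N) U) euclidean (\<lambda>x. f (inv_into U \<phi> (\<phi> x)))"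
    by (simp add: o_def)
  then have "continuous_map (subtopology (mtop N) U) euclidean f"
    by (rule continuous_map_eq) (use topspace_chart[OF c] chart_inv[OF c] in auto)
  then show "continuous_map (subtopology (mtop N) (fst i)) euclidean f" using U by simp
next
  fix x assume "x \<in> topspace (mtop N)"
  then show "\<exists>j. j \<in> atlas N \<and> x \<in> fst j \<and> f x = f x"
    using chart_ex points_topspace by fastforce
qed auto

text \<open>The passage from a function on a chart image to an element of
  \<open>smooth_funs\<close>; vector fields are 0 on anything else. Near the centre nothing is
  changed, as the bump is 1 there.\<close>

definition glue :: "'a set \<Rightarrow> ('a \<Rightarrow> 'e) \<Rightarrow> 'e \<Rightarrow> real \<Rightarrow> ('e \<Rightarrow> complex) \<Rightarrow> 'a \<Rightarrow> complex" where
  "glue U \<phi> z r w = (\<lambda>y. if y \<in> U then bump z r (\<phi> y) *\<^sub>R w (\<phi> y) else 0)"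

lemma glue_smooth:
  assumes c: "(U, \<phi>) \<in> atlas N" and r: "r > 0" and S: "open S" "cball z r \<subseteq> S" "S \<subseteq> \<phi> ` U" and w: "smooth_on S w"
  shows "glue U \<phi> z r w \<in> smooth_funs N"
proof (rule smooth_funsI)
  show "x \<notin> points N \<Longrightarrow> glue U \<phi> z r w x = 0" for x
    using chart_subset[OF c] by (auto simp: glue_def)
next
  fix x assume x: "x \<in> points N"
  let ?K = "inv_into U \<phi> ` cball z r"
  show "\<exists>V \<eta> W. (V, \<eta>) \<in> atlas N \<and> openin (mtop N) W \<and> x \<in> W \<and> W \<subseteq> V \<and>
      smooth_on (\<eta> ` W) (\<lambda>y. glue U \<phi> z r w (inv_into V \<eta> y))"
  proof (cases "x \<in> U \<and> \<phi> x \<in> S")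
    case True
    let ?W = "{x \<in> U. \<phi> x \<in> S}"
    have o: "openin (mtop N) ?W" by (rule chart_preimage_open[OF c S(1)])
    have op: "open (\<phi> ` ?W)" by (rule chart_image_open[OF c o]) auto
    have "smooth_on (\<phi> ` ?W) (\<lambda>y. bump z r y *\<^sub>R w y)"
      by (intro smooth_on_scaleR op) (auto intro: smooth_on_subset[OF smooth_on_bump] smooth_on_subset[OF w])
    then have "smooth_on (\<phi> ` ?W) (\<lambda>y. glue U \<phi> z r w (inv_into U \<phi> y))"
      by (rule smooth_on_cong[OF op, THEN iffD1, rotated]) (use chart_inv[OF c] in \<open>auto simp: glue_def\<close>)
    then show ?thesis using True c o by blast
  next
    case False
    obtain V \<eta> where V: "(V, \<eta>) \<in> atlas N" "x \<in> V" using chart_ex[OF x] by blast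
    let ?W = "V - ?K"
    have "closedin (mtop N) ?K" using chart_compact_closedin[OF c] S by auto
    then have o: "openin (mtop N) ?W" using chart_openin[OF V(1)] openin_diff by blast
    have op: "open (\<eta> ` ?W)" by (rule chart_image_open[OF V(1) o]) auto
    have "x \<notin> ?K"
    proof
      assume "x \<in> ?K"
      then obtain y where y: "y \<in> cball z r" "x = inv_into U \<phi> y" by blast
      then have "y \<in> S" "y \<in> \<phi> ` U" using S by auto
      then have "x \<in> U" "\<phi> x \<in> S" using chart_inv_in[OF c] chart_inv_right[OF c] y by auto
      then show False using False by simp
    qed
    have z: "glue U \<phi> z r w y = 0" if "y \<in> ?W" for y
    proof (cases "y \<in> U")
      case True
      then have "\<phi> y \<notin> cball z r" using that chart_inv[OF c True] by force
      then show ?thesis using bump_outside[OF r, of "\<phi> y" z] by (auto simp: glue_def)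
    qed (simp add: glue_def)
    have "smooth_on (\<eta> ` ?W) (\<lambda>y. 0 :: complex)" by (rule smooth_on_const)
    then have "smooth_on (\<eta> ` ?W) (\<lambda>y. glue U \<phi> z r w (inv_into V \<eta> y))"
      by (rule smooth_on_cong[OF op, THEN iffD1, rotated]) (use chart_inv[OF V(1)] z in auto)
    then show ?thesis using V o \<open>x \<notin> ?K\<close> by (intro exI[of _ V] exI[of _ \<eta>] exI[of _ ?W]) auto
  qed
qed

lemma glue_inside: "r > 0 \<Longrightarrow> y \<in> U \<Longrightarrow> \<phi> y \<in> ball z (r / 2) \<Longrightarrow> glue U \<phi> z r w y = w (\<phi> y)"
  by (simp add: glue_def bump_inside)

lemma glue_outside: "r > 0 \<Longrightarrow> \<phi> y \<notin> ball z r \<or> y \<notin> U \<Longrightarrow> glue U \<phi> z r w y = 0"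
  using bump_outside by (auto simp: glue_def)

section \<open>Derivations are local and act by derivatives in a chart\<close>

context
  fixes X assumes X: "X \<in> vector_fields N"
begin

lemma field_smooth: "f \<in> smooth_funs N \<Longrightarrow> X f \<in> smooth_funs N"
  and field_junk: "f \<notin> smooth_funs N \<Longrightarrow> X f = 0"
  and field_add: "f \<in> smooth_funs N \<Longrightarrow> g \<in> smooth_funs N \<Longrightarrow> X (f + g) = X f + X g"
  and field_scale: "f \<in> smooth_funs N \<Longrightarrow> X ((\<lambda>_. c) * f) = (\<lambda>_. c) * X f"
  and field_mult: "f \<in> smooth_funs N \<Longrightarrow> g \<in> smooth_funs N \<Longrightarrow> X (f * g) = X f * g + f * X g"
  using X unfolding vector_fields_def by blast+

lemma field_zero: "X 0 = 0"
  using field_scale[OF smooth_funs_zero(1), of 0] by (simp add: fun_eq_iff)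

lemma field_uminus: "f \<in> smooth_funs N \<Longrightarrow> X (- f) = - X f"
  using field_scale[of f "-1"] by (simp add: fun_eq_iff times_fun_def fun_Compl_def)

lemma field_diff: "f \<in> smooth_funs N \<Longrightarrow> g \<in> smooth_funs N \<Longrightarrow> X (f - g) = X f - X g"
  using field_add[OF _ smooth_funs_uminus, of f g] field_uminus[of g] by simp

lemma field_sum: "finite A \<Longrightarrow> (\<And>i. i \<in> A \<Longrightarrow> f i \<in> smooth_funs N) \<Longrightarrow> X (sum f A) = (\<Sum>i\<in>A. X (f i))"
  by (induction A rule: finite_induct) (auto simp: field_zero field_add smooth_funs_sum)

text \<open>The indicator is the unit of the ring, since smooth functions vanish outside the
  manifold. A derivation kills an idempotent \<open>e\<close>: on the manifold the Leibniz rule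
  reads \<open>X e = 2 * X e\<close>.\<close>

lemma field_indicator: "X (indicator (points N)) = 0"
proof -
  let ?e = "indicator (points N) :: 'a \<Rightarrow> complex"
  have "?e * ?e = ?e" by (auto simp: fun_eq_iff indicator_def)
  then have "X ?e = X ?e * ?e + ?e * X ?e" using field_mult[OF smooth_funs_indicator smooth_funs_indicator] by simp
  moreover have "X ?e x = 0" if "x \<notin> points N" for x
    using smooth_funsD(1)[OF field_smooth[OF smooth_funs_indicator] that] .
  ultimately have "X ?e x = 0" for x
    by (cases "x \<in> points N") (auto simp: fun_eq_iff)
  then show ?thesis by (simp add: fun_eq_iff)
qed

text \<open>A bump function \<open>b\<close> with value 1 at \<open>x\<close> and support in
  \<open>W\<close> gives \<open>b * (f - g) = 0\<close>; applying \<open>X\<close> and evaluating at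
  \<open>x\<close>, where \<open>f - g\<close> vanishes, leaves
  \<open>X (f - g) x = 0\<close>.\<close>

lemma field_local:
  assumes f: "f \<in> smooth_funs N" and g: "g \<in> smooth_funs N"
    and W: "openin (mtop N) W" "x \<in> W" "\<And>y. y \<in> W \<Longrightarrow> f y = g y"
  shows "X f x = X g x"
proof -
  have "x \<in> points N" using W openin_subset points_topspace by fastforce
  then obtain U \<phi> where U: "(U, \<phi>) \<in> atlas N" "x \<in> U" using chart_ex by blast
  have o: "openin (mtop N) (W \<inter> U)" using W chart_openin[OF U(1)] by blast
  have op: "open (\<phi> ` (W \<inter> U))" by (rule chart_image_open[OF U(1) o]) simp
  then obtain r where r: "r > 0" "cball (\<phi> x) r \<subseteq> \<phi> ` (W \<inter> U)"
    using W U open_contains_cball by blast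
  let ?b = "glue U \<phi> (\<phi> x) r (\<lambda>_. 1)"
  have b: "?b \<in> smooth_funs N"
    by (rule glue_smooth[OF U(1) r(1) op r(2)]) (auto intro: smooth_on_const)
  have "?b * (f - g) = 0"
  proof
    fix y show "(?b * (f - g)) y = 0 y"
    proof (cases "y \<in> W")
      case False
      have "\<phi> y \<notin> ball (\<phi> x) r \<or> y \<notin> U"
      proof (rule ccontr)
        assume "\<not> ?thesis"
        then have y: "y \<in> U" "\<phi> y \<in> \<phi> ` (W \<inter> U)" using r(2) by auto
        then have "y \<in> W" using chart_inj[OF U(1)] by (auto simp: inj_on_def)
        then show False using False by simp
      qed
      then show ?thesis using glue_outside[OF r(1)] by auto
    qed (simp add: W)
  qed
  then have "X ?b * (f - g) + ?b * X (f - g) = 0"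
    using field_mult[OF b smooth_funs_diff[OF f g]] field_zero by simp
  then have "X ?b x * (f x - g x) + ?b x * X (f - g) x = 0" by (simp add: fun_eq_iff)
  moreover have "?b x = 1" using glue_inside[OF r(1), of x U \<phi>] U r by simp
  ultimately show ?thesis using W(2,3) field_diff[OF f g] by simp
qed

text \<open>Near \<open>x\<close>, Hadamard's lemma writes \<open>f\<close> as a constant plus
  products of a centred coordinate and a smooth function; by the Leibniz rule only the derivatives
  of the coordinates survive at \<open>x\<close>. One \<open>W\<close> and one family
  \<open>k\<close> serve all \<open>x\<close> in \<open>W\<close>, so that the coefficients
  \<open>X (k b)\<close> are smooth in \<open>x\<close>.\<close>

lemma field_in_chart:
  assumes c: "(U, \<phi>) \<in> atlas N" and x0: "x0 \<in> U"
  obtains W k where "openin (mtop N) W" "x0 \<in> W" "W \<subseteq> U" "\<And>b. k b \<in> smooth_funs N"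
    "\<And>b y. y \<in> W \<Longrightarrow> k b y = complex_of_real (\<phi> y \<bullet> b)"
    "\<And>x f. x \<in> W \<Longrightarrow> f \<in> smooth_funs N \<Longrightarrow> X f x = (\<Sum>b\<in>Basis. X (k b) x * D (\<lambda>y. f (inv_into U \<phi> y)) (\<phi> x) b)"
proof -
  obtain r where r: "r > 0" "cball (\<phi> x0) r \<subseteq> \<phi> ` U"
    using chart_open_image[OF c] x0 open_contains_cball by blast
  define k where "k = (\<lambda>b. glue U \<phi> (\<phi> x0) r (\<lambda>y. complex_of_real (y \<bullet> b)))"
  define W where "W = {y \<in> U. \<phi> y \<in> ball (\<phi> x0) (r / 2)}"
  have k: "k b \<in> smooth_funs N" for b
    unfolding k_def
    by (rule glue_smooth[OF c r(1) chart_open_image[OF c] r(2) order_refl])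
      (intro smooth_on_linear[OF _ bounded_linear_of_real] smooth_on_linear[OF _ bounded_linear_inner_left] smooth_on_id chart_open_image[OF c])
  have kW: "k b y = complex_of_real (\<phi> y \<bullet> b)" if "y \<in> W" for b y
    unfolding k_def using that r(1) by (simp add: W_def glue_inside)
  have oW: "openin (mtop N) W" unfolding W_def by (rule chart_preimage_open[OF c]) simp
  have main: "X f x = (\<Sum>b\<in>Basis. X (k b) x * D (\<lambda>y. f (inv_into U \<phi> y)) (\<phi> x) b)"
    if x: "x \<in> W" and f: "f \<in> smooth_funs N" for x f
  proof -
    have xU: "x \<in> U" and xp: "x \<in> points N" using x chart_subset[OF c] by (auto simp: W_def)
    have "open (\<phi> ` W)" by (rule chart_image_open[OF c oW]) (auto simp: W_def)
    then obtain \<rho> where \<rho>: "\<rho> > 0" "ball (\<phi> x) \<rho> \<subseteq> \<phi> ` W" using x open_contains_ball by blast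
    have \<rho>U: "ball (\<phi> x) \<rho> \<subseteq> \<phi> ` U" using \<rho> by (auto simp: W_def)
    let ?F = "\<lambda>y. f (inv_into U \<phi> y)"
    obtain H where H: "\<And>b. smooth_on (ball (\<phi> x) \<rho>) (H b)" "\<And>b. \<rho> > 0 \<Longrightarrow> H b (\<phi> x) = D ?F (\<phi> x) b"
      "\<And>y. y \<in> ball (\<phi> x) \<rho> \<Longrightarrow> ?F y = ?F (\<phi> x) + (\<Sum>b\<in>Basis. ((y - \<phi> x) \<bullet> b) *\<^sub>R H b y)"
      by (rule hadamard[OF smooth_on_subset[OF smooth_funsD(2)[OF f c] \<rho>U]], rule that)
    define h where "h = (\<lambda>b. glue U \<phi> (\<phi> x) (\<rho> / 2) (H b))"
    have h: "h b \<in> smooth_funs N" for b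
      unfolding h_def using \<rho> by (intro glue_smooth[OF c _ open_ball _ \<rho>U H(1)]) auto
    let ?e = "indicator (points N) :: 'a \<Rightarrow> complex"
    define t where "t = (\<lambda>b. k b - (\<lambda>_. complex_of_real (\<phi> x \<bullet> b)) * ?e)"
    have t: "t b \<in> smooth_funs N" for b
      unfolding t_def by (intro smooth_funs_diff k smooth_funs_scale smooth_funs_indicator)
    let ?G = "(\<lambda>_. f x) * ?e + (\<Sum>b\<in>Basis. t b * h b)"
    \<comment> \<open>\<open>h b\<close> is glued with a bump of radius \<open>\<rho> / 2\<close>,
      which is 1 on the ball of radius \<open>\<rho> / 4\<close>; there the Hadamard expansion holds
      for the global functions.\<close>
    let ?W = "{y \<in> U. \<phi> y \<in> ball (\<phi> x) (\<rho> / 4)}"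
    have "X f x = X ?G x"
    proof (rule field_local[OF f])
      show "?G \<in> smooth_funs N"
        by (intro smooth_funs_add smooth_funs_scale smooth_funs_indicator smooth_funs_sum smooth_funs_mult t h finite_Basis)
      show "openin (mtop N) ?W" by (rule chart_preimage_open[OF c]) simp
      show "x \<in> ?W" using xU \<rho> by simp
      fix y assume y: "y \<in> ?W"
      then have "\<phi> y \<in> ball (\<phi> x) \<rho>" using \<rho> by auto
      moreover from this have "\<phi> y \<in> \<phi> ` W" using \<rho> by auto
      then have yW: "y \<in> W" using y chart_inj[OF c] by (auto simp: W_def inj_on_def)
      ultimately have "f y = f x + (\<Sum>b\<in>Basis. ((\<phi> y - \<phi> x) \<bullet> b) *\<^sub>R H b (\<phi> y))"
        using H(3)[of "\<phi> y"] y xU chart_inv[OF c] by auto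
      moreover have "h b y = H b (\<phi> y)" for b
        unfolding h_def using y \<rho> by (intro glue_inside) auto
      moreover have "y \<in> points N" using y chart_subset[OF c] by auto
      ultimately show "f y = ?G y"
        using kW[OF yW] by (simp add: t_def sum_fun_apply inner_diff_left scaleR_conv_of_real)
    qed
    also have "\<dots> = (\<Sum>b\<in>Basis. X (t b * h b) x)"
    proof -
      have "X (\<Sum>b\<in>Basis. t b * h b) = (\<Sum>b\<in>Basis. X (t b * h b))"
        by (rule field_sum) (auto intro: smooth_funs_mult t h)
      moreover have "X ?G = X ((\<lambda>_. f x) * ?e) + X (\<Sum>b\<in>Basis. t b * h b)"
        by (intro field_add smooth_funs_scale smooth_funs_indicator smooth_funs_sum smooth_funs_mult t h finite_Basis)
      ultimately show ?thesis
        by (simp add: field_scale smooth_funs_indicator field_indicator sum_fun_apply)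
    qed
    also have "\<dots> = (\<Sum>b\<in>Basis. X (k b) x * D ?F (\<phi> x) b)"
    proof (rule sum.cong[OF refl])
      fix b :: 'e
      have "t b x = 0" using kW[OF x] xp by (simp add: t_def)
      moreover have "h b x = D ?F (\<phi> x) b"
        using H(2)[of b] \<rho> xU by (simp add: h_def glue_inside)
      moreover have "X (t b) x = X (k b) x"
        unfolding t_def by (simp add: field_diff k smooth_funs_scale smooth_funs_indicator field_scale field_indicator)
      ultimately show "X (t b * h b) x = X (k b) x * D ?F (\<phi> x) b"
        by (simp add: field_mult t h)
    qed
    finally show ?thesis .
  qed
  show ?thesis
    by (rule that[of W k]) (use oW x0 r k kW main in \<open>auto simp: W_def\<close>)
qed

end

end


section \<open>Lie groups and left-invariant fields\<close>

text \<open>A derivative in the second variable is the total derivative in the direction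
  \<open>(0, v)\<close>, and this depends smoothly on the parameter \<open>z\<close>. Smooth
  dependence of \<open>lv\<close>, \<open>mc\<close> and \<open>Ad\<close> on the base point is
  obtained in this way.\<close>

lemma smooth_on_partial_D:
  fixes \<Phi> :: "'a::euclidean_space \<times> 'b::euclidean_space \<Rightarrow> 'c::real_normed_vector"
  assumes O: "open O'" and \<Phi>: "smooth_on O' \<Phi>" and S: "open S" and c: "smooth_on S c"
    and sub: "\<And>z. z \<in> S \<Longrightarrow> (z, c z) \<in> O'"
  shows "z \<in> S \<Longrightarrow> D (\<lambda>y. \<Phi> (z, y)) (c z) v = D \<Phi> (z, c z) (0, v)"
    and "smooth_on S (\<lambda>z. D (\<lambda>y. \<Phi> (z, y)) (c z) v)"
proof -
  show 1: "D (\<lambda>y. \<Phi> (z, y)) (c z) v = D \<Phi> (z, c z) (0, v)" if "z \<in> S" for z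
  proof -
    have "((\<lambda>y. (z, y)) has_derivative (\<lambda>v. (0, v))) (at (c z))"
      by (auto intro!: derivative_eq_intros)
    from has_derivative_compose[OF this D_has_derivative[OF smooth_on_differentiable[OF \<Phi> sub[OF that]]]]
    show ?thesis by (simp add: D_eqI)
  qed
  have "smooth_on S (\<lambda>z. (z, c z))" by (intro smooth_on_Pair S smooth_on_id c)
  from smooth_on_compose[OF S O _ this smooth_on_D[OF \<Phi>, of "(0, v)"]]
  have "smooth_on S (\<lambda>z. D \<Phi> (z, c z) (0, v))" using sub by auto
  then show "smooth_on S (\<lambda>z. D (\<lambda>y. \<Phi> (z, y)) (c z) v)"
    by (rule smooth_on_cong[OF S, THEN iffD1, rotated]) (simp add: 1)
qed

lemma (in manifold) bracket_field:
  assumes X: "X \<in> vector_fields N" and Y: "Y \<in> vector_fields N"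
  shows "bracket X Y \<in> vector_fields N"
proof -
  note s = field_smooth[OF X] field_smooth[OF Y] smooth_funs_add smooth_funs_mult smooth_funs_scale
  have "bracket X Y f \<in> smooth_funs N" if "f \<in> smooth_funs N" for f
    using that by (simp add: bracket_def smooth_funs_diff s)
  moreover have "bracket X Y f = 0" if "f \<notin> smooth_funs N" for f
    using that by (simp add: bracket_def field_junk[OF X] field_junk[OF Y] field_zero[OF X] field_zero[OF Y])
  moreover have "bracket X Y (f + g) = bracket X Y f + bracket X Y g"
    if "f \<in> smooth_funs N" "g \<in> smooth_funs N" for f g
    using that by (simp add: bracket_def field_add[OF X] field_add[OF Y] s)
  moreover have "bracket X Y ((\<lambda>_. c) * f) = (\<lambda>_. c) * bracket X Y f"
    if "f \<in> smooth_funs N" for f c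
    using that by (simp add: bracket_def field_scale[OF X] field_scale[OF Y] s) (simp add: fun_eq_iff algebra_simps)
  moreover have "bracket X Y (f * g) = bracket X Y f * g + f * bracket X Y g"
    if "f \<in> smooth_funs N" "g \<in> smooth_funs N" for f g
    using that by (simp add: bracket_def field_add[OF X] field_add[OF Y] field_mult[OF X] field_mult[OF Y] s)
      (simp add: fun_eq_iff algebra_simps)
  ultimately show ?thesis unfolding vector_fields_def by blast
qed

lemma (in manifold) bracket_real_field:
  "X \<in> real_fields N \<Longrightarrow> Y \<in> real_fields N \<Longrightarrow> bracket X Y \<in> real_fields N"
proof -
  assume X: "X \<in> real_fields N" and Y: "Y \<in> real_fields N"
  have "range (bracket X Y f) \<subseteq> \<real>" if f: "f \<in> smooth_funs N" "range f \<subseteq> \<real>" for f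
  proof -
    have Xv: "X \<in> vector_fields N" and Yv: "Y \<in> vector_fields N" using X Y by (auto simp: real_fields_def)
    have "range (X f) \<subseteq> \<real>" "range (Y f) \<subseteq> \<real>" using X Y f by (auto simp: real_fields_def)
    then have "range (X (Y f)) \<subseteq> \<real>" "range (Y (X f)) \<subseteq> \<real>"
      using X Y field_smooth[OF Xv f(1)] field_smooth[OF Yv f(1)] unfolding real_fields_def by blast+
    then show ?thesis by (auto simp: bracket_def image_subset_iff)
  qed
  then show ?thesis using X Y bracket_field by (auto simp: real_fields_def)
qed

locale lie =
  fixes G :: "'g::{t2_space, second_countable_topology} monoid"
    and M :: "('g, 'e::euclidean_space) charted"
  assumes lie: "lie_group G M"
begin

abbreviation mul (infixl "\<cdot>" 70) where "x \<cdot> y \<equiv> x \<otimes>\<^bsub>G\<^esub> y"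
abbreviation iv where "iv x \<equiv> inv\<^bsub>G\<^esub> x"
abbreviation e where "e \<equiv> \<one>\<^bsub>G\<^esub>"

lemma group: "group G" and carrier: "carrier G = UNIV" and mtop: "mtop M = euclidean"
  using lie by (auto simp: lie_group_def)

sublocale grp: group G by (rule group)

sublocale manifold M
  using lie by (auto simp: lie_group_def intro: smooth_manifold_imp_manifold)

lemma points_UNIV: "points M = UNIV"
  by (simp add: points_def mtop)

lemma grp_simps [simp]:
  "x \<cdot> y \<cdot> z = x \<cdot> (y \<cdot> z)" "e \<cdot> x = x" "x \<cdot> e = x" "iv x \<cdot> x = e" "x \<cdot> iv x = e"
  "iv x \<cdot> (x \<cdot> y) = y" "x \<cdot> (iv x \<cdot> y) = y" "iv (iv x) = x" "iv e = e" "iv (x \<cdot> y) = iv y \<cdot> iv x"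
proof -
  have a: "x \<cdot> y \<cdot> z = x \<cdot> (y \<cdot> z)" for x y z by (simp add: grp.m_assoc carrier)
  show "x \<cdot> y \<cdot> z = x \<cdot> (y \<cdot> z)" by (rule a)
  show "e \<cdot> x = x" "x \<cdot> e = x" "iv x \<cdot> x = e" "x \<cdot> iv x = e" "iv (iv x) = x" "iv e = e" "iv (x \<cdot> y) = iv y \<cdot> iv x"
    by (simp_all add: carrier grp.inv_mult_group)
  show "iv x \<cdot> (x \<cdot> y) = y" "x \<cdot> (iv x \<cdot> y) = y"
    by (simp_all add: a[symmetric] carrier)
qed

lemma chart_open: "(U, \<phi>) \<in> atlas M \<Longrightarrow> open U"
  using chart_openin by (simp add: mtop)

lemma continuous_mul: "continuous_on S (\<lambda>p. fst p \<cdot> snd p)"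
proof -
  have "continuous_map (prod_topology euclidean euclidean) euclidean (\<lambda>(x, y). x \<cdot> y)"
    using lie by (simp add: lie_group_def smooth_map_def prod_charted_def mtop)
  then have "continuous_on UNIV (\<lambda>p. fst p \<cdot> snd p)"
    by (simp add: euclidean_product_topology split_beta)
  then show ?thesis using continuous_on_subset by blast
qed

lemma continuous_on_mul [continuous_intros]:
  "continuous_on S f \<Longrightarrow> continuous_on S g \<Longrightarrow> continuous_on S (\<lambda>x. f x \<cdot> g x)"
  using continuous_on_compose2[OF continuous_mul[of UNIV] continuous_on_Pair[of S f g]] by simp

lemma continuous_on_iv [continuous_intros]:
  assumes "continuous_on S f" shows "continuous_on S (\<lambda>x. iv (f x))"
proof -
  have "continuous_map euclidean euclidean (\<lambda>x. iv x)"
    using lie by (simp add: lie_group_def smooth_map_def mtop)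
  then have "continuous_on UNIV (\<lambda>x. iv x)" by simp
  from continuous_on_compose2[OF this assms] show ?thesis by simp
qed

text \<open>Smoothness of a map into the group is tested on smooth functions, so that products and
  inverses can be composed without carrying charts of the target. Continuity makes preimages of
  chart domains open.\<close>

definition plot :: "'a::euclidean_space set \<Rightarrow> ('a \<Rightarrow> 'g) \<Rightarrow> bool" where
  "plot S \<kappa> \<longleftrightarrow> continuous_on S \<kappa> \<and> (\<forall>F\<in>smooth_funs M. smooth_on S (\<lambda>s. F (\<kappa> s)))"

lemma plot_continuous: "plot S \<kappa> \<Longrightarrow> continuous_on S \<kappa>"
  and plot_smooth: "plot S \<kappa> \<Longrightarrow> F \<in> smooth_funs M \<Longrightarrow> smooth_on S (\<lambda>s. F (\<kappa> s))"
  by (auto simp: plot_def)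

lemma plot_subset: "plot S \<kappa> \<Longrightarrow> T \<subseteq> S \<Longrightarrow> plot T \<kappa>"
  by (auto simp: plot_def intro: continuous_on_subset smooth_on_subset)

lemma plot_const: "plot S (\<lambda>_. g)"
  by (auto simp: plot_def intro: smooth_on_const)

lemma plot_compose:
  assumes "open S" "open T" "plot S \<kappa>" "smooth_on T g" "g ` T \<subseteq> S"
  shows "plot T (\<lambda>t. \<kappa> (g t))"
  using assms unfolding plot_def
  by (auto intro: continuous_on_compose2[OF _ smooth_on_continuous_on] smooth_on_compose)

lemma chart_plot:
  assumes c: "(U, \<phi>) \<in> atlas M" shows "plot (\<phi> ` U) (inv_into U \<phi>)"
proof -
  have "continuous_on (\<phi> ` U) (inv_into U \<phi>)"
    unfolding continuous_on_open_vimage[OF chart_open_image[OF c]]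
  proof (intro allI impI)
    fix B :: "'g set" assume "open B"
    then have "open (\<phi> ` (B \<inter> U))"
      using chart_open[OF c] by (intro chart_image_open[OF c]) (auto simp: mtop)
    moreover have "inv_into U \<phi> -` B \<inter> \<phi> ` U = \<phi> ` (B \<inter> U)"
      using chart_inv[OF c] by auto
    ultimately show "open (inv_into U \<phi> -` B \<inter> \<phi> ` U)" by simp
  qed
  then show ?thesis unfolding plot_def using smooth_funsD(2)[OF _ c] by blast
qed

lemma open_plot_preimage:
  assumes "continuous_on S \<kappa>" "open S" "open W" shows "open {s \<in> S. \<kappa> s \<in> W}"
  using continuous_open_preimage[OF assms] by (simp add: vimage_def Int_def conj_commute)

text \<open>Coordinates cut off by a bump are global smooth functions, and so the test by functions
  controls the coordinates themselves.\<close>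

lemma plot_chart:
  assumes S: "open S" and \<kappa>: "plot S \<kappa>" and c: "(U, \<phi>) \<in> atlas M"
  shows "smooth_on {s \<in> S. \<kappa> s \<in> U} (\<lambda>s. \<phi> (\<kappa> s))"
proof (rule smooth_on_local)
  fix s assume s: "s \<in> {s \<in> S. \<kappa> s \<in> U}"
  obtain r where r: "r > 0" "cball (\<phi> (\<kappa> s)) r \<subseteq> \<phi> ` U"
    using chart_open_image[OF c] s open_contains_cball by blast
  define k where "k = (\<lambda>b. glue U \<phi> (\<phi> (\<kappa> s)) r (\<lambda>y. complex_of_real (y \<bullet> b)))"
  have k: "k b \<in> smooth_funs M" for b
    unfolding k_def
    by (rule glue_smooth[OF c r(1) chart_open_image[OF c] r(2) order_refl])
      (intro smooth_on_linear[OF _ bounded_linear_of_real] smooth_on_linear[OF _ bounded_linear_inner_left] smooth_on_id chart_open_image[OF c])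
  define W where "W = {x \<in> U. \<phi> x \<in> ball (\<phi> (\<kappa> s)) (r / 2)}"
  have W: "open W" unfolding W_def using chart_preimage_open[OF c open_ball, unfolded mtop, unfolded open_openin[symmetric]] .
  define T where "T = {t \<in> S. \<kappa> t \<in> W}"
  have T: "open T" unfolding T_def by (rule open_plot_preimage[OF plot_continuous[OF \<kappa>] S W])
  have "smooth_on T (\<lambda>t. \<phi> (\<kappa> t))"
  proof (rule smooth_on_componentwise[OF T])
    fix b :: 'e
    have "smooth_on T (\<lambda>t. Re (k b (\<kappa> t)))"
    proof (rule smooth_on_linear[OF T bounded_linear_Re])
      show "smooth_on T (\<lambda>t. k b (\<kappa> t))"
        by (rule smooth_on_subset[OF plot_smooth[OF \<kappa> k]]) (simp add: T_def)
    qed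
    then show "smooth_on T (\<lambda>t. \<phi> (\<kappa> t) \<bullet> b)"
      by (rule smooth_on_cong[OF T, THEN iffD1, rotated])
        (use r in \<open>auto simp: T_def W_def k_def glue_inside\<close>)
  qed
  moreover have "s \<in> T" using s r by (auto simp: T_def W_def)
  ultimately show "\<exists>T. open T \<and> s \<in> T \<and> smooth_on T (\<lambda>s. \<phi> (\<kappa> s))" using T by blast
qed

lemma plotI:
  assumes "open S" "continuous_on S \<kappa>"
    and loc: "\<And>s. s \<in> S \<Longrightarrow> \<exists>T U \<phi>. open T \<and> s \<in> T \<and> (U, \<phi>) \<in> atlas M \<and> \<kappa> ` T \<subseteq> U \<and> smooth_on T (\<lambda>s. \<phi> (\<kappa> s))"
  shows "plot S \<kappa>"
proof -
  have "smooth_on S (\<lambda>s. F (\<kappa> s))" if F: "F \<in> smooth_funs M" for F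
  proof (rule smooth_on_local)
    fix s assume "s \<in> S"
    then obtain T U \<phi> where T: "open T" "s \<in> T" and c: "(U, \<phi>) \<in> atlas M" and sub: "\<kappa> ` T \<subseteq> U"
      and sm: "smooth_on T (\<lambda>s. \<phi> (\<kappa> s))" using loc by meson
    have "smooth_on T (\<lambda>s. F (inv_into U \<phi> (\<phi> (\<kappa> s))))"
      by (rule smooth_on_compose[OF T(1) chart_open_image[OF c] _ sm smooth_funsD(2)[OF F c]]) (use sub in auto)
    then have "smooth_on T (\<lambda>s. F (\<kappa> s))"
      by (rule smooth_on_cong[OF T(1), THEN iffD1, rotated]) (use sub chart_inv[OF c] in auto)
    then show "\<exists>T. open T \<and> s \<in> T \<and> smooth_on T (\<lambda>s. F (\<kappa> s))" using T by blast
  qed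
  then show ?thesis using assms(2) by (simp add: plot_def)
qed

text \<open>Smoothness of multiplication is given in product charts, where the product falls into a
  third chart; continuity provides a rectangle \<open>U' \<times> V'\<close> on which this is the
  case.\<close>

lemma plot_mul:
  assumes S: "open S" and k1: "plot S \<kappa>" and k2: "plot S \<mu>"
  shows "plot S (\<lambda>s. \<kappa> s \<cdot> \<mu> s)"
proof (rule plotI[OF S])
  show "continuous_on S (\<lambda>s. \<kappa> s \<cdot> \<mu> s)" by (intro continuous_on_mul plot_continuous k1 k2)
  fix s assume s: "s \<in> S"
  obtain U \<phi> where U: "(U, \<phi>) \<in> atlas M" "\<kappa> s \<in> U" using chart_ex points_UNIV by blast
  obtain V \<psi> where V: "(V, \<psi>) \<in> atlas M" "\<mu> s \<in> V" using chart_ex points_UNIV by blast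
  obtain W \<eta> where W: "(W, \<eta>) \<in> atlas M" "\<kappa> s \<cdot> \<mu> s \<in> W" using chart_ex points_UNIV by blast
  have "open {p \<in> U \<times> V. fst p \<cdot> snd p \<in> W}"
    by (rule open_plot_preimage[OF continuous_mul]) (use chart_open[OF W(1)] open_Times[OF chart_open[OF U(1)] chart_open[OF V(1)]] in auto)
  moreover have "(\<kappa> s, \<mu> s) \<in> {p \<in> U \<times> V. fst p \<cdot> snd p \<in> W}" using U V W by simp
  ultimately obtain U' V' where o': "open U'" "open V'" "(\<kappa> s, \<mu> s) \<in> U' \<times> V'"
    and sub: "U' \<times> V' \<subseteq> {p \<in> U \<times> V. fst p \<cdot> snd p \<in> W}"
    by (rule open_prod_elim)
  then have o: "open U'" "open V'" "\<kappa> s \<in> U'" "\<mu> s \<in> V'" by auto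
  have sU: "U' \<subseteq> U" and sV: "V' \<subseteq> V" using sub o(3,4) by auto
  have oi: "open (\<phi> ` U')" "open (\<psi> ` V')"
    using chart_image_open[OF U(1), of U'] chart_image_open[OF V(1), of V'] o sU sV by (auto simp: mtop)
  have "smooth_on (map_prod \<phi> \<psi> ` {p \<in> U \<times> V. (case p of (x, y) \<Rightarrow> x \<cdot> y) \<in> W})
      (\<eta> \<circ> (\<lambda>(x, y). x \<cdot> y) \<circ> inv_into (U \<times> V) (map_prod \<phi> \<psi>))"
  proof -
    have "(U \<times> V, map_prod \<phi> \<psi>) \<in> atlas (prod_charted M M)"
      using U V by (auto simp: prod_charted_def)
    moreover have "smooth_map (prod_charted M M) M (\<lambda>(x, y). x \<cdot> y)" using lie unfolding lie_group_def by blast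
    ultimately show ?thesis using W(1) unfolding smooth_map_def by blast
  qed
  then have sm: "smooth_on (\<phi> ` U' \<times> \<psi> ` V') (\<eta> \<circ> (\<lambda>(x, y). x \<cdot> y) \<circ> inv_into (U \<times> V) (map_prod \<phi> \<psi>))"
  proof (rule smooth_on_subset)
    have "map_prod \<phi> \<psi> ` (U' \<times> V') \<subseteq> map_prod \<phi> \<psi> ` {p \<in> U \<times> V. fst p \<cdot> snd p \<in> W}"
      by (rule image_mono[OF sub])
    then show "\<phi> ` U' \<times> \<psi> ` V' \<subseteq> map_prod \<phi> \<psi> ` {p \<in> U \<times> V. (case p of (x, y) \<Rightarrow> x \<cdot> y) \<in> W}"
      by (simp add: split_beta map_prod_surj_on)
  qed
  have inj: "inj_on (map_prod \<phi> \<psi>) (U \<times> V)"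
    using chart_inj[OF U(1)] chart_inj[OF V(1)] by (rule map_prod_inj_on)
  have inv: "inv_into (U \<times> V) (map_prod \<phi> \<psi>) (\<phi> x, \<psi> y) = (x, y)" if "x \<in> U" "y \<in> V" for x y
    using inv_into_f_f[OF inj, of "(x, y)"] that by simp
  define T where "T = {t \<in> {t \<in> S. \<kappa> t \<in> U'}. \<mu> t \<in> V'}"
  have T: "open T" unfolding T_def
  proof (rule open_plot_preimage)
    show o1: "open {t \<in> S. \<kappa> t \<in> U'}" by (rule open_plot_preimage[OF plot_continuous[OF k1] S o(1)])
    show "continuous_on {t \<in> S. \<kappa> t \<in> U'} \<mu>" by (rule continuous_on_subset[OF plot_continuous[OF k2]]) auto
  qed (rule o(2))
  have "smooth_on T (\<lambda>t. (\<phi> (\<kappa> t), \<psi> (\<mu> t)))"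
    by (intro smooth_on_Pair T smooth_on_subset[OF plot_chart[OF S k1 U(1)]] smooth_on_subset[OF plot_chart[OF S k2 V(1)]])
      (use sU sV in \<open>auto simp: T_def\<close>)
  from smooth_on_compose[OF T open_Times[OF oi] _ this sm]
  have "smooth_on T (\<lambda>t. (\<eta> \<circ> (\<lambda>(x, y). x \<cdot> y) \<circ> inv_into (U \<times> V) (map_prod \<phi> \<psi>)) (\<phi> (\<kappa> t), \<psi> (\<mu> t)))"
    by (auto simp: T_def image_subset_iff)
  then have "smooth_on T (\<lambda>t. \<eta> (\<kappa> t \<cdot> \<mu> t))"
    by (rule smooth_on_cong[OF T, THEN iffD1, rotated]) (use sU sV in \<open>auto simp: T_def inv subset_iff\<close>)
  moreover have "s \<in> T" using s o by (simp add: T_def)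
  moreover have "(\<lambda>t. \<kappa> t \<cdot> \<mu> t) ` T \<subseteq> W" using sub by (auto simp: T_def)
  ultimately show "\<exists>T U \<phi>. open T \<and> s \<in> T \<and> (U, \<phi>) \<in> atlas M \<and> (\<lambda>t. \<kappa> t \<cdot> \<mu> t) ` T \<subseteq> U \<and> smooth_on T (\<lambda>t. \<phi> (\<kappa> t \<cdot> \<mu> t))"
    using T W by blast
qed

lemma plot_iv:
  assumes S: "open S" and k: "plot S \<kappa>"
  shows "plot S (\<lambda>s. iv (\<kappa> s))"
proof (rule plotI[OF S])
  show "continuous_on S (\<lambda>s. iv (\<kappa> s))" by (rule continuous_on_iv[OF plot_continuous[OF k]])
  fix s assume s: "s \<in> S"
  obtain U \<phi> where U: "(U, \<phi>) \<in> atlas M" "\<kappa> s \<in> U" using chart_ex points_UNIV by blast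
  obtain W \<eta> where W: "(W, \<eta>) \<in> atlas M" "iv (\<kappa> s) \<in> W" using chart_ex points_UNIV by blast
  let ?U = "{x \<in> U. iv x \<in> W}"
  have o: "open ?U" by (intro open_plot_preimage continuous_on_iv continuous_on_id chart_open[OF U(1)] chart_open[OF W(1)])
  have oi: "open (\<phi> ` ?U)" using chart_image_open[OF U(1), of ?U] o by (auto simp: mtop)
  have sm: "smooth_on (\<phi> ` ?U) (\<eta> \<circ> (\<lambda>x. iv x) \<circ> inv_into U \<phi>)"
  proof -
    have "smooth_map M M (\<lambda>x. iv x)" using lie unfolding lie_group_def by blast
    then show ?thesis using U(1) W(1) unfolding smooth_map_def by blast
  qed
  define T where "T = {t \<in> S. \<kappa> t \<in> ?U}"
  have T: "open T" unfolding T_def by (rule open_plot_preimage[OF plot_continuous[OF k] S o])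
  have "smooth_on T (\<lambda>t. \<phi> (\<kappa> t))"
    by (rule smooth_on_subset[OF plot_chart[OF S k U(1)]]) (auto simp: T_def)
  from smooth_on_compose[OF T oi _ this sm]
  have "smooth_on T (\<lambda>t. (\<eta> \<circ> (\<lambda>x. iv x) \<circ> inv_into U \<phi>) (\<phi> (\<kappa> t)))" by (auto simp: T_def image_subset_iff)
  then have "smooth_on T (\<lambda>t. \<eta> (iv (\<kappa> t)))"
    by (rule smooth_on_cong[OF T, THEN iffD1, rotated]) (use chart_inv[OF U(1)] in \<open>auto simp: T_def\<close>)
  moreover have "s \<in> T" using s U W by (simp add: T_def)
  moreover have "(\<lambda>t. iv (\<kappa> t)) ` T \<subseteq> W" by (auto simp: T_def)
  ultimately show "\<exists>T U \<phi>. open T \<and> s \<in> T \<and> (U, \<phi>) \<in> atlas M \<and> (\<lambda>t. iv (\<kappa> t)) ` T \<subseteq> U \<and> smooth_on T (\<lambda>t. \<phi> (iv (\<kappa> t)))"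
    using T W by blast
qed

lemma smooth_funs_comp:
  assumes F: "F \<in> smooth_funs M" and "\<And>U \<phi>. (U, \<phi>) \<in> atlas M \<Longrightarrow> plot (\<phi> ` U) (\<lambda>z. h (inv_into U \<phi> z))"
  shows "(\<lambda>x. F (h x)) \<in> smooth_funs M"
proof -
  have "smooth_on (\<phi> ` U) (\<lambda>z. F (h (inv_into U \<phi> z)))" if "(U, \<phi>) \<in> atlas M" for U \<phi>
    by (rule plot_smooth[OF assms(2)[OF that] F])
  then show ?thesis by (auto simp: smooth_funs_def points_UNIV o_def)
qed

lemma smooth_funs_left: "F \<in> smooth_funs M \<Longrightarrow> (\<lambda>x. F (a \<cdot> x)) \<in> smooth_funs M"
  by (erule smooth_funs_comp) (intro plot_mul plot_const chart_plot chart_open_image)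

lemma smooth_funs_right: "F \<in> smooth_funs M \<Longrightarrow> (\<lambda>x. F (x \<cdot> a)) \<in> smooth_funs M"
  by (erule smooth_funs_comp) (intro plot_mul plot_const chart_plot chart_open_image)

section \<open>The unit chart and the left-invariant fields\<close>

definition unit_chart where "unit_chart = (SOME c. c \<in> atlas M \<and> e \<in> fst c)"
definition U0 where "U0 = fst unit_chart"
definition \<phi>0 where "\<phi>0 = snd unit_chart"
abbreviation \<psi>0 where "\<psi>0 \<equiv> inv_into U0 \<phi>0"
abbreviation D0 where "D0 \<equiv> \<phi>0 ` U0"
abbreviation y0 where "y0 \<equiv> \<phi>0 e"

lemma c0: "(U0, \<phi>0) \<in> atlas M" and e_U0: "e \<in> U0"
proof -
  have "\<exists>c. c \<in> atlas M \<and> e \<in> fst c" using chart_ex[of e] points_UNIV by fastforce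
  from someI_ex[OF this] show "(U0, \<phi>0) \<in> atlas M" "e \<in> U0"
    by (auto simp: U0_def \<phi>0_def unit_chart_def)
qed

lemma open_U0: "open U0" and open_D0: "open D0" and y0_D0: "y0 \<in> D0" and \<psi>0_y0 [simp]: "\<psi>0 y0 = e"
  and \<psi>0_\<phi>0: "x \<in> U0 \<Longrightarrow> \<psi>0 (\<phi>0 x) = x" and \<psi>0_in: "y \<in> D0 \<Longrightarrow> \<psi>0 y \<in> U0"
  and plot_\<psi>0: "plot D0 \<psi>0"
  using chart_open[OF c0] chart_open_image[OF c0] e_U0 chart_inv[OF c0] chart_inv_in[OF c0] chart_plot[OF c0] by auto

text \<open>The left-invariant field with value \<open>v\<close> at the identity, where tangent
  vectors are coordinates in the unit chart. In this way \<open>'e\<close> itself becomes the Lie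
  algebra.\<close>

definition lv :: "'e \<Rightarrow> 'g vfield" where
  "lv v F = (if F \<in> smooth_funs M then (\<lambda>x. D (\<lambda>y. F (x \<cdot> \<psi>0 y)) y0 v) else 0)"

lemma lv_apply: "F \<in> smooth_funs M \<Longrightarrow> lv v F x = D (\<lambda>y. F (x \<cdot> \<psi>0 y)) y0 v"
  by (simp add: lv_def)

lemma plot_translate: "plot D0 (\<lambda>y. x \<cdot> \<psi>0 y)"
  by (intro plot_mul open_D0 plot_const plot_\<psi>0)

lemma lv_differentiable: "F \<in> smooth_funs M \<Longrightarrow> (\<lambda>y. F (x \<cdot> \<psi>0 y)) differentiable (at y0)"
  using smooth_on_differentiable[OF plot_smooth[OF plot_translate] y0_D0] .

lemma lv_smooth: assumes F: "F \<in> smooth_funs M" shows "lv v F \<in> smooth_funs M"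
proof -
  have "smooth_on (\<phi> ` U) (\<lambda>z. D (\<lambda>y. F (inv_into U \<phi> z \<cdot> \<psi>0 y)) y0 v)" if c: "(U, \<phi>) \<in> atlas M" for U \<phi>
  proof -
    let ?O = "\<phi> ` U \<times> D0"
    have O: "open ?O" by (intro open_Times chart_open_image[OF c] open_D0)
    have "plot ?O (\<lambda>p. inv_into U \<phi> (fst p) \<cdot> \<psi>0 (snd p))"
      by (intro plot_mul O plot_compose[OF chart_open_image[OF c] O chart_plot[OF c]] plot_compose[OF open_D0 O plot_\<psi>0]
          smooth_on_bounded_linear[OF O] bounded_linear_fst bounded_linear_snd) auto
    from smooth_on_partial_D(2)[OF O plot_smooth[OF this F] chart_open_image[OF c] smooth_on_const]
    show ?thesis using y0_D0 by simp
  qed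
  then show ?thesis using F by (auto simp: smooth_funs_def points_UNIV o_def lv_def)
qed

lemma lv_vector_field: "lv v \<in> vector_fields M"
proof -
  note d = D_has_derivative[OF lv_differentiable]
  have "lv v (F + H) = lv v F + lv v H" if "F \<in> smooth_funs M" "H \<in> smooth_funs M" for F H
    using D_eqI[OF has_derivative_add[OF d[OF that(1)] d[OF that(2)]]] that smooth_funs_add
    by (simp add: fun_eq_iff lv_apply)
  moreover have "lv v ((\<lambda>_. c) * F) = (\<lambda>_. c) * lv v F" if "F \<in> smooth_funs M" for F c
    using D_eqI[OF has_derivative_mult_right[OF d[OF that]]] that smooth_funs_scale
    by (simp add: fun_eq_iff lv_apply)
  moreover have "lv v (F * H) = lv v F * H + F * lv v H" if "F \<in> smooth_funs M" "H \<in> smooth_funs M" for F H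
    using D_eqI[OF has_derivative_mult[OF d[OF that(1)] d[OF that(2)]]] that smooth_funs_mult
    by (simp add: fun_eq_iff lv_apply algebra_simps)
  ultimately show ?thesis unfolding vector_fields_def using lv_smooth by (auto simp: lv_def)
qed

lemma has_derivative_real:
  assumes "(f has_derivative f') (at x)" "\<And>y. f y \<in> (\<real> :: complex set)" shows "f' v \<in> \<real>"
proof -
  have "((\<lambda>y. Im (f y)) has_derivative (\<lambda>v. Im (f' v))) (at x)"
    by (intro bounded_linear.has_derivative[OF bounded_linear_Im] assms)
  moreover have "(\<lambda>y. Im (f y)) = (\<lambda>_. 0)" using assms(2) by (auto simp: complex_is_Real_iff)
  ultimately have "(\<lambda>v. Im (f' v)) = (\<lambda>_. 0)"
    using has_derivative_unique by (metis has_derivative_const)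
  then show ?thesis by (metis complex_is_Real_iff)
qed

lemma lv_real_field: "lv v \<in> real_fields M"
proof -
  have "lv v F x \<in> \<real>" if "F \<in> smooth_funs M" "range F \<subseteq> \<real>" for F x
    unfolding lv_apply[OF that(1)]
    by (rule has_derivative_real[OF D_has_derivative[OF lv_differentiable[OF that(1)]]]) (use that in auto)
  then show ?thesis using lv_vector_field by (auto simp: real_fields_def)
qed

lemma lv_add: "lv (v + w) = lv v + lv w"
  by (auto simp: fun_eq_iff lv_def D_add lv_differentiable)

lemma lv_scale: "lv (r *\<^sub>R v) = cscale (of_real r) (lv v)"
  by (auto simp: fun_eq_iff lv_def D_scale lv_differentiable cscale_def fmult_def scaleR_conv_of_real)

lemma lv_zero: "lv 0 = 0"
  using lv_add[of 0 0] by simp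

lemma lv_sum: "lv (sum f A) F x = (\<Sum>i\<in>A. lv (f i) F x)"
proof (induction A rule: infinite_finite_induct)
  case (insert i A) then show ?case by (simp add: lv_add)
qed (simp_all add: lv_zero)

lemma lv_left_translate: assumes "F \<in> smooth_funs M" shows "lv v (\<lambda>x. F (a \<cdot> x)) x = lv v F (a \<cdot> x)"
  using assms smooth_funs_left[OF assms] by (simp add: lv_apply)

lemma left_translate_smooth_iff: "(\<lambda>x. F (a \<cdot> x)) \<in> smooth_funs M \<longleftrightarrow> F \<in> smooth_funs M"
  using smooth_funs_left[of "\<lambda>x. F (a \<cdot> x)" "iv a"] smooth_funs_left[of F a] by auto

lemma left_push_apply: "left_push G a X F x = X (\<lambda>x. F (a \<cdot> x)) (iv a \<cdot> x)"
  by (simp add: left_push_def o_def)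

lemma lv_left_invariant: "left_push G a (lv v) = lv v"
proof (intro ext)
  fix F x show "left_push G a (lv v) F x = lv v F x"
    using lv_left_translate[of F v a "iv a \<cdot> x"] left_translate_smooth_iff[of F a]
    by (cases "F \<in> smooth_funs M") (simp_all add: left_push_apply lv_def)
qed

lemma lv_lie_algebra: "lv v \<in> lie_algebra G M"
  by (simp add: lie_algebra_def lv_real_field lv_left_invariant)

text \<open>At the identity a derivation is a combination of coordinate derivatives, with real
  coefficients for a real field; left invariance carries the equality to all points.\<close>

lemma lie_algebra_lv: assumes "X \<in> lie_algebra G M" shows "\<exists>v. X = lv v"
proof -
  have X: "X \<in> vector_fields M" and Xr: "X \<in> real_fields M" and Xl: "\<And>a. left_push G a X = X"
    using assms by (auto simp: lie_algebra_def real_fields_def carrier)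
  obtain W k where W: "openin (mtop M) W" "e \<in> W" "W \<subseteq> U0" and k: "\<And>b. k b \<in> smooth_funs M"
    "\<And>b y. y \<in> W \<Longrightarrow> k b y = complex_of_real (\<phi>0 y \<bullet> b)"
    and XF: "\<And>x f. x \<in> W \<Longrightarrow> f \<in> smooth_funs M \<Longrightarrow> X f x = (\<Sum>b\<in>Basis. X (k b) x * D (\<lambda>y. f (\<psi>0 y)) (\<phi>0 x) b)"
    by (rule field_in_chart[OF X c0 e_U0], rule that)
  \<comment> \<open>\<open>k b\<close> is known to be real only on \<open>W\<close>. Its real part
    is real everywhere and agrees with it near the identity, so that locality gives the same
    derivative.\<close>
  have real: "X (k b) e \<in> \<real>" for b
  proof -
    let ?k = "\<lambda>y. complex_of_real (Re (k b y))"
    have "(\<lambda>y. complex_of_real (Re (f y))) \<in> smooth_funs M" if "f \<in> smooth_funs M" for f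
    proof -
      have "smooth_on (\<phi> ` U) (\<lambda>z. complex_of_real (Re (f (inv_into U \<phi> z))))"
        if c: "(U, \<phi>) \<in> atlas M" for U \<phi>
        by (intro smooth_on_linear[OF _ bounded_linear_of_real] smooth_on_linear[OF _ bounded_linear_Re]
            chart_open_image[OF c] smooth_funsD(2)[OF \<open>f \<in> smooth_funs M\<close> c])
      then show ?thesis by (auto simp: smooth_funs_def points_UNIV o_def)
    qed
    then have k': "?k \<in> smooth_funs M" using k by blast
    have "X (k b) e = X ?k e"
      by (rule field_local[OF X k(1) k' W(1,2)]) (simp add: k)
    moreover have "\<forall>f\<in>smooth_funs M. range f \<subseteq> \<real> \<longrightarrow> range (X f) \<subseteq> \<real>"
      using Xr by (simp add: real_fields_def)
    then have "range ?k \<subseteq> \<real> \<longrightarrow> range (X ?k) \<subseteq> \<real>" using k' by (rule bspec)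
    then have "range (X ?k) \<subseteq> \<real>" by (rule mp) auto
    then have "X ?k e \<in> \<real>" by (rule subsetD) (rule rangeI)
    ultimately show ?thesis by (rule ssubst)
  qed
  define v where "v = (\<Sum>b\<in>Basis. Re (X (k b) e) *\<^sub>R b)"
  have e: "X F e = lv v F e" if F: "F \<in> smooth_funs M" for F
  proof -
    have "lv v F e = (\<Sum>b\<in>Basis. complex_of_real (Re (X (k b) e)) * lv b F e)"
      unfolding v_def by (simp add: lv_sum lv_scale cscale_def fmult_def)
    also have "\<dots> = (\<Sum>b\<in>Basis. X (k b) e * D (\<lambda>y. F (\<psi>0 y)) y0 b)"
      using real F by (simp add: lv_apply complex_is_Real_iff complex_eq_iff)
    finally show ?thesis using XF[OF W(2) F] by simp
  qed
  have "X F x = lv v F x" for F x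
  proof (cases "F \<in> smooth_funs M")
    case True
    have "X F x = left_push G x X F x" using Xl by simp
    also have "\<dots> = lv v (\<lambda>y. F (x \<cdot> y)) e" by (simp add: left_push_apply e smooth_funs_left True)
    also have "\<dots> = lv v F x" using lv_left_translate[OF True] by simp
    finally show ?thesis .
  qed (simp add: field_junk[OF X] lv_def)
  then show ?thesis by (intro exI[of _ v] ext)
qed

text \<open>The pullback of the left Maurer-Cartan form by \<open>\<kappa>\<close>, read in the unit
  chart.\<close>

definition mc :: "('a::euclidean_space \<Rightarrow> 'g) \<Rightarrow> 'a \<Rightarrow> 'a \<Rightarrow> 'e" where
  "mc \<kappa> s a = D (\<lambda>t. \<phi>0 (iv (\<kappa> s) \<cdot> \<kappa> t)) s a"

context
  fixes S :: "'a::euclidean_space set" and \<kappa> assumes S: "open S" and \<kappa>: "plot S \<kappa>"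
begin

lemma mc_differentiable: assumes s: "s \<in> S" shows "(\<lambda>t. \<phi>0 (iv (\<kappa> s) \<cdot> \<kappa> t)) differentiable (at s)"
  using smooth_on_differentiable[OF plot_chart[OF S plot_mul[OF S plot_const \<kappa>] c0, of "iv (\<kappa> s)"]] s e_U0 by simp

lemma D_plot:
  assumes s: "s \<in> S" and F: "F \<in> smooth_funs M"
  shows "D (\<lambda>t. F (\<kappa> t)) s a = lv (mc \<kappa> s a) F (\<kappa> s)"
proof -
  let ?T = "{t \<in> S. iv (\<kappa> s) \<cdot> \<kappa> t \<in> U0}"
  have T: "open ?T"
    by (rule open_plot_preimage[OF plot_continuous[OF plot_mul[OF S plot_const \<kappa>]] S open_U0])
  have "D (\<lambda>t. F (\<kappa> t)) s a = D (\<lambda>t. F (\<kappa> s \<cdot> \<psi>0 (\<phi>0 (iv (\<kappa> s) \<cdot> \<kappa> t)))) s a"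
    by (subst D_cong[OF T, of s _ "\<lambda>t. F (\<kappa> s \<cdot> \<psi>0 (\<phi>0 (iv (\<kappa> s) \<cdot> \<kappa> t)))"])
      (use s e_U0 in \<open>auto simp: \<psi>0_\<phi>0\<close>)
  also have "\<dots> = D (\<lambda>y. F (\<kappa> s \<cdot> \<psi>0 y)) y0 (mc \<kappa> s a)"
    using D_comp(1)[OF mc_differentiable[OF s], of "\<lambda>y. F (\<kappa> s \<cdot> \<psi>0 y)" a] lv_differentiable[OF F]
    by (simp add: mc_def)
  finally show ?thesis using F by (simp add: lv_apply)
qed

text \<open>In the definition \<open>s\<close> is both the base point and the point of
  differentiation. The two roles are separated into a function of two variables, which is
  differentiated in the second one along the diagonal.\<close>

lemma mc_smooth: "smooth_on S (\<lambda>s. mc \<kappa> s a)"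
proof -
  let ?k = "\<lambda>p. iv (\<kappa> (fst p)) \<cdot> \<kappa> (snd p)"
  let ?O = "{p \<in> S \<times> S. ?k p \<in> U0}"
  have SS: "open (S \<times> S)" by (intro open_Times S)
  have k: "plot (S \<times> S) ?k"
    by (intro plot_mul plot_iv SS plot_compose[OF S SS \<kappa>] smooth_on_bounded_linear[OF SS] bounded_linear_fst bounded_linear_snd) auto
  have O: "open ?O" by (rule open_plot_preimage[OF plot_continuous[OF k] SS open_U0])
  from smooth_on_partial_D(2)[OF O plot_chart[OF SS k c0] S smooth_on_id]
  show ?thesis using e_U0 by (simp add: mc_def)
qed

lemma mc_expand: "s \<in> S \<Longrightarrow> mc \<kappa> s a = (\<Sum>b\<in>Basis. (a \<bullet> b) *\<^sub>R mc \<kappa> s b)"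
  unfolding mc_def by (rule D_expand[OF mc_differentiable])

end

lemma unit_coordinates:
  obtains k where "\<And>b. k b \<in> smooth_funs M" "\<And>b v. lv v (k b) e = complex_of_real (v \<bullet> b)"
proof -
  obtain W k where W: "openin (mtop M) W" "e \<in> W" "W \<subseteq> U0" and k: "\<And>b. k b \<in> smooth_funs M"
    "\<And>b y. y \<in> W \<Longrightarrow> k b y = complex_of_real (\<phi>0 y \<bullet> b)"
    by (rule field_in_chart[OF lv_vector_field[of 0] c0 e_U0], rule that)
  have W': "open (\<phi>0 ` W)" using chart_image_open[OF c0 W(1,3)] .
  have "lv v (k b) e = complex_of_real (v \<bullet> b)" for b v
  proof -
    have "D (\<lambda>y. k b (\<psi>0 y)) y0 = D (\<lambda>y. complex_of_real (y \<bullet> b)) y0"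
      by (rule D_cong[OF W']) (use W k \<psi>0_\<phi>0 in auto)
    also have "\<dots> = (\<lambda>v. complex_of_real (v \<bullet> b))"
      by (rule D_eqI) (auto intro!: derivative_eq_intros)
    finally show ?thesis using k by (simp add: lv_apply)
  qed
  with k show ?thesis using that by blast
qed

lemma lv_inj: assumes "\<And>F. F \<in> smooth_funs M \<Longrightarrow> lv v F x = lv w F x" shows "v = w"
proof -
  obtain k where k: "\<And>b. k b \<in> smooth_funs M" "\<And>b v. lv v (k b) e = complex_of_real (v \<bullet> b)"
    by (rule unit_coordinates, rule that)
  have "v \<bullet> b = w \<bullet> b" for b
    using assms[of "\<lambda>y. k b (iv x \<cdot> y)"] k smooth_funs_left lv_left_translate[OF k(1)] by simp
  then show ?thesis by (rule euclidean_eqI)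
qed

lemma lv_eq_iff: "lv v = lv w \<longleftrightarrow> v = w"
proof
  assume "lv v = lv w"
  then show "v = w" by (intro lv_inj[of v _ w]) simp
qed simp

lemma bracket_lv_ex: "\<exists>u. bracket (lv v) (lv w) = lv u"
proof -
  have "left_push G a (bracket (lv v) (lv w)) F x = bracket (lv v) (lv w) F x" for a F x
  proof (cases "F \<in> smooth_funs M")
    case True
    have "lv u (\<lambda>x. F (a \<cdot> x)) = (\<lambda>x. lv u F (a \<cdot> x))" for u
      by (rule ext) (rule lv_left_translate[OF True])
    then show ?thesis
      by (simp add: left_push_apply bracket_def lv_left_translate lv_smooth True)
  next
    case False
    then show ?thesis using left_translate_smooth_iff[of F a]
      by (simp add: left_push_apply field_junk[OF bracket_field[OF lv_vector_field lv_vector_field]])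
  qed
  then have "bracket (lv v) (lv w) \<in> lie_algebra G M"
    using bracket_real_field[OF lv_real_field lv_real_field] by (simp add: lie_algebra_def fun_eq_iff)
  then show ?thesis by (rule lie_algebra_lv)
qed

definition br :: "'e \<Rightarrow> 'e \<Rightarrow> 'e" where "br v w = (SOME u. bracket (lv v) (lv w) = lv u)"

lemma bracket_lv: "bracket (lv v) (lv w) = lv (br v w)"
  unfolding br_def by (rule someI_ex[OF bracket_lv_ex])

end


section \<open>The quotient \<open>\<Gamma>\<setminus>G\<close>\<close>

locale lie_quot = lie G M for G :: "'g::{t2_space, second_countable_topology} monoid"
    and M :: "('g, 'e::euclidean_space) charted" +
  fixes \<Gamma> :: "'g set"
  assumes lattice: "uniform_lattice G M \<Gamma>"
begin

abbreviation Q where "Q \<equiv> quotient_manifold G \<Gamma> M"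
abbreviation p where "p \<equiv> coset_proj G \<Gamma>"

lemma subgroup: "subgroup \<Gamma> G" and discrete: "discrete \<Gamma>" and compact_Q: "compact_space (mtop Q)"
  using lattice by (auto simp: uniform_lattice_def)

lemma e_\<Gamma>: "e \<in> \<Gamma>" and mul_\<Gamma>: "a \<in> \<Gamma> \<Longrightarrow> b \<in> \<Gamma> \<Longrightarrow> a \<cdot> b \<in> \<Gamma>" and iv_\<Gamma>: "a \<in> \<Gamma> \<Longrightarrow> iv a \<in> \<Gamma>"
  using subgroup by (auto simp: subgroup.one_closed subgroup.m_closed subgroup.m_inv_closed)

lemma p_eq: "p x = (\<lambda>\<gamma>. \<gamma> \<cdot> x) ` \<Gamma>"
  by (auto simp: coset_proj_def r_coset_def)

lemma p_eq_iff: "p x = p y \<longleftrightarrow> y \<cdot> iv x \<in> \<Gamma>"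
proof
  assume "p x = p y"
  moreover have "y \<in> p y" using e_\<Gamma> by (force simp: p_eq)
  ultimately obtain \<gamma> where "\<gamma> \<in> \<Gamma>" "y = \<gamma> \<cdot> x" by (auto simp: p_eq)
  then show "y \<cdot> iv x \<in> \<Gamma>" by simp
next
  assume a: "y \<cdot> iv x \<in> \<Gamma>"
  show "p x = p y"
  proof (intro equalityI subsetI)
    fix z assume "z \<in> p x"
    then obtain \<gamma> where g: "\<gamma> \<in> \<Gamma>" "z = \<gamma> \<cdot> x" by (auto simp: p_eq)
    then have "z = (\<gamma> \<cdot> iv (y \<cdot> iv x)) \<cdot> y" by simp
    then show "z \<in> p y" using mul_\<Gamma>[OF g(1) iv_\<Gamma>[OF a]] unfolding p_eq by blast
  next
    fix z assume "z \<in> p y"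
    then obtain \<gamma> where g: "\<gamma> \<in> \<Gamma>" "z = \<gamma> \<cdot> y" by (auto simp: p_eq)
    then have "z = (\<gamma> \<cdot> (y \<cdot> iv x)) \<cdot> x" by simp
    then show "z \<in> p x" using mul_\<Gamma>[OF g(1) a] unfolding p_eq by blast
  qed
qed

lemma p_left [simp]: "\<gamma> \<in> \<Gamma> \<Longrightarrow> p (\<gamma> \<cdot> x) = p x"
  using p_eq_iff[of x "\<gamma> \<cdot> x"] by simp

lemma p_eqE: assumes "p x = p y" obtains \<gamma> where "\<gamma> \<in> \<Gamma>" "y = \<gamma> \<cdot> x"
proof -
  have "y = (y \<cdot> iv x) \<cdot> x" by simp
  then show ?thesis using that assms p_eq_iff by blast
qed

lemma mtop_Q: "mtop Q = quotient_topology euclidean p" and points_Q: "points Q = range p"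
  by (simp_all add: quotient_manifold_def mtop points_def topspace_quotient_topology)

lemma openin_Q: "openin (mtop Q) V \<longleftrightarrow> V \<subseteq> range p \<and> open {x. p x \<in> V}"
  by (simp add: mtop_Q openin_quotient_topology)

lemma open_left_translate: assumes "open U" shows "open ((\<lambda>x. a \<cdot> x) ` U)"
proof -
  have "open {x \<in> UNIV. iv a \<cdot> x \<in> U}"
    by (rule open_plot_preimage) (auto intro!: continuous_on_mul assms)
  moreover have "(\<lambda>x. a \<cdot> x) ` U = {x \<in> UNIV. iv a \<cdot> x \<in> U}" by force
  ultimately show ?thesis by simp
qed

lemma openin_p_image: assumes "open U" shows "openin (mtop Q) (p ` U)"
proof -
  have "{x. p x \<in> p ` U} = (\<Union>\<gamma>\<in>\<Gamma>. (\<lambda>x. \<gamma> \<cdot> x) ` U)"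
    by (auto elim!: p_eqE[OF sym])
  then show ?thesis using open_left_translate[OF assms] by (auto simp: openin_Q)
qed

lemma open_p_preimage: "openin (mtop Q) V \<Longrightarrow> open {x. p x \<in> V}"
  by (simp add: openin_Q)

lemma unit_neighbourhood:
  obtains O' where "open O'" "e \<in> O'" "O' \<inter> \<Gamma> = {e}"
  using discrete e_\<Gamma> unfolding discrete_def isolated_in_def by blast

lemma quotient_neighbourhood:
  assumes "open O'" "e \<in> O'"
  obtains U where "open U" "x \<in> U" "\<And>a b. a \<in> U \<Longrightarrow> b \<in> U \<Longrightarrow> a \<cdot> iv b \<in> O'"
proof -
  have "open {q \<in> UNIV. fst q \<cdot> iv (snd q) \<in> O'}"
    by (rule open_plot_preimage[OF _ _ assms(1)])
      (auto intro!: continuous_on_mul continuous_on_iv continuous_on_fst continuous_on_snd continuous_on_id)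
  moreover have "(x, x) \<in> {q \<in> UNIV. fst q \<cdot> iv (snd q) \<in> O'}" using assms by simp
  ultimately obtain A B where AB: "open A" "open B" "(x, x) \<in> A \<times> B" "A \<times> B \<subseteq> {q \<in> UNIV. fst q \<cdot> iv (snd q) \<in> O'}"
    by (rule open_prod_elim)
  show ?thesis by (rule that[of "A \<inter> B"]) (use AB in auto)
qed

lemma p_locally_inj: obtains U where "open U" "x \<in> U" "inj_on p U"
proof -
  obtain O' where O: "open O'" "e \<in> O'" "O' \<inter> \<Gamma> = {e}" by (rule unit_neighbourhood)
  obtain U where U: "open U" "x \<in> U" "\<And>a b. a \<in> U \<Longrightarrow> b \<in> U \<Longrightarrow> a \<cdot> iv b \<in> O'"
    by (rule quotient_neighbourhood[OF O(1,2)], rule that)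
  have "inj_on p U"
  proof (rule inj_onI)
    fix a b assume "a \<in> U" "b \<in> U" "p a = p b"
    then have "b \<cdot> iv a \<in> O' \<inter> \<Gamma>" using U(3) by (simp add: p_eq_iff)
    then have "b \<cdot> iv a = e" using O by auto
    then have "(b \<cdot> iv a) \<cdot> a = a" by (simp only: grp_simps)
    then show "a = b" by simp
  qed
  then show ?thesis using that U by blast
qed

text \<open>A neighbourhood \<open>U\<close> with all quotients \<open>a \<cdot> iv b\<close> in
  \<open>O'\<close> contains at most one element of \<open>\<Gamma>\<close>, and this one can be
  removed. Closedness is what makes the quotient Hausdorff.\<close>

lemma closed_\<Gamma>: "closed \<Gamma>"
proof -
  obtain O' where O: "open O'" "e \<in> O'" "O' \<inter> \<Gamma> = {e}" by (rule unit_neighbourhood)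
  have "\<exists>T. open T \<and> z \<in> T \<and> T \<subseteq> - \<Gamma>" if z: "z \<notin> \<Gamma>" for z
  proof -
    obtain U where U: "open U" "z \<in> U" "\<And>a b. a \<in> U \<Longrightarrow> b \<in> U \<Longrightarrow> a \<cdot> iv b \<in> O'"
      by (rule quotient_neighbourhood[OF O(1,2)], rule that)
    have u: "a = b" if "a \<in> U \<inter> \<Gamma>" "b \<in> U \<inter> \<Gamma>" for a b
    proof -
      have "a \<cdot> iv b \<in> O' \<inter> \<Gamma>" using U(3) that mul_\<Gamma> iv_\<Gamma> by simp
      then have "a \<cdot> iv b = e" using O by auto
      then have "(a \<cdot> iv b) \<cdot> b = b" by (simp only: grp_simps)
      then show "a = b" by simp
    qed
    show ?thesis
    proof (cases "U \<inter> \<Gamma> = {}")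
      case True then show ?thesis using U by blast
    next
      case False
      then obtain g where g: "g \<in> U \<inter> \<Gamma>" by blast
      have "open (U - {g})" using U by (intro open_Diff) auto
      moreover have "z \<in> U - {g}" using U z g by auto
      moreover have "U - {g} \<subseteq> - \<Gamma>" using u g by auto
      ultimately show ?thesis by blast
    qed
  qed
  then have "open (- \<Gamma>)" by (subst open_subopen) (auto 0 3)
  then show ?thesis by (simp add: closed_def)
qed

text \<open>Distinct cosets mean that \<open>y \<cdot> iv x\<close> lies in the open complement of
  \<open>\<Gamma>\<close>; a rectangle around \<open>(y, x)\<close> with this property projects to
  disjoint sets, which are open since \<open>p\<close> is an open map.\<close>

lemma hausdorff_Q: "Hausdorff_space (mtop Q)"
  unfolding Hausdorff_space_def
proof (intro allI impI)
  fix q r assume qr: "q \<in> topspace (mtop Q) \<and> r \<in> topspace (mtop Q) \<and> q \<noteq> r"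
  then obtain x y where xy: "q = p x" "r = p y" using points_Q by (auto simp: points_def)
  have "open {z \<in> UNIV. fst z \<cdot> iv (snd z) \<in> - \<Gamma>}"
    by (rule open_plot_preimage)
      (auto intro!: continuous_on_mul continuous_on_iv continuous_on_fst continuous_on_snd continuous_on_id closed_\<Gamma>)
  moreover have "(y, x) \<in> {z \<in> UNIV. fst z \<cdot> iv (snd z) \<in> - \<Gamma>}" using qr xy p_eq_iff[of x y] by simp
  ultimately obtain B A where AB: "open B" "open A" "(y, x) \<in> B \<times> A" "B \<times> A \<subseteq> {z \<in> UNIV. fst z \<cdot> iv (snd z) \<in> - \<Gamma>}"
    by (rule open_prod_elim)
  have "disjnt (p ` A) (p ` B)"
  proof -
    have "p a \<noteq> p b" if "a \<in> A" "b \<in> B" for a b using AB(4) that p_eq_iff[of a b] by auto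
    then show ?thesis by (auto simp: disjnt_def)
  qed
  then show "\<exists>U V. openin (mtop Q) U \<and> openin (mtop Q) V \<and> q \<in> U \<and> r \<in> V \<and> disjnt U V"
    using AB xy openin_p_image by (intro exI[of _ "p ` A"] exI[of _ "p ` B"]) auto
qed

section \<open>Charts of the quotient\<close>

definition good :: "'g set \<Rightarrow> bool" where
  "good U \<longleftrightarrow> open U \<and> inj_on p U"

abbreviation qchart where "qchart U \<phi> \<equiv> \<phi> \<circ> inv_into U p"

lemma atlas_Q: "c \<in> atlas Q \<longleftrightarrow> (\<exists>U V \<phi>. c = (p ` U, qchart U \<phi>) \<and> (V, \<phi>) \<in> atlas M \<and> U \<subseteq> V \<and> good U)"
  by (auto simp: quotient_manifold_def good_def mtop)

context
  fixes U V \<phi> assumes c: "(V, \<phi>) \<in> atlas M" and sub: "U \<subseteq> V" and good: "good U"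
begin

lemma good_open: "open U" and good_inj: "inj_on p U"
  using good by (auto simp: good_def)

lemma good_image_open: "open (\<phi> ` U)"
  using chart_image_open[OF c _ sub] good_open by (simp add: mtop)

lemma good_inv: "x \<in> U \<Longrightarrow> inv_into V \<phi> (\<phi> x) = x"
  using chart_inv[OF c] sub by auto

lemma qchart_apply: "x \<in> U \<Longrightarrow> qchart U \<phi> (p x) = \<phi> x"
  by (simp add: good_inj)

lemma qchart_image: "qchart U \<phi> ` (p ` W) = \<phi> ` W" if "W \<subseteq> U"
  using that by (force simp: good_inj subset_iff)

lemma qchart_inj: "inj_on (qchart U \<phi>) (p ` U)"
proof (rule inj_onI)
  fix a b assume "a \<in> p ` U" "b \<in> p ` U" and eq: "qchart U \<phi> a = qchart U \<phi> b"
  then obtain x y where xy: "x \<in> U" "y \<in> U" "a = p x" "b = p y" by blast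
  then have "\<phi> x = \<phi> y" using eq qchart_apply by simp
  then show "a = b" using xy chart_inj[OF c] sub by (auto dest!: inj_onD)
qed

lemma qchart_inv: "y \<in> \<phi> ` U \<Longrightarrow> inv_into (p ` U) (qchart U \<phi>) y = p (inv_into V \<phi> y)"
proof -
  assume "y \<in> \<phi> ` U"
  then obtain x where x: "x \<in> U" "y = \<phi> x" by blast
  have "inv_into (p ` U) (qchart U \<phi>) (qchart U \<phi> (p x)) = p x"
    by (rule inv_into_f_f[OF qchart_inj]) (use x in blast)
  then show ?thesis unfolding qchart_apply[OF x(1)] using x good_inv by simp
qed

lemma qchart_homeo: "homeomorphic_map (subtopology (mtop Q) (p ` U)) (top_of_set (qchart U \<phi> ` (p ` U))) (qchart U \<phi>)"
proof (rule bijective_open_imp_homeomorphic_map)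
  have ts: "topspace (subtopology (mtop Q) (p ` U)) = p ` U"
    using points_Q by (auto simp: points_def topspace_subtopology)
  have "continuous_map (subtopology (mtop Q) (p ` U)) euclidean (qchart U \<phi>)"
    unfolding continuous_map_def
  proof (intro conjI allI impI)
    fix B :: "'e set" assume "openin euclidean B"
    then have "open {x \<in> V. \<phi> x \<in> B}" using chart_preimage_open[OF c] by (simp add: mtop)
    then have "open (U \<inter> {x \<in> V. \<phi> x \<in> B})" using good_open by blast
    then have "openin (mtop Q) (p ` (U \<inter> {x \<in> V. \<phi> x \<in> B}))" by (rule openin_p_image)
    moreover have "{x \<in> p ` U. qchart U \<phi> x \<in> B} = p ` (U \<inter> {x \<in> V. \<phi> x \<in> B}) \<inter> p ` U"
      using sub by (auto simp: good_inj)
    ultimately show "openin (subtopology (mtop Q) (p ` U)) {x \<in> topspace (subtopology (mtop Q) (p ` U)). qchart U \<phi> x \<in> B}"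
      unfolding ts openin_subtopology by blast
  qed auto
  then show "continuous_map (subtopology (mtop Q) (p ` U)) (top_of_set (qchart U \<phi> ` (p ` U))) (qchart U \<phi>)"
    using ts by (auto simp: continuous_map_in_subtopology)
  show "open_map (subtopology (mtop Q) (p ` U)) (top_of_set (qchart U \<phi> ` (p ` U))) (qchart U \<phi>)"
    unfolding open_map_def
  proof (intro allI impI)
    fix W assume "openin (subtopology (mtop Q) (p ` U)) W"
    then obtain W' where W': "openin (mtop Q) W'" "W = W' \<inter> p ` U" unfolding openin_subtopology by blast
    have "qchart U \<phi> ` W = \<phi> ` (U \<inter> {x. p x \<in> W'})"
      unfolding W'(2) by (force simp: good_inj)
    moreover have "open (\<phi> ` (U \<inter> {x. p x \<in> W'}))"
      by (rule chart_image_open[OF c]) (use open_p_preimage[OF W'(1)] good_open sub in \<open>auto simp: mtop\<close>)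
    ultimately show "openin (top_of_set (qchart U \<phi> ` (p ` U))) (qchart U \<phi> ` W)"
      unfolding qchart_image[OF order_refl] openin_open by (metis Int_absorb1 Int_lower1 image_mono)
  qed
  show "qchart U \<phi> ` topspace (subtopology (mtop Q) (p ` U)) = topspace (top_of_set (qchart U \<phi> ` (p ` U)))"
    by (simp only: ts topspace_euclidean_subtopology)
  show "inj_on (qchart U \<phi>) (topspace (subtopology (mtop Q) (p ` U)))" by (simp only: ts qchart_inj)
qed

lemma qchart_atlas: "(p ` U, qchart U \<phi>) \<in> atlas Q"
  using atlas_Q c sub good by blast

end

text \<open>Two sheets over one point differ by left translation with some \<open>\<gamma>\<close>.
  With this \<open>\<gamma>\<close> fixed, the transition near the point is the translation read in
  charts of the group.\<close>

lemma qchart_transition: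
  assumes c: "(V, \<phi>) \<in> atlas M" "U \<subseteq> V" "good U" and c': "(V', \<phi>') \<in> atlas M" "U' \<subseteq> V'" "good U'"
  shows "smooth_on (qchart U \<phi> ` (p ` U \<inter> p ` U')) (qchart U' \<phi>' \<circ> inv_into (p ` U) (qchart U \<phi>))"
proof (rule smooth_on_local)
  fix y assume "y \<in> qchart U \<phi> ` (p ` U \<inter> p ` U')"
  then obtain x x' where x: "x \<in> U" "x' \<in> U'" "p x = p x'" "y = \<phi> x"
    using qchart_apply[OF c] by (force simp del: comp_apply)
  obtain \<gamma> where g: "\<gamma> \<in> \<Gamma>" "x' = \<gamma> \<cdot> x" using x(3) by (rule p_eqE)
  let ?k = "\<lambda>z. \<gamma> \<cdot> inv_into V \<phi> z"
  have op: "open (\<phi> ` U)" by (rule good_image_open[OF c])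
  have k: "plot (\<phi> ` U) ?k"
    by (intro plot_mul plot_const op plot_subset[OF chart_plot[OF c(1)]] image_mono c(2))
  define T where "T = {z \<in> \<phi> ` U. ?k z \<in> U'}"
  have T: "open T" unfolding T_def
    by (rule open_plot_preimage[OF plot_continuous[OF k] op good_open[OF c']])
  have "smooth_on T (\<lambda>z. \<phi>' (?k z))"
    by (rule smooth_on_subset[OF plot_chart[OF op k c'(1)]]) (use c'(2) in \<open>auto simp: T_def\<close>)
  then have "smooth_on T (qchart U' \<phi>' \<circ> inv_into (p ` U) (qchart U \<phi>))"
  proof (rule smooth_on_cong[OF T, THEN iffD1, rotated])
    fix z assume z: "z \<in> T"
    then have "(qchart U' \<phi>' \<circ> inv_into (p ` U) (qchart U \<phi>)) z = qchart U' \<phi>' (p (?k z))"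
      using qchart_inv[OF c] g(1) by (simp add: T_def)
    also have "\<dots> = \<phi>' (?k z)" by (rule qchart_apply[OF c']) (use z in \<open>simp add: T_def\<close>)
    finally show "\<phi>' (?k z) = (qchart U' \<phi>' \<circ> inv_into (p ` U) (qchart U \<phi>)) z" by simp
  qed
  moreover have "y \<in> T" using x g good_inv[OF c] by (auto simp: T_def)
  ultimately show "\<exists>T. open T \<and> y \<in> T \<and> smooth_on T (qchart U' \<phi>' \<circ> inv_into (p ` U) (qchart U \<phi>))"
    using T by blast
qed

lemma good_chart_ex: obtains U V \<phi> where "(V, \<phi>) \<in> atlas M" "U \<subseteq> V" "good U" "x \<in> U"
proof -
  obtain V \<phi> where V: "(V, \<phi>) \<in> atlas M" "x \<in> V" using chart_ex points_UNIV by blast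
  obtain U where U: "open U" "x \<in> U" "inj_on p U" by (rule p_locally_inj)
  show ?thesis
    by (rule that[of V \<phi> "U \<inter> V"]) (use U V chart_open[OF V(1)] in \<open>auto simp: good_def intro: inj_on_subset\<close>)
qed

sublocale Q: manifold Q
proof
  show "Hausdorff_space (mtop Q)" by (rule hausdorff_Q)
  show "(\<Union>(U, \<phi>)\<in>atlas Q. U) = points Q"
  proof (intro equalityI subsetI)
    fix q assume "q \<in> points Q"
    then obtain x where x: "q = p x" using points_Q by auto
    obtain U V \<phi> where c: "(V, \<phi>) \<in> atlas M" "U \<subseteq> V" "good U" "x \<in> U" by (rule good_chart_ex)
    then show "q \<in> (\<Union>(U, \<phi>)\<in>atlas Q. U)" using qchart_atlas[OF c(1-3)] x by blast
  qed (auto simp: atlas_Q points_Q)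
next
  fix U \<phi> assume "(U, \<phi>) \<in> atlas Q"
  then obtain U' V \<phi>' where c: "(V, \<phi>') \<in> atlas M" "U' \<subseteq> V" "good U'" and U: "U = p ` U'" "\<phi> = qchart U' \<phi>'"
    by (auto simp: atlas_Q)
  show "openin (mtop Q) U \<and> open (\<phi> ` U) \<and> homeomorphic_map (subtopology (mtop Q) U) (top_of_set (\<phi> ` U)) \<phi>"
    unfolding U using qchart_homeo[OF c] openin_p_image[OF good_open[OF c]] good_image_open[OF c]
      qchart_image[OF c order_refl] by simp
next
  fix U \<phi> V \<psi> assume "(U, \<phi>) \<in> atlas Q" "(V, \<psi>) \<in> atlas Q"
  then show "smooth_on (\<phi> ` (U \<inter> V)) (\<psi> \<circ> inv_into U \<phi>)"
    unfolding atlas_Q using qchart_transition by (elim exE conjE) (simp only: prod.inject)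
qed

text \<open>Lets functions on the quotient be handled as their \<open>\<Gamma>\<close>-invariant
  pullbacks. The extra clause concerns sets that are not cosets, where smooth functions are 0 by
  convention.\<close>

lemma smooth_funs_Q:
  "f \<in> smooth_funs Q \<longleftrightarrow> (\<forall>q. q \<notin> range p \<longrightarrow> f q = 0) \<and> (\<lambda>x. f (p x)) \<in> smooth_funs M"
proof
  assume f: "f \<in> smooth_funs Q"
  have "(\<lambda>x. f (p x)) \<in> smooth_funs M"
  proof (rule smooth_funsI)
    fix x
    obtain U V \<phi> where c: "(V, \<phi>) \<in> atlas M" "U \<subseteq> V" "good U" "x \<in> U" by (rule good_chart_ex)
    have "smooth_on (\<phi> ` U) (\<lambda>y. f (inv_into (p ` U) (qchart U \<phi>) y))"
      using Q.smooth_funsD(2)[OF f qchart_atlas[OF c(1-3)]] qchart_image[OF c(1-3) order_refl] by simp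
    then have "smooth_on (\<phi> ` U) (\<lambda>y. f (p (inv_into V \<phi> y)))"
      by (rule smooth_on_cong[OF good_image_open[OF c(1-3)], THEN iffD1, rotated]) (simp add: qchart_inv[OF c(1-3)])
    then show "\<exists>V \<phi> U. (V, \<phi>) \<in> atlas M \<and> openin (mtop M) U \<and> x \<in> U \<and> U \<subseteq> V \<and> smooth_on (\<phi> ` U) (\<lambda>y. f (p (inv_into V \<phi> y)))"
      using c good_open[OF c(1-3)] by (auto simp: mtop)
  qed (simp add: points_UNIV)
  then show "(\<forall>q. q \<notin> range p \<longrightarrow> f q = 0) \<and> (\<lambda>x. f (p x)) \<in> smooth_funs M"
    using Q.smooth_funsD(1)[OF f] points_Q by auto
next
  assume f: "(\<forall>q. q \<notin> range p \<longrightarrow> f q = 0) \<and> (\<lambda>x. f (p x)) \<in> smooth_funs M"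
  have "smooth_on (\<phi> ` U) (\<lambda>y. f (inv_into U \<phi> y))" if "(U, \<phi>) \<in> atlas Q" for U \<phi>
  proof -
    obtain U' V \<phi>' where c: "(V, \<phi>') \<in> atlas M" "U' \<subseteq> V" "good U'" and U: "U = p ` U'" "\<phi> = qchart U' \<phi>'"
      using \<open>(U, \<phi>) \<in> atlas Q\<close> by (auto simp: atlas_Q)
    have "smooth_on (\<phi>' ` U') (\<lambda>y. f (p (inv_into V \<phi>' y)))"
      using smooth_on_subset[OF smooth_funsD(2)[OF conjunct2[OF f] c(1)] image_mono[OF c(2)]] by simp
    then have "smooth_on (\<phi>' ` U') (\<lambda>y. f (inv_into (p ` U') (qchart U' \<phi>') y))"
      by (rule smooth_on_cong[OF good_image_open[OF c], THEN iffD1, rotated]) (simp add: qchart_inv[OF c])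
    then show ?thesis unfolding U qchart_image[OF c order_refl] .
  qed
  then show "f \<in> smooth_funs Q" using f points_Q by (auto simp: smooth_funs_def o_def)
qed

end


section \<open>The left-invariant frame of the quotient\<close>

lemma real_fieldsD: "X \<in> real_fields N \<Longrightarrow> f \<in> smooth_funs N \<Longrightarrow> (\<And>x. f x \<in> \<real>) \<Longrightarrow> X f x \<in> \<real>"
proof -
  assume X: "X \<in> real_fields N" and f: "f \<in> smooth_funs N" "\<And>x. f x \<in> \<real>"
  have "range f \<subseteq> \<real>" using f(2) by auto
  then have "range (X f) \<subseteq> \<real>" using X f(1) by (simp add: real_fields_def)
  then show "X f x \<in> \<real>" by (rule subsetD) (rule rangeI)
qed

lemma real_fieldsI:
  "X \<in> vector_fields N \<Longrightarrow> (\<And>f x. f \<in> smooth_funs N \<Longrightarrow> (\<And>y. f y \<in> \<real>) \<Longrightarrow> X f x \<in> \<real>) \<Longrightarrow> X \<in> real_fields N"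
  by (simp add: real_fields_def image_subset_iff)

lemma (in manifold) smooth_funs_real_linear:
  assumes f: "f \<in> smooth_funs N" and h: "bounded_linear h"
  shows "(\<lambda>x. complex_of_real (h (f x))) \<in> smooth_funs N"
proof -
  have "smooth_on (\<phi> ` U) (\<lambda>z. complex_of_real (h (f (inv_into U \<phi> z))))" if c: "(U, \<phi>) \<in> atlas N" for U \<phi>
    by (intro smooth_on_linear[OF _ bounded_linear_of_real] smooth_on_linear[OF _ h] chart_open_image[OF c]
        smooth_funsD(2)[OF f c])
  then show ?thesis using smooth_funsD(1)[OF f] linear_0[OF bounded_linear.linear[OF h]]
    by (auto simp: smooth_funs_def o_def)
qed

context lie_quot begin

text \<open>The frame of the quotient. The choice of a representative does no harm, because the
  pullback of \<open>f\<close> and its derivative along \<open>lv v\<close> are both invariant under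
  \<open>\<Gamma>\<close>.\<close>

definition E :: "'e \<Rightarrow> 'g set vfield" where
  "E v f = (if f \<in> smooth_funs Q then \<lambda>q. if q \<in> range p then lv v (\<lambda>x. f (p x)) (SOME x. p x = q) else 0 else 0)"

lemma pull: "f \<in> smooth_funs Q \<Longrightarrow> (\<lambda>x. f (p x)) \<in> smooth_funs M"
  using smooth_funs_Q by blast

lemma E_p: assumes f: "f \<in> smooth_funs Q" shows "E v f (p x) = lv v (\<lambda>x. f (p x)) x"
proof -
  have "p (SOME y. p y = p x) = p x" by (rule someI[of _ x]) simp
  then obtain \<gamma> where g: "\<gamma> \<in> \<Gamma>" "x = \<gamma> \<cdot> (SOME y. p y = p x)" by (rule p_eqE)
  have "lv v (\<lambda>x. f (p x)) (SOME y. p y = p x) = lv v (\<lambda>x. f (p (\<gamma> \<cdot> x))) (SOME y. p y = p x)"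
    using g(1) by simp
  also have "\<dots> = lv v (\<lambda>x. f (p x)) x"
    using lv_left_translate[OF pull[OF f], of v \<gamma>] g(2) by simp
  finally show ?thesis using f by (simp add: E_def)
qed

lemma E_outside: "q \<notin> range p \<Longrightarrow> E v f q = 0"
  by (simp add: E_def)

lemma E_junk: "f \<notin> smooth_funs Q \<Longrightarrow> E v f = 0"
  by (simp add: E_def)

lemma E_smooth: assumes "f \<in> smooth_funs Q" shows "E v f \<in> smooth_funs Q"
  using lv_smooth[OF pull[OF assms]] by (simp add: smooth_funs_Q[of "E v f"] E_outside E_p[OF assms])

lemma fun_Q_eqI: "(\<And>x. f (p x) = g (p x)) \<Longrightarrow> (\<And>q. q \<notin> range p \<Longrightarrow> f q = g q) \<Longrightarrow> f = g"
  by (metis ext rangeE)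

lemma E_vector_field: "E v \<in> vector_fields Q"
proof -
  have "E v (f + g) = E v f + E v g" if f: "f \<in> smooth_funs Q" "g \<in> smooth_funs Q" for f g
  proof (rule fun_Q_eqI)
    have "(\<lambda>x. (f + g) (p x)) = (\<lambda>x. f (p x)) + (\<lambda>x. g (p x))" by (simp add: fun_eq_iff)
    then show "E v (f + g) (p x) = (E v f + E v g) (p x)" for x
      using field_add[OF lv_vector_field pull[OF f(1)] pull[OF f(2)]]
      by (simp add: E_p f Q.smooth_funs_add)
  qed (simp add: E_outside)
  moreover have "E v ((\<lambda>_. c) * f) = (\<lambda>_. c) * E v f" if f: "f \<in> smooth_funs Q" for f c
  proof (rule fun_Q_eqI)
    have "(\<lambda>x. ((\<lambda>_. c) * f) (p x)) = (\<lambda>_. c) * (\<lambda>x. f (p x))" by (simp add: fun_eq_iff)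
    then show "E v ((\<lambda>_. c) * f) (p x) = ((\<lambda>_. c) * E v f) (p x)" for x
      using field_scale[OF lv_vector_field pull[OF f]]
      by (simp add: E_p f Q.smooth_funs_scale)
  qed (simp add: E_outside)
  moreover have "E v (f * g) = E v f * g + f * E v g" if f: "f \<in> smooth_funs Q" "g \<in> smooth_funs Q" for f g
  proof (rule fun_Q_eqI)
    have "(\<lambda>x. (f * g) (p x)) = (\<lambda>x. f (p x)) * (\<lambda>x. g (p x))" by (simp add: fun_eq_iff)
    then show "E v (f * g) (p x) = (E v f * g + f * E v g) (p x)" for x
      using field_mult[OF lv_vector_field pull[OF f(1)] pull[OF f(2)]]
      by (simp add: E_p f Q.smooth_funs_mult)
    show "E v (f * g) q = (E v f * g + f * E v g) q" if "q \<notin> range p" for q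
      using that f by (simp add: E_outside)
  qed
  ultimately show ?thesis unfolding vector_fields_def using E_smooth E_junk by blast
qed

lemma E_real_field: "E v \<in> real_fields Q"
proof (rule real_fieldsI[OF E_vector_field])
  fix f q assume f: "f \<in> smooth_funs Q" "\<And>q. f q \<in> \<real>"
  show "E v f q \<in> \<real>"
  proof (cases "q \<in> range p")
    case True
    then show ?thesis using real_fieldsD[OF lv_real_field pull[OF f(1)] f(2)] E_p[OF f(1)] by auto
  qed (simp add: E_outside)
qed

lemma E_add: "E (v + w) = E v + E w"
proof
  fix f show "E (v + w) f = (E v + E w) f"
  proof (cases "f \<in> smooth_funs Q")
    case True then show ?thesis by (intro fun_Q_eqI) (simp_all add: E_p E_outside lv_add)
  qed (simp add: E_junk)
qed

lemma E_scale: "E (r *\<^sub>R v) = cscale (of_real r) (E v)"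
proof
  fix f show "E (r *\<^sub>R v) f = cscale (of_real r) (E v) f"
  proof (cases "f \<in> smooth_funs Q")
    case True then show ?thesis by (intro fun_Q_eqI) (simp_all add: E_p E_outside lv_scale cscale_def fmult_def)
  qed (simp add: E_junk cscale_def fmult_def fun_eq_iff)
qed

lemma bracket_E: "bracket (E v) (E w) = E (br v w)"
proof
  fix f show "bracket (E v) (E w) f = E (br v w) f"
  proof (cases "f \<in> smooth_funs Q")
    case True
    show ?thesis
    proof (rule fun_Q_eqI)
      show "bracket (E v) (E w) f (p x) = E (br v w) f (p x)" for x
        by (simp add: bracket_def E_p True E_smooth bracket_lv[symmetric])
    qed (simp add: bracket_def E_outside)
  qed (simp add: E_junk Q.field_junk[OF Q.bracket_field[OF E_vector_field E_vector_field]])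
qed

lemma E_projects: "projects_to G \<Gamma> M (lv v) (E v)"
  by (auto simp: projects_to_def o_def fun_eq_iff E_p)

text \<open>\<open>J'\<close> commutes with left translations, so it sends \<open>lv v\<close> to
  some \<open>lv w\<close>; the compatibility of \<open>J'\<close> with \<open>J\<close> along
  projections transports this to the quotient.\<close>

lemma complex_structure_E:
  assumes "invariant_complex_structure_on_quotient G \<Gamma> M J"
  shows "\<exists>w. J (E v) = E w"
proof -
  from assms obtain J' where J: "complex_structure Q J" and J': "left_invariant_complex_structure G M J'"
    and pr: "\<And>X' X. X' \<in> vector_fields M \<Longrightarrow> X \<in> vector_fields Q \<Longrightarrow> projects_to G \<Gamma> M X' X \<Longrightarrow> projects_to G \<Gamma> M (J' X') (J X)"
    unfolding invariant_complex_structure_on_quotient_def by blast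
  have "J' (lv v) \<in> real_fields M"
    using J' lv_real_field unfolding left_invariant_complex_structure_def complex_structure_def by blast
  moreover have "left_push G a (J' (lv v)) = J' (lv v)" for a
    using J' lv_vector_field lv_left_invariant carrier unfolding left_invariant_complex_structure_def by (metis UNIV_I)
  ultimately have "J' (lv v) \<in> lie_algebra G M" by (simp add: lie_algebra_def)
  then obtain w where w: "J' (lv v) = lv w" using lie_algebra_lv by blast
  have p1: "projects_to G \<Gamma> M (lv w) (J (E v))" using pr[OF lv_vector_field E_vector_field E_projects, of v] w by simp
  have JE: "J (E v) \<in> vector_fields Q" using J E_vector_field unfolding complex_structure_def by blast
  have "J (E v) f = E w f" for f
  proof (cases "f \<in> smooth_funs Q")
    case True
    show ?thesis
    proof (rule fun_Q_eqI)
      show "J (E v) f (p x) = E w f (p x)" for x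
        using p1 True by (simp add: projects_to_def o_def fun_eq_iff E_p)
      show "J (E v) f q = E w f q" if "q \<notin> range p" for q
        using that Q.smooth_funsD(1)[OF Q.field_smooth[OF JE True]] points_Q by (simp add: E_outside)
    qed
  qed (simp add: E_junk Q.field_junk[OF JE])
  then show ?thesis by blast
qed

text \<open>Coordinates around \<open>p x\<close> are pulled back to a plot of \<open>G\<close>, whose logarithmic derivative
  expresses coordinate derivatives in the frame.\<close>

lemma field_in_frame_local:
  assumes X: "X \<in> vector_fields Q"
  obtains V \<phi> W h where "(V, \<phi>) \<in> atlas M" "open W" "x \<in> W" "W \<subseteq> V"
    "\<And>c. smooth_on (\<phi> ` W) (\<lambda>z. h c (inv_into V \<phi> z))"
    "\<And>f y. f \<in> smooth_funs Q \<Longrightarrow> y \<in> W \<Longrightarrow> X f (p y) = (\<Sum>c\<in>Basis. h c y * E c f (p y))"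
proof -
  obtain U V \<phi> where c: "(V, \<phi>) \<in> atlas M" "U \<subseteq> V" "good U" "x \<in> U" by (rule good_chart_ex)
  note c' = c(1-3)
  have px: "p x \<in> p ` U" using c by blast
  obtain W k where W: "openin (mtop Q) W" "p x \<in> W" "W \<subseteq> p ` U" and k: "\<And>b. k b \<in> smooth_funs Q"
    "\<And>b y. y \<in> W \<Longrightarrow> k b y = complex_of_real (qchart U \<phi> y \<bullet> b)"
    and XF: "\<And>q f. q \<in> W \<Longrightarrow> f \<in> smooth_funs Q \<Longrightarrow>
      X f q = (\<Sum>b\<in>Basis. X (k b) q * D (\<lambda>y. f (inv_into (p ` U) (qchart U \<phi>) y)) (qchart U \<phi> q) b)"
    by (rule Q.field_in_chart[OF X qchart_atlas[OF c'] px], rule that)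
  let ?\<kappa> = "inv_into V \<phi>"
  have op: "open (\<phi> ` U)" by (rule good_image_open[OF c'])
  have pl: "plot (\<phi> ` U) ?\<kappa>" by (rule plot_subset[OF chart_plot[OF c(1)] image_mono[OF c(2)]])
  define W' where "W' = U \<inter> {y. p y \<in> W}"
  have oW': "open W'" unfolding W'_def using good_open[OF c'] open_p_preimage[OF W(1)] by blast
  define h where "h = (\<lambda>c y. \<Sum>b\<in>Basis. X (k b) (p y) * complex_of_real (mc ?\<kappa> (\<phi> y) b \<bullet> c))"
  have "X f (p y) = (\<Sum>c\<in>Basis. h c y * E c f (p y))" if f: "f \<in> smooth_funs Q" and y: "y \<in> W'" for f y
  proof -
    have yU: "y \<in> U" using y by (simp add: W'_def)
    then have fy: "\<phi> y \<in> \<phi> ` U" by blast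
    have d: "D (\<lambda>z. f (inv_into (p ` U) (qchart U \<phi>) z)) (\<phi> y) b =
        (\<Sum>c\<in>Basis. complex_of_real (mc ?\<kappa> (\<phi> y) b \<bullet> c) * E c f (p y))" for b
    proof -
      have "D (\<lambda>z. f (inv_into (p ` U) (qchart U \<phi>) z)) (\<phi> y) b = D (\<lambda>z. f (p (?\<kappa> z))) (\<phi> y) b"
        using D_cong[OF op fy, of "\<lambda>z. f (inv_into (p ` U) (qchart U \<phi>) z)" "\<lambda>z. f (p (?\<kappa> z))"] qchart_inv[OF c'] by simp
      also have "\<dots> = lv (mc ?\<kappa> (\<phi> y) b) (\<lambda>x. f (p x)) y"
        using D_plot[OF op pl fy pull[OF f]] good_inv[OF c' yU] by simp
      also have "\<dots> = lv (\<Sum>c\<in>Basis. (mc ?\<kappa> (\<phi> y) b \<bullet> c) *\<^sub>R c) (\<lambda>x. f (p x)) y"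
        by (simp only: euclidean_representation)
      also have "\<dots> = (\<Sum>c\<in>Basis. complex_of_real (mc ?\<kappa> (\<phi> y) b \<bullet> c) * E c f (p y))"
        unfolding lv_sum by (simp add: lv_scale cscale_def fmult_def E_p[OF f])
      finally show ?thesis .
    qed
    have "X f (p y) = (\<Sum>b\<in>Basis. X (k b) (p y) * D (\<lambda>y. f (inv_into (p ` U) (qchart U \<phi>) y)) (\<phi> y) b)"
      using XF[OF _ f, of "p y"] y qchart_apply[OF c' yU] by (simp add: W'_def)
    also have "\<dots> = (\<Sum>b\<in>Basis. \<Sum>c\<in>Basis. X (k b) (p y) * (complex_of_real (mc ?\<kappa> (\<phi> y) b \<bullet> c) * E c f (p y)))"
      unfolding d sum_distrib_left ..
    also have "\<dots> = (\<Sum>c\<in>Basis. h c y * E c f (p y))"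
      by (subst sum.swap) (simp add: h_def sum_distrib_right mult.assoc)
    finally show ?thesis .
  qed
  moreover have "smooth_on (\<phi> ` W') (\<lambda>z. h c (?\<kappa> z))" for c
  proof -
    have sub: "\<phi> ` W' \<subseteq> \<phi> ` U" by (auto simp: W'_def)
    have oi: "open (\<phi> ` W')" by (rule chart_image_open[OF c(1)]) (use oW' c(2) in \<open>auto simp: W'_def mtop\<close>)
    have "smooth_on (\<phi> ` W') (\<lambda>z. \<Sum>b\<in>Basis. X (k b) (p (?\<kappa> z)) * complex_of_real (mc ?\<kappa> z b \<bullet> c))"
    proof (intro smooth_on_sum smooth_on_mult oi finite_Basis)
      fix b :: 'e
      show "smooth_on (\<phi> ` W') (\<lambda>z. X (k b) (p (?\<kappa> z)))"
        using plot_smooth[OF plot_subset[OF pl sub] pull[OF Q.field_smooth[OF X k(1)]]] .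
      show "smooth_on (\<phi> ` W') (\<lambda>z. complex_of_real (mc ?\<kappa> z b \<bullet> c))"
        by (intro smooth_on_linear[OF oi bounded_linear_of_real] smooth_on_linear[OF oi bounded_linear_inner_left]
            smooth_on_subset[OF mc_smooth[OF op pl] sub])
    qed
    then show ?thesis
      by (rule smooth_on_cong[OF oi, THEN iffD1, rotated])
        (auto simp: h_def W'_def good_inv[OF c'])
  qed
  ultimately show ?thesis
    using that[OF c(1) oW', of h] c W by (auto simp: W'_def)
qed

text \<open>The cut-off coordinates see the frame through the matrix of \<open>A\<close>, the
  differential at the identity of translation by \<open>x\<close>. It is injective, as translation
  can be undone; complex coefficients split into two real relations.\<close>

lemma frame_unique:
  fixes c :: "'e \<Rightarrow> complex"
  assumes eq: "\<And>f. f \<in> smooth_funs Q \<Longrightarrow> (\<Sum>b\<in>Basis. c b * E b f (p x)) = 0" and b: "b \<in> Basis"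
  shows "c b = 0"
proof -
  obtain U V \<phi> where c: "(V, \<phi>) \<in> atlas M" "U \<subseteq> V" "good U" "x \<in> U" by (rule good_chart_ex)
  note c' = c(1-3)
  have px: "p x \<in> p ` U" using c by blast
  obtain W k where W: "openin (mtop Q) W" "p x \<in> W" "W \<subseteq> p ` U" and k: "\<And>b. k b \<in> smooth_funs Q"
    "\<And>b y. y \<in> W \<Longrightarrow> k b y = complex_of_real (qchart U \<phi> y \<bullet> b)"
    by (rule Q.field_in_chart[OF E_vector_field[of 0] qchart_atlas[OF c'] px], rule that)
  define A where "A = D (\<lambda>y. \<phi> (x \<cdot> \<psi>0 y)) y0"
  let ?T = "{y \<in> D0. x \<cdot> \<psi>0 y \<in> U \<inter> {y. p y \<in> W}}"
  have T: "open ?T"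
    by (rule open_plot_preimage[OF plot_continuous[OF plot_translate] open_D0])
      (use good_open[OF c'] open_p_preimage[OF W(1)] in blast)
  have yT: "y0 \<in> ?T" using y0_D0 c(4) W(2) by simp
  have "smooth_on ?T (\<lambda>y. \<phi> (x \<cdot> \<psi>0 y))"
    by (rule smooth_on_subset[OF plot_chart[OF open_D0 plot_translate c(1)]]) (use c(2) in auto)
  then have dA: "(\<lambda>y. \<phi> (x \<cdot> \<psi>0 y)) differentiable (at y0)" by (rule smooth_on_differentiable[OF _ yT])
  have Ek: "E v (k b) (p x) = complex_of_real (A v \<bullet> b)" for v b
  proof -
    have "E v (k b) (p x) = D (\<lambda>y. k b (p (x \<cdot> \<psi>0 y))) y0 v" by (simp add: E_p k lv_apply pull)
    also have "\<dots> = D (\<lambda>y. complex_of_real (\<phi> (x \<cdot> \<psi>0 y) \<bullet> b)) y0 v"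
      by (subst D_cong[OF T yT, of _ "\<lambda>y. complex_of_real (\<phi> (x \<cdot> \<psi>0 y) \<bullet> b)"])
        (use k(2) qchart_apply[OF c'] in auto)
    also have "\<dots> = complex_of_real (A v \<bullet> b)"
      unfolding A_def
      by (subst D_eqI[OF bounded_linear.has_derivative[OF bounded_linear_of_real
            bounded_linear.has_derivative[OF bounded_linear_inner_left D_has_derivative[OF dA]]]]) simp
    finally show ?thesis .
  qed
  have inj: "v = 0" if Av: "A v = 0" for v
  proof -
    let ?B = "\<lambda>z. \<phi>0 (iv x \<cdot> inv_into V \<phi> z)"
    have fx: "\<phi> x \<in> {z \<in> \<phi> ` V. iv x \<cdot> inv_into V \<phi> z \<in> U0}"
      using c e_U0 chart_inv[OF c(1)] by auto
    have "?B differentiable (at (\<phi> x))"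
      using smooth_on_differentiable[OF plot_chart[OF chart_open_image[OF c(1)] plot_mul[OF chart_open_image[OF c(1)] plot_const chart_plot[OF c(1)]] c0] fx] .
    then have "D (\<lambda>y. ?B (\<phi> (x \<cdot> \<psi>0 y))) y0 v = D ?B (\<phi> x) (A v)"
      using D_comp(1)[OF dA, of ?B v] by (simp add: A_def)
    moreover have "D (\<lambda>y. ?B (\<phi> (x \<cdot> \<psi>0 y))) y0 v = D (\<lambda>y. y) y0 v"
      by (subst D_cong[OF T yT, of _ "\<lambda>y. y"]) (use chart_inv[OF c(1)] c(2) chart_inv_right[OF c0] in auto)
    moreover have "D ?B (\<phi> x) 0 = 0"
      using linear_0[OF linear_frechet_derivative[OF \<open>?B differentiable (at (\<phi> x))\<close>]] .
    ultimately show ?thesis using Av by simp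
  qed
  have lin: "linear A" unfolding A_def by (rule linear_frechet_derivative[OF dA])
  have z: "(\<Sum>b\<in>Basis. r b *\<^sub>R b) = 0"
    if "\<And>b'. (\<Sum>b\<in>Basis. r b * (A b \<bullet> b')) = 0" for r :: "'e \<Rightarrow> real"
  proof (rule inj, rule euclidean_eqI)
    fix b' :: 'e
    have "A (\<Sum>b\<in>Basis. r b *\<^sub>R b) \<bullet> b' = (\<Sum>b\<in>Basis. r b * (A b \<bullet> b'))"
      by (simp add: linear_sum[OF lin] linear_scale[OF lin] inner_sum_left)
    then show "A (\<Sum>b\<in>Basis. r b *\<^sub>R b) \<bullet> b' = 0 \<bullet> b'" using that by simp
  qed
  have s: "(\<Sum>b\<in>Basis. c b * complex_of_real (A b \<bullet> b')) = 0" for b'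
    using eq[OF k(1)] Ek by simp
  have "(\<Sum>b\<in>Basis. Re (c b) *\<^sub>R b) = 0" "(\<Sum>b\<in>Basis. Im (c b) *\<^sub>R b) = 0"
    using arg_cong[OF s, of Re] arg_cong[OF s, of Im] by (auto intro!: z simp: Re_sum Im_sum)
  then have "(\<Sum>b\<in>Basis. Re (c b) *\<^sub>R b) \<bullet> b = 0" "(\<Sum>b\<in>Basis. Im (c b) *\<^sub>R b) \<bullet> b = 0"
    by simp_all
  then have "Re (c b) = 0" "Im (c b) = 0"
    using b by (simp_all add: inner_sum_left inner_Basis if_distrib cong: if_cong)
  then show ?thesis by (simp add: complex_eq_iff)
qed

text \<open>Coefficients exist at each point and are chosen there arbitrarily; uniqueness identifies
  them with the local smooth ones, so that the choice is globally smooth.\<close>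

lemma frame:
  assumes X: "X \<in> vector_fields Q"
  shows "\<exists>h. (\<forall>b\<in>Basis. h b \<in> smooth_funs Q) \<and> (\<forall>f\<in>smooth_funs Q. X f = (\<Sum>b\<in>Basis. h b * E b f))"
proof -
  have ex: "\<exists>c. \<forall>f\<in>smooth_funs Q. X f (p x) = (\<Sum>b\<in>Basis. c b * E b f (p x))" for x
  proof -
    obtain V \<phi> W h where W: "x \<in> W"
      and h: "\<And>f y. f \<in> smooth_funs Q \<Longrightarrow> y \<in> W \<Longrightarrow> X f (p y) = (\<Sum>c\<in>Basis. h c y * E c f (p y))"
      by (rule field_in_frame_local[OF X, of x], rule that)
    then have "\<forall>f\<in>smooth_funs Q. X f (p x) = (\<Sum>b\<in>Basis. h b x * E b f (p x))" by simp
    then show ?thesis by (rule exI[of _ "\<lambda>b. h b x"])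
  qed
  define C where "C = (\<lambda>q. SOME c. \<forall>f\<in>smooth_funs Q. X f q = (\<Sum>b\<in>Basis. c b * E b f q))"
  have C: "X f (p x) = (\<Sum>b\<in>Basis. C (p x) b * E b f (p x))" if "f \<in> smooth_funs Q" for f x
    using someI_ex[OF ex[of x]] that unfolding C_def by blast
  define h where "h = (\<lambda>b q. if q \<in> range p then C q b else 0)"
  have "X f = (\<Sum>b\<in>Basis. h b * E b f)" if f: "f \<in> smooth_funs Q" for f
  proof (rule fun_Q_eqI)
    show "X f (p x) = (\<Sum>b\<in>Basis. h b * E b f) (p x)" for x
      using C[OF f] by (simp add: sum_fun_apply h_def)
    show "X f q = (\<Sum>b\<in>Basis. h b * E b f) q" if "q \<notin> range p" for q
      using that Q.smooth_funsD(1)[OF Q.field_smooth[OF X f]] points_Q by (simp add: sum_fun_apply E_outside)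
  qed
  moreover have "h b \<in> smooth_funs Q" if b: "b \<in> Basis" for b
    unfolding smooth_funs_Q
  proof (intro conjI allI impI)
    show "(\<lambda>x. h b (p x)) \<in> smooth_funs M"
    proof (rule smooth_funsI)
      fix x
      obtain V \<phi> W k where W: "(V, \<phi>) \<in> atlas M" "open W" "x \<in> W" "W \<subseteq> V"
        and sm: "\<And>c. smooth_on (\<phi> ` W) (\<lambda>z. k c (inv_into V \<phi> z))"
        and k: "\<And>f y. f \<in> smooth_funs Q \<Longrightarrow> y \<in> W \<Longrightarrow> X f (p y) = (\<Sum>c\<in>Basis. k c y * E c f (p y))"
        by (rule field_in_frame_local[OF X, of x], rule that)
      have hk: "h b (p y) = k b y" if y: "y \<in> W" for y
      proof -
        have "C (p y) b - k b y = 0"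
          by (rule frame_unique[OF _ b, of "\<lambda>b. C (p y) b - k b y" y])
            (use C k[OF _ y] in \<open>simp add: left_diff_distrib sum_subtractf\<close>)
        then show ?thesis by (simp add: h_def)
      qed
      have oi: "open (\<phi> ` W)" by (rule chart_image_open[OF W(1)]) (use W in \<open>auto simp: mtop\<close>)
      have "smooth_on (\<phi> ` W) (\<lambda>z. h b (p (inv_into V \<phi> z)))"
        using sm[of b] by (rule smooth_on_cong[OF oi, THEN iffD1, rotated])
          (use hk chart_inv[OF W(1)] W(4) in auto)
      then show "\<exists>V \<phi> W. (V, \<phi>) \<in> atlas M \<and> openin (mtop M) W \<and> x \<in> W \<and> W \<subseteq> V \<and>
          smooth_on (\<phi> ` W) (\<lambda>z. h b (p (inv_into V \<phi> z)))"
        using W by (auto simp: mtop)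
    qed (simp add: points_UNIV)
  qed (simp add: h_def)
  ultimately show ?thesis by blast
qed

end


section \<open>The adjoint representation\<close>

text \<open>A Gronwall argument in several variables: if \<open>S z\<close> is the maximum over a
  ball of radius \<open>\<delta>\<close> of the sum of the norms, the mean value inequality bounds
  it by \<open>C * card A * \<delta> * S z\<close>, which for the chosen \<open>\<delta>\<close> is
  at most half of it.\<close>

lemma zero_near:
  fixes u :: "'i \<Rightarrow> 'a::euclidean_space \<Rightarrow> 'b::real_normed_vector"
  assumes A: "finite A" and r: "r > 0" and C: "C \<ge> 0"
    and diff: "\<And>i y. i \<in> A \<Longrightarrow> y \<in> ball y0 r \<Longrightarrow> u i differentiable (at y)"
    and bnd: "\<And>i y a. i \<in> A \<Longrightarrow> y \<in> ball y0 r \<Longrightarrow> norm (D (u i) y a) \<le> C * norm a * (\<Sum>j\<in>A. norm (u j y))"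
    and zero: "\<And>i. i \<in> A \<Longrightarrow> u i y0 = 0"
  shows "\<exists>\<delta>>0. \<forall>i\<in>A. \<forall>y\<in>ball y0 \<delta>. u i y = 0"
proof -
  define S where "S = (\<lambda>y. \<Sum>j\<in>A. norm (u j y))"
  define \<delta> where "\<delta> = min (r / 2) (1 / (2 * (C * card A + 1)))"
  have pos: "C * card A + 1 > 0" using C by (simp add: add_nonneg_pos)
  have \<delta>: "\<delta> > 0" "\<delta> < r" "C * card A * \<delta> \<le> 1 / 2"
  proof -
    show "\<delta> > 0" "\<delta> < r" using r pos by (auto simp: \<delta>_def)
    have "(C * card A + 1) * \<delta> \<le> (C * card A + 1) * (1 / (2 * (C * card A + 1)))"
      using pos by (intro mult_left_mono) (auto simp: \<delta>_def)
    also have "\<dots> = 1 / 2" using pos by simp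
    finally show "C * card A * \<delta> \<le> 1 / 2" using \<open>\<delta> > 0\<close> by (simp add: algebra_simps)
  qed
  have sub: "cball y0 \<delta> \<subseteq> ball y0 r" using \<delta> by auto
  have cu: "continuous_on (cball y0 \<delta>) (u i)" if "i \<in> A" for i
    using diff[OF that] sub
    by (intro continuous_at_imp_continuous_on ballI differentiable_imp_continuous_within) auto
  have "continuous_on (cball y0 \<delta>) S"
    unfolding S_def by (intro continuous_on_sum continuous_on_norm cu)
  moreover have "cball y0 \<delta> \<noteq> {}" using \<delta> by simp
  ultimately obtain z where z: "z \<in> cball y0 \<delta>" and max: "\<And>y. y \<in> cball y0 \<delta> \<Longrightarrow> S y \<le> S z"
    using continuous_attains_sup[OF compact_cball] by metis
  have S0: "S y \<ge> 0" for y by (simp add: S_def sum_nonneg)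
  have u: "norm (u i y) \<le> C * S z * \<delta>" if i: "i \<in> A" and y: "y \<in> cball y0 \<delta>" for i y
  proof -
    have "norm (u i y - u i y0) \<le> (C * S z) * norm (y - y0)"
    proof (rule differentiable_bound[of "cball y0 \<delta>" "u i" "\<lambda>x. D (u i) x"])
      fix x assume x: "x \<in> cball y0 \<delta>"
      show "(u i has_derivative D (u i) x) (at x within cball y0 \<delta>)"
        by (rule has_derivative_at_withinI[OF D_has_derivative[OF diff[OF i subsetD[OF sub x]]]])
      show "onorm (D (u i) x) \<le> C * S z"
      proof (rule onorm_bound)
        show "norm (D (u i) x a) \<le> C * S z * norm a" for a
        proof -
          have "norm (D (u i) x a) \<le> C * norm a * S x" unfolding S_def by (rule bnd[OF i]) (use x sub in auto)
          also have "\<dots> \<le> C * norm a * S z" using C max[OF x] by (intro mult_left_mono) auto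
          finally show ?thesis by (simp add: algebra_simps)
        qed
      qed (use C S0 in simp)
    qed (use y \<delta> in auto)
    also have "\<dots> \<le> C * S z * \<delta>"
      using y C S0 by (intro mult_left_mono) (auto simp: dist_norm norm_minus_commute)
    finally show ?thesis using zero[OF i] by simp
  qed
  have "S z = (\<Sum>j\<in>A. norm (u j z))" by (simp add: S_def)
  also have "\<dots> \<le> (\<Sum>j\<in>A. C * S z * \<delta>)" by (intro sum_mono u z)
  also have "\<dots> = (C * card A * \<delta>) * S z" by simp
  also have "\<dots> \<le> (1 / 2) * S z" using \<delta>(3) S0 by (intro mult_right_mono)
  finally have "S z = 0" using S0[of z] by simp
  then have "u i y = 0" if "i \<in> A" "y \<in> ball y0 \<delta>" for i y
    using u[OF that(1), of y] that(2) by simp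
  then show ?thesis using \<delta>(1) by blast
qed

context lie begin

definition Ad :: "'g \<Rightarrow> 'e \<Rightarrow> 'e" where
  "Ad g v = D (\<lambda>y. \<phi>0 (g \<cdot> (\<psi>0 y \<cdot> iv g))) y0 v"

lemma conj_plot: "plot D0 (\<lambda>y. g \<cdot> (\<psi>0 y \<cdot> h))"
  by (intro plot_mul plot_const plot_\<psi>0 open_D0)

lemma Ad_differentiable: "(\<lambda>y. \<phi>0 (g \<cdot> (\<psi>0 y \<cdot> iv g))) differentiable (at y0)"
  using smooth_on_differentiable[OF plot_chart[OF open_D0 conj_plot c0], of y0 g "iv g"] y0_D0 e_U0 by simp

lemma linear_Ad: "linear (Ad g)"
  unfolding Ad_def[abs_def] by (rule linear_frechet_derivative[OF Ad_differentiable])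

lemma Ad_e: "Ad e v = v"
proof -
  have "D (\<lambda>y. \<phi>0 (e \<cdot> (\<psi>0 y \<cdot> iv e))) y0 = D (\<lambda>y. y) y0"
    by (rule D_cong[OF open_D0 y0_D0]) (use chart_inv_right[OF c0] in auto)
  then show ?thesis by (simp add: Ad_def)
qed

text \<open>\<open>x \<cdot> \<psi>0 y \<cdot> a\<close> equals \<open>x \<cdot> a\<close> times the
  conjugate of \<open>\<psi>0 y\<close> by \<open>iv a\<close>. This expresses \<open>Ad\<close> by
  fields acting on functions, and translating twice then shows that it is multiplicative.\<close>

lemma smooth_right_lv:
  assumes F: "F \<in> smooth_funs M"
  shows "lv v (\<lambda>x. F (x \<cdot> a)) x = lv (Ad (iv a) v) F (x \<cdot> a)"
proof -
  have "lv v (\<lambda>x. F (x \<cdot> a)) x = D (\<lambda>y. F (x \<cdot> (\<psi>0 y \<cdot> a))) y0 v"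
    using smooth_funs_right[OF F] by (simp add: lv_apply)
  also have "\<dots> = lv (mc (\<lambda>y. x \<cdot> (\<psi>0 y \<cdot> a)) y0 v) F (x \<cdot> a)"
    using D_plot[OF open_D0 conj_plot y0_D0 F] by simp
  also have "mc (\<lambda>y. x \<cdot> (\<psi>0 y \<cdot> a)) y0 v = Ad (iv a) v"
    by (simp add: mc_def Ad_def)
  finally show ?thesis .
qed

lemma Ad_mul: "Ad (a \<cdot> b) v = Ad a (Ad b v)"
proof (rule lv_inj)
  fix F assume F: "F \<in> smooth_funs M"
  have "lv v (\<lambda>x. F (x \<cdot> iv b \<cdot> iv a)) (b \<cdot> a) = lv (Ad a (Ad b v)) F (b \<cdot> a \<cdot> iv b \<cdot> iv a)"
    using smooth_right_lv[OF smooth_funs_right[OF F, of "iv a"], of v "iv b" "b \<cdot> a"]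
      smooth_right_lv[OF F, of "Ad b v" "iv a" "b \<cdot> a \<cdot> iv b"] by simp
  moreover have "lv v (\<lambda>x. F (x \<cdot> iv b \<cdot> iv a)) (b \<cdot> a) = lv (Ad (a \<cdot> b) v) F (b \<cdot> a \<cdot> iv b \<cdot> iv a)"
    using smooth_right_lv[OF F, of v "iv b \<cdot> iv a" "b \<cdot> a"] by simp
  ultimately show "lv (Ad (a \<cdot> b) v) F (b \<cdot> a \<cdot> iv b \<cdot> iv a) = lv (Ad a (Ad b v)) F (b \<cdot> a \<cdot> iv b \<cdot> iv a)" by simp
qed

lemma Ad_iv [simp]: "Ad (iv a) (Ad a v) = v" "Ad a (Ad (iv a) v) = v"
  using Ad_mul[of "iv a" a v] Ad_mul[of a "iv a" v] by (simp_all add: Ad_e)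

lemma smooth_on_Ad:
  fixes S :: "'a::euclidean_space set"
  assumes S: "open S" and k: "plot S \<kappa>" shows "smooth_on S (\<lambda>s. Ad (\<kappa> s) v)"
proof -
  let ?k = "\<lambda>q. \<kappa> (fst q) \<cdot> (\<psi>0 (snd q) \<cdot> iv (\<kappa> (fst q)))"
  let ?O = "{q \<in> S \<times> D0. ?k q \<in> U0}"
  have SS: "open (S \<times> D0)" by (intro open_Times S open_D0)
  have k1: "plot (S \<times> D0) (\<lambda>q. \<kappa> (fst q))" and k2: "plot (S \<times> D0) (\<lambda>q. \<psi>0 (snd q))"
    by (auto intro!: plot_compose[OF S SS k] plot_compose[OF open_D0 SS plot_\<psi>0]
        smooth_on_bounded_linear[OF SS] bounded_linear_fst bounded_linear_snd)
  have k': "plot (S \<times> D0) ?k" by (intro plot_mul plot_iv SS k1 k2)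
  have O: "open ?O" by (rule open_plot_preimage[OF plot_continuous[OF k'] SS open_U0])
  from smooth_on_partial_D(2)[OF O plot_chart[OF SS k' c0] S smooth_on_const]
  show ?thesis using y0_D0 e_U0 by (simp add: Ad_def)
qed

definition AdF :: "'e \<Rightarrow> 'e \<Rightarrow> 'g \<Rightarrow> complex" where
  "AdF v w = (\<lambda>g. complex_of_real (Ad g v \<bullet> w))"

lemma AdF_smooth: "AdF v w \<in> smooth_funs M"
proof -
  have "smooth_on (\<phi> ` U) (\<lambda>z. complex_of_real (Ad (inv_into U \<phi> z) v \<bullet> w))" if c: "(U, \<phi>) \<in> atlas M" for U \<phi>
    by (intro smooth_on_linear[OF _ bounded_linear_of_real] smooth_on_linear[OF _ bounded_linear_inner_left]
        smooth_on_Ad chart_plot[OF c] chart_open_image[OF c])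
  then show ?thesis by (auto simp: smooth_funs_def points_UNIV AdF_def o_def)
qed

text \<open>The differential of \<open>Ad\<close> is the bracket. Let \<open>\<Phi>\<close> be
  \<open>F\<close> on products of two points of the unit chart, so that iterated \<open>lv\<close>
  derivatives at the identity are mixed second derivatives of \<open>\<Phi>\<close>. Writing
  \<open>lv v F\<close> at \<open>\<psi>0 y\<close> by derivatives in the first factor introduces
  \<open>Ad (\<psi>0 y) v\<close>; the product rule then leaves its derivative as the commutator of
  the two fields.\<close>

lemma D_Ad_unit: "D (\<lambda>y. Ad (\<psi>0 y) v) y0 u = br u v"
proof (rule lv_inj)
  fix F assume F: "F \<in> smooth_funs M"
  let ?d = "D (\<lambda>y. Ad (\<psi>0 y) v) y0 u"
  let ?O = "D0 \<times> D0"
  define \<Phi> where "\<Phi> = (\<lambda>q. F (e \<cdot> (\<psi>0 (fst q) \<cdot> \<psi>0 (snd q))))"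
  have O: "open ?O" and yO: "(y0, y0) \<in> ?O" using open_D0 y0_D0 by (auto intro: open_Times)
  have "plot ?O (\<lambda>q. \<psi>0 (fst q))" "plot ?O (\<lambda>q. \<psi>0 (snd q))"
    by (auto intro!: plot_compose[OF open_D0 O plot_\<psi>0] smooth_on_bounded_linear[OF O] bounded_linear_fst bounded_linear_snd)
  then have "plot ?O (\<lambda>q. e \<cdot> (\<psi>0 (fst q) \<cdot> \<psi>0 (snd q)))" by (intro plot_mul plot_const O)
  from plot_smooth[OF this F] have \<Phi>: "smooth_on ?O \<Phi>" by (simp add: \<Phi>_def)
  have D1: "D (\<lambda>z. \<Phi> (y, z)) y0 w = D \<Phi> (y, y0) (0, w)" if "y \<in> D0" for y w
    using smooth_on_partial_D(1)[OF O \<Phi> open_D0 smooth_on_const[of _ y0] _ that] y0_D0 by simp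
  have D2: "D (\<lambda>z. \<Phi> (z, y)) y0 w = D \<Phi> (y0, y) (w, 0)" if "y \<in> D0" for y w
  proof -
    have "((\<lambda>z. (z, y)) has_derivative (\<lambda>v. (v, 0))) (at y0)"
      by (auto intro!: derivative_eq_intros)
    from has_derivative_compose[OF this D_has_derivative[OF smooth_on_differentiable[OF \<Phi>, of "(y0, y)"]]]
    show ?thesis using that y0_D0 by (simp add: D_eqI)
  qed
  have l1: "lv w (lv w' F) e = D (\<lambda>q. D \<Phi> q (0, w')) (y0, y0) (w, 0)" for w w'
  proof -
    have "lv w (lv w' F) e = D (\<lambda>y. lv w' F (\<psi>0 y)) y0 w"
      by (simp add: lv_apply lv_smooth F)
    also have "\<dots> = D (\<lambda>y. D \<Phi> (y, y0) (0, w')) y0 w"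
    proof -
      have "lv w' F (\<psi>0 y) = D \<Phi> (y, y0) (0, w')" if "y \<in> D0" for y
        using D1[OF that, of w'] by (simp add: lv_apply F \<Phi>_def)
      from D_cong[OF open_D0 y0_D0 this] show ?thesis by simp
    qed
    also have "\<dots> = D (\<lambda>q. D \<Phi> q (0, w')) (y0, y0) (w, 0)"
    proof -
      have "((\<lambda>z. (z, y0)) has_derivative (\<lambda>v. (v, 0))) (at y0)"
        by (auto intro!: derivative_eq_intros)
      from has_derivative_compose[OF this D_has_derivative[OF smooth_on_differentiable[OF smooth_on_D[OF \<Phi>, of "(0, w')"] yO]]]
      show ?thesis by (simp add: D_eqI)
    qed
    finally show ?thesis .
  qed
  \<comment> \<open>Symmetry of second derivatives turns the derivative in the second factor of one
    in the first into \<open>lv b\<close> applied to \<open>lv w F\<close>, the opposite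
    order.\<close>
  have l2: "D (\<lambda>y. D \<Phi> (y0, y) (b, 0)) y0 w = lv b (lv w F) e"
    and l2d: "(\<lambda>y. D \<Phi> (y0, y) (b, 0)) differentiable (at y0)" for b w
  proof -
    have "((\<lambda>z. (y0, z)) has_derivative (\<lambda>v. (0, v))) (at y0)"
      by (auto intro!: derivative_eq_intros)
    from has_derivative_compose[OF this D_has_derivative[OF smooth_on_differentiable[OF smooth_on_D[OF \<Phi>, of "(b, 0)"] yO]]]
    have *: "((\<lambda>y. D \<Phi> (y0, y) (b, 0)) has_derivative (\<lambda>v. D (\<lambda>q. D \<Phi> q (b, 0)) (y0, y0) (0, v))) (at y0)" .
    show "(\<lambda>y. D \<Phi> (y0, y) (b, 0)) differentiable (at y0)" using * by (auto simp: differentiable_def)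
    show "D (\<lambda>y. D \<Phi> (y0, y) (b, 0)) y0 w = lv b (lv w F) e"
      using D_eqI[OF *] D_D_commute[OF O yO \<Phi>, of "(b, 0)" "(0, w)"] by (simp add: l1)
  qed
  have a: "lv v F (\<psi>0 y) = (\<Sum>b\<in>Basis. complex_of_real (Ad (\<psi>0 y) v \<bullet> b) * D \<Phi> (y0, y) (b, 0))" if y: "y \<in> D0" for y
  proof -
    have "lv v F (\<psi>0 y) = lv (Ad (\<psi>0 y) v) (\<lambda>x. F (x \<cdot> \<psi>0 y)) e"
      using smooth_right_lv[OF F, of "Ad (\<psi>0 y) v" "\<psi>0 y" e] by simp
    also have "\<dots> = lv (\<Sum>b\<in>Basis. (Ad (\<psi>0 y) v \<bullet> b) *\<^sub>R b) (\<lambda>x. F (x \<cdot> \<psi>0 y)) e"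
      by (simp only: euclidean_representation)
    also have "\<dots> = (\<Sum>b\<in>Basis. complex_of_real (Ad (\<psi>0 y) v \<bullet> b) * lv b (\<lambda>x. F (x \<cdot> \<psi>0 y)) e)"
      unfolding lv_sum by (simp add: lv_scale cscale_def fmult_def)
    also have "\<dots> = (\<Sum>b\<in>Basis. complex_of_real (Ad (\<psi>0 y) v \<bullet> b) * D \<Phi> (y0, y) (b, 0))"
    proof -
      have "lv b (\<lambda>x. F (x \<cdot> \<psi>0 y)) e = D (\<lambda>z. \<Phi> (z, y)) y0 b" for b
        by (simp add: lv_apply smooth_funs_right[OF F] \<Phi>_def)
      then show ?thesis by (simp add: D2[OF y])
    qed
    finally show ?thesis .
  qed
  have Adv: "(\<lambda>y. Ad (\<psi>0 y) v) differentiable (at y0)"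
    by (rule smooth_on_differentiable[OF smooth_on_Ad[OF open_D0 plot_\<psi>0] y0_D0])
  have l3: "D \<Phi> (y0, y0) (b, 0) = lv b F e" for b
  proof -
    have "lv b F e = D (\<lambda>z. \<Phi> (z, y0)) y0 b" by (simp add: lv_apply F \<Phi>_def)
    then show ?thesis by (simp add: D2[OF y0_D0])
  qed
  have "lv u (lv v F) e = D (\<lambda>y. lv v F (\<psi>0 y)) y0 u" by (simp add: lv_apply lv_smooth F)
  also have "\<dots> = D (\<lambda>y. \<Sum>b\<in>Basis. complex_of_real (Ad (\<psi>0 y) v \<bullet> b) * D \<Phi> (y0, y) (b, 0)) y0 u"
    using D_cong[OF open_D0 y0_D0 a] by simp
  also have "\<dots> = (\<Sum>b\<in>Basis. complex_of_real (Ad (\<psi>0 y0) v \<bullet> b) * D (\<lambda>y. D \<Phi> (y0, y) (b, 0)) y0 u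
      + complex_of_real (?d \<bullet> b) * D \<Phi> (y0, y0) (b, 0))"
    by (rule D_eqI[THEN fun_cong])
      (intro has_derivative_sum has_derivative_mult D_has_derivative[OF l2d]
        bounded_linear.has_derivative[OF bounded_linear_of_real] bounded_linear.has_derivative[OF bounded_linear_inner_left]
        D_has_derivative[OF Adv])
  also have "\<dots> = (\<Sum>b\<in>Basis. complex_of_real (v \<bullet> b) * lv b (lv u F) e) + (\<Sum>b\<in>Basis. complex_of_real (?d \<bullet> b) * lv b F e)"
    by (simp add: Ad_e l2 l3 sum.distrib)
  also have "\<dots> = lv (\<Sum>b\<in>Basis. (v \<bullet> b) *\<^sub>R b) (lv u F) e + lv (\<Sum>b\<in>Basis. (?d \<bullet> b) *\<^sub>R b) F e"
    unfolding lv_sum by (simp add: lv_scale cscale_def fmult_def)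
  also have "\<dots> = lv v (lv u F) e + lv ?d F e" by (simp only: euclidean_representation)
  finally have "lv ?d F e = bracket (lv u) (lv v) F e" by (simp add: bracket_def)
  then show "lv ?d F e = lv (br u v) F e" by (simp add: bracket_lv)
qed

text \<open>Along the frame the matrix coefficients of \<open>Ad\<close> satisfy a linear system
  with constant coefficients; the facts on \<open>Ad\<close> needed for solvability are drawn from
  uniqueness for this system.\<close>

lemma lv_AdF: "lv u (AdF v w) g = AdF (br u v) w g"
proof -
  have Adv: "((\<lambda>y. Ad (\<psi>0 y) v) has_derivative (\<lambda>u. br u v)) (at y0)"
    using D_has_derivative[OF smooth_on_differentiable[OF smooth_on_Ad[OF open_D0 plot_\<psi>0] y0_D0], of v]
    unfolding D_Ad_unit[THEN ext, of "\<lambda>_. v" "\<lambda>u. u"] .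
  have "lv u (AdF v w) g = D (\<lambda>y. complex_of_real (Ad g (Ad (\<psi>0 y) v) \<bullet> w)) y0 u"
    by (simp add: lv_apply AdF_smooth) (simp add: AdF_def Ad_mul)
  also have "\<dots> = complex_of_real (Ad g (br u v) \<bullet> w)"
    by (subst D_eqI[OF bounded_linear.has_derivative[OF bounded_linear_of_real
      bounded_linear.has_derivative[OF bounded_linear_inner_left
      bounded_linear.has_derivative[OF linear_conv_bounded_linear[THEN iffD1, OF linear_Ad] Adv]]]]) simp
  finally show ?thesis by (simp add: AdF_def)
qed

lemma smooth_funs_M_continuous: "F \<in> smooth_funs M \<Longrightarrow> continuous_on UNIV F"
  using smooth_funs_continuous by (simp add: mtop)

text \<open>The common zero set is closed, and it is open by \<open>zero_near\<close> in a
  translated unit chart; connectedness makes it everything.\<close>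

lemma zero_solution:
  assumes conn: "connected (UNIV :: 'g set)" and A: "finite A"
    and F: "\<And>i. i \<in> A \<Longrightarrow> F i \<in> smooth_funs M"
    and sys: "\<And>b i. b \<in> Basis \<Longrightarrow> i \<in> A \<Longrightarrow> \<exists>c. \<forall>g. lv b (F i) g = (\<Sum>j\<in>A. c j * F j g)"
    and init: "\<And>i. i \<in> A \<Longrightarrow> F i e = 0"
  shows "i \<in> A \<Longrightarrow> F i g = 0"
proof -
  obtain c where c: "\<And>b i g. b \<in> Basis \<Longrightarrow> i \<in> A \<Longrightarrow> lv b (F i) g = (\<Sum>j\<in>A. c b i j * F j g)"
  proof -
    have "\<exists>c. \<forall>b\<in>Basis. \<forall>i\<in>A. \<forall>g. lv b (F i) g = (\<Sum>j\<in>A. c b i j * F j g)"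
      using sys by (intro bchoice[where 'a = 'e] ballI bchoice) auto
    then show ?thesis using that by auto
  qed
  define Zs where "Zs = {g. \<forall>i\<in>A. F i g = 0}"
  have "closed Zs"
  proof -
    have "Zs = (\<Inter>i\<in>A. {g. F i g = 0})" by (auto simp: Zs_def)
    then show ?thesis
      by (auto intro!: closed_INT closed_Collect_eq smooth_funs_M_continuous F continuous_on_const)
  qed
  moreover have "open Zs"
  proof (subst open_subopen, intro ballI)
    fix g assume g: "g \<in> Zs"
    let ?k = "\<lambda>y. g \<cdot> \<psi>0 y"
    have pl: "plot D0 ?k" by (rule plot_translate)
    define L where "L = (\<lambda>y. \<Sum>b\<in>Basis. \<Sum>b'\<in>(Basis::'e set). \<bar>mc ?k y b \<bullet> b'\<bar>)"
    have cL: "continuous_on D0 L" unfolding L_def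
      by (intro continuous_on_sum continuous_on_rabs continuous_on_inner continuous_on_const
          smooth_on_continuous_on[OF mc_smooth[OF open_D0 pl]])
    obtain r where r: "r > 0" "cball y0 r \<subseteq> D0" using open_D0 y0_D0 open_contains_cball by blast
    have "cball y0 r \<noteq> {}" using r by simp
    from continuous_attains_sup[OF compact_cball this continuous_on_subset[OF cL r(2)]]
    obtain z where K: "\<forall>y\<in>cball y0 r. L y \<le> L z" by blast
    define K' where "K' = max (L z) 0"
    define m where "m = (\<Sum>b\<in>Basis. \<Sum>i\<in>A. \<Sum>j\<in>A. cmod (c b i j))"
    have m: "cmod (c b i j) \<le> m" if "b \<in> Basis" "i \<in> A" "j \<in> A" for b i j
    proof -
      have "cmod (c b i j) \<le> (\<Sum>j\<in>A. cmod (c b i j))" using that A by (intro member_le_sum) auto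
      also have "\<dots> \<le> (\<Sum>i\<in>A. \<Sum>j\<in>A. cmod (c b i j))"
        using that A by (intro member_le_sum[of _ _ "\<lambda>i. \<Sum>j\<in>A. cmod (c b i j)"]) (auto intro: sum_nonneg)
      also have "\<dots> \<le> m" unfolding m_def
        using that A by (intro member_le_sum[of _ _ "\<lambda>b. \<Sum>i\<in>A. \<Sum>j\<in>A. cmod (c b i j)"]) (auto intro!: sum_nonneg)
      finally show ?thesis .
    qed
    have m0: "m \<ge> 0" unfolding m_def by (intro sum_nonneg) simp
    define u where "u = (\<lambda>i y. F i (?k y))"
    \<comment> \<open>In the constant below, \<open>K'\<close> bounds the Maurer-Cartan form on the
      compact ball, \<open>m\<close> bounds the coefficients of the system, and the dimension counts
      the directions of the frame.\<close>
    have "\<exists>\<delta>>0. \<forall>i\<in>A. \<forall>y\<in>ball y0 \<delta>. u i y = 0"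
    proof (rule zero_near[OF A r(1), of "real DIM('e) * K' * m"])
      show "0 \<le> real DIM('e) * K' * m" using m0 by (simp add: K'_def)
      fix i assume i: "i \<in> A"
      show "u i y0 = 0" using g i by (simp add: u_def Zs_def)
      fix y assume y: "y \<in> ball y0 r"
      then have yD: "y \<in> D0" using r by auto
      show "u i differentiable (at y)" unfolding u_def
        by (rule smooth_on_differentiable[OF plot_smooth[OF pl F[OF i]] yD])
      fix a :: 'e
      let ?S = "\<Sum>j\<in>A. norm (u j y)"
      have mc1: "\<bar>mc ?k y a \<bullet> b\<bar> \<le> K' * norm a" if b: "b \<in> Basis" for b
      proof -
        have "mc ?k y a \<bullet> b = (\<Sum>b'\<in>Basis. (a \<bullet> b') * (mc ?k y b' \<bullet> b))"
          by (subst mc_expand[OF open_D0 pl yD]) (simp add: inner_sum_left)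
        also have "\<bar>\<dots>\<bar> \<le> (\<Sum>b'\<in>Basis. norm a * \<bar>mc ?k y b' \<bullet> b\<bar>)"
          by (rule order_trans[OF sum_abs]) (auto intro!: sum_mono mult_right_mono simp: abs_mult Basis_le_norm)
        also have "\<dots> \<le> norm a * L y"
          unfolding sum_distrib_left[symmetric] L_def using b
          by (intro mult_left_mono sum_mono member_le_sum) auto
        also have "\<dots> \<le> norm a * K'" using bspec[OF K, of y] y by (intro mult_left_mono) (auto simp: K'_def)
        finally show ?thesis by (simp add: mult.commute)
      qed
      have "D (u i) y a = lv (\<Sum>b\<in>Basis. (mc ?k y a \<bullet> b) *\<^sub>R b) (F i) (?k y)"
        unfolding u_def using D_plot[OF open_D0 pl yD F[OF i], of a] by (simp only: euclidean_representation)
      also have "\<dots> = (\<Sum>b\<in>Basis. complex_of_real (mc ?k y a \<bullet> b) * (\<Sum>j\<in>A. c b i j * u j y))"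
        unfolding lv_sum using c[OF _ i] by (simp add: lv_scale cscale_def fmult_def u_def)
      finally have "norm (D (u i) y a) \<le> (\<Sum>b\<in>(Basis::'e set). \<bar>mc ?k y a \<bullet> b\<bar> * norm (\<Sum>j\<in>A. c b i j * u j y))"
        using norm_sum[of "\<lambda>b. complex_of_real (mc ?k y a \<bullet> b) * (\<Sum>j\<in>A. c b i j * u j y)" Basis] by (simp add: norm_mult)
      also have "\<dots> \<le> (\<Sum>b\<in>(Basis::'e set). (K' * norm a) * (m * ?S))"
      proof (intro sum_mono mult_mono mc1)
        fix b :: 'e assume b: "b \<in> Basis"
        have "norm (\<Sum>j\<in>A. c b i j * u j y) \<le> (\<Sum>j\<in>A. m * norm (u j y))"
          by (rule order_trans[OF norm_sum]) (auto intro!: sum_mono mult_right_mono m b i simp: norm_mult)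
        then show "norm (\<Sum>j\<in>A. c b i j * u j y) \<le> m * ?S" by (simp add: sum_distrib_left)
      qed (auto simp: K'_def)
      also have "\<dots> = real DIM('e) * K' * m * norm a * ?S" by (simp add: algebra_simps)
      finally show "norm (D (u i) y a) \<le> real DIM('e) * K' * m * norm a * ?S" .
    qed
    then obtain \<delta> where \<delta>: "\<delta> > 0" "\<And>i y. i \<in> A \<Longrightarrow> y \<in> ball y0 \<delta> \<Longrightarrow> u i y = 0" by blast
    let ?T = "{h \<in> UNIV. iv g \<cdot> h \<in> {x \<in> U0. \<phi>0 x \<in> ball y0 \<delta>}}"
    have "open ?T"
      by (rule open_plot_preimage) (use chart_preimage_open[OF c0 open_ball] in \<open>auto intro!: continuous_on_mul simp: mtop\<close>)
    moreover have "g \<in> ?T" using e_U0 \<delta>(1) by simp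
    moreover have "?T \<subseteq> Zs"
    proof
      fix h assume h: "h \<in> ?T"
      then have "?k (\<phi>0 (iv g \<cdot> h)) = h" by (simp add: \<psi>0_\<phi>0)
      then have "F i h = 0" if "i \<in> A" for i using \<delta>(2)[OF that, of "\<phi>0 (iv g \<cdot> h)"] h by (simp add: u_def)
      then show "h \<in> Zs" by (simp add: Zs_def)
    qed
    ultimately show "\<exists>T. open T \<and> g \<in> T \<and> T \<subseteq> Zs" by blast
  qed
  moreover have "e \<in> Zs" using init by (simp add: Zs_def)
  ultimately have "Zs = UNIV"
    using conn[unfolded connected_clopen, rule_format, of Zs] by (auto simp flip: open_openin closed_closedin)
  then show "i \<in> A \<Longrightarrow> F i g = 0" by (auto simp: Zs_def)
qed

end


section \<open>Almost abelian Lie groups\<close>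

lemma smooth_lipschitz:
  fixes h :: "'a::euclidean_space \<Rightarrow> 'b::real_normed_vector"
  assumes h: "smooth_on S h" and sub: "cball x r \<subseteq> S"
  shows "\<exists>L\<ge>0. \<forall>y\<in>cball x r. \<forall>z\<in>cball x r. norm (h y - h z) \<le> L * norm (y - z)"
proof (cases "cball x r = {}")
  case False
  define l where "l = (\<lambda>y. \<Sum>b\<in>Basis. norm (D h y b))"
  have cl: "continuous_on S l" unfolding l_def
    by (intro continuous_on_sum continuous_on_norm smooth_on_continuous_on[OF smooth_on_D[OF h]])
  from continuous_attains_sup[OF compact_cball False continuous_on_subset[OF cl sub]]
  obtain w where w: "\<forall>y\<in>cball x r. l y \<le> l w" by blast
  have l0: "l y \<ge> 0" for y by (simp add: l_def sum_nonneg)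
  have "norm (h y - h z) \<le> l w * norm (y - z)" if "y \<in> cball x r" "z \<in> cball x r" for y z
  proof (rule differentiable_bound[OF convex_cball _ _ that])
    fix v assume v: "v \<in> cball x r"
    have d: "h differentiable (at v)" by (rule smooth_on_differentiable[OF h subsetD[OF sub v]])
    show "(h has_derivative D h v) (at v within cball x r)"
      by (rule has_derivative_at_withinI[OF D_has_derivative[OF d]])
    show "onorm (D h v) \<le> l w"
    proof (rule onorm_bound)
      show "norm (D h v a) \<le> l w * norm a" for a
      proof -
        have "norm (D h v a) \<le> (\<Sum>b\<in>Basis. norm a * norm (D h v b))"
          unfolding D_expand[OF d, of a]
          by (rule order_trans[OF norm_sum]) (auto intro!: sum_mono mult_right_mono simp: Basis_le_norm)
        also have "\<dots> = norm a * l v" by (simp add: l_def sum_distrib_left)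
        also have "\<dots> \<le> norm a * l w" using w v by (intro mult_left_mono) auto
        finally show ?thesis by (simp add: mult.commute)
      qed
    qed (rule l0)
  qed
  then show ?thesis using l0 by blast
qed (auto intro: exI[of _ 0])

context lie begin

lemma br_add_left: "br (x + y) z = br x z + br y z"
  and br_add_right: "br z (x + y) = br z x + br z y"
  and br_scale_left: "br (r *\<^sub>R x) z = r *\<^sub>R br x z"
  and br_scale_right: "br z (r *\<^sub>R x) = r *\<^sub>R br z x"
proof -
  have "lv (br (x + y) z) F = lv (br x z + br y z) F \<and> lv (br z (x + y)) F = lv (br z x + br z y) F
    \<and> lv (br (r *\<^sub>R x) z) F = lv (r *\<^sub>R br x z) F \<and> lv (br z (r *\<^sub>R x)) F = lv (r *\<^sub>R br z x) F" for F
  proof (cases "F \<in> smooth_funs M")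
    case True
    then show ?thesis
      by (simp add: lv_add lv_scale bracket_lv[symmetric] bracket_def field_add[OF lv_vector_field] lv_smooth
          cscale_def fmult_def field_scale[OF lv_vector_field] fun_eq_iff algebra_simps)
  qed (simp add: lv_def)
  then have "lv (br (x + y) z) = lv (br x z + br y z)" "lv (br z (x + y)) = lv (br z x + br z y)"
    "lv (br (r *\<^sub>R x) z) = lv (r *\<^sub>R br x z)" "lv (br z (r *\<^sub>R x)) = lv (r *\<^sub>R br z x)" by blast+
  then show "br (x + y) z = br x z + br y z" "br z (x + y) = br z x + br z y"
    "br (r *\<^sub>R x) z = r *\<^sub>R br x z" "br z (r *\<^sub>R x) = r *\<^sub>R br z x" by (simp_all only: lv_eq_iff)
qed

end

text \<open>The Lie algebra, identified with \<open>'e\<close> through the left-invariant frame, has the abelian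
  ideal \<open>{x. pi x = 0}\<close> and the complementary vector \<open>Z0\<close>.\<close>

locale lie_almost_abelian = lie G M for G :: "'g::{t2_space, second_countable_topology} monoid"
    and M :: "('g, 'e::euclidean_space) charted" +
  fixes pi :: "'e \<Rightarrow> real" and Z0 :: 'e
  assumes conn: "connected (UNIV :: 'g set)"
    and pi_linear: "linear pi" and pi_Z0: "pi Z0 = 1"
    and pi_br: "pi (br x y) = 0"
    and br_abelian: "pi x = 0 \<Longrightarrow> pi y = 0 \<Longrightarrow> br x y = 0"
begin

abbreviation "B \<equiv> br Z0"

lemma linear_B: "linear B"
  by (intro linearI br_add_right br_scale_right)

definition P :: "'e \<Rightarrow> 'e" where "P x = x - pi x *\<^sub>R Z0"

lemma pi_simps [simp]: "pi (x + y) = pi x + pi y" "pi (x - y) = pi x - pi y" "pi (r *\<^sub>R x) = r * pi x" "pi 0 = 0" "pi Z0 = 1"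
  "pi (br x y) = 0"
  using pi_linear pi_Z0 pi_br by (simp_all add: linear_add linear_diff linear_scale linear_0)

lemma pi_P [simp]: "pi (P x) = 0" and P_id: "pi x = 0 \<Longrightarrow> P x = x" and P_split: "x = P x + pi x *\<^sub>R Z0"
  by (simp_all add: P_def)

lemma linear_P: "linear P"
  unfolding P_def by (intro linearI) (simp_all add: algebra_simps)

lemma br_ideal: "pi y = 0 \<Longrightarrow> br u y = pi u *\<^sub>R B y"
  by (subst P_split[of u]) (simp add: br_add_left br_scale_left br_abelian)

lemma P_expand: "pi y = 0 \<Longrightarrow> y = (\<Sum>b\<in>Basis. (y \<bullet> b) *\<^sub>R P b)"
proof -
  assume "pi y = 0"
  then have "y = P (\<Sum>b\<in>Basis. (y \<bullet> b) *\<^sub>R b)" by (simp add: P_id euclidean_representation)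
  then show ?thesis by (simp add: linear_sum[OF linear_P] linear_scale[OF linear_P])
qed

lemma Ad_simps: "Ad g (x + y) = Ad g x + Ad g y" "Ad g (x - y) = Ad g x - Ad g y" "Ad g (r *\<^sub>R x) = r *\<^sub>R Ad g x" "Ad g 0 = 0"
  using linear_Ad by (simp_all add: linear_add linear_diff linear_scale linear_0)

text \<open>A system is solved along the ideal: the functions are indexed by the projections of a basis.\<close>

lemma ideal_system:
  assumes F: "\<And>b. K b \<in> smooth_funs M" and lin: "\<And>g. linear (\<lambda>y. f y g)"
    and K: "\<And>b g. K b g = complex_of_real (f (P b) g)"
    and T: "\<And>u y. pi y = 0 \<Longrightarrow> pi (T u y) = 0"
    and lv: "\<And>u b g. lv u (K b) g = complex_of_real (f (T u (P b)) g)"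
    and init: "\<And>b. f (P b) e = 0" and y: "pi y = 0"
  shows "f y g = 0"
proof -
  have fx: "f x h = (\<Sum>b\<in>Basis. (x \<bullet> b) * f (P b) h)" if "pi x = 0" for x h
    by (subst P_expand[OF that]) (simp add: linear_sum[OF lin] linear_scale[OF lin] o_def)
  have "K b g = 0" if "b \<in> Basis" for b
  proof (rule zero_solution[OF conn finite_Basis, where F = K])
    fix u b :: 'e
    have "\<forall>g. lv u (K b) g = (\<Sum>j\<in>Basis. complex_of_real (T u (P b) \<bullet> j) * K j g)"
      using fx[OF T] by (simp add: lv K)
    then show "\<exists>c. \<forall>g. lv u (K b) g = (\<Sum>j\<in>Basis. c j * K j g)"
      by (rule exI[of _ "\<lambda>j. complex_of_real (T u (P b) \<bullet> j)"])
  qed (use F init K that in auto)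
  then have "f (P b) g = 0" if "b \<in> Basis" for b using that K by simp
  then show ?thesis using fx[OF y] by simp
qed

text \<open>Differentiation in \<open>g\<close> replaces \<open>y\<close> by \<open>br u y\<close>,
  which stays in the ideal, so the functions \<open>pi (Ad g y)\<close> with \<open>y\<close> in the
  ideal form a closed linear system; at the identity they are 0. The vector \<open>w\<close>
  represents \<open>pi\<close> by the inner product.\<close>

lemma Ad_ideal: assumes "pi y = 0" shows "pi (Ad g y) = 0"
proof -
  define w where "w = (\<Sum>b\<in>Basis. pi b *\<^sub>R b)"
  have w: "pi x = x \<bullet> w" for x
  proof -
    have "pi x = pi (\<Sum>b\<in>Basis. (x \<bullet> b) *\<^sub>R b)" by (simp add: euclidean_representation)
    then show ?thesis by (simp add: w_def linear_sum[OF pi_linear] inner_sum_right mult.commute)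
  qed
  show ?thesis
  proof (rule ideal_system[where f = "\<lambda>y g. pi (Ad g y)" and K = "\<lambda>b. AdF (P b) w" and T = br])
    show "linear (\<lambda>y. pi (Ad g y))" for g by (intro linearI) (simp_all add: Ad_simps)
    show "AdF (P b) w \<in> smooth_funs M" for b by (rule AdF_smooth)
    show "AdF (P b) w g = complex_of_real (pi (Ad g (P b)))" for b g by (simp add: AdF_def w)
    show "lv u (AdF (P b) w) g = complex_of_real (pi (Ad g (br u (P b))))" for u b g
      unfolding lv_AdF by (simp add: AdF_def w)
  qed (use assms in \<open>simp_all add: Ad_e\<close>)
qed

text \<open>The derivative of \<open>pi (Ad g v)\<close> in \<open>g\<close> is
  \<open>pi (Ad g (br u v))\<close>. This is 0, since brackets lie in the ideal and
  \<open>Ad\<close> preserves the ideal; so the function is constant.\<close>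

lemma pi_Ad: "pi (Ad g v) = pi v"
proof -
  define w where "w = (\<Sum>b\<in>Basis. pi b *\<^sub>R b)"
  have w: "pi x = x \<bullet> w" for x
  proof -
    have "pi x = pi (\<Sum>b\<in>Basis. (x \<bullet> b) *\<^sub>R b)" by (simp add: euclidean_representation)
    then show ?thesis by (simp add: w_def linear_sum[OF pi_linear] inner_sum_right mult.commute)
  qed
  let ?F = "\<lambda>_::unit. AdF v w - (\<lambda>_. complex_of_real (pi v)) * indicator (points M)"
  have sm: "?F i \<in> smooth_funs M" for i
    by (intro smooth_funs_diff AdF_smooth smooth_funs_scale smooth_funs_indicator)
  have "?F () g = 0"
  proof (rule zero_solution[OF conn, of "UNIV :: unit set" ?F])
    fix u :: 'e
    have "lv u (?F i) g = AdF (br u v) w g" for i g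
      using field_diff[OF lv_vector_field AdF_smooth smooth_funs_scale[OF smooth_funs_indicator], of u v w]
      by (simp add: lv_AdF field_scale[OF lv_vector_field smooth_funs_indicator] field_indicator[OF lv_vector_field])
    then have "lv u (?F i) g = 0" for i g
      using Ad_ideal[of "br u v" g] by (simp add: AdF_def w[symmetric])
    then show "\<exists>c. \<forall>g. lv u (?F i) g = (\<Sum>j\<in>UNIV. c j * ?F j g)" for i by (intro exI[of _ "\<lambda>_. 0"]) simp
  qed (use sm in \<open>auto simp: AdF_def Ad_e w[symmetric] points_UNIV\<close>)
  then show ?thesis by (simp add: AdF_def w[symmetric] points_UNIV)
qed

text \<open>The algebra acts on the ideal by multiples of the single operator \<open>B\<close>.
  Whatever commutes with \<open>B\<close> there commutes with the whole linear system, hence with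
  \<open>Ad g\<close>. This is applied to \<open>B\<close> itself and then to
  \<open>Ad h\<close>.\<close>

lemma Ad_commutes:
  assumes S: "linear S" "\<And>y. pi y = 0 \<Longrightarrow> pi (S y) = 0" "\<And>y. pi y = 0 \<Longrightarrow> S (B y) = B (S y)" and y: "pi y = 0"
  shows "Ad g (S y) = S (Ad g y)"
proof (rule euclidean_eqI)
  fix w :: 'e
  have adj: "S x \<bullet> w = x \<bullet> adjoint S w" for x by (simp add: adjoint_works[OF S(1)])
  let ?f = "\<lambda>y g. (Ad g (S y) - S (Ad g y)) \<bullet> w"
  have "?f y g = 0"
  proof (rule ideal_system[where f = ?f and K = "\<lambda>b. AdF (S (P b)) w - AdF (P b) (adjoint S w)" and T = br])
    show "linear (\<lambda>y. ?f y g)" for g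
      by (intro linearI) (simp_all add: linear_add[OF S(1)] linear_scale[OF S(1)] Ad_simps algebra_simps inner_diff_left inner_add_left)
    fix b g u
    show "(AdF (S (P b)) w - AdF (P b) (adjoint S w)) g = complex_of_real (?f (P b) g)"
      by (simp add: AdF_def inner_diff_left adj)
    have brS: "br u (S (P b)) = S (br u (P b))"
      using br_ideal[of "S (P b)" u] br_ideal[of "P b" u] S(2,3)[of "P b"] by (simp add: linear_scale[OF S(1)])
    show "lv u (AdF (S (P b)) w - AdF (P b) (adjoint S w)) g = complex_of_real (?f (br u (P b)) g)"
    proof -
      have "lv u (AdF (S (P b)) w - AdF (P b) (adjoint S w)) g
          = AdF (br u (S (P b))) w g - AdF (br u (P b)) (adjoint S w) g"
        using field_diff[OF lv_vector_field AdF_smooth AdF_smooth, of u] by (simp add: lv_AdF)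
      then show ?thesis using brS by (simp add: AdF_def inner_diff_left adj)
    qed
  qed (use y in \<open>auto simp: Ad_e intro!: smooth_funs_diff AdF_smooth\<close>)
  then show "Ad g (S y) \<bullet> w = S (Ad g y) \<bullet> w" by (simp add: inner_diff_left)
qed

lemma Ad_Ad_commute: assumes "pi y = 0" shows "Ad g (Ad h y) = Ad h (Ad g y)"
proof (rule Ad_commutes[OF linear_Ad Ad_ideal _ assms])
  show "Ad h (B y) = B (Ad h y)" if "pi y = 0" for y
    by (rule Ad_commutes[OF linear_B _ _ that]) auto
qed

section \<open>Commutators and the kernels of \<open>Ad\<close>\<close>

definition comm :: "'g \<Rightarrow> 'g \<Rightarrow> 'g" where "comm a b = a \<cdot> (b \<cdot> (iv a \<cdot> iv b))"

text \<open>\<open>HH\<close> and \<open>CC\<close> are the kernels of \<open>Ad\<close> on the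
  ideal and on the whole algebra. Commutators descend along the chain of the whole group,
  \<open>HH\<close>, \<open>CC\<close> and the trivial group, which is the form in which solvability
  is used.\<close>

definition HH :: "'g set" where "HH = {g. \<forall>y. pi y = 0 \<longrightarrow> Ad g y = y}"
definition CC :: "'g set" where "CC = {g. \<forall>v. Ad g v = v}"

lemma comm_HH: "comm a b \<in> HH"
proof -
  have "Ad (comm a b) y = y" if "pi y = 0" for y
    using Ad_Ad_commute[of "Ad (iv b) y" b "iv a"] Ad_ideal[OF that, of "iv b"]
    by (simp add: comm_def Ad_mul)
  then show ?thesis by (simp add: HH_def)
qed

text \<open>For \<open>a\<close> in \<open>HH\<close> the difference \<open>Ad a v - v\<close> lies
  in the ideal by \<open>pi_Ad\<close>, and elements of \<open>HH\<close> act trivially there; hence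
  \<open>Ad a\<close> and \<open>Ad b\<close> commute on all vectors.\<close>

lemma comm_CC: assumes "a \<in> HH" "b \<in> HH" shows "comm a b \<in> CC"
proof -
  have inv: "iv a \<in> HH" if "a \<in> HH" for a
    unfolding HH_def
  proof (clarify)
    fix y assume "pi y = 0"
    then have "Ad a y = y" using that by (simp add: HH_def)
    then show "Ad (iv a) y = y" using Ad_iv(1)[of a y] by simp
  qed
  have c: "Ad a (Ad b v) = Ad b (Ad a v)" if a: "a \<in> HH" and b: "b \<in> HH" for a b v
  proof -
    have "Ad a (Ad b v - v) = Ad b v - v" "Ad b (Ad a v - v) = Ad a v - v"
      using a b by (simp_all add: HH_def pi_Ad)
    then have "v + Ad a (Ad b v) = v + Ad b (Ad a v)" by (simp add: Ad_simps algebra_simps)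
    then show ?thesis by simp
  qed
  have "Ad (comm a b) v = v" for v
    using c[OF assms(2) inv[OF assms(1)], of "Ad (iv b) v"] by (simp add: comm_def Ad_mul)
  then show ?thesis by (simp add: CC_def)
qed

text \<open>Conjugation by \<open>c\<close> and the identity map have the same Maurer-Cartan form,
  because \<open>Ad c\<close> is trivial, and they agree at the identity; so they agree nearby, and
  by connectedness everywhere.\<close>

lemma CC_central: assumes c: "c \<in> CC" shows "c \<cdot> g = g \<cdot> c"
proof -
  define Zs where "Zs = {g. c \<cdot> g = g \<cdot> c}"
  have "closed Zs" unfolding Zs_def
    by (intro closed_Collect_eq continuous_on_mul continuous_on_const continuous_on_id)
  let ?k = "\<lambda>y. c \<cdot> (\<psi>0 y \<cdot> iv c)"
  have k: "plot D0 ?k" by (rule conj_plot)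
  have mck: "mc ?k y a = mc \<psi>0 y a" if y: "y \<in> D0" for y a
  proof (rule lv_inj)
    fix F assume F: "F \<in> smooth_funs M"
    have "lv (mc ?k y a) F (?k y) = D (\<lambda>t. F (?k t)) y a" by (rule D_plot[OF open_D0 k y F, symmetric])
    also have "\<dots> = lv (mc \<psi>0 y a) (\<lambda>x. F (c \<cdot> (x \<cdot> iv c))) (\<psi>0 y)"
      using D_plot[OF open_D0 plot_\<psi>0 y smooth_funs_right[OF smooth_funs_left[OF F, of c], of "iv c"]] by simp
    also have "\<dots> = lv (mc \<psi>0 y a) F (?k y)"
      using smooth_right_lv[OF smooth_funs_left[OF F, of c], of "mc \<psi>0 y a" "iv c" "\<psi>0 y"] c
        lv_left_translate[OF F, of "mc \<psi>0 y a" c]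
      by (simp add: CC_def)
    finally show "lv (mc ?k y a) F (?k y) = lv (mc \<psi>0 y a) F (?k y)" .
  qed
  obtain W q where W: "openin (mtop M) W" "e \<in> W" "W \<subseteq> U0" and q: "\<And>b. q b \<in> smooth_funs M"
    "\<And>b y. y \<in> W \<Longrightarrow> q b y = complex_of_real (\<phi>0 y \<bullet> b)"
    by (rule field_in_chart[OF lv_vector_field[of 0] c0 e_U0], rule that)
  obtain \<rho> where \<rho>: "\<rho> > 0" "cball y0 \<rho> \<subseteq> D0" using open_D0 y0_D0 open_contains_cball by blast
  define W' where "W' = W \<inter> {x \<in> U0. \<phi>0 x \<in> ball y0 \<rho>}"
  have oW: "open W'"
    unfolding W'_def using W(1) chart_preimage_open[OF c0 open_ball, unfolded mtop, unfolded open_openin[symmetric]]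
    by (auto simp: mtop)
  have eW: "e \<in> W'" using W e_U0 \<rho> by (simp add: W'_def)
  define T where "T = {y \<in> {y \<in> D0. \<psi>0 y \<in> W'}. ?k y \<in> W'}"
  have T: "open T" unfolding T_def
    by (intro open_plot_preimage oW continuous_on_subset[OF plot_continuous[OF k]] plot_continuous plot_\<psi>0 open_D0) auto
  have yT: "y0 \<in> T" using eW y0_D0 by (simp add: T_def)
  obtain r where r: "r > 0" "ball y0 r \<subseteq> T" using T yT open_contains_ball by blast
  \<comment> \<open>The frame derivatives of the coordinates are compared at the values of both
    maps, which may differ. A Lipschitz bound by the coordinate differences themselves yields the
    linear inequality that \<open>zero_near\<close> needs.\<close>
  have lip: "\<exists>L\<ge>0. \<forall>x\<in>W'. \<forall>x'\<in>W'. cmod (H x - H x') \<le> L * (\<Sum>b\<in>Basis. cmod (q b x - q b x'))"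
    if H: "H \<in> smooth_funs M" for H
  proof -
    obtain L where L: "L \<ge> 0" "\<forall>y\<in>cball y0 \<rho>. \<forall>z\<in>cball y0 \<rho>. cmod (H (\<psi>0 y) - H (\<psi>0 z)) \<le> L * norm (y - z)"
      using smooth_lipschitz[OF smooth_funsD(2)[OF H c0] \<rho>(2)] by blast
    have "cmod (H x - H x') \<le> L * (\<Sum>b\<in>Basis. cmod (q b x - q b x'))" if x: "x \<in> W'" "x' \<in> W'" for x x'
    proof -
      have "cmod (H x - H x') \<le> L * norm (\<phi>0 x - \<phi>0 x')"
        using bspec[OF bspec[OF L(2), of "\<phi>0 x"], of "\<phi>0 x'"] x by (simp add: W'_def \<psi>0_\<phi>0)
      also have "norm (\<phi>0 x - \<phi>0 x') \<le> (\<Sum>b\<in>Basis. \<bar>(\<phi>0 x - \<phi>0 x') \<bullet> b\<bar>)" by (rule norm_le_l1)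
      also have "\<dots> = (\<Sum>b\<in>Basis. cmod (q b x - q b x'))"
        using x q(2) by (simp add: W'_def inner_diff_left flip: of_real_diff)
      finally show ?thesis using L(1) by (simp add: mult_left_mono)
    qed
    then show ?thesis using L(1) by blast
  qed
  define u where "u = (\<lambda>b y. q b (?k y) - q b (\<psi>0 y))"
  have "\<exists>L. \<forall>d\<in>Basis. \<forall>b. L d b \<ge> 0 \<and> (\<forall>x\<in>W'. \<forall>x'\<in>W'. cmod (lv d (q b) x - lv d (q b) x') \<le> L d b * (\<Sum>b\<in>Basis. cmod (q b x - q b x')))"
    using lip[OF lv_smooth[OF q(1)]] by metis
  then obtain L where L: "\<And>d b. d \<in> Basis \<Longrightarrow> L d b \<ge> 0"
    "\<And>d b x x'. d \<in> Basis \<Longrightarrow> x \<in> W' \<Longrightarrow> x' \<in> W' \<Longrightarrow> cmod (lv d (q b) x - lv d (q b) x') \<le> L d b * (\<Sum>b\<in>Basis. cmod (q b x - q b x'))"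
    by blast
  obtain r' where r': "r' > 0" "cball y0 r' \<subseteq> ball y0 r" using r(1) by (intro that[of "r / 2"]) auto
  have "\<exists>K. \<forall>y\<in>cball y0 r'. \<forall>b\<in>Basis. \<forall>d. \<bar>mc \<psi>0 y b \<bullet> d\<bar> \<le> K * norm d"
  proof -
    define l where "l = (\<lambda>y. \<Sum>b\<in>Basis. norm (mc \<psi>0 y b))"
    have "continuous_on D0 l" unfolding l_def
      by (intro continuous_on_sum continuous_on_norm smooth_on_continuous_on[OF mc_smooth[OF open_D0 plot_\<psi>0]])
    moreover have sub: "cball y0 r' \<subseteq> D0" using r' r by (auto simp: T_def)
    ultimately have cl: "continuous_on (cball y0 r') l" using continuous_on_subset by blast
    have "cball y0 r' \<noteq> {}" using r' by simp
    from continuous_attains_sup[OF compact_cball this cl] obtain w where w: "\<forall>y\<in>cball y0 r'. l y \<le> l w" by blast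
    have "\<bar>mc \<psi>0 y b \<bullet> d\<bar> \<le> l w * norm d" if "y \<in> cball y0 r'" "b \<in> Basis" for y b d
    proof -
      have "\<bar>mc \<psi>0 y b \<bullet> d\<bar> \<le> norm (mc \<psi>0 y b) * norm d" by (rule Cauchy_Schwarz_ineq2)
      also have "norm (mc \<psi>0 y b) \<le> l y" unfolding l_def using that by (intro member_le_sum) auto
      also have "\<dots> \<le> l w" using w that by blast
      finally show ?thesis by (simp add: mult_right_mono)
    qed
    then show ?thesis by blast
  qed
  then obtain K where K: "\<And>y b d. y \<in> cball y0 r' \<Longrightarrow> b \<in> Basis \<Longrightarrow> \<bar>mc \<psi>0 y b \<bullet> d\<bar> \<le> K * norm d" by blast
  define K' where "K' = max K 0"
  define m where "m = (\<Sum>d\<in>(Basis::'e set). \<Sum>b\<in>(Basis::'e set). L d b)"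
  have Lm: "L d b \<le> m" if "d \<in> Basis" "b \<in> Basis" for d b
  proof -
    have "L d b \<le> (\<Sum>b\<in>(Basis::'e set). L d b)" using that L(1) by (intro member_le_sum) auto
    also have "\<dots> \<le> m" unfolding m_def using that L(1)
      by (intro member_le_sum[of _ _ "\<lambda>d. \<Sum>b\<in>Basis. L d b"]) (auto intro!: sum_nonneg)
    finally show ?thesis .
  qed
  have m0: "m \<ge> 0" unfolding m_def using L(1) by (intro sum_nonneg) auto
  have "\<exists>\<delta>>0. \<forall>b\<in>Basis. \<forall>y\<in>ball y0 \<delta>. u b y = 0"
  proof (rule zero_near[OF finite_Basis r'(1), of "real DIM('e) * (real DIM('e) * K') * m"])
    show "0 \<le> real DIM('e) * (real DIM('e) * K') * m" using m0 by (simp add: K'_def)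
    fix b :: 'e assume b: "b \<in> Basis"
    show "u b y0 = 0" by (simp add: u_def)
    fix y assume y: "y \<in> ball y0 r'"
    then have "y \<in> T" using r(2) r'(2) ball_subset_cball by blast
    then have yD: "y \<in> D0" and yW: "\<psi>0 y \<in> W'" "?k y \<in> W'" by (auto simp: T_def)
    have d1: "(\<lambda>y. q b (?k y)) differentiable (at y)" "(\<lambda>y. q b (\<psi>0 y)) differentiable (at y)"
      by (rule smooth_on_differentiable[OF plot_smooth[OF k q(1)] yD],
          rule smooth_on_differentiable[OF plot_smooth[OF plot_\<psi>0 q(1)] yD])
    then show "u b differentiable (at y)" unfolding u_def by (rule differentiable_diff)
    fix a :: 'e
    let ?S = "\<Sum>j\<in>Basis. norm (u j y)"
    have "D (u b) y a = D (\<lambda>y. q b (?k y)) y a - D (\<lambda>y. q b (\<psi>0 y)) y a"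
      unfolding u_def
      by (subst D_eqI[OF has_derivative_diff[OF D_has_derivative[OF d1(1)] D_has_derivative[OF d1(2)]]]) simp
    also have "\<dots> = lv (mc \<psi>0 y a) (q b) (?k y) - lv (mc \<psi>0 y a) (q b) (\<psi>0 y)"
      using D_plot[OF open_D0 k yD q(1)] D_plot[OF open_D0 plot_\<psi>0 yD q(1)] mck[OF yD] by simp
    also have "\<dots> = lv (\<Sum>d\<in>Basis. (mc \<psi>0 y a \<bullet> d) *\<^sub>R d) (q b) (?k y) - lv (\<Sum>d\<in>Basis. (mc \<psi>0 y a \<bullet> d) *\<^sub>R d) (q b) (\<psi>0 y)"
      by (simp only: euclidean_representation)
    also have "\<dots> = (\<Sum>d\<in>Basis. complex_of_real (mc \<psi>0 y a \<bullet> d) * (lv d (q b) (?k y) - lv d (q b) (\<psi>0 y)))"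
      unfolding lv_sum by (simp add: lv_scale cscale_def fmult_def sum_subtractf right_diff_distrib)
    finally have "norm (D (u b) y a) \<le> (\<Sum>d\<in>Basis. \<bar>mc \<psi>0 y a \<bullet> d\<bar> * cmod (lv d (q b) (?k y) - lv d (q b) (\<psi>0 y)))"
      using norm_sum[of "\<lambda>d. complex_of_real (mc \<psi>0 y a \<bullet> d) * (lv d (q b) (?k y) - lv d (q b) (\<psi>0 y))" Basis]
      by (simp add: norm_mult)
    also have "\<dots> \<le> (\<Sum>d\<in>(Basis::'e set). (real DIM('e) * K' * norm a) * (m * ?S))"
    proof (intro sum_mono mult_mono)
      fix d :: 'e assume d: "d \<in> Basis"
      have "\<bar>mc \<psi>0 y a \<bullet> d\<bar> = \<bar>\<Sum>b\<in>Basis. (a \<bullet> b) * (mc \<psi>0 y b \<bullet> d)\<bar>"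
        by (subst mc_expand[OF open_D0 plot_\<psi>0 yD]) (simp add: inner_sum_left)
      also have "\<dots> \<le> (\<Sum>b\<in>(Basis::'e set). norm a * K')"
      proof (rule order_trans[OF sum_abs], rule sum_mono)
        fix b' :: 'e assume b': "b' \<in> Basis"
        have "\<bar>mc \<psi>0 y b' \<bullet> d\<bar> \<le> K'" using K[of y b' d] y b' d by (simp add: K'_def)
        then show "\<bar>(a \<bullet> b') * (mc \<psi>0 y b' \<bullet> d)\<bar> \<le> norm a * K'"
          unfolding abs_mult using Basis_le_norm[OF b'] by (intro mult_mono) auto
      qed
      finally show "\<bar>mc \<psi>0 y a \<bullet> d\<bar> \<le> real DIM('e) * K' * norm a" by (simp add: algebra_simps)
      have "cmod (lv d (q b) (?k y) - lv d (q b) (\<psi>0 y)) \<le> L d b * ?S"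
        using L(2)[OF d yW(2,1)] by (simp add: u_def)
      also have "\<dots> \<le> m * ?S" using Lm[OF d b] by (intro mult_right_mono sum_nonneg) auto
      finally show "cmod (lv d (q b) (?k y) - lv d (q b) (\<psi>0 y)) \<le> m * ?S" .
    qed (auto simp: K'_def)
    also have "\<dots> = real DIM('e) * (real DIM('e) * K') * m * norm a * ?S" by (simp add: algebra_simps)
    finally show "norm (D (u b) y a) \<le> real DIM('e) * (real DIM('e) * K') * m * norm a * ?S" .
  qed
  then obtain \<delta> where \<delta>: "\<delta> > 0" "\<And>b y. b \<in> Basis \<Longrightarrow> y \<in> ball y0 \<delta> \<Longrightarrow> u b y = 0" by blast
  define \<delta>' where "\<delta>' = min \<delta> r"
  have eq: "c \<cdot> \<psi>0 y = \<psi>0 y \<cdot> c" if y: "y \<in> ball y0 \<delta>'" for y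
  proof -
    have yT: "y \<in> T" using y r by (auto simp: \<delta>'_def)
    have "\<phi>0 (?k y) \<bullet> b = \<phi>0 (\<psi>0 y) \<bullet> b" if b: "b \<in> Basis" for b
    proof -
      have "q b (?k y) = q b (\<psi>0 y)" using \<delta>(2)[OF b, of y] y by (simp add: \<delta>'_def u_def)
      then show ?thesis using q(2) yT by (simp add: T_def W'_def)
    qed
    then have "\<phi>0 (?k y) = \<phi>0 (\<psi>0 y)" by (rule euclidean_eqI)
    then have "?k y = \<psi>0 y" using chart_inj[OF c0] yT by (auto simp: T_def W'_def dest: inj_onD)
    then have "(c \<cdot> (\<psi>0 y \<cdot> iv c)) \<cdot> c = \<psi>0 y \<cdot> c" by (simp only:)
    then show ?thesis by simp
  qed
  \<comment> \<open>If \<open>g\<close> commutes with \<open>c\<close> and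
    \<open>iv g \<cdot> h\<close> is so close to the identity that it commutes as well, then so does
    \<open>h\<close>.\<close>
  have "open Zs"
  proof (subst open_subopen, intro ballI)
    fix g assume g: "g \<in> Zs"
    let ?T = "{h \<in> UNIV. iv g \<cdot> h \<in> {x \<in> U0. \<phi>0 x \<in> ball y0 \<delta>'}}"
    have "open ?T"
      by (rule open_plot_preimage) (use chart_preimage_open[OF c0 open_ball] in \<open>auto intro!: continuous_on_mul simp: mtop\<close>)
    moreover have "g \<in> ?T" using e_U0 \<delta>(1) r(1) by (simp add: \<delta>'_def)
    moreover have "?T \<subseteq> Zs"
    proof
      fix h assume h: "h \<in> ?T"
      then have "c \<cdot> (iv g \<cdot> h) = (iv g \<cdot> h) \<cdot> c" using eq[of "\<phi>0 (iv g \<cdot> h)"] by (simp add: \<psi>0_\<phi>0)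
      then have "g \<cdot> (c \<cdot> (iv g \<cdot> h)) = g \<cdot> ((iv g \<cdot> h) \<cdot> c)" by simp
      then have "(g \<cdot> c) \<cdot> (iv g \<cdot> h) = h \<cdot> c" by simp
      moreover have "g \<cdot> c = c \<cdot> g" using g by (simp add: Zs_def)
      ultimately have "(c \<cdot> g) \<cdot> (iv g \<cdot> h) = h \<cdot> c" by (simp only:)
      then show "h \<in> Zs" by (simp add: Zs_def)
    qed
    ultimately show "\<exists>T. open T \<and> g \<in> T \<and> T \<subseteq> Zs" by blast
  qed
  moreover have "e \<in> Zs" by (simp add: Zs_def)
  ultimately have "Zs = UNIV" using \<open>closed Zs\<close>
    using conn[unfolded connected_clopen, rule_format, of Zs] by (auto simp flip: open_openin closed_closedin)
  then show ?thesis by (auto simp: Zs_def)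
qed

lemma comm_one: assumes "a \<in> CC" shows "comm a b = e"
  using CC_central[OF assms, of "b \<cdot> (iv a \<cdot> iv b)"] CC_central[OF assms, of "iv b", symmetric] by (simp add: comm_def)

end


section \<open>Invariant means\<close>

text \<open>Means on bounded functions, extended by \<open>0\<close> to unbounded ones so that the set of all means
  is compact for pointwise convergence.\<close>

definition bdd :: "('x \<Rightarrow> real) \<Rightarrow> bool" where
  "bdd f \<longleftrightarrow> (\<exists>K. \<forall>x. \<bar>f x\<bar> \<le> K)"

definition mean :: "(('x \<Rightarrow> real) \<Rightarrow> real) \<Rightarrow> bool" where
  "mean I \<longleftrightarrow> (\<forall>f. \<not> bdd f \<longrightarrow> I f = 0) \<and>
     (\<forall>f g. bdd f \<longrightarrow> bdd g \<longrightarrow> I (\<lambda>x. f x + g x) = I f + I g) \<and>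
     (\<forall>c f. bdd f \<longrightarrow> I (\<lambda>x. c * f x) = c * I f) \<and>
     (\<forall>f. bdd f \<longrightarrow> (\<forall>x. 0 \<le> f x) \<longrightarrow> 0 \<le> I f) \<and> I (\<lambda>_. 1) = 1"

lemma bdd_const: "bdd (\<lambda>_. c)"
  by (auto simp: bdd_def)

lemma bdd_add: "bdd f \<Longrightarrow> bdd g \<Longrightarrow> bdd (\<lambda>x. f x + g x)"
  unfolding bdd_def by (meson abs_triangle_ineq add_mono order_trans)

lemma bdd_scale: "bdd f \<Longrightarrow> bdd (\<lambda>x. c * f x)"
  unfolding bdd_def by (metis abs_ge_zero abs_mult mult_left_mono)

context
  fixes I assumes I: "mean I"
begin

lemma mean_unbounded: "\<not> bdd f \<Longrightarrow> I f = 0"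
  and mean_add: "bdd f \<Longrightarrow> bdd g \<Longrightarrow> I (\<lambda>x. f x + g x) = I f + I g"
  and mean_scale: "bdd f \<Longrightarrow> I (\<lambda>x. c * f x) = c * I f"
  and mean_nonneg: "bdd f \<Longrightarrow> (\<And>x. 0 \<le> f x) \<Longrightarrow> 0 \<le> I f"
  and mean_one: "I (\<lambda>_. 1) = 1"
  using I unfolding mean_def by blast+

lemma mean_const: "I (\<lambda>_. c) = c"
  using mean_scale[OF bdd_const, of c 1] mean_one by simp

lemma mean_mono: assumes "bdd f" "bdd g" "\<And>x. f x \<le> g x" shows "I f \<le> I g"
proof -
  have "I (\<lambda>x. g x + (-1) * f x) \<ge> 0"
    using assms by (intro mean_nonneg bdd_add bdd_scale) auto
  then show ?thesis using mean_add[OF assms(2) bdd_scale[OF assms(1)], of "-1"] mean_scale[OF assms(1), of "-1"] by simp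
qed

lemma mean_bound: assumes "\<And>x. \<bar>f x\<bar> \<le> K" shows "\<bar>I f\<bar> \<le> K"
proof -
  have f: "bdd f" using assms by (auto simp: bdd_def)
  have "f x \<le> K" "- K \<le> f x" for x using assms[of x] by auto
  then have "I f \<le> K" "- K \<le> I f"
    using mean_mono[OF f bdd_const, of K] mean_mono[OF bdd_const f, of "-K"] by (auto simp: mean_const)
  then show ?thesis by simp
qed

end

lemma closed_coord: "closed {I :: 'i \<Rightarrow> real. a * I f + b * I g + c * I h = d}"
  by (intro closed_Collect_eq continuous_on_add continuous_on_mult continuous_on_const continuous_on_product_coordinates)

text \<open>Tychonoff's theorem: a mean respects every bound of its argument, so the means form a
  closed subset of a product of intervals. The value 0 at unbounded functions shrinks their
  intervals to a point.\<close>

lemma compact_means: "compact {I :: ('x \<Rightarrow> real) \<Rightarrow> real. mean I}"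
proof -
  have "\<forall>f :: 'x \<Rightarrow> real. \<exists>K. bdd f \<longrightarrow> (\<forall>x. \<bar>f x\<bar> \<le> K)" by (auto simp: bdd_def)
  from choice[OF this] obtain K where K: "\<And>(f :: 'x \<Rightarrow> real) x. bdd f \<Longrightarrow> \<bar>f x\<bar> \<le> K f" by blast
  define K' where "K' = (\<lambda>f. if bdd f then K f else 0)"
  let ?P = "PiE UNIV (\<lambda>f. {- K' f .. K' f})"
  have "compactin (product_topology (\<lambda>_. euclidean) UNIV) ?P"
    by (subst compactin_PiE) auto
  then have "compact ?P" by (simp add: euclidean_product_topology)
  moreover have "closed {I :: ('x \<Rightarrow> real) \<Rightarrow> real. mean I}"
    unfolding mean_def
  proof (intro closed_Collect_conj closed_Collect_all closed_Collect_imp open_Collect_const closed_Collect_const)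
    fix f g :: "'x \<Rightarrow> real" and c :: real
    show "closed {I :: ('x \<Rightarrow> real) \<Rightarrow> real. I f = 0}" using closed_coord[of 1 f 0 f 0 f 0] by simp
    show "closed {I :: ('x \<Rightarrow> real) \<Rightarrow> real. I (\<lambda>x. f x + g x) = I f + I g}"
      using closed_coord[of 1 "\<lambda>x. f x + g x" "-1" f "-1" g 0] by (simp add: algebra_simps)
    show "closed {I :: ('x \<Rightarrow> real) \<Rightarrow> real. I (\<lambda>x. c * f x) = c * I f}"
      using closed_coord[of 1 "\<lambda>x. c * f x" "-c" f 0 f 0] by (simp add: algebra_simps)
    show "closed {I :: ('x \<Rightarrow> real) \<Rightarrow> real. I (\<lambda>_. 1) = 1}" using closed_coord[of 1 "\<lambda>_. 1" 0 f 0 f 1] by simp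
    show "closed {I :: ('x \<Rightarrow> real) \<Rightarrow> real. 0 \<le> I f}"
      by (intro closed_Collect_le continuous_on_const continuous_on_product_coordinates)
  qed
  moreover have "{I :: ('x \<Rightarrow> real) \<Rightarrow> real. mean I} \<subseteq> ?P"
  proof clarify
    fix I :: "('x \<Rightarrow> real) \<Rightarrow> real" assume I: "mean I"
    have "\<bar>I f\<bar> \<le> K' f" for f
      using mean_bound[OF I, of f "K f"] K mean_unbounded[OF I, of f] by (auto simp: K'_def)
    then show "I \<in> ?P" by (auto simp: abs_le_iff) (metis minus_le_iff)
  qed
  ultimately show ?thesis using compact_Int_closed by (metis inf.absorb2)
qed

section \<open>Means fixed by right translations\<close>

context lie begin

definition act :: "'g \<Rightarrow> (('g \<Rightarrow> real) \<Rightarrow> real) \<Rightarrow> ('g \<Rightarrow> real) \<Rightarrow> real" where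
  "act a I = (\<lambda>f. I (\<lambda>x. f (x \<cdot> a)))"

definition Inv :: "'g set \<Rightarrow> (('g \<Rightarrow> real) \<Rightarrow> real) set" where
  "Inv N = {I. mean I \<and> (\<forall>a\<in>N. act a I = I)}"

lemma bdd_act: "bdd (\<lambda>x. f (x \<cdot> a)) \<longleftrightarrow> bdd (f :: 'g \<Rightarrow> real)"
proof
  assume "bdd (\<lambda>x. f (x \<cdot> a))"
  then obtain K where K: "\<And>x. \<bar>f (x \<cdot> a)\<bar> \<le> K" by (auto simp: bdd_def)
  have "\<bar>f x\<bar> \<le> K" for x using K[of "x \<cdot> iv a"] by simp
  then show "bdd f" by (auto simp: bdd_def)
qed (auto simp: bdd_def)

lemma mean_act: assumes "mean I" shows "mean (act a I)"
  unfolding mean_def act_def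
  by (intro conjI allI impI mean_unbounded[OF assms] mean_add[OF assms] mean_scale[OF assms] mean_nonneg[OF assms] mean_one[OF assms])
    (auto simp: bdd_act)

lemma act_act: "act a (act b I) = act (b \<cdot> a) I"
  by (rule ext) (simp add: act_def)

lemma act_e: "act e I = I"
  by (rule ext) (simp add: act_def)

lemma compact_Inv: "compact (Inv N)"
proof -
  have "Inv N = {I. mean I} \<inter> {I. \<forall>a. a \<in> N \<longrightarrow> (\<forall>f. act a I f = I f)}"
    by (auto simp: Inv_def fun_eq_iff)
  moreover have "closed {I. \<forall>a. a \<in> N \<longrightarrow> (\<forall>f. act a I f = I f)}"
    unfolding act_def
    by (intro closed_Collect_all closed_Collect_imp open_Collect_const closed_Collect_eq continuous_on_product_coordinates)
  ultimately show ?thesis using compact_Int_closed[OF compact_means] by simp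
qed

lemma mean_average:
  fixes J :: "nat \<Rightarrow> ('x \<Rightarrow> real) \<Rightarrow> real"
  assumes "\<And>k. k < n \<Longrightarrow> mean (J k)" "n > 0"
  shows "mean (\<lambda>f. (\<Sum>k<n. J k f) / n)"
  unfolding mean_def
proof (intro conjI allI impI)
  fix f g :: "'x \<Rightarrow> real" and c
  show "\<not> bdd f \<Longrightarrow> (\<Sum>k<n. J k f) / n = 0" using assms by (simp add: mean_unbounded)
  show "bdd f \<Longrightarrow> bdd g \<Longrightarrow> (\<Sum>k<n. J k (\<lambda>x. f x + g x)) / n = (\<Sum>k<n. J k f) / n + (\<Sum>k<n. J k g) / n"
    using assms by (simp add: mean_add sum.distrib add_divide_distrib)
  show "bdd f \<Longrightarrow> (\<Sum>k<n. J k (\<lambda>x. c * f x)) / n = c * ((\<Sum>k<n. J k f) / n)"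
    using assms by (simp add: mean_scale sum_distrib_left)
  show "bdd f \<Longrightarrow> \<forall>x. 0 \<le> f x \<Longrightarrow> 0 \<le> (\<Sum>k<n. J k f) / n"
    using assms by (intro divide_nonneg_nonneg sum_nonneg) (auto intro: mean_nonneg)
  show "(\<Sum>k<n. J k (\<lambda>_. 1)) / n = 1" using assms by (simp add: mean_one)
qed

text \<open>One step of the Markov--Kakutani fixed point argument: averaging over the powers of \<open>a\<close>.\<close>

lemma Inv_insert:
  assumes ne: "Inv N \<noteq> {}" and pres: "\<And>I. I \<in> Inv N \<Longrightarrow> act a I \<in> Inv N"
  shows "Inv (insert a N) \<noteq> {}"
proof -
  obtain J where J: "J \<in> Inv N" using ne by blast
  define pw where "pw = rec_nat J (\<lambda>_. act a)"
  have pw_simps: "pw 0 = J" "pw (Suc k) = act a (pw k)" for k by (simp_all add: pw_def)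
  have pw: "pw k \<in> Inv N" for k by (induction k) (simp_all add: pw_simps J pres)
  \<comment> \<open>Approximately invariant means: the sets are closed, and a mean that lies in all
    of them is invariant under \<open>a\<close>.\<close>
  define C where "C n = {I. \<forall>f K. (\<forall>x. \<bar>f x\<bar> \<le> K) \<longrightarrow> \<bar>act a I f - I f\<bar> \<le> 2 * K / real (Suc n)}" for n
  have clC: "closed (C n)" for n
    unfolding C_def act_def
    by (intro closed_Collect_all closed_Collect_imp open_Collect_const closed_Collect_le continuous_on_rabs
        continuous_on_diff continuous_on_const continuous_on_product_coordinates)
  have "Inv N \<inter> \<Inter> (C ` UNIV) \<noteq> {}"
  proof (rule compact_imp_fip_image[OF compact_Inv clC])
    fix S :: "nat set" assume S: "finite S"
    \<comment> \<open>One average over \<open>n\<close> powers meets all finitely many conditions: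
      the telescoping sum leaves at most \<open>2 * K / n\<close>, and \<open>n\<close> exceeds
      every index in \<open>S\<close>. The inserted 0 covers the empty \<open>S\<close>.\<close>
    define n where "n = Suc (Max (insert 0 S))"
    have n: "Suc k \<le> n" if "k \<in> S" for k using S that by (simp add: n_def)
    define I where "I = (\<lambda>f. (\<Sum>k<n. pw k f) / n)"
    have mI: "mean I" unfolding I_def using pw by (intro mean_average) (auto simp: Inv_def n_def)
    have "act b I = I" if "b \<in> N" for b
    proof -
      have "act b (pw k) f = pw k f" for k f using pw[of k] that by (simp add: Inv_def)
      then show ?thesis by (auto simp: I_def act_def fun_eq_iff)
    qed
    then have IN: "I \<in> Inv N" using mI by (simp add: Inv_def)
    have "I \<in> C k" if k: "k \<in> S" for k
      unfolding C_def
    proof (clarify)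
      fix f :: "'g \<Rightarrow> real" and K assume f: "\<forall>x. \<bar>f x\<bar> \<le> K"
      have K0: "0 \<le> K" using f abs_ge_zero order_trans by blast
      have "act a I f - I f = (\<Sum>k<n. pw (Suc k) f - pw k f) / n"
        by (simp add: I_def act_def pw_simps sum_subtractf diff_divide_distrib)
      also have "(\<Sum>k<n. pw (Suc k) f - pw k f) = pw n f - pw 0 f" by (rule sum_lessThan_telescope)
      finally have "\<bar>act a I f - I f\<bar> = \<bar>pw n f - pw 0 f\<bar> / n" by simp
      also have "\<dots> \<le> (2 * K) / n"
      proof (rule divide_right_mono)
        have "\<bar>pw n f\<bar> \<le> K" "\<bar>pw 0 f\<bar> \<le> K"
          using mean_bound[of "pw n" f K] mean_bound[of "pw 0" f K] pw f by (auto simp: Inv_def)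
        then show "\<bar>pw n f - pw 0 f\<bar> \<le> 2 * K" by linarith
      qed simp
      also have "\<dots> \<le> 2 * K / real (Suc k)"
        using n[OF k] K0 by (intro divide_left_mono) (auto simp: n_def)
      finally show "\<bar>act a I f - I f\<bar> \<le> 2 * K / real (Suc k)" .
    qed
    then show "Inv N \<inter> \<Inter> (C ` S) \<noteq> {}" using IN by blast
  qed
  then obtain I where I: "I \<in> Inv N" "\<And>n. I \<in> C n" by blast
  have mI: "mean I" using I(1) by (simp add: Inv_def)
  have "act a I f = I f" for f
  proof (cases "bdd f")
    case True
    then obtain K where K: "\<forall>x. \<bar>f x\<bar> \<le> K" by (auto simp: bdd_def)
    have "(\<lambda>n. 2 * K / real (Suc n)) \<longlonglongrightarrow> 0" by real_asymp
    moreover have "\<bar>act a I f - I f\<bar> \<le> 2 * K / real (Suc n)" for n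
      using I(2)[of n] K unfolding C_def by blast
    ultimately have "\<bar>act a I f - I f\<bar> \<le> 0" by (intro LIMSEQ_le_const) auto
    then show ?thesis by simp
  next
    case False
    then show ?thesis using mean_unbounded[OF mI] mean_unbounded[OF mean_act[OF mI]] by metis
  qed
  then have "act a I = I" by blast
  then show ?thesis using I(1) unfolding Inv_def by blast
qed

text \<open>The hypotheses say that \<open>S\<close> normalises \<open>N\<close> and is commutative
  modulo \<open>N\<close>; so the means fixed by \<open>N\<close> and by a part of \<open>S\<close>
  are preserved by all of \<open>S\<close>. Finitely many elements are added by
  \<open>Inv_insert\<close>, all of them by compactness.\<close>

lemma Inv_extend:
  assumes ne: "Inv N \<noteq> {}"
    and conj: "\<And>a k. a \<in> S \<Longrightarrow> k \<in> N \<Longrightarrow> a \<cdot> (k \<cdot> iv a) \<in> N"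
    and commut: "\<And>a b. a \<in> S \<Longrightarrow> b \<in> S \<Longrightarrow> a \<cdot> (b \<cdot> (iv a \<cdot> iv b)) \<in> N"
  shows "Inv (N \<union> S) \<noteq> {}"
proof -
  have pres: "act a I \<in> Inv (N \<union> S')" if a: "a \<in> S" and S': "S' \<subseteq> S" and I: "I \<in> Inv (N \<union> S')" for a S' I
  proof -
    have mI: "mean I" and IN: "\<And>k. k \<in> N \<union> S' \<Longrightarrow> act k I = I" using I by (auto simp: Inv_def)
    have "act k (act a I) = act a I" if "k \<in> N \<union> S'" for k
      using that
    proof
      assume k: "k \<in> N"
      have "act k (act a I) = act a (act (a \<cdot> (k \<cdot> iv a)) I)" by (simp add: act_act)
      then show ?thesis using IN[of "a \<cdot> (k \<cdot> iv a)"] conj[OF a k] by simp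
    next
      assume k: "k \<in> S'"
      then have "k \<in> S" using S' by blast
      have "act k (act a I) = act a (act k (act (a \<cdot> (k \<cdot> (iv a \<cdot> iv k))) I))" by (simp add: act_act)
      then show ?thesis using IN[of "a \<cdot> (k \<cdot> (iv a \<cdot> iv k))"] IN[of k] commut[OF a \<open>k \<in> S\<close>] k by simp
    qed
    then show ?thesis using mean_act[OF mI] by (simp add: Inv_def)
  qed
  have fin: "Inv (N \<union> S') \<noteq> {}" if "finite S'" "S' \<subseteq> S" for S'
    using that
  proof (induction S')
    case (insert a S')
    then have "Inv (insert a (N \<union> S')) \<noteq> {}" using pres[of a S'] by (intro Inv_insert) auto
    then show ?case by simp
  qed (use ne in simp)
  define F where "F a = {I. \<forall>f. act a I f = I f}" for a
  have clF: "closed (F a)" for a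
    unfolding F_def act_def by (intro closed_Collect_all closed_Collect_eq continuous_on_product_coordinates)
  have "Inv N \<inter> \<Inter> (F ` S) \<noteq> {}"
  proof (rule compact_imp_fip_image[OF compact_Inv clF])
    fix S' assume "finite S'" "S' \<subseteq> S"
    from fin[OF this] show "Inv N \<inter> \<Inter> (F ` S') \<noteq> {}" by (force simp: Inv_def F_def)
  qed
  then show ?thesis by (force simp: Inv_def F_def)
qed

end

context lie_almost_abelian begin

lemma conj_HH: "a \<in> HH \<Longrightarrow> g \<cdot> (a \<cdot> iv g) \<in> HH"
  using Ad_ideal by (simp add: HH_def Ad_mul)

lemma conj_CC: "a \<in> CC \<Longrightarrow> g \<cdot> (a \<cdot> iv g) \<in> CC"
  by (simp add: CC_def Ad_mul)

text \<open>Evaluation at the identity is fixed by \<open>e\<close>; three uses of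
  \<open>Inv_extend\<close> then enlarge the invariance to \<open>CC\<close>, to \<open>HH\<close>
  and to the whole group.\<close>

lemma invariant_mean: obtains I :: "('g \<Rightarrow> real) \<Rightarrow> real" where "mean I" "\<And>f a. I (\<lambda>x. f (x \<cdot> a)) = I f"
proof -
  have "mean (\<lambda>f :: 'g \<Rightarrow> real. if bdd f then f e else 0)"
    unfolding mean_def by (auto simp: bdd_add bdd_scale bdd_const)
  then have "Inv {e} \<noteq> {}" by (auto simp: Inv_def act_e)
  then have "Inv ({e} \<union> CC) \<noteq> {}"
    by (rule Inv_extend) (auto simp: comm_one[unfolded comm_def])
  then have "Inv (({e} \<union> CC) \<union> HH) \<noteq> {}"
    by (rule Inv_extend) (use conj_CC comm_CC[unfolded comm_def] in auto)
  then have "Inv ((({e} \<union> CC) \<union> HH) \<union> UNIV) \<noteq> {}"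
    by (rule Inv_extend) (use conj_CC conj_HH comm_HH[unfolded comm_def] in auto)
  then obtain I where "mean I" "\<And>a. act a I = I" by (auto simp: Inv_def)
  then show ?thesis using that by (metis act_def)
qed

end


section \<open>Averages over the quotient\<close>

locale lie_solv = lie_quot G M \<Gamma> + lie_almost_abelian G M pi Z0
  for G :: "'g::{t2_space, second_countable_topology} monoid" and M :: "('g, 'e::euclidean_space) charted"
    and \<Gamma> :: "'g set" and pi :: "'e \<Rightarrow> real" and Z0 :: 'e
begin

lemma Q_compact_image: assumes "f \<in> smooth_funs Q" shows "compact (range (\<lambda>x. f (p x)))"
proof -
  have "compactin euclidean (f ` topspace (mtop Q))"
    using image_compactin[OF _ Q.smooth_funs_continuous[OF assms]] compact_Q by (simp add: compact_space_def)
  moreover have "f ` topspace (mtop Q) = range (\<lambda>x. f (p x))"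
    using points_Q by (simp add: points_def image_image)
  ultimately show ?thesis by simp
qed

lemma bdd_Q: assumes f: "f \<in> smooth_funs Q" shows "bdd (\<lambda>x. Re (f (p x)))" "bdd (\<lambda>x. Im (f (p x)))"
proof -
  obtain K where K: "\<And>x. cmod (f (p x)) \<le> K"
    using compact_imp_bounded[OF Q_compact_image[OF f]] by (auto simp: bounded_iff)
  show "bdd (\<lambda>x. Re (f (p x)))" "bdd (\<lambda>x. Im (f (p x)))"
    using K order_trans[OF abs_Re_le_cmod] order_trans[OF abs_Im_le_cmod] unfolding bdd_def by blast+
qed

definition mn :: "('g \<Rightarrow> real) \<Rightarrow> real" where
  "mn = (SOME I. mean I \<and> (\<forall>f a. I (\<lambda>x. f (x \<cdot> a)) = I f))"

lemma mean_mn: "mean mn" and mn_right: "mn (\<lambda>x. f (x \<cdot> a)) = mn f"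
proof -
  have "\<exists>I :: ('g \<Rightarrow> real) \<Rightarrow> real. mean I \<and> (\<forall>f a. I (\<lambda>x. f (x \<cdot> a)) = I f)"
    by (rule invariant_mean) blast
  from someI_ex[OF this] show "mean mn" "mn (\<lambda>x. f (x \<cdot> a)) = mn f" by (auto simp: mn_def)
qed

text \<open>Averages over the quotient are computed on pullbacks to the group, where right
  translations act and the mean is invariant under them.\<close>

definition Avg :: "('g set \<Rightarrow> complex) \<Rightarrow> complex" where
  "Avg f = Complex (mn (\<lambda>x. Re (f (p x)))) (mn (\<lambda>x. Im (f (p x))))"

lemma Avg_add: "f \<in> smooth_funs Q \<Longrightarrow> g \<in> smooth_funs Q \<Longrightarrow> Avg (f + g) = Avg f + Avg g"
  using bdd_Q by (simp add: Avg_def complex_eq_iff mean_add[OF mean_mn])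

lemma Avg_scale: assumes f: "f \<in> smooth_funs Q" shows "Avg ((\<lambda>_. c) * f) = c * Avg f"
proof -
  have "mn (\<lambda>x. Re c * Re (f (p x)) - Im c * Im (f (p x))) = Re c * mn (\<lambda>x. Re (f (p x))) - Im c * mn (\<lambda>x. Im (f (p x)))"
  proof -
    have "mn (\<lambda>x. Re c * Re (f (p x)) + (- Im c) * Im (f (p x))) = Re c * mn (\<lambda>x. Re (f (p x))) + (- Im c) * mn (\<lambda>x. Im (f (p x)))"
      by (simp only: mean_add[OF mean_mn] mean_scale[OF mean_mn] bdd_scale bdd_Q[OF f])
    then show ?thesis by simp
  qed
  moreover have "mn (\<lambda>x. Re c * Im (f (p x)) + Im c * Re (f (p x))) = Re c * mn (\<lambda>x. Im (f (p x))) + Im c * mn (\<lambda>x. Re (f (p x)))"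
    by (simp only: mean_add[OF mean_mn] mean_scale[OF mean_mn] bdd_scale bdd_Q[OF f])
  ultimately show ?thesis by (simp add: Avg_def complex_eq_iff)
qed

lemma Avg_real: "(\<And>q. f q \<in> \<real>) \<Longrightarrow> Avg f \<in> \<real>"
proof -
  assume "\<And>q. f q \<in> \<real>"
  then have "Im (f q) = 0" for q by (simp add: complex_is_Real_iff)
  then show ?thesis by (simp add: Avg_def complex_is_Real_iff mean_const[OF mean_mn])
qed

text \<open>Positivity of a mean gives only a weak inequality. Compactness of the quotient supplies
  a positive lower bound of \<open>f\<close>, which makes it strict.\<close>

lemma Avg_pos: assumes f: "f \<in> smooth_funs Q" and pos: "\<And>x. Re (f (p x)) > 0" shows "Re (Avg f) > 0"
proof -
  have "compact (Re ` range (\<lambda>x. f (p x)))"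
    by (intro compact_continuous_image Q_compact_image f continuous_intros)
  then obtain x0 where x0: "\<And>x. Re (f (p x0)) \<le> Re (f (p x))"
    using compact_attains_inf[of "Re ` range (\<lambda>x. f (p x))"] by auto
  have "Re (f (p x0)) \<le> mn (\<lambda>x. Re (f (p x)))"
    using mean_mono[OF mean_mn bdd_const bdd_Q(1)[OF f] x0] by (simp add: mean_const[OF mean_mn])
  then show ?thesis using pos[of x0] by (simp add: Avg_def)
qed

text \<open>On the connected group a real function without zeros has one sign. The sign is left
  open, as it is for a power of the fundamental form on an arbitrary basis.\<close>

lemma Avg_nonzero:
  assumes f: "f \<in> smooth_funs Q" and real: "\<And>q. f q \<in> \<real>" and nz: "\<And>x. f (p x) \<noteq> 0"
  shows "Avg f \<noteq> 0"
proof -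
  let ?r = "\<lambda>x. Re (f (p x))"
  have r: "?r x \<noteq> 0" for x using real nz by (metis complex_is_Real_iff complex_eq_iff zero_complex.sel)
  have "continuous_on UNIV ?r"
    by (intro continuous_on_Re smooth_funs_M_continuous pull f)
  then have "connected (range ?r)" by (rule connected_continuous_image[OF _ conn])
  then have ivl: "\<And>a b c. a \<in> range ?r \<Longrightarrow> b \<in> range ?r \<Longrightarrow> a \<le> c \<Longrightarrow> c \<le> b \<Longrightarrow> c \<in> range ?r"
    using connected_iff_interval by blast
  have "(\<forall>x. ?r x > 0) \<or> (\<forall>x. ?r x < 0)"
  proof (rule ccontr)
    assume "\<not> ?thesis"
    then obtain x y where "?r x \<le> 0" "?r y \<ge> 0" by (auto simp: not_less)
    then have "0 \<in> range ?r" using ivl[of "?r x" "?r y" 0] by blast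
    then show False using r by auto
  qed
  then show ?thesis
  proof
    assume "\<forall>x. ?r x > 0" then show ?thesis using Avg_pos[OF f] by force
  next
    assume "\<forall>x. ?r x < 0"
    then have "Re (Avg ((\<lambda>_. -1) * f)) > 0" by (intro Avg_pos Q.smooth_funs_scale f) simp
    then show ?thesis using Avg_scale[OF f, of "-1"] by force
  qed
qed

text \<open>By compactness of the quotient, the difference quotients along \<open>v\<close> converge uniformly.\<close>

lemma uniform_quotient:
  assumes f: "f \<in> smooth_funs Q" and eps: "\<epsilon> > 0"
  shows "\<exists>t>0. \<exists>a. \<forall>x. cmod (f (p (x \<cdot> a)) - f (p x) - complex_of_real t * lv v (\<lambda>x. f (p x)) x) \<le> t * \<epsilon>"
proof -
  define F where "F = (\<lambda>x. f (p x))"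
  have F: "F \<in> smooth_funs M" unfolding F_def by (rule pull[OF f])
  \<comment> \<open>The derivative at all chart points \<open>y\<close> and not only at
    \<open>y0\<close>. It is invariant under \<open>\<Gamma>\<close> in \<open>x\<close>, which lets
    a finite cover of the quotient provide one radius for all \<open>x\<close>.\<close>
  define R where "R = (\<lambda>x y. D (\<lambda>y. F (x \<cdot> \<psi>0 y)) y v)"
  have R\<Gamma>: "R (\<gamma> \<cdot> x) y = R x y" if "\<gamma> \<in> \<Gamma>" for \<gamma> x y using that by (simp add: R_def F_def)
  have loc: "\<exists>N \<delta>. open N \<and> x0 \<in> N \<and> \<delta> > 0 \<and> ball y0 \<delta> \<subseteq> D0 \<and> (\<forall>x\<in>N. \<forall>y\<in>ball y0 \<delta>. cmod (R x y - R x y0) \<le> \<epsilon>)" for x0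
  proof -
    obtain U \<phi> where c: "(U, \<phi>) \<in> atlas M" "x0 \<in> U" using chart_ex points_UNIV by blast
    let ?O = "\<phi> ` U \<times> D0"
    have O: "open ?O" by (intro open_Times chart_open_image[OF c(1)] open_D0)
    define \<Phi> where "\<Phi> = (\<lambda>q. F (inv_into U \<phi> (fst q) \<cdot> \<psi>0 (snd q)))"
    have "plot ?O (\<lambda>q. inv_into U \<phi> (fst q) \<cdot> \<psi>0 (snd q))"
      by (intro plot_mul O plot_compose[OF chart_open_image[OF c(1)] O chart_plot[OF c(1)]] plot_compose[OF open_D0 O plot_\<psi>0]
          smooth_on_bounded_linear[OF O] bounded_linear_fst bounded_linear_snd) auto
    from plot_smooth[OF this F] have \<Phi>: "smooth_on ?O \<Phi>" by (simp add: \<Phi>_def)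
    have RD: "R x y = D \<Phi> (\<phi> x, y) (0, v)" if "x \<in> U" "y \<in> D0" for x y
    proof -
      have "D (\<lambda>y. \<Phi> (\<phi> x, y)) y v = D \<Phi> (\<phi> x, y) (0, v)"
        using smooth_on_partial_D(1)[OF O \<Phi> chart_open_image[OF c(1)] smooth_on_const[of _ y], of "\<phi> x" v] that by auto
      then show ?thesis using chart_inv[OF c(1) that(1)] by (simp add: R_def \<Phi>_def)
    qed
    have "continuous (at (\<phi> x0, y0)) (\<lambda>q. D \<Phi> q (0, v))"
      using smooth_on_continuous_on[OF smooth_on_D[OF \<Phi>]] O c(2) y0_D0 continuous_on_eq_continuous_at by blast
    then obtain d where d: "d > 0" "\<And>q. dist q (\<phi> x0, y0) < d \<Longrightarrow> dist (D \<Phi> q (0, v)) (D \<Phi> (\<phi> x0, y0) (0, v)) < \<epsilon> / 2"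
      using eps unfolding continuous_at_eps_delta by (metis half_gt_zero)
    obtain d' where d': "d' > 0" "ball y0 d' \<subseteq> D0" using open_D0 y0_D0 open_contains_ball by blast
    define \<delta> where "\<delta> = min (d / 2) d'"
    let ?N = "{x \<in> U. \<phi> x \<in> ball (\<phi> x0) (d / 2)}"
    have "cmod (R x y - R x y0) \<le> \<epsilon>" if x: "x \<in> ?N" and y: "y \<in> ball y0 \<delta>" for x y
    proof -
      have "dist (\<phi> x, y') (\<phi> x0, y0) < d" if "dist y' y0 < d / 2" for y'
      proof -
        have "dist (\<phi> x, y') (\<phi> x0, y0) \<le> dist (\<phi> x) (\<phi> x0) + dist y' y0"
          unfolding dist_prod_def fst_conv snd_conv using sqrt_sum_squares_le_sum by force
        then show ?thesis using x that by (simp add: dist_commute)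
      qed
      note dd = d(2)[OF this]
      have "dist (D \<Phi> (\<phi> x, y) (0, v)) (D \<Phi> (\<phi> x0, y0) (0, v)) < \<epsilon> / 2"
        by (rule dd) (use y in \<open>auto simp: \<delta>_def dist_commute\<close>)
      moreover have "dist (D \<Phi> (\<phi> x, y0) (0, v)) (D \<Phi> (\<phi> x0, y0) (0, v)) < \<epsilon> / 2"
        by (rule dd) (use d(1) in simp)
      ultimately have "dist (D \<Phi> (\<phi> x, y) (0, v)) (D \<Phi> (\<phi> x, y0) (0, v)) < \<epsilon>"
        by (metis dist_triangle_half_l dist_commute)
      moreover have "y \<in> D0" using y d' by (auto simp: \<delta>_def)
      ultimately show ?thesis using RD[of x y] RD[of x y0] x y0_D0 by (simp add: dist_norm)
    qed
    moreover have "open ?N" using chart_preimage_open[OF c(1) open_ball, unfolded mtop, unfolded open_openin[symmetric]] .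
    moreover have "x0 \<in> ?N" "\<delta> > 0" "ball y0 \<delta> \<subseteq> D0" using c d(1) d' by (auto simp: \<delta>_def)
    ultimately show ?thesis by blast
  qed
  then obtain N \<delta> where N: "\<And>x. open (N x)" "\<And>x. x \<in> N x" "\<And>x. \<delta> x > 0" "\<And>x. ball y0 (\<delta> x) \<subseteq> D0"
    "\<And>x0 x y. x \<in> N x0 \<Longrightarrow> y \<in> ball y0 (\<delta> x0) \<Longrightarrow> cmod (R x y - R x y0) \<le> \<epsilon>"
    by metis
  have "compactin (mtop Q) (topspace (mtop Q))" using compact_Q by (simp add: compact_space_def)
  moreover have "\<forall>V\<in>range (\<lambda>x. p ` N x). openin (mtop Q) V" using openin_p_image[OF N(1)] by blast
  moreover have "topspace (mtop Q) \<subseteq> \<Union> (range (\<lambda>x. p ` N x))" using points_Q N(2) by (auto simp: points_def)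
  ultimately obtain \<F> where \<F>: "finite \<F>" "\<F> \<subseteq> range (\<lambda>x. p ` N x)" "topspace (mtop Q) \<subseteq> \<Union> \<F>"
    unfolding compactin_def by meson
  then obtain A where A: "finite A" "\<F> = (\<lambda>x. p ` N x) ` A" by (meson finite_subset_image)
  define d where "d = Min (insert 1 (\<delta> ` A))"
  have d: "d > 0" "\<And>x. x \<in> A \<Longrightarrow> d \<le> \<delta> x" unfolding d_def using A(1) N(3) by (auto intro: Min_le)
  have "A \<noteq> {}" using \<F>(3) A(2) points_Q by (auto simp: points_def)
  then obtain a0 where a0: "a0 \<in> A" by blast
  have dD: "ball y0 d \<subseteq> D0" using d(2)[OF a0] N(4)[of a0] by force
  have Rb: "cmod (R x y - R x y0) \<le> \<epsilon>" if y: "y \<in> ball y0 d" for x y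
  proof -
    have "p x \<in> topspace (mtop Q)" using points_Q by (auto simp: points_def)
    then obtain a x' where a: "a \<in> A" "x' \<in> N a" "p x = p x'" using \<F>(3) A(2) by auto
    obtain \<gamma> where g: "\<gamma> \<in> \<Gamma>" "x = \<gamma> \<cdot> x'" using a(3)[symmetric] by (rule p_eqE)
    have "y \<in> ball y0 (\<delta> a)" using y d(2)[OF a(1)] by auto
    then show ?thesis using N(5)[OF a(2)] R\<Gamma>[OF g(1)] g(2) by simp
  qed
  define t where "t = d / 2 / (norm v + 1)"
  have nv: "norm v + 1 > 0" by (simp add: add_nonneg_pos)
  have t: "t > 0" unfolding t_def using d(1) nv by (intro divide_pos_pos) auto
  have tb: "y0 + s *\<^sub>R v \<in> ball y0 d" if "s \<in> {0..t}" for s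
  proof -
    have "norm (s *\<^sub>R v) \<le> t * (norm v + 1)" using that by (simp add: mult_mono)
    also have "\<dots> = d / 2" unfolding t_def using nv by (intro nonzero_eq_divide_eq[THEN iffD1, OF _ refl]) simp
    finally show ?thesis using d(1) by (simp add: dist_norm)
  qed
  have "cmod (F (x \<cdot> \<psi>0 (y0 + t *\<^sub>R v)) - F x - complex_of_real t * lv v F x) \<le> t * \<epsilon>" for x
  proof -
    define h where "h = (\<lambda>s. F (x \<cdot> \<psi>0 (y0 + s *\<^sub>R v)) - s *\<^sub>R R x y0)"
    have "norm (h t - h 0) \<le> \<epsilon> * norm (t - 0)"
    proof (rule differentiable_bound[of "{0..t}" h "\<lambda>s r. r *\<^sub>R (R x (y0 + s *\<^sub>R v) - R x y0)"])
      fix s assume s: "s \<in> {0..t}"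
      have df: "(\<lambda>y. F (x \<cdot> \<psi>0 y)) differentiable (at (y0 + s *\<^sub>R v))"
        by (rule smooth_on_differentiable[OF plot_smooth[OF plot_translate F]]) (use tb[OF s] dD in blast)
      have "((\<lambda>s. y0 + s *\<^sub>R v) has_derivative (\<lambda>r. r *\<^sub>R v)) (at s within {0..t})"
        by (auto intro!: derivative_eq_intros)
      from has_derivative_compose[OF this D_has_derivative[OF df]]
      have "((\<lambda>s. F (x \<cdot> \<psi>0 (y0 + s *\<^sub>R v))) has_derivative (\<lambda>r. r *\<^sub>R R x (y0 + s *\<^sub>R v))) (at s within {0..t})"
        using D_scale[OF df] by (simp add: R_def)
      then show "(h has_derivative (\<lambda>r. r *\<^sub>R (R x (y0 + s *\<^sub>R v) - R x y0))) (at s within {0..t})"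
        unfolding h_def by (auto intro!: derivative_eq_intros simp: scaleR_diff_right)
      show "onorm (\<lambda>r. r *\<^sub>R (R x (y0 + s *\<^sub>R v) - R x y0)) \<le> \<epsilon>"
        by (rule onorm_scaleR_le[OF Rb[OF tb[OF s]]])
    qed (use t in auto)
    moreover have "R x y0 = lv v F x" using F by (simp add: R_def lv_apply)
    ultimately show ?thesis using t by (simp add: h_def scaleR_conv_of_real algebra_simps)
  qed
  then show ?thesis using t unfolding F_def by blast
qed

text \<open>The difference quotients along \<open>v\<close> are those of right translations, so
  their means vanish. The uniformity of \<open>uniform_quotient\<close> matters, since a mean need
  not respect pointwise limits.\<close>

lemma Avg_E: assumes f: "f \<in> smooth_funs Q" shows "Avg (E v f) = 0"
proof -
  have key: "mn (\<lambda>x. L (lv v (\<lambda>x. f (p x)) x)) = 0"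
    if L: "bounded_linear L" "\<And>z. \<bar>L z\<bar> \<le> cmod z" and b1: "bdd (\<lambda>x. L (f (p x)))" and b2: "bdd (\<lambda>x. L (lv v (\<lambda>x. f (p x)) x))"
    for L :: "complex \<Rightarrow> real"
  proof -
    have "\<bar>mn (\<lambda>x. L (lv v (\<lambda>x. f (p x)) x))\<bar> \<le> \<epsilon>" if eps: "\<epsilon> > 0" for \<epsilon>
    proof -
      obtain t a where t: "t > 0"
        and a: "\<And>x. cmod (f (p (x \<cdot> a)) - f (p x) - complex_of_real t * lv v (\<lambda>x. f (p x)) x) \<le> t * \<epsilon>"
        using uniform_quotient[OF f eps] by blast
      interpret L: bounded_linear L by (rule L(1))
      have b1a: "bdd (\<lambda>x. L (f (p (x \<cdot> a))))" using bdd_act[of "\<lambda>x. L (f (p x))" a] b1 by simp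
      let ?h = "\<lambda>x. L (f (p (x \<cdot> a))) + ((-1) * L (f (p x)) + (- t) * L (lv v (\<lambda>x. f (p x)) x))"
      have "\<bar>mn ?h\<bar> \<le> t * \<epsilon>"
      proof (rule mean_bound[OF mean_mn])
        fix x
        have "?h x = L (f (p (x \<cdot> a)) - f (p x) - complex_of_real t * lv v (\<lambda>x. f (p x)) x)"
          using L.scaleR[of t "lv v (\<lambda>x. f (p x)) x"] by (simp add: L.diff scaleR_conv_of_real)
        then show "\<bar>?h x\<bar> \<le> t * \<epsilon>" using order_trans[OF L(2) a[of x]] by simp
      qed
      moreover have "mn ?h = - t * mn (\<lambda>x. L (lv v (\<lambda>x. f (p x)) x))"
        using mn_right[of "\<lambda>x. L (f (p x))" a]
        by (simp only: mean_add[OF mean_mn] mean_scale[OF mean_mn] bdd_add bdd_scale b1 b2 b1a)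
      ultimately have "t * \<bar>mn (\<lambda>x. L (lv v (\<lambda>x. f (p x)) x))\<bar> \<le> t * \<epsilon>" using t by (simp add: abs_mult)
      then show ?thesis using t by simp
    qed
    then have "\<bar>mn (\<lambda>x. L (lv v (\<lambda>x. f (p x)) x))\<bar> \<le> 0" by (rule field_le_epsilon[of _ 0, simplified])
    then show ?thesis by simp
  qed
  have "mn (\<lambda>x. Re (lv v (\<lambda>x. f (p x)) x)) = 0"
    by (rule key[OF bounded_linear_Re abs_Re_le_cmod]) (use bdd_Q[OF f] bdd_Q[OF E_smooth[OF f]] E_p[OF f] in simp_all)
  moreover have "mn (\<lambda>x. Im (lv v (\<lambda>x. f (p x)) x)) = 0"
    by (rule key[OF bounded_linear_Im abs_Im_le_cmod]) (use bdd_Q[OF f] bdd_Q[OF E_smooth[OF f]] E_p[OF f] in simp_all)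
  ultimately show ?thesis by (simp add: Avg_def E_p[OF f] complex_eq_iff)
qed

end


section \<open>Alternating forms\<close>

hide_const (open) Finite_Cartesian_Product.transpose

definition alternating_form :: "nat \<Rightarrow> ((nat \<Rightarrow> 'v::real_vector) \<Rightarrow> real) \<Rightarrow> bool" where
  "alternating_form k f \<longleftrightarrow>
     (\<forall>w w'. (\<forall>i<k. w i = w' i) \<longrightarrow> f w = f w') \<and>
     (\<forall>w i x y. i < k \<longrightarrow> f (w(i := x + y)) = f (w(i := x)) + f (w(i := y))) \<and>
     (\<forall>w i c x. i < k \<longrightarrow> f (w(i := c *\<^sub>R x)) = c * f (w(i := x))) \<and>
     (\<forall>w a b. a < k \<longrightarrow> b < k \<longrightarrow> a \<noteq> b \<longrightarrow> f (w \<circ> transpose a b) = - f w)"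

context
  fixes k and f :: "(nat \<Rightarrow> 'v::real_vector) \<Rightarrow> real" assumes f: "alternating_form k f"
begin

lemma af_cong: "(\<And>i. i < k \<Longrightarrow> w i = w' i) \<Longrightarrow> f w = f w'"
  and af_add: "i < k \<Longrightarrow> f (w(i := x + y)) = f (w(i := x)) + f (w(i := y))"
  and af_scale: "i < k \<Longrightarrow> f (w(i := c *\<^sub>R x)) = c * f (w(i := x))"
  and af_swap: "a < k \<Longrightarrow> b < k \<Longrightarrow> a \<noteq> b \<Longrightarrow> f (w \<circ> transpose a b) = - f w"
  using f unfolding alternating_form_def by blast+

lemma af_zero: "i < k \<Longrightarrow> w i = 0 \<Longrightarrow> f w = 0"
  using af_scale[of i w 0 "w i"] by (metis fun_upd_triv mult_zero_left scale_zero_left)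

lemma af_repeat: assumes "a < k" "b < k" "a \<noteq> b" "w a = w b" shows "f w = 0"
proof -
  have "w \<circ> transpose a b = w" using assms(4) by (auto simp: fun_eq_iff Transposition.transpose_def)
  then show ?thesis using af_swap[OF assms(1-3), of w] by simp
qed

lemma af_sum: assumes "i < k" shows "f (w(i := \<Sum>l\<in>A. c l *\<^sub>R u l)) = (\<Sum>l\<in>A. c l * f (w(i := u l)))"
proof (induction A rule: infinite_finite_induct)
  case (insert x A)
  then show ?case by (simp only: sum.insert[OF insert.hyps] af_add[OF assms] af_scale[OF assms])
qed (use assms in \<open>simp_all add: af_zero\<close>)

lemma af_perm: assumes "\<rho> permutes {..<k}" shows "f (w \<circ> \<rho>) = of_int (sign \<rho>) * f w"
  using assms finite_lessThan
proof (induction arbitrary: w rule: permutes_induct)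
  case id then show ?case by simp
next
  case (swap a b p)
  have e1: "f (w \<circ> (transpose a b \<circ> p)) = of_int (sign p) * f (w \<circ> transpose a b)"
    using swap.IH[of "w \<circ> transpose a b"] by (simp only: comp_assoc)
  have e2: "sign (transpose a b \<circ> p) = - sign p"
    using swap.hyps permutes_imp_permutation[OF finite_lessThan swap.hyps(4)]
    by (simp add: sign_compose permutation_swap_id sign_swap_id)
  have e3: "f (w \<circ> transpose a b) = - f w"
    using swap.hyps by (intro af_swap) auto
  show ?case unfolding e1 e2 e3 by simp
qed

text \<open>Multilinear expansion in the family \<open>u\<close>. The number \<open>p\<close> bounds
  the leading arguments still to be expanded; when all arguments are members of \<open>u\<close>,
  either one is repeated or they are a permutation of \<open>u\<close>.\<close>

lemma af_vanish:
  assumes u: "\<And>y. y \<in> S \<Longrightarrow> \<exists>c. y = (\<Sum>l<k. c l *\<^sub>R u l)" and uS: "\<And>i. i < k \<Longrightarrow> u i \<in> S" and fu: "f u = 0"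
    and w: "\<And>i. i < k \<Longrightarrow> w i \<in> S"
  shows "f w = 0"
proof -
  have "f w = 0" if "p \<le> k" "\<And>i. i < k \<Longrightarrow> w i \<in> S" "\<And>i. p \<le> i \<Longrightarrow> i < k \<Longrightarrow> w i \<in> u ` {..<k}" for p w
    using that
  proof (induction p arbitrary: w)
    case 0
    then have "\<forall>i<k. \<exists>s. s < k \<and> w i = u s" by auto
    then obtain s where s: "\<And>i. i < k \<Longrightarrow> s i < k \<and> w i = u (s i)" by metis
    show ?case
    proof (cases "inj_on s {..<k}")
      case False
      then obtain a b where "a < k" "b < k" "a \<noteq> b" "s a = s b" by (auto simp: inj_on_def)
      then show ?thesis using s by (intro af_repeat[of a b]) auto
    next
      case True
      define \<rho> where "\<rho> = (\<lambda>i. if i < k then s i else i)"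
      have "inj_on \<rho> {..<k}" using True by (auto simp: \<rho>_def inj_on_def)
      moreover have "\<rho> ` {..<k} \<subseteq> {..<k}" using s by (auto simp: \<rho>_def)
      ultimately have "bij_betw \<rho> {..<k} {..<k}" by (simp add: bij_betw_def endo_inj_surj)
      then have "\<rho> permutes {..<k}" by (rule bij_imp_permutes) (auto simp: \<rho>_def)
      from af_perm[OF this, of u] have "f (u \<circ> \<rho>) = 0" using fu by simp
      moreover have "f w = f (u \<circ> \<rho>)" using s by (intro af_cong) (auto simp: \<rho>_def)
      ultimately show ?thesis by simp
    qed
  next
    case (Suc p)
    then have p: "p < k" by simp
    obtain c where c: "w p = (\<Sum>l<k. c l *\<^sub>R u l)" using u[OF Suc.prems(2)[OF p]] by blast
    have "f w = f (w(p := \<Sum>l<k. c l *\<^sub>R u l))" using c by (metis fun_upd_triv)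
    also have "\<dots> = (\<Sum>l<k. c l * f (w(p := u l)))" by (rule af_sum[OF p])
    also have "\<dots> = 0"
    proof (rule sum.neutral, rule ballI)
      fix l assume l: "l \<in> {..<k}"
      have "f (w(p := u l)) = 0"
        by (rule Suc.IH) (use p l Suc.prems uS in auto)
      then show "c l * f (w(p := u l)) = 0" by simp
    qed
    finally show ?case .
  qed
  from this[of k w] show ?thesis using w by auto
qed

text \<open>Moving the front argument to position \<open>i\<close> passes \<open>i\<close> others.
  The left-hand side has the shape that bracket terms of \<open>ext_d\<close> take.\<close>

lemma af_cycle: "i < k \<Longrightarrow> f (case_nat y (omit i w)) = (-1) ^ i * f (w(i := y))"
proof (induction i arbitrary: w)
  case 0
  have "case_nat y (omit 0 w) = w(0 := y)" by (auto simp: fun_eq_iff omit_def split: nat.split)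
  then show ?case by simp
next
  case (Suc i)
  let ?w = "w \<circ> transpose i (Suc i)"
  have e1: "case_nat y (omit (Suc i) w) = case_nat y (omit i ?w)"
    by (auto simp: fun_eq_iff omit_def Transposition.transpose_def less_Suc_eq split: nat.split)
  have e2: "?w(i := y) = (w(Suc i := y)) \<circ> transpose i (Suc i)"
    by (auto simp: fun_eq_iff Transposition.transpose_def)
  have e3: "f (w(Suc i := y) \<circ> transpose i (Suc i)) = - f (w(Suc i := y))"
    using Suc.prems by (intro af_swap) auto
  show ?case unfolding e1 Suc.IH[OF Suc_lessD[OF Suc.prems]] e2 e3
    by (simp only: power_Suc mult_minus_left mult_minus_right mult_1_left)
qed

end

text \<open>The normalization is the one of \<open>wedge\<close>.\<close>

fun wp :: "('v \<Rightarrow> 'v \<Rightarrow> real) \<Rightarrow> nat \<Rightarrow> (nat \<Rightarrow> 'v) \<Rightarrow> real" where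
  "wp b 0 w = 1"
| "wp b (Suc m) w = (\<Sum>\<sigma> | \<sigma> permutes {..<2 + 2 * m}.
     of_int (sign \<sigma>) * b (w (\<sigma> 0)) (w (\<sigma> 1)) * wp b m (\<lambda>i. w (\<sigma> (2 + i)))) / (fact 2 * fact (2 * m))"

lemma wp_cong: "(\<And>i. i < 2 * m \<Longrightarrow> w i = w' i) \<Longrightarrow> wp b m w = wp b m w'"
proof (induction m arbitrary: w w')
  case (Suc m)
  have "w (\<sigma> i) = w' (\<sigma> i)" if "\<sigma> permutes {..<2 + 2 * m}" "i < 2 + 2 * m" for \<sigma> i
    using Suc.prems permutes_in_image[OF that(1), of i] that(2) by auto
  then have "wp b m (\<lambda>i. w (\<sigma> (2 + i))) = wp b m (\<lambda>i. w' (\<sigma> (2 + i)))" "w (\<sigma> 0) = w' (\<sigma> 0)" "w (\<sigma> 1) = w' (\<sigma> 1)"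
    if "\<sigma> permutes {..<2 + 2 * m}" for \<sigma>
    using that by (auto intro!: Suc.IH)
  then show ?case by (auto intro!: sum.cong arg_cong2[of _ _ _ _ "(/)"])
qed simp

text \<open>Composing each \<open>\<sigma>\<close> with the transposition permutes the summands
  among themselves and reverses every sign.\<close>

lemma wp_swap:
  assumes "a < 2 * m" "b < 2 * m" "a \<noteq> b"
  shows "wp g m (w \<circ> transpose a b) = - wp g m w"
proof (cases m)
  case (Suc m')
  let ?P = "{\<sigma>. \<sigma> permutes {..<2 + 2 * m'}}"
  let ?t = "transpose a b"
  let ?F = "\<lambda>\<sigma>. of_int (sign \<sigma>) * g (w (\<sigma> 0)) (w (\<sigma> 1)) * wp g m' (\<lambda>i. w (\<sigma> (2 + i)))"
  have t: "?t permutes {..<2 + 2 * m'}" using assms Suc by (intro permutes_swap_id) auto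
  have s: "sign (?t \<circ> \<sigma>) = - sign \<sigma>" if "\<sigma> permutes {..<2 + 2 * m'}" for \<sigma>
    using permutes_imp_permutation[OF finite_lessThan that] assms(3)
    by (simp add: sign_compose permutation_swap_id sign_swap_id)
  have "(\<Sum>\<sigma>\<in>?P. of_int (sign \<sigma>) * g (w (?t (\<sigma> 0))) (w (?t (\<sigma> 1))) * wp g m' (\<lambda>i. w (?t (\<sigma> (2 + i)))))
    = (\<Sum>\<sigma>\<in>?P. - ?F (?t \<circ> \<sigma>))"
    by (rule sum.cong) (use s in auto)
  also have "\<dots> = - (\<Sum>\<sigma>\<in>?P. ?F (?t \<circ> \<sigma>))" by (rule sum_negf)
  also have "(\<Sum>\<sigma>\<in>?P. ?F (?t \<circ> \<sigma>)) = (\<Sum>\<sigma>\<in>?P. ?F \<sigma>)"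
  proof -
    have c: "?t \<circ> \<sigma> \<in> ?P" if "\<sigma> \<in> ?P" for \<sigma> using permutes_compose[OF _ t] that by blast
    have tt: "?t \<circ> (?t \<circ> \<sigma>) = \<sigma>" for \<sigma> by (simp add: fun_eq_iff)
    show ?thesis
      by (intro sum.reindex_bij_witness[of _ "\<lambda>\<sigma>. ?t \<circ> \<sigma>" "\<lambda>\<sigma>. ?t \<circ> \<sigma>"]) (simp_all only: c tt)
  qed
  finally show ?thesis using Suc by (simp add: o_def)
qed (use assms in simp)

text \<open>In each summand the argument number \<open>i\<close> occurs exactly once, at the
  position \<open>l\<close> with \<open>\<sigma> l = i\<close>: in one of the two slots of
  \<open>b\<close> or in the smaller power.\<close>

lemma wp_linear:
  assumes b: "\<And>x y z. b (x + y) z = b x z + b y z" "\<And>x y z. b z (x + y) = b z x + b z y"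
    "\<And>c x z. b (c *\<^sub>R x) z = c * b x z" "\<And>c x z. b z (c *\<^sub>R x) = c * b z x"
    and i: "i < 2 * m"
  shows "wp b m (w(i := x + y)) = wp b m (w(i := x)) + wp b m (w(i := y))"
    and "wp b m (w(i := c *\<^sub>R x)) = c * wp b m (w(i := x))"
proof -
  have "wp b m (w(i := x + y)) = wp b m (w(i := x)) + wp b m (w(i := y)) \<and> wp b m (w(i := c *\<^sub>R x)) = c * wp b m (w(i := x))"
    using i
  proof (induction m arbitrary: w i)
    case (Suc m)
    let ?P = "{\<sigma>. \<sigma> permutes {..<2 + 2 * m}}"
    let ?T = "\<lambda>w \<sigma>. of_int (sign \<sigma>) * b (w (\<sigma> 0)) (w (\<sigma> 1)) * wp b m (\<lambda>i. w (\<sigma> (2 + i)))"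
    have "?T (w(i := x + y)) \<sigma> = ?T (w(i := x)) \<sigma> + ?T (w(i := y)) \<sigma> \<and> ?T (w(i := c *\<^sub>R x)) \<sigma> = c * ?T (w(i := x)) \<sigma>"
      if \<sigma>: "\<sigma> permutes {..<2 + 2 * m}" for \<sigma>
    proof -
      have "i \<in> \<sigma> ` {..<2 + 2 * m}" using permutes_image[OF \<sigma>] Suc.prems by simp
      then obtain l where l: "l < 2 + 2 * m" "i = \<sigma> l" by blast
      have inj: "\<sigma> q = \<sigma> l \<longleftrightarrow> q = l" for q using permutes_inj[OF \<sigma>] by (auto simp: inj_def)
      have u: "(w(i := z)) (\<sigma> q) = (if q = l then z else w (\<sigma> q))" for z q using inj l by simp
      have "l = 0 \<or> l = 1 \<or> (\<exists>l'. l = 2 + l' \<and> l' < 2 * m)" using l(1) by presburger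
      then consider "l = 0" | "l = 1" | l' where "l = 2 + l'" "l' < 2 * m" by blast
      then show ?thesis
      proof cases
        case 3
        have "(\<lambda>q. (w(i := z)) (\<sigma> (2 + q))) = (\<lambda>q. w (\<sigma> (2 + q)))(l' := z)" for z
          unfolding u using 3 by (auto simp: fun_eq_iff)
        then have e1: "wp b m (\<lambda>q. (w(i := z)) (\<sigma> (2 + q))) = wp b m ((\<lambda>q. w (\<sigma> (2 + q)))(l' := z))" for z
          by (simp only:)
        have e2: "(w(i := z)) (\<sigma> 0) = w (\<sigma> 0)" "(w(i := z)) (\<sigma> 1) = w (\<sigma> 1)" for z
          using 3 u[of z 0] u[of z 1] by simp_all
        note IH = Suc.IH[OF 3(2), of "\<lambda>q. w (\<sigma> (2 + q))"]
        show ?thesis unfolding e1 e2 conjunct1[OF IH] conjunct2[OF IH] by (simp only: distrib_left mult.left_commute)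
      next
        case 1
        have e: "(w(i := z)) (\<sigma> 0) = z" "(w(i := z)) (\<sigma> 1) = w (\<sigma> 1)"
          "(\<lambda>q. (w(i := z)) (\<sigma> (2 + q))) = (\<lambda>q. w (\<sigma> (2 + q)))" for z
          unfolding u using 1 by simp_all
        show ?thesis unfolding e b by (simp only: distrib_left distrib_right mult_ac)
      next
        case 2
        have e: "(w(i := z)) (\<sigma> 0) = w (\<sigma> 0)" "(w(i := z)) (\<sigma> 1) = z"
          "(\<lambda>q. (w(i := z)) (\<sigma> (2 + q))) = (\<lambda>q. w (\<sigma> (2 + q)))" for z
          unfolding u using 2 by simp_all
        show ?thesis unfolding e b by (simp only: distrib_left distrib_right mult_ac)
      qed
    qed
    then have "(\<Sum>\<sigma>\<in>?P. ?T (w(i := x + y)) \<sigma>) = (\<Sum>\<sigma>\<in>?P. ?T (w(i := x)) \<sigma>) + (\<Sum>\<sigma>\<in>?P. ?T (w(i := y)) \<sigma>)"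
      "(\<Sum>\<sigma>\<in>?P. ?T (w(i := c *\<^sub>R x)) \<sigma>) = c * (\<Sum>\<sigma>\<in>?P. ?T (w(i := x)) \<sigma>)"
      unfolding sum.distrib[symmetric] sum_distrib_left by (auto intro!: sum.cong)
    then show ?case unfolding wp.simps by (simp only: add_divide_distrib times_divide_eq_right)
  qed simp
  then show "wp b m (w(i := x + y)) = wp b m (w(i := x)) + wp b m (w(i := y))" "wp b m (w(i := c *\<^sub>R x)) = c * wp b m (w(i := x))"
    by blast+
qed

lemma wp_alternating:
  assumes "\<And>x y z. b (x + y) z = b x z + b y z" "\<And>x y z. b z (x + y) = b z x + b z y"
    "\<And>c x z. b (c *\<^sub>R x) z = c * b x z" "\<And>c x z. b z (c *\<^sub>R x) = c * b z x"
  shows "alternating_form (2 * m) (wp b m)"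
  unfolding alternating_form_def
proof (intro conjI allI impI)
  show "(\<forall>i<2 * m. w i = w' i) \<Longrightarrow> wp b m w = wp b m w'" for w w' by (intro wp_cong) auto
  show "i < 2 * m \<Longrightarrow> wp b m (w(i := x + y)) = wp b m (w(i := x)) + wp b m (w(i := y))" for w i x y
    by (rule wp_linear(1)[OF assms])
  show "i < 2 * m \<Longrightarrow> wp b m (w(i := c *\<^sub>R x)) = c * wp b m (w(i := x))" for w i c x
    by (rule wp_linear(2)[OF assms])
  show "a < 2 * m \<Longrightarrow> a' < 2 * m \<Longrightarrow> a \<noteq> a' \<Longrightarrow> wp b m (w \<circ> transpose a a') = - wp b m w" for w a a'
    by (rule wp_swap)
qed

text \<open>A Darboux basis for \<open>b\<close>, with the pairs numbered \<open>2 * i\<close> and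
  \<open>2 * i + 1\<close>.\<close>

definition symplectic :: "('v \<Rightarrow> 'v \<Rightarrow> real) \<Rightarrow> nat \<Rightarrow> (nat \<Rightarrow> 'v) \<Rightarrow> bool" where
  "symplectic b m w \<longleftrightarrow> (\<forall>a<2*m. \<forall>c<2*m. b (w a) (w c) =
     (if a div 2 = c div 2 then if a = c then 0 else if even a then 1 else -1 else 0))"

lemma wp_shift_perm:
  assumes "\<rho> permutes {2..<2 + 2 * m}"
  shows "wp b m (\<lambda>i. w (\<rho> (2 + i))) = of_int (sign \<rho>) * wp b m (\<lambda>i. w (2 + i))"
  using assms finite_atLeastLessThan
proof (induction arbitrary: w rule: permutes_induct)
  case id then show ?case by simp
next
  case (swap a c p)
  obtain a' c' where ac: "a = 2 + a'" "c = 2 + c'" "a' < 2 * m" "c' < 2 * m" "a' \<noteq> c'"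
    by (rule that[of "a - 2" "c - 2"]) (use swap.hyps in auto)
  have e0: "(\<lambda>i. (w \<circ> transpose a c) (2 + i)) = (\<lambda>i. w (2 + i)) \<circ> transpose a' c'"
    using ac by (auto simp: fun_eq_iff Transposition.transpose_def)
  have e1: "wp b m (\<lambda>i. w ((transpose a c \<circ> p) (2 + i))) = of_int (sign p) * wp b m (\<lambda>i. (w \<circ> transpose a c) (2 + i))"
    using swap.IH[of "w \<circ> transpose a c"] by (simp only: comp_apply)
  have e2: "sign (transpose a c \<circ> p) = - sign p"
    using swap.hyps permutes_imp_permutation[OF finite_atLeastLessThan swap.hyps(4)]
    by (simp add: sign_compose permutation_swap_id sign_swap_id)
  show ?case unfolding e1 e2 e0 wp_swap[OF ac(3-5)] by simp
qed

text \<open>Every permutation contributes non-negatively: an even permutation of the pairs moves the pair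
  \<open>{\<sigma> 0, \<sigma> 1}\<close> to \<open>{0, 1}\<close>.\<close>

lemma wp_pos: "symplectic b m w \<Longrightarrow> wp b m w > 0"
proof (induction m arbitrary: w)
  case (Suc m)
  let ?P = "{\<sigma>. \<sigma> permutes {..<2 + 2 * m}}"
  define T where "T = (\<lambda>w \<sigma>. of_int (sign \<sigma>) * b (w (\<sigma> 0)) (w (\<sigma> 1)) * wp b m (\<lambda>i. w (\<sigma> (2 + i))))"
  have shift: "wp b m (\<lambda>i. w (2 + i)) > 0" if "symplectic b (Suc m) w" for w
  proof (rule Suc.IH)
    show "symplectic b m (\<lambda>i. w (2 + i))"
      unfolding symplectic_def
    proof (intro allI impI)
      fix a c assume "a < 2 * m" "c < 2 * m"
      then show "b (w (2 + a)) (w (2 + c)) = (if a div 2 = c div 2 then if a = c then 0 else if even a then 1 else - 1 else 0)"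
        using that[unfolded symplectic_def, rule_format, of "2 + a" "2 + c"] by simp
    qed
  qed
  have fix01: "T w \<sigma> > 0" if w: "symplectic b (Suc m) w" and \<sigma>: "\<sigma> permutes {..<2 + 2 * m}" "\<sigma> 0 = 0" "\<sigma> 1 = 1" for w \<sigma>
  proof -
    have "\<sigma> permutes {2..<2 + 2 * m}"
    proof (rule permutes_superset[OF \<sigma>(1)])
      fix x assume "x \<in> {..<2 + 2 * m} - {2..<2 + 2 * m}"
      then have "x = 0 \<or> x = 1" by auto
      then show "\<sigma> x = x" using \<sigma> by auto
    qed
    from wp_shift_perm[OF this, of b w] have "T w \<sigma> = (of_int (sign \<sigma>))\<^sup>2 * b (w 0) (w 1) * wp b m (\<lambda>i. w (2 + i))"
      using \<sigma> by (simp add: T_def power2_eq_square)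
    moreover have "b (w 0) (w 1) = 1" using w[unfolded symplectic_def, rule_format, of 0 1] by simp
    moreover have "(of_int (sign \<sigma>) :: real)\<^sup>2 = 1" by (simp add: sign_def)
    ultimately show ?thesis using shift[OF w] by simp
  qed
  have pair01: "T w \<sigma> > 0" if w: "symplectic b (Suc m) w" and \<sigma>: "\<sigma> permutes {..<2 + 2 * m}"
    and s: "\<sigma> 0 div 2 = 0" "\<sigma> 1 div 2 = 0" for w \<sigma>
  proof -
    have ne: "\<sigma> 0 \<noteq> \<sigma> 1" using permutes_inj[OF \<sigma>] by (metis injD zero_neq_one)
    have "\<sigma> 0 < 2" "\<sigma> 1 < 2" using s by auto
    then consider "\<sigma> 0 = 0" "\<sigma> 1 = 1" | "\<sigma> 0 = 1" "\<sigma> 1 = 0" using ne by (metis less_2_cases One_nat_def)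
    then show ?thesis
    proof cases
      case 1 then show ?thesis by (rule fix01[OF w \<sigma>])
    next
      case 2
      \<comment> \<open>Interchanging the two entries flips both the sign of the permutation and the
        sign of \<open>b\<close>, so the summand is unchanged.\<close>
      let ?t = "transpose 0 (1::nat)"
      have t: "?t permutes {..<2 + 2 * m}" by (intro permutes_swap_id) auto
      have \<sigma>': "\<sigma> \<circ> ?t permutes {..<2 + 2 * m}" by (rule permutes_compose[OF t \<sigma>])
      have sg: "sign (\<sigma> \<circ> ?t) = - sign \<sigma>"
        using permutes_imp_permutation[OF finite_lessThan \<sigma>]
        by (simp add: sign_compose permutation_swap_id sign_swap_id)
      have "b (w 0) (w 1) = 1" "b (w 1) (w 0) = -1"
        using w[unfolded symplectic_def, rule_format, of 0 1] w[unfolded symplectic_def, rule_format, of 1 0] by simp_all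
      then have "T w \<sigma> = T w (\<sigma> \<circ> ?t)"
        using 2 sg by (simp add: T_def)
      then show ?thesis using fix01[OF w \<sigma>'] 2 by simp
    qed
  qed
  have nonneg: "T w \<sigma> \<ge> 0" if w: "symplectic b (Suc m) w" and \<sigma>: "\<sigma> permutes {..<2 + 2 * m}" for w \<sigma>
  proof (cases "\<sigma> 0 div 2 = \<sigma> 1 div 2")
    case False
    have "\<sigma> 0 < 2 + 2 * m" "\<sigma> 1 < 2 + 2 * m"
      using permutes_in_image[OF \<sigma>, of 0] permutes_in_image[OF \<sigma>, of 1] by auto
    then have "b (w (\<sigma> 0)) (w (\<sigma> 1)) = 0"
      using w[unfolded symplectic_def, rule_format, of "\<sigma> 0" "\<sigma> 1"] False by simp
    then show ?thesis by (simp add: T_def)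
  next
    case True
    show ?thesis
    proof (cases "\<sigma> 0 div 2 = 0")
      case True then show ?thesis using pair01[OF w \<sigma>] \<open>\<sigma> 0 div 2 = \<sigma> 1 div 2\<close> by (simp add: less_imp_le)
    next
      case False
      define i where "i = \<sigma> 0 div 2"
      have i: "i > 0" "i < Suc m" "\<sigma> 0 div 2 = i" "\<sigma> 1 div 2 = i"
        using False permutes_in_image[OF \<sigma>, of 0] \<open>\<sigma> 0 div 2 = \<sigma> 1 div 2\<close> by (auto simp: i_def)
      let ?\<pi> = "transpose 0 (2 * i) \<circ> transpose 1 (2 * i + 1)"
      have \<pi>: "?\<pi> permutes {..<2 + 2 * m}" by (intro permutes_compose permutes_swap_id) (use i in auto)
      have \<pi>\<pi>: "?\<pi> (?\<pi> x) = x" for x using i by (auto simp: Transposition.transpose_def)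
      have \<pi>2: "?\<pi> x div 2 = transpose 0 i (x div 2)" "even (?\<pi> x) \<longleftrightarrow> even x" for x
        using i by (auto simp: Transposition.transpose_def; presburger)+
      have sg: "sign (?\<pi> \<circ> \<sigma>) = sign \<sigma>"
      proof -
        have "sign ?\<pi> = 1" using i by (simp add: sign_compose permutation_swap_id sign_swap_id)
        then show ?thesis
          using permutes_imp_permutation[OF finite_lessThan \<sigma>] permutes_imp_permutation[OF finite_lessThan \<pi>]
          by (simp add: sign_compose)
      qed
      have w': "symplectic b (Suc m) (w \<circ> ?\<pi>)"
        unfolding symplectic_def
      proof (intro allI impI)
        fix a c assume ac: "a < 2 * Suc m" "c < 2 * Suc m"
        have "?\<pi> a < 2 * Suc m" "?\<pi> c < 2 * Suc m"
          using permutes_in_image[OF \<pi>, of a] permutes_in_image[OF \<pi>, of c] ac by auto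
        moreover have "transpose 0 i (a div 2) = transpose 0 i (c div 2) \<longleftrightarrow> a div 2 = c div 2"
          by (auto simp: Transposition.transpose_def)
        moreover have "?\<pi> a = ?\<pi> c \<longleftrightarrow> a = c" using \<pi>\<pi> by metis
        ultimately show "b ((w \<circ> ?\<pi>) a) ((w \<circ> ?\<pi>) c) = (if a div 2 = c div 2 then if a = c then 0 else if even a then 1 else - 1 else 0)"
          using w[unfolded symplectic_def, rule_format, of "?\<pi> a" "?\<pi> c"] unfolding \<pi>2 by simp
      qed
      have "T w \<sigma> = T (w \<circ> ?\<pi>) (?\<pi> \<circ> \<sigma>)"
        unfolding T_def sg using \<pi>\<pi> by (simp only: comp_apply)
      moreover have "(?\<pi> \<circ> \<sigma>) 0 div 2 = 0" "(?\<pi> \<circ> \<sigma>) 1 div 2 = 0"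
        using \<pi>2(1)[of "\<sigma> 0"] \<pi>2(1)[of "\<sigma> 1"] i by (simp_all only: comp_apply[of ?\<pi> \<sigma>]) simp_all
      ultimately show ?thesis using pair01[OF w' permutes_compose[OF \<sigma> \<pi>]] by (simp add: less_imp_le)
    qed
  qed
  have "(\<Sum>\<sigma>\<in>?P. T w \<sigma>) > 0"
  proof (rule sum_pos2[of _ id])
    show "finite ?P" by (simp add: finite_permutations)
    show "id \<in> ?P" by (simp add: permutes_id)
    show "0 < T w id" by (rule fix01[OF Suc.prems]) (auto simp: permutes_id)
  qed (use nonneg[OF Suc.prems] in auto)
  then show ?case by (simp add: T_def)
qed simp

section \<open>Bases adapted to a complex structure\<close>

lemma dim_two_more:
  fixes S :: "'v::euclidean_space set"
  assumes S: "subspace S" and ind: "\<And>\<alpha> \<beta>. \<alpha> *\<^sub>R a + \<beta> *\<^sub>R b \<in> S \<Longrightarrow> \<alpha> = 0 \<and> \<beta> = 0"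
    and T: "T = {y + (\<alpha> *\<^sub>R a + \<beta> *\<^sub>R b) | y \<alpha> \<beta>. y \<in> S}"
  shows "dim T = dim S + 2"
proof -
  have "x \<in> span {a, b} \<longleftrightarrow> (\<exists>\<alpha> \<beta>. x = \<alpha> *\<^sub>R a + \<beta> *\<^sub>R b)" for x
  proof
    assume "x \<in> span {a, b}"
    then obtain k where "x - k *\<^sub>R a \<in> span {b}" by (auto simp: span_breakdown_eq)
    then obtain l where "x - k *\<^sub>R a = l *\<^sub>R b" by (auto simp: span_singleton)
    then have "x = k *\<^sub>R a + l *\<^sub>R b" by (simp add: diff_eq_eq add.commute)
    then show "\<exists>\<alpha> \<beta>. x = \<alpha> *\<^sub>R a + \<beta> *\<^sub>R b" by blast
  qed (auto intro!: span_add span_scale intro: span_base)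
  then have sp: "span {a, b} = {\<alpha> *\<^sub>R a + \<beta> *\<^sub>R b | \<alpha> \<beta>. True}" by blast
  have 0: "0 \<in> S" by (rule subspace_0[OF S])
  have "a \<noteq> b"
    using ind[of 1 "-1"] 0 by auto
  moreover have "independent {a, b}"
  proof (rule independent_insertI)
    show "a \<notin> span {b}"
    proof
      assume "a \<in> span {b}"
      then obtain c where "a = c *\<^sub>R b" by (auto simp: span_singleton)
      then show False using ind[of 1 "-c"] 0 by simp
    qed
    show "independent {b}" using ind[of 0 1] 0 by (auto simp: dependent_single)
  qed
  ultimately have d2: "dim (span {a, b}) = 2" by (simp add: dim_eq_card_independent)
  have "S \<inter> span {a, b} = {0}"
  proof (intro equalityI subsetI)
    fix x assume "x \<in> S \<inter> span {a, b}"
    then obtain \<alpha> \<beta> where x: "x = \<alpha> *\<^sub>R a + \<beta> *\<^sub>R b" "x \<in> S" by (auto simp: sp)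
    then show "x \<in> {0}" using ind[of \<alpha> \<beta>] by simp
  qed (simp add: 0 span_zero)
  moreover have "T = {x + y | x y. x \<in> S \<and> y \<in> span {a, b}}" unfolding T sp by blast
  ultimately show ?thesis using dim_sums_Int[OF S subspace_span[of "{a, b}"]] d2 by simp
qed

text \<open>Gram-Schmidt over the complex numbers: a unit vector \<open>e0\<close> is orthogonal to
  \<open>j e0\<close>, since invariance under \<open>j\<close> gives
  \<open>h e0 (j e0) = - h e0 (j e0)\<close>, and the orthogonal complement of both is again stable
  under \<open>j\<close>.\<close>

lemma adapted_basis:
  fixes h :: "'v::euclidean_space \<Rightarrow> 'v \<Rightarrow> real" and j :: "'v \<Rightarrow> 'v"
  assumes h: "\<And>x y z. h (x + y) z = h x z + h y z" "\<And>c x z. h (c *\<^sub>R x) z = c * h x z" "\<And>x y. h x y = h y x"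
    and hpos: "\<And>x. x \<noteq> 0 \<Longrightarrow> h x x > 0" and hj: "\<And>x y. h (j x) (j y) = h x y"
    and j: "linear j" "\<And>x. j (j x) = - x"
    and S: "subspace S" "\<And>x. x \<in> S \<Longrightarrow> j x \<in> S" "dim S = 2 * m"
  shows "\<exists>u. (\<forall>i<2*m. u i \<in> S) \<and> (\<forall>i<2*m. \<forall>l<2*m. h (u i) (u l) = (if i = l then 1 else 0)) \<and>
    (\<forall>i<m. u (2 * i + 1) = j (u (2 * i))) \<and> (\<forall>y\<in>S. y = (\<Sum>i<2*m. h y (u i) *\<^sub>R u i))"
  using S
proof (induction m arbitrary: S)
  case 0
  then have "S \<subseteq> {0}" using dim_eq_0 by simp
  then show ?case by auto
next
  case (Suc m)
  have h': "h z (x + y) = h z x + h z y" "h z (c *\<^sub>R x) = c * h z x" for x y z c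
    using h by metis+
  note hl = h(1,2)
  have h0: "h 0 z = 0" "h z 0 = 0" for z using h(2)[of 0 0 z] h'(2)[of z 0 0] by simp_all
  have hm: "h (- x) z = - h x z" "h z (- x) = - h z x" for x z
    using h(2)[of "-1" x z] h'(2)[of z "-1" x] by simp_all
  have hd: "h (x - y) z = h x z - h y z" for x y z using h(1)[of x "-y" z] hm by simp
  have "\<not> S \<subseteq> {0}" using dim_eq_0[of S] Suc.prems(3) by auto
  then obtain x where x: "x \<in> S" "x \<noteq> 0" by blast
  define e0 where "e0 = (1 / sqrt (h x x)) *\<^sub>R x"
  define e1 where "e1 = j e0"
  have e0S: "e0 \<in> S" and e1S: "e1 \<in> S"
    using x Suc.prems subspace_scale by (auto simp: e0_def e1_def)
  have e00: "h e0 e0 = 1" using hpos[OF x(2)] by (simp add: e0_def hl h' field_simps)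
  have e11: "h e1 e1 = 1" by (simp add: e1_def hj e00)
  have e01: "h e0 e1 = 0"
  proof -
    have "h e0 (j e0) = h (j e0) (j (j e0))" by (simp only: hj)
    also have "\<dots> = - h e0 (j e0)" by (simp add: j hm h(3)[of "j e0" e0])
    finally show ?thesis by (simp add: e1_def)
  qed
  have e10: "h e1 e0 = 0" using e01 h(3) by metis
  define S' where "S' = {y \<in> S. h y e0 = 0 \<and> h y e1 = 0}"
  have S': "subspace S'"
    using Suc.prems(1) unfolding subspace_def S'_def by (auto simp: hl h0)
  have jS': "j y \<in> S'" if "y \<in> S'" for y
  proof -
    have "h (j y) e0 = h (j (j y)) (j e0)" by (simp only: hj)
    then have "h (j y) e0 = 0" using that by (simp add: j hm S'_def e1_def)
    moreover have "h (j y) e1 = 0" using that by (simp add: e1_def hj S'_def)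
    ultimately show ?thesis using that Suc.prems(2) by (simp add: S'_def)
  qed
  have rem: "y - (h y e0 *\<^sub>R e0 + h y e1 *\<^sub>R e1) \<in> S'" if "y \<in> S" for y
    using that e0S e1S Suc.prems(1) unfolding S'_def
    by (auto simp: hd hl e00 e11 e01 e10 intro!: subspace_diff subspace_add subspace_scale)
  have "dim S = dim S' + 2"
  proof (rule dim_two_more[OF S'])
    show "\<alpha> = 0 \<and> \<beta> = 0" if "\<alpha> *\<^sub>R e0 + \<beta> *\<^sub>R e1 \<in> S'" for \<alpha> \<beta>
      using that by (simp add: S'_def hl e00 e11 e01 e10)
    show "S = {y + (\<alpha> *\<^sub>R e0 + \<beta> *\<^sub>R e1) | y \<alpha> \<beta>. y \<in> S'}"
    proof (intro equalityI subsetI)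
      fix y assume "y \<in> S"
      from rem[OF this] show "y \<in> {y + (\<alpha> *\<^sub>R e0 + \<beta> *\<^sub>R e1) | y \<alpha> \<beta>. y \<in> S'}"
        by (intro CollectI exI[of _ "y - (h y e0 *\<^sub>R e0 + h y e1 *\<^sub>R e1)"] exI[of _ "h y e0"] exI[of _ "h y e1"]) simp
    next
      fix z assume "z \<in> {y + (\<alpha> *\<^sub>R e0 + \<beta> *\<^sub>R e1) | y \<alpha> \<beta>. y \<in> S'}"
      then show "z \<in> S" using e0S e1S Suc.prems(1)
        by (auto simp: S'_def intro!: subspace_add subspace_scale)
    qed
  qed
  then have "dim S' = 2 * m" using Suc.prems(3) by simp
  from Suc.IH[OF S' jS' this] obtain u where
    u: "\<And>i. i < 2*m \<Longrightarrow> u i \<in> S'" "\<And>i l. i < 2*m \<Longrightarrow> l < 2*m \<Longrightarrow> h (u i) (u l) = (if i = l then 1 else 0)"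
    "\<And>i. i < m \<Longrightarrow> u (2 * i + 1) = j (u (2 * i))" "\<And>y. y \<in> S' \<Longrightarrow> y = (\<Sum>i<2*m. h y (u i) *\<^sub>R u i)" by blast
  define u' where "u' = case_nat e0 (case_nat e1 u)"
  have u'_simps: "u' 0 = e0" "u' (Suc 0) = e1" "u' (Suc (Suc i)) = u i" for i by (simp_all add: u'_def)
  have ue: "h (u i) e0 = 0" "h (u i) e1 = 0" "h e0 (u i) = 0" "h e1 (u i) = 0" if "i < 2 * m" for i
    using u(1)[OF that] h(3) by (auto simp: S'_def)
  have c: "i = 0 \<or> i = Suc 0 \<or> (\<exists>i'. i = Suc (Suc i') \<and> i' < 2 * m)" if "i < 2 * Suc m" for i
    using that by (cases i; cases "i - 1") auto
  show ?case
  proof (intro exI[of _ u'] conjI allI impI ballI)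
    show "u' i \<in> S" if "i < 2 * Suc m" for i
      using c[OF that] e0S e1S u(1) by (auto simp: u'_simps S'_def)
    show "h (u' i) (u' l) = (if i = l then 1 else 0)" if "i < 2 * Suc m" "l < 2 * Suc m" for i l
      using c[OF that(1)] c[OF that(2)] by (auto simp: u'_simps e00 e11 e01 e10 ue u(2) split: if_splits)
    show "u' (2 * i + 1) = j (u' (2 * i))" if "i < Suc m" for i
      using that u(3)[of "i - 1"] by (cases i) (auto simp: u'_simps e1_def)
    fix y assume y: "y \<in> S"
    let ?z = "y - (h y e0 *\<^sub>R e0 + h y e1 *\<^sub>R e1)"
    have "?z = (\<Sum>i<2*m. h ?z (u i) *\<^sub>R u i)" by (rule u(4)[OF rem[OF y]])
    also have "\<dots> = (\<Sum>i<2*m. h y (u i) *\<^sub>R u i)" by (rule sum.cong) (simp_all add: hd hl ue)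
    finally have "y = h y e0 *\<^sub>R e0 + (h y e1 *\<^sub>R e1 + (\<Sum>i<2*m. h y (u i) *\<^sub>R u i))" by (simp add: algebra_simps)
    also have "\<dots> = (\<Sum>i<2 * Suc m. h y (u' i) *\<^sub>R u' i)"
      by (simp only: mult_Suc_right add_2_eq_Suc sum.lessThan_Suc_shift u'_simps)
    finally show "y = (\<Sum>i<2 * Suc m. h y (u' i) *\<^sub>R u' i)" .
  qed
qed


section \<open>Differential forms and types\<close>

lemma cscale_apply: "cscale c X f q = c * X f q"
  by (simp add: cscale_def fmult_def)

lemma cscale_one: "cscale 1 X = X" and cscale_zero: "cscale 0 X = 0" and cscale_zero_right: "cscale c 0 = 0"
  and cscale_minus: "cscale (- c) X = - cscale c X"
  by (simp_all add: fun_eq_iff cscale_apply algebra_simps)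

context manifold begin

abbreviation "VF \<equiv> vector_fields N"

lemma vf_zero: "0 \<in> VF"
  by (simp add: vector_fields_def smooth_funs_zero)

lemma vf_add: assumes X: "X \<in> VF" and Y: "Y \<in> VF" shows "X + Y \<in> VF"
proof -
  have "(X + Y) (f + g) = (X + Y) f + (X + Y) g" if "f \<in> smooth_funs N" "g \<in> smooth_funs N" for f g
    using that by (simp add: field_add[OF X] field_add[OF Y])
  moreover have "(X + Y) ((\<lambda>_. c) * f) = (\<lambda>_. c) * (X + Y) f" if "f \<in> smooth_funs N" for f c
    using that by (simp add: field_scale[OF X] field_scale[OF Y] distrib_left)
  moreover have "(X + Y) (f * g) = (X + Y) f * g + f * (X + Y) g" if "f \<in> smooth_funs N" "g \<in> smooth_funs N" for f g
    using that by (simp add: field_mult[OF X] field_mult[OF Y] distrib_left distrib_right)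
  moreover have "(X + Y) f \<in> smooth_funs N" if "f \<in> smooth_funs N" for f
    using that by (simp add: smooth_funs_add field_smooth[OF X] field_smooth[OF Y])
  moreover have "(X + Y) f = 0" if "f \<notin> smooth_funs N" for f
    using that by (simp add: field_junk[OF X] field_junk[OF Y])
  ultimately show ?thesis unfolding vector_fields_def by blast
qed

lemma vf_fmult: assumes h: "h \<in> smooth_funs N" and X: "X \<in> VF" shows "fmult h X \<in> VF"
proof -
  have "fmult h X (f + g) = fmult h X f + fmult h X g" if "f \<in> smooth_funs N" "g \<in> smooth_funs N" for f g
    using that by (simp add: fmult_def field_add[OF X] distrib_left)
  moreover have "fmult h X ((\<lambda>_. c) * f) = (\<lambda>_. c) * fmult h X f" if "f \<in> smooth_funs N" for f c
    using that by (simp add: fmult_def field_scale[OF X] mult.left_commute)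
  moreover have "fmult h X (f * g) = fmult h X f * g + f * fmult h X g" if "f \<in> smooth_funs N" "g \<in> smooth_funs N" for f g
    using that by (simp add: fmult_def field_mult[OF X] distrib_left mult_ac)
  moreover have "fmult h X f \<in> smooth_funs N" if "f \<in> smooth_funs N" for f
    using that h by (simp add: fmult_def smooth_funs_mult field_smooth[OF X])
  moreover have "fmult h X f = 0" if "f \<notin> smooth_funs N" for f
    using that by (simp add: fmult_def field_junk[OF X])
  ultimately show ?thesis unfolding vector_fields_def by blast
qed

lemma field_outside: "X \<in> VF \<Longrightarrow> q \<notin> points N \<Longrightarrow> X f q = 0"
  using smooth_funsD(1)[OF field_smooth] field_junk by (cases "f \<in> smooth_funs N") auto

text \<open>The constant functions on the type are not smooth functions on \<open>N\<close>, which vanish outside \<open>N\<close>.\<close>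

lemma const_smooth: "(\<lambda>_. c) * indicator (points N) \<in> smooth_funs N"
  by (rule smooth_funs_scale[OF smooth_funs_indicator])

lemma cscale_fmult: assumes X: "X \<in> VF" shows "cscale c X = fmult ((\<lambda>_. c) * indicator (points N)) X"
proof (intro ext)
  fix f q show "cscale c X f q = fmult ((\<lambda>_. c) * indicator (points N)) X f q"
    using field_outside[OF X, of q f] by (cases "q \<in> points N") (auto simp: cscale_apply fmult_def)
qed

lemma vf_cscale: "X \<in> VF \<Longrightarrow> cscale c X \<in> VF"
  by (simp add: cscale_fmult vf_fmult const_smooth)

lemma vf_uminus: "X \<in> VF \<Longrightarrow> - X \<in> VF"
  using vf_cscale[of X "-1"] by (simp add: cscale_minus cscale_one)

lemma vf_diff: "X \<in> VF \<Longrightarrow> Y \<in> VF \<Longrightarrow> X - Y \<in> VF"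
  using vf_add[OF _ vf_uminus] by (metis ab_group_add_class.ab_diff_conv_add_uminus)

lemma bracket_add:
  assumes X: "X \<in> VF" and Y: "Y \<in> VF" and Z: "Z \<in> VF"
  shows "bracket (X + Y) Z = bracket X Z + bracket Y Z" "bracket Z (X + Y) = bracket Z X + bracket Z Y"
proof -
  have "bracket (X + Y) Z f = (bracket X Z + bracket Y Z) f \<and> bracket Z (X + Y) f = (bracket Z X + bracket Z Y) f" for f
  proof (cases "f \<in> smooth_funs N")
    case True
    then show ?thesis by (simp add: bracket_def field_add[OF Z] field_smooth[OF X] field_smooth[OF Y])
  qed (simp add: bracket_def field_junk[OF X] field_junk[OF Y] field_junk[OF Z] field_zero[OF X] field_zero[OF Y] field_zero[OF Z])
  then show "bracket (X + Y) Z = bracket X Z + bracket Y Z" "bracket Z (X + Y) = bracket Z X + bracket Z Y" by blast+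
qed

lemma bracket_cscale:
  assumes X: "X \<in> VF" and Z: "Z \<in> VF"
  shows "bracket (cscale c X) Z = cscale c (bracket X Z)" "bracket Z (cscale c X) = cscale c (bracket Z X)"
proof -
  have "bracket (cscale c X) Z f = cscale c (bracket X Z) f \<and> bracket Z (cscale c X) f = cscale c (bracket Z X) f" for f
  proof (cases "f \<in> smooth_funs N")
    case True
    then show ?thesis
      by (simp add: bracket_def cscale_def fmult_def field_scale[OF Z] field_smooth[OF X] right_diff_distrib)
  qed (simp add: bracket_def cscale_def fmult_def field_junk[OF X] field_junk[OF Z] field_zero[OF X] field_zero[OF Z])
  then show "bracket (cscale c X) Z = cscale c (bracket X Z)" "bracket Z (cscale c X) = cscale c (bracket Z X)" by blast+
qed

lemma bracket_zero: "X \<in> VF \<Longrightarrow> bracket 0 X = 0" "X \<in> VF \<Longrightarrow> bracket X 0 = 0"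
  by (auto simp: bracket_def field_zero fun_eq_iff)

lemma bracket_swap: "bracket Y X = cscale (-1) (bracket X Y)"
  by (simp add: bracket_def fun_eq_iff cscale_apply)

text \<open>The properties that pass through \<open>ext_d\<close> and \<open>type_part\<close>:
  dependence on the first \<open>k\<close> arguments, smooth values, and vanishing at a zero
  argument, which is what removes components of the wrong type.\<close>

definition vform :: "nat \<Rightarrow> 'a form \<Rightarrow> bool" where
  "vform k \<alpha> \<longleftrightarrow> (\<forall>X Y. (\<forall>i<k. X i = Y i) \<longrightarrow> \<alpha> X = \<alpha> Y) \<and>
     (\<forall>X. (\<forall>i<k. X i \<in> VF) \<longrightarrow> \<alpha> X \<in> smooth_funs N) \<and>
     (\<forall>X i. i < k \<longrightarrow> X i = 0 \<longrightarrow> (\<forall>l<k. X l \<in> VF) \<longrightarrow> \<alpha> X = 0)"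

lemma vform_cong: "vform k \<alpha> \<Longrightarrow> (\<And>i. i < k \<Longrightarrow> X i = Y i) \<Longrightarrow> \<alpha> X = \<alpha> Y"
  and vform_smooth: "vform k \<alpha> \<Longrightarrow> (\<And>i. i < k \<Longrightarrow> X i \<in> VF) \<Longrightarrow> \<alpha> X \<in> smooth_funs N"
  and vform_zero: "vform k \<alpha> \<Longrightarrow> i < k \<Longrightarrow> X i = 0 \<Longrightarrow> (\<And>l. l < k \<Longrightarrow> X l \<in> VF) \<Longrightarrow> \<alpha> X = 0"
  unfolding vform_def by blast+

lemma omit_vf: "(\<And>i. i < Suc k \<Longrightarrow> X i \<in> VF) \<Longrightarrow> i < k \<Longrightarrow> omit l X i \<in> VF"
  by (simp add: omit_def)

lemma case_nat_vf: "A \<in> VF \<Longrightarrow> (\<And>i. i < k \<Longrightarrow> X i \<in> VF) \<Longrightarrow> i < Suc k \<Longrightarrow> case_nat A X i \<in> VF"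
  by (cases i) auto

lemma smooth_fun_sum: "(\<And>i. i \<in> A \<Longrightarrow> f i \<in> smooth_funs N) \<Longrightarrow> finite A \<Longrightarrow> (\<lambda>x. \<Sum>i\<in>A. f i x) \<in> smooth_funs N"
  using smooth_funs_sum[of A f] by (simp add: sum_fun_apply[abs_def] fun_eq_iff)

lemma smooth_fun_cmult: "f \<in> smooth_funs N \<Longrightarrow> (\<lambda>x. c * f x) \<in> smooth_funs N"
  using smooth_funs_scale[of f c] by (simp add: times_fun_def)

lemma smooth_fun_add: "f \<in> smooth_funs N \<Longrightarrow> g \<in> smooth_funs N \<Longrightarrow> (\<lambda>x. f x + g x) \<in> smooth_funs N"
  using smooth_funs_add[of f g] by (simp add: plus_fun_def)

lemma vform_ext_d_args:
  assumes X: "\<And>i. i < Suc k \<Longrightarrow> X i \<in> VF" and ij: "i < j" "j \<le> k" and l: "l < k"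
  shows "case_nat (bracket (X i) (X j)) (omit i (omit j X)) l \<in> VF"
proof -
  obtain k' where k: "k = Suc k'" using l by (cases k) auto
  show ?thesis
    unfolding k
    by (rule case_nat_vf[of _ k']) (use X ij l k in \<open>auto intro!: bracket_field omit_vf[of k'] omit_vf[of "Suc k'" X]\<close>)
qed

lemma vform_ext_d: assumes \<alpha>: "vform k \<alpha>" shows "vform (Suc k) (ext_d k \<alpha>)"
  unfolding vform_def
proof (intro conjI allI impI)
  fix X Y :: "nat \<Rightarrow> 'a vfield" assume XY: "\<forall>i<Suc k. X i = Y i"
  have 1: "\<alpha> (omit i X) = \<alpha> (omit i Y)" for i
    by (rule vform_cong[OF \<alpha>]) (use XY in \<open>simp add: omit_def\<close>)
  have 2: "\<alpha> (case_nat (bracket (X i) (X j)) (omit i (omit j X))) = \<alpha> (case_nat (bracket (Y i) (Y j)) (omit i (omit j Y)))"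
    if "i < j" "j \<le> k" for i j
    by (rule vform_cong[OF \<alpha>]) (use XY that in \<open>auto simp: omit_def split: nat.split\<close>)
  have "(\<Sum>i\<le>k. (-1) ^ i * X i (\<alpha> (omit i X)) x) = (\<Sum>i\<le>k. (-1) ^ i * Y i (\<alpha> (omit i Y)) x)" for x
    by (rule sum.cong[OF refl]) (use XY in \<open>simp add: 1\<close>)
  moreover have "(\<Sum>j\<le>k. \<Sum>i<j. (-1) ^ (i + j) * \<alpha> (case_nat (bracket (X i) (X j)) (omit i (omit j X))) x)
    = (\<Sum>j\<le>k. \<Sum>i<j. (-1) ^ (i + j) * \<alpha> (case_nat (bracket (Y i) (Y j)) (omit i (omit j Y))) x)" for x
    by (intro sum.cong refl) (simp add: 2)
  ultimately show "ext_d k \<alpha> X = ext_d k \<alpha> Y" by (simp add: ext_d_def)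
next
  fix X :: "nat \<Rightarrow> 'a vfield" assume X: "\<forall>i<Suc k. X i \<in> VF"
  show "ext_d k \<alpha> X \<in> smooth_funs N"
    unfolding ext_d_def
  proof (rule smooth_fun_add; rule smooth_fun_sum, rule_tac [2] finite_atMost; (rule smooth_fun_sum, rule_tac [2] finite_lessThan)?; rule smooth_fun_cmult)
    fix i assume i: "i \<in> {..k}"
    have "\<alpha> (omit i X) \<in> smooth_funs N" by (rule vform_smooth[OF \<alpha>], rule omit_vf[of k]) (use X in auto)
    then show "X i (\<alpha> (omit i X)) \<in> smooth_funs N" using X i by (intro field_smooth[of "X i"]) auto
  next
    fix j i assume "j \<in> {..k}" "i \<in> {..<j}"
    then show "\<alpha> (case_nat (bracket (X i) (X j)) (omit i (omit j X))) \<in> smooth_funs N"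
      by (intro vform_smooth[OF \<alpha>] vform_ext_d_args) (use X in auto)
  qed
next
  fix X :: "nat \<Rightarrow> 'a vfield" and i0 assume i0: "i0 < Suc k" "X i0 = 0" and X: "\<forall>l<Suc k. X l \<in> VF"
  have 1: "X i (\<alpha> (omit i X)) = 0" if "i \<le> k" for i
  proof (cases "i = i0")
    case False
    obtain l where l: "l < k" "omit i X l = 0"
    proof (cases "i0 < i")
      case True then show ?thesis using that[of i0] i0 \<open>i \<le> k\<close> by (simp add: omit_def)
    next
      case False
      then show ?thesis using that[of "i0 - 1"] i0 \<open>i \<noteq> i0\<close> by (auto simp: omit_def)
    qed
    have "\<alpha> (omit i X) = 0" by (rule vform_zero[OF \<alpha> l(1), of "omit i X"], rule l) (rule omit_vf[of k], use X in auto)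
    then show ?thesis using field_zero[of "X i"] X \<open>i \<le> k\<close> by simp
  qed (simp add: i0)
  have 2: "\<alpha> (case_nat (bracket (X i) (X j)) (omit i (omit j X))) = 0" if ij: "i < j" "j \<le> k" for i j
  proof (cases "i0 = i \<or> i0 = j")
    case True
    have args: "case_nat (bracket (X i) (X j)) (omit i (omit j X)) l \<in> VF" if "l < k" for l
      by (rule vform_ext_d_args[OF _ ij that]) (use X in auto)
    have "bracket (X i) (X j) = 0" using True i0 X ij bracket_zero[of "X i"] bracket_zero[of "X j"] by auto
    moreover have "0 < k" using ij by simp
    ultimately show ?thesis
      using args by (intro vform_zero[OF \<alpha>, of 0 "case_nat (bracket (X i) (X j)) (omit i (omit j X))"]) simp_all
  next
    case False
    have args: "case_nat (bracket (X i) (X j)) (omit i (omit j X)) l \<in> VF" if "l < k" for l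
      by (rule vform_ext_d_args[OF _ ij that]) (use X in auto)
    \<comment> \<open>The position of the zero argument after \<open>j\<close> and then
      \<open>i\<close> have been omitted: it is shifted once for each omitted index below
      it.\<close>
    define l where "l = (if i0 < i then i0 else if i0 < j then i0 - 1 else i0 - 2)"
    have "Suc l < k" using False i0(1) ij by (auto simp: l_def)
    moreover have "omit i (omit j X) l = 0"
    proof -
      consider "i0 < i" | "i < i0" "i0 < j" | "j < i0" using False by linarith
      then show ?thesis
      proof cases
        case 2
        then have "Suc (i0 - 1) = i0" "\<not> i0 - 1 < i" by auto
        then show ?thesis using 2 i0(2) by (simp add: l_def omit_def)
      next
        case 3
        then have "Suc (Suc (i0 - 2)) = i0" "\<not> i0 - 2 < i" "\<not> Suc (i0 - 2) < j" using ij by auto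
        then show ?thesis using 3 i0(2) ij by (simp add: l_def omit_def)
      qed (use i0(2) ij in \<open>simp add: l_def omit_def\<close>)
    qed
    ultimately show ?thesis
      using args by (intro vform_zero[OF \<alpha>, of "Suc l" "case_nat (bracket (X i) (X j)) (omit i (omit j X))"]) simp_all
  qed
  show "ext_d k \<alpha> X = 0" by (rule ext) (simp add: ext_d_def 1 2)
qed

end

section \<open>Fields and forms of pure type\<close>

locale complex_manifold = manifold N for N :: "('q, 'e::euclidean_space) charted" +
  fixes J :: "'q vfield \<Rightarrow> 'q vfield"
  assumes J: "complex_structure N J"
begin

lemma J_vf: "X \<in> VF \<Longrightarrow> J X \<in> VF" and J_add: "X \<in> VF \<Longrightarrow> Y \<in> VF \<Longrightarrow> J (X + Y) = J X + J Y"
  and J_fmult: "h \<in> smooth_funs N \<Longrightarrow> X \<in> VF \<Longrightarrow> J (fmult h X) = fmult h (J X)"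
  and JJ: "X \<in> VF \<Longrightarrow> J (J X) = - X"
  using J unfolding complex_structure_def by blast+

lemma J_cscale: "X \<in> VF \<Longrightarrow> J (cscale c X) = cscale c (J X)"
  by (simp add: cscale_fmult J_vf J_fmult const_smooth)

lemma J_zero: "J 0 = 0"
  using J_cscale[OF vf_zero, of 0] by (simp add: cscale_zero)

text \<open>Fields of type (1, 0), and of type (0, 1) for \<open>isQ\<close>. On arguments of pure
  type the sums in \<open>type_part\<close>, \<open>del\<close> and \<open>delbar\<close> collapse
  to at most one term.\<close>

definition isP where "isP X \<longleftrightarrow> X \<in> VF \<and> J X = cscale \<i> X"
definition isQ where "isQ X \<longleftrightarrow> X \<in> VF \<and> J X = cscale (-\<i>) X"

lemma part_vf: "X \<in> VF \<Longrightarrow> part10 J X \<in> VF" "X \<in> VF \<Longrightarrow> part01 J X \<in> VF"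
  by (simp_all add: part10_def part01_def vf_cscale vf_diff vf_add J_vf)

lemma part_zero: "part10 J 0 = 0" "part01 J 0 = 0"
  by (simp_all add: part10_def part01_def J_zero cscale_zero_right)

lemma part_pure: "isP X \<Longrightarrow> part10 J X = X" "isP X \<Longrightarrow> part01 J X = 0" "isQ X \<Longrightarrow> part10 J X = 0" "isQ X \<Longrightarrow> part01 J X = X"
  by (auto simp: isP_def isQ_def part10_def part01_def fun_eq_iff cscale_apply)

lemma vform_type_part: assumes \<alpha>: "vform (p + q) \<alpha>" shows "vform (p + q) (type_part J p q \<alpha>)"
  unfolding vform_def
proof (intro conjI allI impI)
  fix X Y :: "nat \<Rightarrow> 'q vfield" assume XY: "\<forall>i<p + q. X i = Y i"
  have "\<alpha> (\<lambda>i. if i \<in> S then part10 J (X i) else part01 J (X i)) = \<alpha> (\<lambda>i. if i \<in> S then part10 J (Y i) else part01 J (Y i))" for S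
    by (rule vform_cong[OF \<alpha>]) (use XY in simp)
  then show "type_part J p q \<alpha> X = type_part J p q \<alpha> Y" by (simp add: type_part_def)
next
  fix X :: "nat \<Rightarrow> 'q vfield" assume X: "\<forall>i<p + q. X i \<in> VF"
  show "type_part J p q \<alpha> X \<in> smooth_funs N"
    unfolding type_part_def
    by (intro smooth_fun_sum vform_smooth[OF \<alpha>]) (use X part_vf in auto)
next
  fix X :: "nat \<Rightarrow> 'q vfield" and i assume i: "i < p + q" "X i = 0" and X: "\<forall>l<p + q. X l \<in> VF"
  have "\<alpha> (\<lambda>i. if i \<in> S then part10 J (X i) else part01 J (X i)) = 0" for S
    by (rule vform_zero[OF \<alpha> i(1), of "\<lambda>i. if i \<in> S then part10 J (X i) else part01 J (X i)"]) (use i X part_vf part_zero in auto)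
  then show "type_part J p q \<alpha> X = 0" by (simp add: type_part_def fun_eq_iff)
qed

lemma type_part_eval:
  assumes \<alpha>: "vform (p + q) \<alpha>" and X: "\<And>i. i < p + q \<Longrightarrow> X i \<in> VF"
    and S: "S \<subseteq> {..<p + q}" "card S = p"
    and z: "\<And>S'. S' \<subseteq> {..<p + q} \<Longrightarrow> card S' = p \<Longrightarrow> S' \<noteq> S \<Longrightarrow>
      \<exists>i<p + q. (if i \<in> S' then part10 J (X i) else part01 J (X i)) = 0"
  shows "type_part J p q \<alpha> X = \<alpha> (\<lambda>i. if i \<in> S then part10 J (X i) else part01 J (X i))"
proof
  fix x
  let ?F = "\<lambda>S. \<alpha> (\<lambda>i. if i \<in> S then part10 J (X i) else part01 J (X i)) x"
  have "type_part J p q \<alpha> X x = (\<Sum>S' | S' \<subseteq> {..<p + q} \<and> card S' = p. ?F S')" by (simp add: type_part_def)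
  also have "\<dots> = ?F S + (\<Sum>S' \<in> {S'. S' \<subseteq> {..<p + q} \<and> card S' = p} - {S}. ?F S')"
    by (rule sum.remove) (use S in auto)
  also have "(\<Sum>S' \<in> {S'. S' \<subseteq> {..<p + q} \<and> card S' = p} - {S}. ?F S') = 0"
  proof (rule sum.neutral, rule ballI)
    fix S' assume S': "S' \<in> {S'. S' \<subseteq> {..<p + q} \<and> card S' = p} - {S}"
    then obtain i where i: "i < p + q" "(if i \<in> S' then part10 J (X i) else part01 J (X i)) = 0" using z[of S'] S' by blast
    have "\<alpha> (\<lambda>i. if i \<in> S' then part10 J (X i) else part01 J (X i)) = 0"
      by (rule vform_zero[OF \<alpha> i(1), of "\<lambda>i. if i \<in> S' then part10 J (X i) else part01 J (X i)"]) (use i X part_vf in auto)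
    then show "?F S' = 0" by simp
  qed
  finally show "type_part J p q \<alpha> X x = ?F S" by simp
qed

text \<open>A subset other than \<open>S\<close> projects some argument to the opposite type, which
  gives 0; at most the summand of \<open>S\<close> is left, and it occurs only if \<open>S\<close>
  has the right size.\<close>

lemma type_part_pure:
  assumes \<alpha>: "vform (p + q) \<alpha>" and S: "S \<subseteq> {..<p + q}"
    and P: "\<And>i. i \<in> S \<Longrightarrow> isP (X i)" and Q: "\<And>i. i < p + q \<Longrightarrow> i \<notin> S \<Longrightarrow> isQ (X i)"
  shows "type_part J p q \<alpha> X = (if card S = p then \<alpha> X else 0)"
proof -
  have X: "X i \<in> VF" if "i < p + q" for i using P Q that by (cases "i \<in> S") (auto simp: isP_def isQ_def)
  have z: "\<exists>i<p + q. (if i \<in> S' then part10 J (X i) else part01 J (X i)) = 0" if S': "S' \<subseteq> {..<p + q}" "S' \<noteq> S" for S'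
  proof -
    obtain i where i: "i \<in> S \<longleftrightarrow> i \<notin> S'" using S'(2) by blast
    then have "i < p + q" using S S'(1) by auto
    then show ?thesis using i P[of i] Q[of i] part_pure[of "X i"] by (intro exI[of _ i]) auto
  qed
  show ?thesis
  proof (cases "card S = p")
    case True
    have "type_part J p q \<alpha> X = \<alpha> (\<lambda>i. if i \<in> S then part10 J (X i) else part01 J (X i))"
      by (rule type_part_eval[OF \<alpha> X S True]) (use z in auto)
    also have "\<dots> = \<alpha> X" by (rule vform_cong[OF \<alpha>]) (use P Q part_pure in auto)
    finally show ?thesis using True by simp
  next
    case False
    have "\<alpha> (\<lambda>i. if i \<in> S' then part10 J (X i) else part01 J (X i)) = 0" if "S' \<subseteq> {..<p + q}" "card S' = p" for S'
    proof -
      have "S' \<noteq> S" using that False by auto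
      from z[OF that(1) this] obtain i where i: "i < p + q" "(if i \<in> S' then part10 J (X i) else part01 J (X i)) = 0" by auto
      show ?thesis by (rule vform_zero[OF \<alpha> i(1), of "\<lambda>i. if i \<in> S' then part10 J (X i) else part01 J (X i)"]) (use i X part_vf in auto)
    qed
    then show ?thesis using False by (simp add: type_part_def fun_eq_iff)
  qed
qed

lemma vform_delbar2: assumes \<alpha>: "vform 2 \<alpha>" shows "vform 3 (delbar J 2 \<alpha>)"
proof -
  have e: "0 + 3 = (3::nat)" "1 + 2 = (3::nat)" "2 + 1 = (3::nat)" "0 + 2 = (2::nat)" "1 + 1 = (2::nat)" "2 + 0 = (2::nat)" "Suc 2 = 3" by simp_all
  have v: "vform 3 (type_part J 0 3 (ext_d 2 (type_part J 0 2 \<alpha>)))"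
    "vform 3 (type_part J 1 2 (ext_d 2 (type_part J 1 1 \<alpha>)))"
    "vform 3 (type_part J 2 1 (ext_d 2 (type_part J 2 0 \<alpha>)))"
    by (rule vform_type_part[of 0 3, unfolded e] vform_type_part[of 1 2, unfolded e] vform_type_part[of 2 1, unfolded e]
        vform_type_part[of 0 2, unfolded e] vform_type_part[of 1 1, unfolded e] vform_type_part[of 2 0, unfolded e]
        vform_ext_d[of 2, unfolded e] \<alpha>)+
  have "delbar J 2 \<alpha> = (\<lambda>X x. type_part J 0 3 (ext_d 2 (type_part J 0 2 \<alpha>)) X x + (type_part J 1 2 (ext_d 2 (type_part J 1 1 \<alpha>)) X x
     + type_part J 2 1 (ext_d 2 (type_part J 2 0 \<alpha>)) X x))"
    by (simp add: delbar_def numeral_2_eq_2 numeral_3_eq_3 fun_eq_iff)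
  then have eq: "delbar J 2 \<alpha> X = type_part J 0 3 (ext_d 2 (type_part J 0 2 \<alpha>)) X + (type_part J 1 2 (ext_d 2 (type_part J 1 1 \<alpha>)) X
     + type_part J 2 1 (ext_d 2 (type_part J 2 0 \<alpha>)) X)" for X
    by (simp add: plus_fun_def)
  show ?thesis unfolding vform_def
  proof (intro conjI allI impI)
    fix X Y :: "nat \<Rightarrow> 'q vfield" assume "\<forall>i<3. X i = Y i"
    then show "delbar J 2 \<alpha> X = delbar J 2 \<alpha> Y"
      using v[THEN vform_cong, of X Y] by (simp add: eq)
  next
    fix X :: "nat \<Rightarrow> 'q vfield" assume "\<forall>i<3. X i \<in> VF"
    then show "delbar J 2 \<alpha> X \<in> smooth_funs N"
      using v[THEN vform_smooth, of X] by (simp add: eq smooth_funs_add)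
  next
    fix X :: "nat \<Rightarrow> 'q vfield" and i :: nat assume "i < 3" "X i = 0" "\<forall>l<3. X l \<in> VF"
    then show "delbar J 2 \<alpha> X = 0"
      using v[THEN vform_zero, of i X] by (simp add: eq)
  qed
qed

text \<open>One argument of type (1, 0) among three selects the summand \<open>p = 1\<close> of
  \<open>delbar\<close>; the outer projection disappears, and only the (1, 1)-part of the form is
  differentiated.\<close>

lemma delbar2_pure:
  assumes \<alpha>: "vform 2 \<alpha>" and S: "S \<subseteq> {..<3}" "card S = 1"
    and P: "\<And>i. i \<in> S \<Longrightarrow> isP (X i)" and Q: "\<And>i. i < 3 \<Longrightarrow> i \<notin> S \<Longrightarrow> isQ (X i)"
  shows "delbar J 2 \<alpha> X = ext_d 2 (type_part J 1 1 \<alpha>) X"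
proof -
  have "type_part J p (2 - p + 1) (ext_d 2 (type_part J p (2 - p) \<alpha>)) X x = (if card S = p then ext_d 2 (type_part J p (2 - p) \<alpha>) X x else 0)"
    if "p \<le> 2" for p x
  proof (subst type_part_pure)
    have e: "p + (2 - p + 1) = 3" "p + (2 - p) = 2" "Suc 2 = 3" using that by auto
    show "vform (p + (2 - p + 1)) (ext_d 2 (type_part J p (2 - p) \<alpha>))"
      using vform_ext_d[of 2 "type_part J p (2 - p) \<alpha>"] vform_type_part[of p "2 - p" \<alpha>] \<alpha> unfolding e by simp
    show "S \<subseteq> {..<p + (2 - p + 1)}" unfolding e by (rule S)
    show "\<And>i. i < p + (2 - p + 1) \<Longrightarrow> i \<notin> S \<Longrightarrow> isQ (X i)" unfolding e by (rule Q)
  qed (auto intro: P)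
  then have "delbar J 2 \<alpha> X = (\<lambda>x. \<Sum>p\<le>2. if card S = p then ext_d 2 (type_part J p (2 - p) \<alpha>) X x else 0)"
    unfolding delbar_def by (intro ext sum.cong refl) simp
  then show ?thesis using S(2) by (simp add: numeral_2_eq_2)
qed

text \<open>Two arguments of each type again select the summand \<open>p = 1\<close>, so that only
  the (1, 2)-part is differentiated.\<close>

lemma del3_pure:
  assumes \<alpha>: "vform 3 \<alpha>" and S: "S \<subseteq> {..<4}" "card S = 2"
    and P: "\<And>i. i \<in> S \<Longrightarrow> isP (X i)" and Q: "\<And>i. i < 4 \<Longrightarrow> i \<notin> S \<Longrightarrow> isQ (X i)"
  shows "del J 3 \<alpha> X = ext_d 3 (type_part J 1 2 \<alpha>) X"
proof -
  have "type_part J (p + 1) (3 - p) (ext_d 3 (type_part J p (3 - p) \<alpha>)) X x = (if card S = p + 1 then ext_d 3 (type_part J p (3 - p) \<alpha>) X x else 0)"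
    if "p \<le> 3" for p x
  proof (subst type_part_pure)
    have e: "p + 1 + (3 - p) = 4" "p + (3 - p) = 3" "Suc 3 = 4" using that by auto
    show "vform (p + 1 + (3 - p)) (ext_d 3 (type_part J p (3 - p) \<alpha>))"
      using vform_ext_d[of 3 "type_part J p (3 - p) \<alpha>"] vform_type_part[of p "3 - p" \<alpha>] \<alpha> unfolding e by simp
    show "S \<subseteq> {..<p + 1 + (3 - p)}" unfolding e by (rule S)
    show "\<And>i. i < p + 1 + (3 - p) \<Longrightarrow> i \<notin> S \<Longrightarrow> isQ (X i)" unfolding e by (rule Q)
  qed (auto intro: P)
  then have "del J 3 \<alpha> X = (\<lambda>x. \<Sum>p\<le>3. if card S = p + 1 then ext_d 3 (type_part J p (3 - p) \<alpha>) X x else 0)"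
    unfolding del_def by (intro ext sum.cong refl) simp
  then show ?thesis using S(2) by (simp add: numeral_2_eq_2 numeral_3_eq_3)
qed

end


section \<open>Left-invariant complex structures\<close>

context complex_manifold begin

context
  fixes g assumes herm: "hermitian_metric N J g"
begin

lemma g_smooth: "X \<in> VF \<Longrightarrow> Y \<in> VF \<Longrightarrow> g X Y \<in> smooth_funs N"
  and g_sym: "X \<in> VF \<Longrightarrow> Y \<in> VF \<Longrightarrow> g X Y = g Y X"
  and g_add: "X \<in> VF \<Longrightarrow> Y \<in> VF \<Longrightarrow> Z \<in> VF \<Longrightarrow> g (X + Y) Z = g X Z + g Y Z"
  and g_fmult: "h \<in> smooth_funs N \<Longrightarrow> X \<in> VF \<Longrightarrow> Y \<in> VF \<Longrightarrow> g (fmult h X) Y = h * g X Y"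
  and g_pos: "X \<in> real_fields N \<Longrightarrow> x \<in> points N \<Longrightarrow> f \<in> smooth_funs N \<Longrightarrow> X f x \<noteq> 0 \<Longrightarrow> Re (g X X x) > 0"
  and g_J: "X \<in> VF \<Longrightarrow> Y \<in> VF \<Longrightarrow> g (J X) (J Y) = g X Y"
  using herm unfolding hermitian_metric_def by blast+

lemma g_real: assumes "X \<in> real_fields N" "Y \<in> real_fields N" shows "g X Y q \<in> \<real>"
proof -
  have "range (g X Y) \<subseteq> \<real>" using herm assms unfolding hermitian_metric_def by blast
  then show ?thesis by (rule subsetD) (rule rangeI)
qed

lemma g_add_right: "X \<in> VF \<Longrightarrow> Y \<in> VF \<Longrightarrow> Z \<in> VF \<Longrightarrow> g Z (X + Y) = g Z X + g Z Y"
  using g_sym[of Z "X + Y"] g_add[of X Y Z] g_sym[of X Z] g_sym[of Y Z] by (simp add: vf_add)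

lemma g_outside: "X \<in> VF \<Longrightarrow> Y \<in> VF \<Longrightarrow> q \<notin> points N \<Longrightarrow> g X Y q = 0"
  using smooth_funsD(1)[OF g_smooth] .

lemma g_cscale: assumes X: "X \<in> VF" "Y \<in> VF"
  shows "g (cscale c X) Y = (\<lambda>q. c * g X Y q)" "g Y (cscale c X) = (\<lambda>q. c * g Y X q)"
proof -
  show 1: "g (cscale c X) Y = (\<lambda>q. c * g X Y q)"
  proof
    fix q show "g (cscale c X) Y q = c * g X Y q"
      unfolding cscale_fmult[OF X(1)] g_fmult[OF const_smooth X]
      by (cases "q \<in> points N") (use g_outside[OF X] in auto)
  qed
  show "g Y (cscale c X) = (\<lambda>q. c * g Y X q)"
    using 1 g_sym[of Y "cscale c X"] g_sym[of Y X] X by (simp add: vf_cscale)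
qed

lemma g_zero: "Y \<in> VF \<Longrightarrow> g 0 Y = 0" "Y \<in> VF \<Longrightarrow> g Y 0 = 0"
  using g_cscale[OF vf_zero, of Y 0] by (auto simp: cscale_zero fun_eq_iff)

lemma vform_fundamental_form: "vform 2 (fundamental_form J g)"
  unfolding vform_def fundamental_form_def
proof (intro conjI allI impI)
  fix X and i :: nat assume "i < 2" "X i = 0" "\<forall>l<2. X l \<in> VF"
  then have "i = 0 \<or> i = 1" by auto
  then show "g (J (X 0)) (X 1) = 0"
    using \<open>X i = 0\<close> \<open>\<forall>l<2. X l \<in> VF\<close> by (auto simp: J_zero g_zero J_vf)
qed (auto simp: g_smooth J_vf)

lemma wedge_power_smooth:
  "(\<And>i. i < 2 * m \<Longrightarrow> X i \<in> VF) \<Longrightarrow> wedge_power N (fundamental_form J g) m X \<in> smooth_funs N"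
proof (induction m arbitrary: X)
  case 0 then show ?case by (simp add: smooth_funs_indicator)
next
  case (Suc m)
  have Xs: "X (\<sigma> i) \<in> VF" if "\<sigma> permutes {..<2 + 2 * m}" "i < 2 + 2 * m" for \<sigma> i
    using permutes_in_image[OF that(1), of i] that(2) Suc.prems by auto
  have "(\<lambda>x. \<Sum>\<sigma> | \<sigma> permutes {..<2 + 2 * m}. (1 / (fact 2 * fact (2 * m))) * (of_int (sign \<sigma>) *
      (g (J (X (\<sigma> 0))) (X (\<sigma> 1)) * wedge_power N (fundamental_form J g) m (\<lambda>i. X (\<sigma> (2 + i)))) x)) \<in> smooth_funs N"
    by (intro smooth_fun_sum smooth_fun_cmult smooth_funs_mult g_smooth J_vf Suc.IH finite_permutations)
      (use Xs in auto)
  then show ?case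
    by (simp add: wedge_def fundamental_form_def sum_divide_distrib mult.assoc)
qed

end

definition seq2 :: "'a \<Rightarrow> 'a \<Rightarrow> nat \<Rightarrow> 'a" where "seq2 X Y = case_nat X (\<lambda>_. Y)"
definition seq3 :: "'a \<Rightarrow> 'a \<Rightarrow> 'a \<Rightarrow> nat \<Rightarrow> 'a" where "seq3 X Y Z = case_nat X (seq2 Y Z)"

lemma seq_simps [simp]: "seq2 X Y 0 = X" "seq2 X Y (Suc 0) = Y" "seq2 X Y 1 = Y"
  "seq3 X Y Z 0 = X" "seq3 X Y Z (Suc 0) = Y" "seq3 X Y Z 1 = Y" "seq3 X Y Z 2 = Z" "seq3 X Y Z (Suc (Suc 0)) = Z"
  by (simp_all add: seq2_def seq3_def numeral_2_eq_2)

lemma less_3: "i < 3 \<longleftrightarrow> i = 0 \<or> i = 1 \<or> i = (2::nat)"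
  by auto

lemma vform2_seq: "vform 2 \<alpha> \<Longrightarrow> \<alpha> F = \<alpha> (seq2 (F 0) (F 1))"
  by (rule vform_cong[of 2 \<alpha>]) (auto simp: less_2_cases_iff)

lemma vform3_seq: "vform 3 \<alpha> \<Longrightarrow> \<alpha> F = \<alpha> (seq3 (F 0) (F 1) (F 2))"
  by (rule vform_cong[of 3 \<alpha>]) (auto simp: less_3)

end

lemma sum_sum_nonneg_eq_0: "(\<Sum>i\<in>I. \<Sum>l\<in>L. f i l) = (0::real) \<Longrightarrow> finite I \<Longrightarrow> finite L \<Longrightarrow> (\<And>i l. f i l \<ge> 0) \<Longrightarrow> i \<in> I \<Longrightarrow> l \<in> L \<Longrightarrow> f i l = 0"
proof -
  assume *: "(\<Sum>i\<in>I. \<Sum>l\<in>L. f i l) = 0" "finite I" "finite L" "\<And>i l. f i l \<ge> 0" "i \<in> I" "l \<in> L"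
  have "(\<Sum>l\<in>L. f i l) = 0" using *(1,2,4,5) by (simp add: sum_nonneg_eq_0_iff sum_nonneg)
  then show "f i l = 0" using *(3,4,6) by (simp add: sum_nonneg_eq_0_iff)
qed

text \<open>An abstraction of the quotient: \<open>E\<close> is its left-invariant frame, indexed by the Lie algebra \<open>'e\<close> with
  bracket \<open>br\<close>, the complex structure acts on it by \<open>j\<close>, and \<open>Avg\<close> is an invariant mean.\<close>

locale framed = complex_manifold N J for N :: "('q, 'e::euclidean_space) charted" and J +
  fixes E :: "'e \<Rightarrow> 'q vfield" and br :: "'e \<Rightarrow> 'e \<Rightarrow> 'e" and j :: "'e \<Rightarrow> 'e"
    and Avg :: "('q \<Rightarrow> complex) \<Rightarrow> complex" and pi :: "'e \<Rightarrow> real" and Z0 :: 'e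
  assumes points_nonempty: "points N \<noteq> {}"
    and E_real_field: "E v \<in> real_fields N"
    and E_add: "E (v + w) = E v + E w"
    and E_scale: "E (r *\<^sub>R v) = cscale (of_real r) (E v)"
    and bracket_E: "bracket (E v) (E w) = E (br v w)"
    and J_E: "J (E v) = E (j v)"
    and frame: "X \<in> vector_fields N \<Longrightarrow>
      \<exists>h. (\<forall>b\<in>Basis. h b \<in> smooth_funs N) \<and> (\<forall>f\<in>smooth_funs N. X f = (\<Sum>b\<in>Basis. h b * E b f))"
    and frame_unique: "q \<in> points N \<Longrightarrow> (\<And>f. f \<in> smooth_funs N \<Longrightarrow> (\<Sum>b\<in>Basis. c b * E b f q) = 0)
      \<Longrightarrow> b \<in> Basis \<Longrightarrow> c b = 0"
    and Avg_add: "f \<in> smooth_funs N \<Longrightarrow> h \<in> smooth_funs N \<Longrightarrow> Avg (f + h) = Avg f + Avg h"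
    and Avg_scale: "f \<in> smooth_funs N \<Longrightarrow> Avg ((\<lambda>_. d) * f) = d * Avg f"
    and Avg_real: "(\<And>q. f q \<in> \<real>) \<Longrightarrow> Avg f \<in> \<real>"
    and Avg_pos: "f \<in> smooth_funs N \<Longrightarrow> (\<And>q. q \<in> points N \<Longrightarrow> Re (f q) > 0) \<Longrightarrow> Re (Avg f) > 0"
    and Avg_nonzero: "f \<in> smooth_funs N \<Longrightarrow> (\<And>q. f q \<in> \<real>) \<Longrightarrow> (\<And>q. q \<in> points N \<Longrightarrow> f q \<noteq> 0) \<Longrightarrow> Avg f \<noteq> 0"
    and Avg_E: "f \<in> smooth_funs N \<Longrightarrow> Avg (E v f) = 0"
    and br_add_left: "br (x + y) z = br x z + br y z"
    and br_scale_left: "br (r *\<^sub>R x) z = r *\<^sub>R br x z"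
    and pi_linear: "linear pi" and pi_Z0: "pi Z0 = 1" and pi_br: "pi (br x y) = 0"
    and br_abelian: "pi x = 0 \<Longrightarrow> pi y = 0 \<Longrightarrow> br x y = 0"
begin

lemma E_vf: "E v \<in> VF"
  using E_real_field by (auto simp: real_fields_def)

lemma E_zero: "E 0 = 0"
  using E_scale[of 0 0] by (simp add: cscale_zero)

lemma E_minus: "E (- v) = - E v"
  using E_scale[of "-1" v] by (simp add: cscale_minus cscale_one)

lemma E_diff: "E (v - w) = E v - E w"
  using E_add[of v "- w"] by (simp add: E_minus)

lemma E_sum: "E (\<Sum>i\<in>A. v i) = (\<Sum>i\<in>A. E (v i))"
  by (induction A rule: infinite_finite_induct) (auto simp: E_zero E_add)

lemma E_expand: "E v f q = (\<Sum>b\<in>Basis. of_real (v \<bullet> b) * E b f q)"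
proof -
  have "E v = (\<Sum>b\<in>Basis. E ((v \<bullet> b) *\<^sub>R b))" by (subst euclidean_representation[symmetric, of v]) (rule E_sum)
  then show ?thesis by (simp add: sum_fun_apply E_scale cscale_apply)
qed

lemma E_nonzero: assumes v: "v \<noteq> 0" and q: "q \<in> points N" shows "\<exists>f\<in>smooth_funs N. E v f q \<noteq> 0"
proof (rule ccontr)
  assume "\<not> ?thesis"
  then have "complex_of_real (v \<bullet> b) = 0" if "b \<in> Basis" for b
    by (intro frame_unique[OF q _ that, of "\<lambda>b. of_real (v \<bullet> b)"]) (auto simp: E_expand[symmetric])
  then have "v \<bullet> b = 0" if "b \<in> Basis" for b using that by simp
  then show False using v euclidean_all_zero_iff[of v] by blast
qed

lemma E_inj: assumes "E v = E w" shows "v = w"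
proof (rule ccontr)
  assume "v \<noteq> w"
  then have "v - w \<noteq> 0" by simp
  moreover obtain q where "q \<in> points N" using points_nonempty by blast
  ultimately obtain f where "E (v - w) f q \<noteq> 0" using E_nonzero[of "v - w" q] by blast
  then show False using assms by (simp add: E_diff)
qed

lemma j_add: "j (x + y) = j x + j y" and j_scale: "j (r *\<^sub>R x) = r *\<^sub>R j x" and jj: "j (j x) = - x"
proof -
  show "j (x + y) = j x + j y" by (rule E_inj) (simp add: J_E[symmetric] E_add J_add E_vf)
  show "j (r *\<^sub>R x) = r *\<^sub>R j x" by (rule E_inj) (simp add: J_E[symmetric] E_scale J_cscale E_vf)
  show "j (j x) = - x" by (rule E_inj) (simp add: J_E[symmetric] E_minus JJ E_vf)
qed

lemma linear_j: "linear j"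
  by (intro linearI j_add j_scale)

lemma br_swap: "br y x = - br x y"
proof (rule E_inj)
  show "E (br y x) = E (- br x y)"
    unfolding E_minus bracket_E[symmetric] bracket_swap[of "E y"] by (simp add: cscale_minus cscale_one)
qed

lemma br_add_right: "br z (x + y) = br z x + br z y"
  by (simp only: br_swap[of z] br_add_left minus_add_distrib)

lemma br_scale_right: "br z (r *\<^sub>R x) = r *\<^sub>R br z x"
  by (simp only: br_swap[of z] br_scale_left scaleR_minus_right)

lemma nijenhuis: "br (j x) (j y) = j (br (j x) y) + j (br x (j y)) + br x y"
proof (rule E_inj)
  have "bracket (J (E x)) (J (E y)) - J (bracket (J (E x)) (E y)) - J (bracket (E x) (J (E y))) - bracket (E x) (E y) = 0"
    using J E_vf unfolding complex_structure_def by blast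
  then show "E (br (j x) (j y)) = E (j (br (j x) y) + j (br x (j y)) + br x y)"
    by (simp add: J_E bracket_E E_add algebra_simps)
qed

lemmas pi_simps [simp] = linear_add[OF pi_linear] linear_diff[OF pi_linear] linear_scale[OF pi_linear]
  linear_0[OF pi_linear] linear_neg[OF pi_linear] pi_br pi_Z0

lemmas j_simps = j_add j_scale jj linear_0[OF linear_j] linear_neg[OF linear_j] linear_diff[OF linear_j]

abbreviation "B \<equiv> br Z0"

lemma linear_B: "linear B"
  by (intro linearI br_add_right br_scale_right)

lemma br_ideal: assumes "pi y = 0" shows "br x y = pi x *\<^sub>R B y"
proof -
  have "br x y = br ((x - pi x *\<^sub>R Z0) + pi x *\<^sub>R Z0) y" by simp
  also have "\<dots> = pi x *\<^sub>R B y" unfolding br_add_left using br_abelian[of "x - pi x *\<^sub>R Z0" y] assms by (simp add: br_scale_left)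
  finally show ?thesis .
qed

definition n1 :: "'e set" where "n1 = {x. pi x = 0 \<and> pi (j x) = 0}"

lemma n1_subspace: "subspace n1"
  by (auto simp: n1_def subspace_def j_simps)

lemma n1_j: "x \<in> n1 \<Longrightarrow> j x \<in> n1"
  by (simp add: n1_def jj)

text \<open>The vector in the span of \<open>Z0\<close> and \<open>j Z0\<close> that solves
  \<open>pi V0 = 0\<close> and \<open>pi (j V0) = 1\<close>; the denominator is, up to sign, the
  determinant of this linear system.\<close>

definition V0 :: 'e where
  "V0 = (pi (j Z0) / (1 + (pi (j Z0))\<^sup>2)) *\<^sub>R Z0 - (1 / (1 + (pi (j Z0))\<^sup>2)) *\<^sub>R j Z0"

lemma V0: "pi V0 = 0" "pi (j V0) = 1"
proof -
  have "1 + (pi (j Z0))\<^sup>2 \<noteq> 0" using zero_le_power2[of "pi (j Z0)"] by linarith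
  then show "pi V0 = 0" "pi (j V0) = 1"
    by (simp_all add: V0_def j_simps power2_eq_square field_simps)
qed

text \<open>Integrability for \<open>V0\<close> and \<open>y\<close>: as a member of the abelian
  ideal, \<open>V0\<close> has zero bracket with \<open>y\<close> and \<open>j y\<close>, while
  \<open>j V0\<close> acts on them as \<open>B\<close>; so two of the four brackets drop
  out.\<close>

lemma B_j: assumes y: "y \<in> n1" shows "B (j y) = j (B y)"
proof -
  have y': "pi y = 0" "pi (j y) = 0" using y by (auto simp: n1_def)
  show ?thesis
    using nijenhuis[of V0 y] br_ideal[OF y'(1), of V0] br_ideal[OF y'(1), of "j V0"] br_ideal[OF y'(2), of V0]
      br_ideal[OF y'(2), of "j V0"] by (simp add: V0 j_simps)
qed

lemma n1_B: assumes "x \<in> n1" shows "B x \<in> n1"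
  using assms pi_br[of Z0 "j x"] B_j[OF assms] by (simp add: n1_def)

lemma dim_n1: "DIM('e) = dim n1 + 2"
proof -
  have "dim (UNIV :: 'e set) = dim n1 + 2"
  proof (rule dim_two_more[OF n1_subspace, of V0 "j V0"])
    show "\<alpha> = 0 \<and> \<beta> = 0" if "\<alpha> *\<^sub>R V0 + \<beta> *\<^sub>R j V0 \<in> n1" for \<alpha> \<beta>
      using that by (simp add: n1_def V0 j_simps)
    have "x - (pi (j x) *\<^sub>R V0 + pi x *\<^sub>R j V0) \<in> n1" for x
      by (simp add: n1_def V0 j_simps)
    then have "\<exists>y \<alpha> \<beta>. x = y + (\<alpha> *\<^sub>R V0 + \<beta> *\<^sub>R j V0) \<and> y \<in> n1" for x
      by (intro exI[of _ "x - (pi (j x) *\<^sub>R V0 + pi x *\<^sub>R j V0)"] exI[of _ "pi (j x)"] exI[of _ "pi x"]) simp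
    then show "UNIV = {y + (\<alpha> *\<^sub>R V0 + \<beta> *\<^sub>R j V0) | y \<alpha> \<beta>. y \<in> n1}" by auto
  qed
  then show ?thesis by simp
qed

lemma Avg_cmult: "f \<in> smooth_funs N \<Longrightarrow> Avg (\<lambda>q. c * f q) = c * Avg f"
  using Avg_scale[of f c] by (simp add: times_fun_def)

lemma Avg_zero: "Avg (\<lambda>q. 0) = 0"
  using Avg_cmult[OF smooth_funs_indicator, of 0] by simp

lemma Avg_plus: "f \<in> smooth_funs N \<Longrightarrow> h \<in> smooth_funs N \<Longrightarrow> Avg (\<lambda>q. f q + h q) = Avg f + Avg h"
  using Avg_add[of f h] by (simp add: plus_fun_def)

lemma Avg_sum: "(\<And>i. i \<in> A \<Longrightarrow> f i \<in> smooth_funs N) \<Longrightarrow> finite A \<Longrightarrow> Avg (\<lambda>q. \<Sum>i\<in>A. f i q) = (\<Sum>i\<in>A. Avg (f i))"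
proof (induction A rule: infinite_finite_induct)
  case (insert x A)
  have "(\<lambda>q. \<Sum>i\<in>A. f i q) \<in> smooth_funs N" by (rule smooth_fun_sum) (use insert in auto)
  then show ?case using insert by (simp add: Avg_plus)
qed (simp_all add: Avg_zero)

definition invariant :: "'q vfield \<Rightarrow> bool" where
  "invariant X \<longleftrightarrow> (\<exists>v w. X = E v + cscale \<i> (E w))"

lemma invariant_vf: "invariant X \<Longrightarrow> X \<in> VF"
  by (auto simp: invariant_def vf_add vf_cscale E_vf)

lemma invariant_E: "invariant (E v)"
  unfolding invariant_def by (intro exI[of _ v] exI[of _ 0]) (simp add: E_zero cscale_zero_right)

lemma invariant_Avg: assumes "invariant X" "f \<in> smooth_funs N" shows "Avg (X f) = 0"
proof -
  obtain v w where X: "X = E v + cscale \<i> (E w)" using assms(1) by (auto simp: invariant_def)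
  have "X f = (\<lambda>q. E v f q + \<i> * E w f q)" by (simp add: X fun_eq_iff cscale_apply)
  then show ?thesis
    using assms(2) by (simp add: Avg_plus smooth_fun_cmult field_smooth[OF E_vf] Avg_cmult Avg_E)
qed

text \<open>The first sum of the Koszul formula consists of derivatives along invariant fields,
  whose averages are 0. What remains is the differential of the averaged form on the Lie
  algebra.\<close>

lemma Avg_ext_d:
  assumes \<alpha>: "\<And>Y. (\<And>i. i < k \<Longrightarrow> Y i \<in> VF) \<Longrightarrow> \<alpha> Y \<in> smooth_funs N"
    and X: "\<And>i. i \<le> k \<Longrightarrow> invariant (X i)"
  shows "Avg (ext_d k \<alpha> X) = (\<Sum>j\<le>k. \<Sum>i<j. (-1) ^ (i + j) *
        Avg (\<alpha> (case_nat (bracket (X i) (X j)) (omit i (omit j X)))))"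
proof -
  have Xv: "X i \<in> VF" if "i < Suc k" for i using X that by (auto intro: invariant_vf)
  have s1: "\<alpha> (omit i X) \<in> smooth_funs N" if "i \<le> k" for i
    by (rule \<alpha>, rule omit_vf[of k]) (use Xv in auto)
  have s2: "X i (\<alpha> (omit i X)) \<in> smooth_funs N" if "i \<le> k" for i
    using that by (intro field_smooth[of "X i"] Xv s1) auto
  have s3: "\<alpha> (case_nat (bracket (X i) (X j)) (omit i (omit j X))) \<in> smooth_funs N" if "i < j" "j \<le> k" for i j
    by (rule \<alpha>, rule vform_ext_d_args[OF _ that]) (use Xv in auto)
  have "Avg (ext_d k \<alpha> X) = Avg (\<lambda>x. \<Sum>i\<le>k. (-1) ^ i * X i (\<alpha> (omit i X)) x) +
    Avg (\<lambda>x. \<Sum>j\<le>k. \<Sum>i<j. (-1) ^ (i + j) * \<alpha> (case_nat (bracket (X i) (X j)) (omit i (omit j X))) x)"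
    unfolding ext_d_def by (rule Avg_plus) (use s2 s3 in \<open>auto intro!: smooth_fun_sum smooth_fun_cmult\<close>)
  also have "Avg (\<lambda>x. \<Sum>i\<le>k. (-1) ^ i * X i (\<alpha> (omit i X)) x) = (\<Sum>i\<le>k. Avg (\<lambda>x. (-1) ^ i * X i (\<alpha> (omit i X)) x))"
    by (rule Avg_sum) (use s2 in \<open>auto intro!: smooth_fun_cmult\<close>)
  also have "\<dots> = 0"
    by (rule sum.neutral) (use s1 s2 X in \<open>auto simp: Avg_cmult invariant_Avg\<close>)
  also have "Avg (\<lambda>x. \<Sum>j\<le>k. \<Sum>i<j. (-1) ^ (i + j) * \<alpha> (case_nat (bracket (X i) (X j)) (omit i (omit j X))) x)
    = (\<Sum>j\<le>k. \<Sum>i<j. Avg (\<lambda>x. (-1) ^ (i + j) * \<alpha> (case_nat (bracket (X i) (X j)) (omit i (omit j X))) x))"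
    by (subst Avg_sum; (intro sum.cong refl Avg_sum)?) (use s3 in \<open>auto intro!: smooth_fun_sum smooth_fun_cmult\<close>)
  also have "\<dots> = (\<Sum>j\<le>k. \<Sum>i<j. (-1) ^ (i + j) * Avg (\<alpha> (case_nat (bracket (X i) (X j)) (omit i (omit j X)))))"
    by (intro sum.cong refl Avg_cmult s3) auto
  finally show ?thesis by simp
qed


section \<open>Balanced metrics\<close>


context
  fixes g assumes herm: "hermitian_metric N J g"
begin

definition "hq q v w = Re (g (E v) (E w) q)"

lemma hq_add: "hq q (x + y) z = hq q x z + hq q y z"
  and hq_scale: "hq q (c *\<^sub>R x) z = c * hq q x z"
  and hq_sym: "hq q x y = hq q y x"
  by (simp_all add: hq_def E_add E_scale g_add[OF herm] g_cscale[OF herm] g_sym[OF herm, of "E x"] E_vf)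

lemma hq_j: "hq q (j x) (j y) = hq q x y"
  by (simp add: hq_def J_E[symmetric] g_J[OF herm] E_vf)

lemma hq_pos: assumes q: "q \<in> points N" and x: "x \<noteq> 0" shows "hq q x x > 0"
proof -
  obtain f where f: "f \<in> smooth_funs N" "E x f q \<noteq> 0" using E_nonzero[OF x q] by blast
  show ?thesis unfolding hq_def by (rule g_pos[OF herm E_real_field q f])
qed

definition "omq q v w = hq q (j v) w"

lemma omq_bilinear: "omq q (x + y) z = omq q x z + omq q y z" "omq q z (x + y) = omq q z x + omq q z y"
  "omq q (c *\<^sub>R x) z = c * omq q x z" "omq q z (c *\<^sub>R x) = c * omq q z x"
  by (simp_all add: omq_def j_simps hq_add hq_scale hq_sym[of q "j z"])

lemma wedge_power_E:
  "q \<in> points N \<Longrightarrow> wedge_power N (fundamental_form J g) m (\<lambda>i. E (w i)) q = of_real (wp (omq q) m w)"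
proof (induction m arbitrary: w)
  case (Suc m)
  have "g (E x) (E y) q = of_real (hq q x y)" for x y
    unfolding hq_def using g_real[OF herm E_real_field E_real_field] by (simp add: of_real_Re)
  then have om: "g (J (E x)) (E y) q = of_real (omq q x y)" for x y by (simp add: omq_def J_E)
  have "wedge_power N (fundamental_form J g) (Suc m) (\<lambda>i. E (w i)) q = (\<Sum>\<sigma> | \<sigma> permutes {..<2 + 2 * m}.
      of_int (sign \<sigma>) * g (J (E (w (\<sigma> 0)))) (E (w (\<sigma> 1))) q *
      wedge_power N (fundamental_form J g) m (\<lambda>i. E (w (\<sigma> (2 + i)))) q) / (fact 2 * fact (2 * m))"
    by (simp add: wedge_def fundamental_form_def)
  also have "\<dots> = (\<Sum>\<sigma> | \<sigma> permutes {..<2 + 2 * m}. of_real (of_int (sign \<sigma>) * omq q (w (\<sigma> 0)) (w (\<sigma> 1)) *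
      wp (omq q) m (\<lambda>i. w (\<sigma> (2 + i))))) / (fact 2 * fact (2 * m))"
    using Suc.IH[OF Suc.prems] by (simp add: om)
  also have "\<dots> = of_real (wp (omq q) (Suc m) w)"
    by simp
  finally show ?case .
qed simp

definition "Om m w = Re (Avg (wedge_power N (fundamental_form J g) m (\<lambda>i. E (w i))))"

lemma wpE_smooth: "wedge_power N (fundamental_form J g) m (\<lambda>i. E (w i)) \<in> smooth_funs N"
  by (rule wedge_power_smooth[OF herm E_vf])

lemma wpE_eq: "wedge_power N (fundamental_form J g) m (\<lambda>i. E (w i)) =
    (\<lambda>q. indicator (points N) q * of_real (wp (omq q) m w))"
proof
  fix q show "wedge_power N (fundamental_form J g) m (\<lambda>i. E (w i)) q = indicator (points N) q * of_real (wp (omq q) m w)"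
    using wedge_power_E[of q m w] smooth_funsD(1)[OF wpE_smooth, of q m w] by (cases "q \<in> points N") auto
qed

lemma Avg_wp: "Avg (wedge_power N (fundamental_form J g) m (\<lambda>i. E (w i))) = of_real (Om m w)"
  unfolding Om_def by (rule of_real_Re[symmetric], rule Avg_real) (simp add: wpE_eq indicator_def)

lemma Om_alternating: "alternating_form (2 * m) (Om m)"
proof -
  have af: "alternating_form (2 * m) (wp (omq q) m)" for q by (rule wp_alternating) (rule omq_bilinear)+
  have s: "(\<lambda>q. indicator (points N) q * of_real (wp (omq q) m w)) \<in> smooth_funs N" for w
    using wpE_smooth[of m w] by (simp only: wpE_eq)
  define F where "F w = (\<lambda>q. indicator (points N) q * complex_of_real (wp (omq q) m w))" for w
  have Fs: "F w \<in> smooth_funs N" for w unfolding F_def by (rule s)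
  have Om: "Om m w = Re (Avg (F w))" for w by (simp add: Om_def wpE_eq F_def)
  have 1: "Om m w = Om m w'" if w: "\<forall>i<2*m. w i = w' i" for w w'
  proof -
    have "wp (omq q) m w = wp (omq q) m w'" for q by (rule af_cong[OF af]) (use w in simp)
    then show ?thesis by (simp add: Om F_def)
  qed
  have "F (w(i := x + y)) = (\<lambda>q. F (w(i := x)) q + F (w(i := y)) q)" if "i < 2 * m" for w i x y
    by (simp add: F_def af_add[OF af that] distrib_left del: fun_upd_apply)
  then have 2: "Om m (w(i := x + y)) = Om m (w(i := x)) + Om m (w(i := y))" if "i < 2 * m" for w i x y
    unfolding Om using that by (simp only: Avg_plus[OF Fs Fs] plus_complex.sel)
  have "F (w(i := c *\<^sub>R x)) = (\<lambda>q. of_real c * F (w(i := x)) q)" if "i < 2 * m" for w i x c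
    by (simp add: F_def af_scale[OF af that] mult.left_commute del: fun_upd_apply)
  then have 3: "Om m (w(i := c *\<^sub>R x)) = c * Om m (w(i := x))" if "i < 2 * m" for w i x c
    unfolding Om using that by (simp only: Avg_cmult[OF Fs] Re_complex_of_real Im_complex_of_real times_complex.sel)
  have 4: "Om m (w \<circ> Transposition.transpose a b) = - Om m w" if ab: "a < 2 * m" "b < 2 * m" "a \<noteq> b" for w a b
  proof -
    have "F (w \<circ> Transposition.transpose a b) = (\<lambda>q. (-1) * F w q)"
      by (simp only: F_def af_swap[OF af ab]) simp
    then show ?thesis unfolding Om by (simp only: Avg_cmult[OF Fs]) simp
  qed
  show ?thesis
    unfolding alternating_form_def
  proof (intro conjI allI impI)
    show "Om m w = Om m w'" if "\<forall>i<2*m. w i = w' i" for w w' by (rule 1[OF that])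
    show "Om m (w(i := x + y)) = Om m (w(i := x)) + Om m (w(i := y))" if "i < 2 * m" for w i x y by (rule 2[OF that])
    show "Om m (w(i := c *\<^sub>R x)) = c * Om m (w(i := x))" if "i < 2 * m" for w i c x by (rule 3[OF that])
    show "Om m (w \<circ> Transposition.transpose a b) = - Om m w" if "a < 2 * m" "b < 2 * m" "a \<noteq> b" for w a b
      by (rule 4[OF that])
  qed
qed

text \<open>At every point the power is positive on a Darboux basis of \<open>n1\<close> that
  depends on the point. If it vanished there on \<open>u\<close>, it would vanish on all of
  \<open>n1\<close>; so on the fixed family \<open>u\<close> it has no zero, and
  \<open>Avg_nonzero\<close> applies.\<close>

lemma Om_nonzero:
  assumes dim: "dim n1 = 2 * m" and u: "\<And>i. i < 2 * m \<Longrightarrow> u i \<in> n1"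
    and span: "\<And>y. y \<in> n1 \<Longrightarrow> \<exists>c. y = (\<Sum>l<2 * m. c l *\<^sub>R u l)"
  shows "Om m u \<noteq> 0"
proof -
  have nz: "wp (omq q) m u \<noteq> 0" if q: "q \<in> points N" for q
  proof
    assume zero: "wp (omq q) m u = 0"
    have "\<exists>u. (\<forall>i<2*m. u i \<in> n1) \<and> (\<forall>i<2*m. \<forall>l<2*m. hq q (u i) (u l) = (if i = l then 1 else 0)) \<and>
      (\<forall>i<m. u (2 * i + 1) = j (u (2 * i))) \<and> (\<forall>y\<in>n1. y = (\<Sum>i<2*m. hq q y (u i) *\<^sub>R u i))"
      by (rule adapted_basis[of "hq q" j n1 m, OF hq_add hq_scale hq_sym hq_pos[OF q] hq_j linear_j jj n1_subspace n1_j dim])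
    then obtain w where w: "\<And>i. i < 2*m \<Longrightarrow> w i \<in> n1"
        "\<And>i l. i < 2*m \<Longrightarrow> l < 2*m \<Longrightarrow> hq q (w i) (w l) = (if i = l then 1 else 0)"
      and wj: "\<And>i. i < m \<Longrightarrow> w (2 * i + 1) = j (w (2 * i))" by blast
    have neg: "hq q (- x) y = - hq q x y" for x y using hq_scale[of q "-1" x y] by simp
    have "symplectic (omq q) m w"
      unfolding symplectic_def
    proof (intro allI impI)
      fix a c assume ac: "a < 2 * m" "c < 2 * m"
      show "omq q (w a) (w c) = (if a div 2 = c div 2 then if a = c then 0 else if even a then 1 else - 1 else 0)"
      proof (cases "even a")
        case True
        then obtain i where i: "a = 2 * i" by blast
        have "omq q (w a) (w c) = hq q (w (2 * i + 1)) (w c)" using wj[of i] ac by (simp add: omq_def i)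
        also have "\<dots> = (if 2 * i + 1 = c then 1 else 0)" using w(2)[of "2 * i + 1" c] ac i by auto
        finally show ?thesis using i by (cases "even c") (auto elim!: oddE evenE)
      next
        case False
        then obtain i where i: "a = 2 * i + 1" using oddE by blast
        have "omq q (w a) (w c) = hq q (- w (2 * i)) (w c)" using wj[of i] ac by (simp add: omq_def i jj)
        also have "\<dots> = (if 2 * i = c then - 1 else 0)" using w(2)[of "2 * i" c] ac i by (auto simp: neg)
        finally show ?thesis using i by (cases "even c") (auto elim!: oddE evenE)
      qed
    qed
    then have "wp (omq q) m w > 0" by (rule wp_pos)
    moreover have "wp (omq q) m w = 0"
      by (rule af_vanish[OF wp_alternating[OF omq_bilinear] span u zero w(1)])
    ultimately show False by simp
  qed
  have "Avg (wedge_power N (fundamental_form J g) m (\<lambda>i. E (u i))) \<noteq> 0"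
    by (rule Avg_nonzero[OF wpE_smooth]) (use nz in \<open>simp_all add: wpE_eq indicator_def\<close>)
  then show ?thesis by (simp add: Avg_wp)
qed

text \<open>Closedness is tested on \<open>Z0\<close> followed by \<open>2 * m\<close> vectors of
  the ideal. Brackets inside the ideal vanish, so only those with \<open>Z0\<close> are left, one
  for each position.\<close>

lemma Om_closed:
  assumes closed: "vanishes N (2 * m + 1) (ext_d (2 * m) (wedge_power N (fundamental_form J g) m))"
    and e: "\<And>i. i < 2 * m \<Longrightarrow> pi (e i) = 0"
  shows "(\<Sum>l<2 * m. Om m (e(l := B (e l)))) = 0"
proof -
  let ?W = "wedge_power N (fundamental_form J g) m"
  define x where "x = case_nat Z0 e"
  have shift: "case_nat (E a) (omit i (omit l (\<lambda>n. E (x n)))) = (\<lambda>n. E (case_nat a (omit i (omit l x)) n))" for a i l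
    by (auto simp: fun_eq_iff omit_def split: nat.split)
  have "ext_d (2 * m) ?W (\<lambda>n. E (x n)) = 0"
    by (rule closed[unfolded vanishes_def, rule_format]) (rule E_vf)
  then have "0 = Avg (ext_d (2 * m) ?W (\<lambda>n. E (x n)))" using Avg_zero by (simp add: zero_fun_def)
  also have "\<dots> = (\<Sum>l\<le>2*m. \<Sum>i<l. (-1) ^ (i + l) * Avg (?W (case_nat (bracket (E (x i)) (E (x l))) (omit i (omit l (\<lambda>n. E (x n)))))))"
    by (rule Avg_ext_d) (simp_all add: wedge_power_smooth[OF herm] invariant_E)
  also have "\<dots> = of_real (\<Sum>l\<le>2*m. \<Sum>i<l. (-1) ^ (i + l) * Om m (case_nat (br (x i) (x l)) (omit i (omit l x))))"
    by (simp add: bracket_E shift Avg_wp)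
  finally have "0 = (\<Sum>l\<le>2*m. \<Sum>i<l. (-1) ^ (i + l) * Om m (case_nat (br (x i) (x l)) (omit i (omit l x))))"
    by (rule of_real_eq_0_iff[THEN iffD1, OF sym, THEN sym])
  also have "\<dots> = (\<Sum>l<2*m. \<Sum>i<Suc l. (-1) ^ (i + Suc l) * Om m (case_nat (br (x i) (x (Suc l))) (omit i (omit (Suc l) x))))"
    by (simp only: sum.atMost_shift) simp
  also have "\<dots> = (\<Sum>l<2*m. - Om m (e(l := B (e l))))"
  proof (rule sum.cong[OF refl])
    fix l assume "l \<in> {..<2*m}" then have l: "l < 2 * m" by simp
    have "Om m (case_nat (br (x (Suc i)) (x (Suc l))) (omit (Suc i) (omit (Suc l) x))) = 0" if "i < l" for i
    proof (rule af_zero[OF Om_alternating, of 0])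
      show "case_nat (br (x (Suc i)) (x (Suc l))) (omit (Suc i) (omit (Suc l) x)) 0 = 0"
        using e[of i] e[of l] that l by (simp add: x_def br_abelian)
    qed (use l in simp)
    then have "(\<Sum>i<Suc l. (-1) ^ (i + Suc l) * Om m (case_nat (br (x i) (x (Suc l))) (omit i (omit (Suc l) x))))
      = (-1) ^ Suc l * Om m (case_nat (br (x 0) (x (Suc l))) (omit 0 (omit (Suc l) x)))"
      by (simp only: sum.lessThan_Suc_shift) simp
    also have "case_nat (br (x 0) (x (Suc l))) (omit 0 (omit (Suc l) x)) = case_nat (B (e l)) (omit l e)"
      by (auto simp: fun_eq_iff omit_def x_def split: nat.split)
    also have "(-1) ^ Suc l * Om m (case_nat (B (e l)) (omit l e)) = (-1) ^ Suc l * ((-1) ^ l * Om m (e(l := B (e l))))"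
      by (simp only: af_cycle[OF Om_alternating l])
    also have "\<dots> = - Om m (e(l := B (e l)))"
      by (simp add: mult.assoc[symmetric] power_add[symmetric] del: fun_upd_apply)
    finally show "(\<Sum>i<Suc l. (-1) ^ (i + Suc l) * Om m (case_nat (br (x i) (x (Suc l))) (omit i (omit (Suc l) x))))
      = - Om m (e(l := B (e l)))" .
  qed
  finally show ?thesis by (simp add: sum_negf)
qed

end

text \<open>The line complementary to \<open>n1\<close> is chosen so that replacing any \<open>u i\<close> by a vector \<open>v\<close> on it makes \<open>f\<close>
  vanish; closedness with \<open>v\<close> in the place of \<open>u i\<close> then says that \<open>B v\<close> has no component along \<open>u i\<close>.\<close>

lemma balanced_algebra:
  assumes f: "alternating_form k f" and fu: "f u \<noteq> 0"
    and closed: "\<And>e. (\<And>i. i < k \<Longrightarrow> pi (e i) = 0) \<Longrightarrow> (\<Sum>l<k. f (e(l := B (e l)))) = 0"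
    and u: "\<And>i. i < k \<Longrightarrow> u i \<in> n1"
    and expand: "\<And>y. y \<in> n1 \<Longrightarrow> y = (\<Sum>l<k. h y (u l) *\<^sub>R u l)"
  shows "(\<Sum>i<k. h (B (u i)) (u i)) = 0"
    and "\<exists>v a. pi v = 0 \<and> pi (j v) = 1 \<and> B v = a *\<^sub>R v"
proof -
  have rep0: "f (w(l := w i)) = 0" if "i < k" "l < k" "i \<noteq> l" for w i l
    by (rule af_repeat[OF f that(1,2,3)]) (use that in simp)
  \<comment> \<open>When \<open>y\<close> is expanded, every term except the one along
    \<open>u l\<close> repeats an argument.\<close>
  have single: "f (u(l := y)) = h y (u l) * f u" if "l < k" "y \<in> n1" for l y
  proof -
    have "f (u(l := y)) = f (u(l := (\<Sum>s<k. h y (u s) *\<^sub>R u s)))" using expand[OF that(2)] by simp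
    also have "\<dots> = (\<Sum>s<k. h y (u s) * f (u(l := u s)))" by (rule af_sum[OF f that(1)])
    also have "\<dots> = (\<Sum>s<k. if s = l then h y (u l) * f u else 0)"
      by (rule sum.cong[OF refl]) (use rep0[of _ l u] that in auto)
    finally show ?thesis using that by simp
  qed
  have "(\<Sum>l<k. h (B (u l)) (u l) * f u) = 0"
    using closed[of u] u single n1_B by (simp add: n1_def)
  then show "(\<Sum>i<k. h (B (u i)) (u i)) = 0" using fu by (simp add: sum_distrib_right[symmetric])
  define v where "v = V0 - (\<Sum>i<k. (f (u(i := V0)) / f u) *\<^sub>R u i)"
  have s1: "(\<Sum>i<k. (f (u(i := V0)) / f u) *\<^sub>R u i) \<in> n1"
    by (intro subspace_sum[OF n1_subspace] subspace_scale[OF n1_subspace] u) auto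
  then have v: "pi v = 0" "pi (j v) = 1" by (simp_all add: v_def n1_def V0 j_simps)
  have V0v: "V0 = v + (\<Sum>i<k. (f (u(i := V0)) / f u) *\<^sub>R u i)" by (simp add: v_def)
  have fv: "f (u(i := v)) = 0" if i: "i < k" for i
  proof -
    have "f (u(i := V0)) = f (u(i := v)) + f (u(i := (\<Sum>l<k. (f (u(l := V0)) / f u) *\<^sub>R u l)))"
      by (subst V0v) (rule af_add[OF f i])
    also have "f (u(i := (\<Sum>l<k. (f (u(l := V0)) / f u) *\<^sub>R u l))) = (\<Sum>l<k. (f (u(l := V0)) / f u) * f (u(i := u l)))"
      by (rule af_sum[OF f i])
    also have "\<dots> = (\<Sum>l<k. if l = i then f (u(i := V0)) else 0)"
      by (rule sum.cong[OF refl]) (use rep0[of _ i u] i fu in auto)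
    also have "\<dots> = f (u(i := V0))" by (subst sum.delta) (use i in \<open>simp_all only: finite_lessThan lessThan_iff if_True\<close>)
    finally show ?thesis by linarith
  qed
  \<comment> \<open>The only possible eigenvalue, because \<open>pi (j v) = 1\<close>. With it the
    difference lies in \<open>n1\<close> and can be tested against the basis.\<close>
  define a where "a = pi (j (B v))"
  have d: "B v - a *\<^sub>R v \<in> n1" using v by (simp add: n1_def a_def j_simps)
  have "h (B v - a *\<^sub>R v) (u i) = 0" if i: "i < k" for i
  proof -
    let ?e = "u(i := v)"
    have "f (?e(l := B (?e l))) = (if l = i then h (B v - a *\<^sub>R v) (u i) * f u else 0)" if l: "l < k" for l
    proof (cases "l = i")
      case True
      have "f (u(i := B v)) = f (u(i := (B v - a *\<^sub>R v) + a *\<^sub>R v))" by simp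
      also have "\<dots> = f (u(i := B v - a *\<^sub>R v)) + a * f (u(i := v))"
        by (simp only: af_add[OF f i] af_scale[OF f i])
      finally show ?thesis using True fv[OF i] single[OF i d] by simp
    next
      case False
      have "f (?e(l := B (u l))) = f (?e(l := (\<Sum>s<k. h (B (u l)) (u s) *\<^sub>R u s)))"
        using expand[OF n1_B[OF u[OF l]]] by simp
      also have "\<dots> = (\<Sum>s<k. h (B (u l)) (u s) * f (?e(l := u s)))" by (rule af_sum[OF f l])
      also have "\<dots> = 0"
      proof (rule sum.neutral, rule ballI)
        fix s assume "s \<in> {..<k}" then have s: "s < k" by simp
        \<comment> \<open>The three ways in which the term vanishes: the list is \<open>?e\<close>
          again, it is \<open>u\<close> with \<open>v\<close> at position \<open>l\<close> up to a
          swap, or \<open>u s\<close> occurs twice.\<close>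
        consider "s = l" | "s = i" | "s \<noteq> l" "s \<noteq> i" by blast
        then have "f (?e(l := u s)) = 0"
        proof cases
          case 1
          have e: "?e(l := u l) = ?e" using False by (auto simp: fun_eq_iff)
          show ?thesis unfolding 1 e by (rule fv[OF i])
        next
          case 2
          have e: "?e(l := u i) = u(l := v) \<circ> Transposition.transpose i l"
            using False by (auto simp: fun_eq_iff Transposition.transpose_def)
          show ?thesis unfolding 2 e af_swap[OF f i l False[symmetric]] fv[OF l] by simp
        next
          case 3
          have e: "?e s = u s" using 3 by simp
          show ?thesis by (rule rep0[OF s l 3(1), of ?e, unfolded e])
        qed
        then show "h (B (u l)) (u s) * f (?e(l := u s)) = 0" by (rule ssubst) (rule mult_zero_right)
      qed
      finally show ?thesis using False by simp
    qed
    then have "(\<Sum>l<k. if l = i then h (B v - a *\<^sub>R v) (u i) * f u else 0) = (\<Sum>l<k. f (?e(l := B (?e l))))"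
      by (intro sum.cong refl) (simp del: fun_upd_apply)
    also have "\<dots> = 0" by (rule closed) (use u v in \<open>auto simp: n1_def\<close>)
    finally show ?thesis using i fu by simp
  qed
  then have "B v - a *\<^sub>R v = 0" using expand[OF d] by simp
  then show "\<exists>v a. pi v = 0 \<and> pi (j v) = 1 \<and> B v = a *\<^sub>R v" using v by auto
qed


section \<open>SKT metrics\<close>


lemma Avg_ext_d2:
  assumes \<alpha>: "vform 2 \<alpha>" and X: "\<And>i. i \<le> 2 \<Longrightarrow> invariant (X i)"
  shows "Avg (ext_d 2 \<alpha> X) = - Avg (\<alpha> (seq2 (bracket (X 0) (X 1)) (X 2)))
    + Avg (\<alpha> (seq2 (bracket (X 0) (X 2)) (X 1))) - Avg (\<alpha> (seq2 (bracket (X 1) (X 2)) (X 0)))"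
proof -
  have s: "{..2::nat} = {0, 1, 2}" "{..<1::nat} = {0}" "{..<2::nat} = {0, 1}" by auto
  have "Avg (ext_d 2 \<alpha> X) = (\<Sum>l\<le>2. \<Sum>i<l. (-1) ^ (i + l) *
        Avg (\<alpha> (case_nat (bracket (X i) (X l)) (omit i (omit l X)))))"
    by (rule Avg_ext_d) (use vform_smooth[OF \<alpha>] X in auto)
  also have "\<dots> = (\<Sum>l\<le>2. \<Sum>i<l. (-1) ^ (i + l) * Avg (\<alpha> (seq2 (bracket (X i) (X l)) (omit i (omit l X) 0))))"
    by (simp only: vform2_seq[OF \<alpha>, of "case_nat a b" for a b] nat.case One_nat_def)
  finally show ?thesis
    by (simp add: s omit_def numeral_2_eq_2)
qed

lemma Avg_ext_d3:
  assumes \<alpha>: "vform 3 \<alpha>" and X: "\<And>i. i \<le> 3 \<Longrightarrow> invariant (X i)"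
  shows "Avg (ext_d 3 \<alpha> X) = - Avg (\<alpha> (seq3 (bracket (X 0) (X 1)) (X 2) (X 3)))
    + Avg (\<alpha> (seq3 (bracket (X 0) (X 2)) (X 1) (X 3))) - Avg (\<alpha> (seq3 (bracket (X 1) (X 2)) (X 0) (X 3)))
    - Avg (\<alpha> (seq3 (bracket (X 0) (X 3)) (X 1) (X 2))) + Avg (\<alpha> (seq3 (bracket (X 1) (X 3)) (X 0) (X 2)))
    - Avg (\<alpha> (seq3 (bracket (X 2) (X 3)) (X 0) (X 1)))"
proof -
  have s: "{..3::nat} = {0, 1, 2, 3}" "{..<1::nat} = {0}" "{..<2::nat} = {0, 1}" "{..<3::nat} = {0, 1, 2}" by auto
  have "Avg (ext_d 3 \<alpha> X) = (\<Sum>l\<le>3. \<Sum>i<l. (-1) ^ (i + l) *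
        Avg (\<alpha> (case_nat (bracket (X i) (X l)) (omit i (omit l X)))))"
    by (rule Avg_ext_d) (use vform_smooth[OF \<alpha>] X in auto)
  also have "\<dots> = (\<Sum>l\<le>3. \<Sum>i<l. (-1) ^ (i + l) *
      Avg (\<alpha> (seq3 (bracket (X i) (X l)) (omit i (omit l X) 0) (omit i (omit l X) (Suc 0)))))"
    by (simp only: vform3_seq[OF \<alpha>, of "case_nat a b" for a b] nat.case One_nat_def numeral_2_eq_2)
  finally show ?thesis
    by (simp add: s omit_def numeral_2_eq_2 numeral_3_eq_3)
qed

text \<open>Left-invariant fields with complex coefficients, kept as pairs of vectors so that
  brackets and \<open>J\<close> are computed in the real Lie algebra.\<close>

definition C :: "'e \<Rightarrow> 'e \<Rightarrow> 'q vfield" where "C x y = E x + cscale \<i> (E y)"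

lemma C_vf: "C x y \<in> VF"
  by (simp add: C_def vf_add vf_cscale E_vf)

lemma C_invariant: "invariant (C x y)"
  by (auto simp: C_def invariant_def)

lemma C_apply: "C x y f q = E x f q + \<i> * E y f q"
  by (simp add: C_def cscale_apply)

lemma C_zero: "C 0 0 = 0"
  by (simp add: C_def E_zero cscale_zero_right)

lemma J_C: "J (C x y) = C (j x) (j y)"
  by (simp add: C_def J_add J_cscale vf_cscale E_vf J_E)

lemma C_cscale: "cscale \<i> (C x y) = C (- y) x" "cscale (-\<i>) (C x y) = C y (- x)"
  "cscale (of_real r) (C x y) = C (r *\<^sub>R x) (r *\<^sub>R y)"
  by (simp_all add: fun_eq_iff cscale_apply C_apply E_minus E_scale algebra_simps)

lemma C_add: "C x y + C x' y' = C (x + x') (y + y')"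
  by (simp add: fun_eq_iff C_apply E_add algebra_simps)

lemma bracket_C: "bracket (C x y) (C x' y') = C (br x x' - br y y') (br x y' + br y x')"
proof -
  have "bracket (C x y) (C x' y') = (E (br x x') + cscale \<i> (E (br y x'))) + cscale \<i> (E (br x y') + cscale \<i> (E (br y y')))"
    by (simp add: C_def bracket_add bracket_cscale vf_add vf_cscale E_vf bracket_E)
  then show ?thesis
    by (simp add: fun_eq_iff C_apply cscale_apply E_add E_diff algebra_simps)
qed

text \<open>Twice the (1, 0)-part of the frame field \<open>E u\<close>; \<open>Qf u\<close> is
  twice the (0, 1)-part.\<close>

definition Pf :: "'e \<Rightarrow> 'q vfield" where "Pf u = C u (- j u)"
definition Qf :: "'e \<Rightarrow> 'q vfield" where "Qf u = C u (j u)"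

lemma isP_Pf: "isP (Pf u)" and isQ_Qf: "isQ (Qf u)"
  by (simp_all add: isP_def isQ_def Pf_def Qf_def C_vf J_C C_cscale j_simps)

lemma PQ_invariant: "invariant (Pf u)" "invariant (Qf u)"
  by (simp_all add: Pf_def Qf_def C_invariant)

lemma PQ_vf: "Pf u \<in> VF" "Qf u \<in> VF"
  by (simp_all add: Pf_def Qf_def C_vf)

lemma part01_C: "part01 J (C x y) = C ((1/2) *\<^sub>R (x - j y)) ((1/2) *\<^sub>R (y + j x))"
  using C_cscale(3)[of "1/2"] by (simp add: part01_def J_C C_cscale C_add)

lemma br_n1: "x \<in> n1 \<Longrightarrow> y \<in> n1 \<Longrightarrow> br x y = 0"
  by (simp add: n1_def br_abelian)

lemma br_zero: "br x 0 = 0" "br 0 x = 0"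
  using br_scale_right[of x 0 0] br_scale_left[of 0 0 x] by simp_all

lemma br_self: "br x x = 0"
proof -
  have "2 *\<^sub>R br x x = 0" using br_swap[of x x] by (simp only: scaleR_2 eq_neg_iff_add_eq_0)
  then show ?thesis by simp
qed

lemma br_neg: "br x (- y) = - br x y" "br (- x) y = - br x y"
  using br_scale_right[of x "-1" y] br_scale_left[of "-1" x y] by simp_all

lemma n1_neg: "x \<in> n1 \<Longrightarrow> - x \<in> n1"
  using subspace_neg[OF n1_subspace] .

lemma bracket_n1: assumes "u \<in> n1" "w \<in> n1"
  shows "bracket (Pf u) (Qf w) = 0" "bracket (Qf w) (Pf u) = 0"
  using assms by (simp_all add: Pf_def Qf_def bracket_C br_neg br_n1 n1_j n1_neg C_zero)

context
  fixes g assumes herm: "hermitian_metric N J g"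
begin

definition "G u w = Re (Avg (g (E u) (E w)))"

lemma Avg_G: "Avg (g (E u) (E w)) = of_real (G u w)"
  unfolding G_def by (rule of_real_Re[symmetric], rule Avg_real) (rule g_real[OF herm E_real_field E_real_field])

lemma gE_smooth: "g (E u) (E w) \<in> smooth_funs N"
  by (rule g_smooth[OF herm E_vf E_vf])

lemma G_add: "G (x + y) z = G x z + G y z"
  by (simp add: G_def E_add g_add[OF herm] E_vf Avg_add gE_smooth)

lemma G_scale: "G (c *\<^sub>R x) z = c * G x z"
  by (simp add: G_def E_scale g_cscale[OF herm] E_vf Avg_cmult gE_smooth)

lemma G_sym: "G x y = G y x"
  by (simp add: G_def g_sym[OF herm, of "E x"] E_vf)

lemma G_j: "G (j x) (j y) = G x y"
  by (simp add: G_def J_E[symmetric] g_J[OF herm] E_vf)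

lemma G_pos: "x \<noteq> 0 \<Longrightarrow> G x x > 0"
  unfolding G_def using hq_pos[OF herm, of _ x] by (intro Avg_pos gE_smooth) (simp add: hq_def[OF herm])

lemma G_simps: "G (- x) y = - G x y" "G x (- y) = - G x y" "G x (c *\<^sub>R y) = c * G x y" "G x (y + z) = G x y + G x z"
  "G 0 x = 0" "G x 0 = 0"
  using G_scale[of "-1" x y] G_scale[of "-1" y x] G_scale[of c y x] G_add[of y z x] G_scale[of 0 0 x]
  by (simp_all add: G_sym[of x])

lemma Avg_g_C: "Avg (g (C x y) (C x' y')) = of_real (G x x' - G y y') + \<i> * of_real (G x y' + G y x')"
proof -
  have "g (C x y) (C x' y') = (\<lambda>q. (g (E x) (E x') q + \<i> * g (E y) (E x') q) + \<i> * (g (E x) (E y') q + \<i> * g (E y) (E y') q))"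
    by (simp add: C_def g_add[OF herm] g_add_right[OF herm] g_cscale[OF herm] vf_add vf_cscale E_vf fun_eq_iff)
  then show ?thesis
    by (simp only: Avg_plus Avg_cmult smooth_fun_add smooth_fun_cmult gE_smooth Avg_G) (simp add: algebra_simps)
qed

abbreviation "\<omega> \<equiv> fundamental_form J g"
definition "\<omega>11 = type_part J 1 1 \<omega>"

lemma e12: "1 + 2 = (3::nat)" and e11: "1 + 1 = (2::nat)" by simp_all

lemma vform_\<omega>11: "vform 2 \<omega>11"
  unfolding \<omega>11_def using vform_type_part[of 1 1 \<omega>, unfolded e11] vform_fundamental_form[OF herm] .

lemma \<omega>11_eval:
  "isP X \<and> isQ Y \<or> isQ X \<and> isP Y \<Longrightarrow> \<omega>11 (seq2 X Y) = g (J X) Y"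
proof -
  assume XY: "isP X \<and> isQ Y \<or> isQ X \<and> isP Y"
  define S where "S = (if isP X \<and> isQ Y then {0} else {1::nat})"
  have "\<omega>11 (seq2 X Y) = (if card S = 1 then \<omega> (seq2 X Y) else 0)"
    unfolding \<omega>11_def
    by (rule type_part_pure[of 1 1, unfolded e11]) (use XY vform_fundamental_form[OF herm] in \<open>auto simp: S_def less_2_cases_iff split: if_splits\<close>)
  then show ?thesis by (simp add: S_def fundamental_form_def)
qed

text \<open>The real part of the average is a multiple of \<open>G (j u) w\<close>; the imaginary
  part isolates \<open>G u w\<close>, in which the SKT identity is to be stated.\<close>

lemma Im_\<omega>11: "Im (Avg (\<omega>11 (seq2 (Pf u) (Qf w)))) = 2 * G u w" "Im (Avg (\<omega>11 (seq2 (Qf w) (Pf u)))) = - 2 * G u w"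
  by (simp_all add: \<omega>11_eval isP_Pf isQ_Qf)
    (simp_all add: Pf_def Qf_def J_C Avg_g_C j_simps G_simps G_j G_sym[of w])

lemma \<omega>11_zero: "Y \<in> VF \<Longrightarrow> Avg (\<omega>11 (seq2 0 Y)) = 0"
proof -
  assume Y: "Y \<in> VF"
  have "\<omega>11 (seq2 0 Y) = 0"
    by (rule vform_zero[OF vform_\<omega>11, of 0]) (use vf_zero Y in \<open>auto simp: less_2_cases_iff\<close>)
  then show ?thesis using Avg_zero by (simp add: zero_fun_def)
qed

abbreviation "\<delta> \<equiv> delbar J 2 \<omega>"
definition "\<delta>12 = type_part J 1 2 \<delta>"

lemma vform_\<delta>: "vform 3 \<delta>" "vform 3 \<delta>12"
proof -
  show 1: "vform 3 \<delta>" by (rule vform_delbar2[OF vform_fundamental_form[OF herm]])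
  show "vform 3 \<delta>12" unfolding \<delta>12_def using vform_type_part[of 1 2 \<delta>, unfolded e12] 1 .
qed

lemma \<delta>12_eval:
  assumes S: "S \<subseteq> {..<3}" and P: "\<And>i. i \<in> S \<Longrightarrow> isP (Y i)" and Q: "\<And>i. i < 3 \<Longrightarrow> i \<notin> S \<Longrightarrow> isQ (Y i)"
  shows "\<delta>12 Y = (if card S = 1 then ext_d 2 \<omega>11 Y else 0)"
proof -
  have "\<delta>12 Y = (if card S = 1 then \<delta> Y else 0)"
    unfolding \<delta>12_def by (rule type_part_pure[of 1 2, unfolded e12]) (use S P Q vform_\<delta> in auto)
  then show ?thesis using delbar2_pure[OF vform_fundamental_form[OF herm] S _ P Q] by (simp add: \<omega>11_def)
qed

text \<open>Next to one (1, 0)- and one (0, 1)-argument, a form of type (1, 2) sees only the (0,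
  1)-part of the third. This serves the bracket of \<open>Pf v\<close> and \<open>Qf v\<close>,
  which is of mixed type.\<close>

lemma \<delta>12_mixed:
  assumes X: "X \<in> VF" and P: "isP Y" and Q: "isQ Z" and X': "isQ (part01 J X)"
  shows "\<delta>12 (seq3 X Y Z) = \<delta>12 (seq3 (part01 J X) Y Z)"
proof -
  let ?Y = "seq3 X Y Z"
  have YZ: "Y \<in> VF" "Z \<in> VF" using P Q by (auto simp: isP_def isQ_def)
  have "\<delta>12 ?Y = \<delta> (\<lambda>i. if i \<in> {1} then part10 J (?Y i) else part01 J (?Y i))"
    unfolding \<delta>12_def
  proof (rule type_part_eval[of 1 2, unfolded e12])
    fix S' :: "nat set" assume S': "S' \<subseteq> {..<3}" "card S' = 1" "S' \<noteq> {1}"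
    then obtain s where "S' = {s}" by (auto simp: card_1_singleton_iff)
    then have s: "S' = {s}" "s = 0 \<or> s = 2" using S' by auto
    then show "\<exists>i<3. (if i \<in> S' then part10 J (?Y i) else part01 J (?Y i)) = 0"
      using part_pure(2)[OF P] part_pure(3)[OF Q] by (intro exI[of _ "if s = 0 then 1 else 2"]) auto
  qed (use vform_\<delta> X YZ in \<open>auto simp: less_3\<close>)
  also have "\<dots> = \<delta> (seq3 (part01 J X) Y Z)"
    by (rule vform_cong[OF vform_\<delta>(1)]) (use part_pure(1)[OF P] part_pure(4)[OF Q] in \<open>auto simp: less_3\<close>)
  also have "\<dots> = \<delta>12 (seq3 (part01 J X) Y Z)"
  proof -
    have "\<delta>12 (seq3 (part01 J X) Y Z) = (if card {1::nat} = 1 then \<delta> (seq3 (part01 J X) Y Z) else 0)"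
      unfolding \<delta>12_def by (rule type_part_pure[of 1 2, unfolded e12]) (use vform_\<delta> P Q X' in \<open>auto simp: less_3\<close>)
    then show ?thesis by simp
  qed
  finally show ?thesis .
qed

lemma Avg_\<delta>12:
  assumes inv: "invariant X" "invariant Y" "invariant Z" and Z: "isQ Z"
    and XY: "isP X \<and> isQ Y \<or> isQ X \<and> isP Y"
  shows "Avg (\<delta>12 (seq3 X Y Z)) = - Avg (\<omega>11 (seq2 (bracket X Y) Z)) + Avg (\<omega>11 (seq2 (bracket X Z) Y))
    - Avg (\<omega>11 (seq2 (bracket Y Z) X))"
proof -
  define S where "S = (if isP X \<and> isQ Y then {0} else {1::nat})"
  have "\<delta>12 (seq3 X Y Z) = (if card S = 1 then ext_d 2 \<omega>11 (seq3 X Y Z) else 0)"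
    by (rule \<delta>12_eval) (use XY Z in \<open>auto simp: S_def less_3 split: if_splits\<close>)
  then have "\<delta>12 (seq3 X Y Z) = ext_d 2 \<omega>11 (seq3 X Y Z)" by (simp add: S_def)
  moreover have "invariant (seq3 X Y Z i)" if "i \<le> 2" for i
  proof -
    have "i = 0 \<or> i = 1 \<or> i = 2" using that by auto
    then show ?thesis using inv by auto
  qed
  ultimately show ?thesis using Avg_ext_d2[OF vform_\<omega>11, of "seq3 X Y Z"] by simp
qed

lemma \<delta>12_two:
  assumes "isP X \<and> isP Y \<and> isQ Z \<or> isQ X \<and> isP Y \<and> isP Z" shows "Avg (\<delta>12 (seq3 X Y Z)) = 0"
proof -
  define S where "S = (if isP X \<and> isP Y \<and> isQ Z then {0, 1} else {1::nat, 2})"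
  have "\<delta>12 (seq3 X Y Z) = (if card S = 1 then ext_d 2 \<omega>11 (seq3 X Y Z) else 0)"
    by (rule \<delta>12_eval) (use assms in \<open>auto simp: S_def less_3 split: if_splits\<close>)
  then show ?thesis using Avg_zero by (simp add: S_def zero_fun_def)
qed

lemma \<delta>12_zero: assumes "Y \<in> VF" "Z \<in> VF" shows "Avg (\<delta>12 (seq3 0 Y Z)) = 0"
proof -
  have "\<delta>12 (seq3 0 Y Z) = 0"
    by (rule vform_zero[OF vform_\<delta>(2), of 0]) (use assms vf_zero in \<open>auto simp: less_3\<close>)
  then show ?thesis using Avg_zero by (simp add: zero_fun_def)
qed

lemma SKT_identity:
  assumes skt: "vanishes N 4 (del J 3 \<delta>)"
    and v: "pi v = 0" "pi (j v) = 1" "B v = a *\<^sub>R v" and u: "u \<in> n1" and w: "w \<in> n1"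
  shows "G (B (B u)) w + 2 * G (B u) (B w) + G u (B (B w)) + a * (G (B u) w + G u (B w)) = 0"
proof -
  have br: "br v x = 0" "br x v = 0" "br (j v) x = B x" "br x (j v) = - B x" if "x \<in> n1" for x
    using that v(1,2) br_ideal[of x "j v"] br_swap[of x "j v"] by (auto simp: n1_def br_abelian)
  have brv: "br v v = 0" "br (j v) (j v) = 0" "br (j v) v = a *\<^sub>R v" "br v (j v) = - a *\<^sub>R v"
    using v br_swap[of v "j v"] br_ideal[of v "j v"] br_self by (simp_all add: br_abelian)
  have B: "B 0 = 0" "B (- x) = - B x" for x using br_zero br_neg by auto
  \<comment> \<open>Since \<open>v\<close> commutes with \<open>n1\<close> and \<open>j v\<close>
    acts on it as \<open>B\<close>, \<open>Pf v\<close> acts as -i times \<open>B\<close> and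
    \<open>Qf v\<close> as i times \<open>B\<close>; multiplication by i is \<open>j\<close> under
    \<open>Pf\<close> and \<open>- j\<close> under \<open>Qf\<close>.\<close>
  have PvP: "bracket (Pf v) (Pf x) = Pf (- j (B x))"
    and PvQ: "bracket (Pf v) (Qf x) = Qf (j (B x))"
    and PQv: "bracket (Pf x) (Qf v) = Pf (- j (B x))"
    and QvQ: "bracket (Qf v) (Qf x) = Qf (- j (B x))"
    and QQv: "bracket (Qf x) (Qf v) = Qf (j (B x))"
    and QaP: "bracket (Qf (a *\<^sub>R j v)) (Pf x) = Pf (a *\<^sub>R B x)"
    and QaQ: "bracket (Qf (a *\<^sub>R j v)) (Qf x) = Qf (a *\<^sub>R B x)" if "x \<in> n1" for x
    using that br[OF that] br[OF n1_j[OF that]]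
    by (simp_all add: Pf_def Qf_def bracket_C br_neg br_scale_left br_scale_right j_simps B_j)
  have half: "(1/2) *\<^sub>R (- x - x) = - x" for x :: 'e
    by (simp only: diff_conv_add_uminus scaleR_half_double)
  \<comment> \<open>The bracket itself is -2 i a times \<open>E v\<close>; only its (0, 1)-part will
    count, and it is the source of the terms with the factor \<open>a\<close>.\<close>
  have PvQv: "part01 J (bracket (Pf v) (Qf v)) = Qf (a *\<^sub>R j v)"
    by (simp add: Pf_def Qf_def bracket_C part01_C br_neg brv j_simps half)
  have n1s: "B u \<in> n1" "B w \<in> n1" "j (B u) \<in> n1" "j (B w) \<in> n1" "- j (B u) \<in> n1" "- j (B w) \<in> n1"
    using u w n1_B n1_j n1_neg by auto
  have jB: "j (B (j (B x))) = - B (B x)" if "x \<in> n1" for x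
    using B_j[OF n1_B[OF that]] by (simp add: jj)
  define X where "X = case_nat (Pf v) (seq3 (Pf u) (Qf v) (Qf w))"
  have Xs: "X 0 = Pf v" "X 1 = Pf u" "X 2 = Qf v" "X 3 = Qf w"
    by (simp_all add: X_def numeral_2_eq_2 numeral_3_eq_3)
  have le3: "i \<le> 3 \<longleftrightarrow> i = 0 \<or> i = 1 \<or> i = 2 \<or> i = (3::nat)" for i by auto
  have "del J 3 \<delta> X = ext_d 3 \<delta>12 X"
    unfolding \<delta>12_def
    by (rule del3_pure[OF vform_\<delta>(1), of "{0, 1}"])
      (use le3 Xs isP_Pf isQ_Qf in \<open>auto simp: less_Suc_eq_le[of _ 3, simplified]\<close>)
  moreover have "del J 3 \<delta> X = 0"
    by (rule skt[unfolded vanishes_def, rule_format])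
      (use le3 Xs PQ_vf in \<open>auto simp: less_Suc_eq_le[of _ 3, simplified]\<close>)
  ultimately have "0 = Avg (ext_d 3 \<delta>12 X)" using Avg_zero by (simp add: zero_fun_def)
  also have "\<dots> = - Avg (\<delta>12 (seq3 (Pf (- j (B u))) (Qf v) (Qf w))) + Avg (\<delta>12 (seq3 (bracket (Pf v) (Qf v)) (Pf u) (Qf w)))
      - Avg (\<delta>12 (seq3 (Pf (- j (B u))) (Pf v) (Qf w))) - Avg (\<delta>12 (seq3 (Qf (j (B w))) (Pf u) (Qf v)))
      + Avg (\<delta>12 (seq3 0 (Pf v) (Qf v))) - Avg (\<delta>12 (seq3 (Qf (- j (B w))) (Pf v) (Pf u)))"
  proof -
    have "Avg (ext_d 3 \<delta>12 X) = - Avg (\<delta>12 (seq3 (bracket (X 0) (X 1)) (X 2) (X 3)))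
      + Avg (\<delta>12 (seq3 (bracket (X 0) (X 2)) (X 1) (X 3))) - Avg (\<delta>12 (seq3 (bracket (X 1) (X 2)) (X 0) (X 3)))
      - Avg (\<delta>12 (seq3 (bracket (X 0) (X 3)) (X 1) (X 2))) + Avg (\<delta>12 (seq3 (bracket (X 1) (X 3)) (X 0) (X 2)))
      - Avg (\<delta>12 (seq3 (bracket (X 2) (X 3)) (X 0) (X 1)))"
      by (rule Avg_ext_d3[OF vform_\<delta>(2)]) (use le3 Xs PQ_invariant in auto)
    then show ?thesis by (simp only: Xs PvP[OF u] PvQ[OF w] PQv[OF u] QvQ[OF w] bracket_n1[OF u w])
  qed
  finally have eq0: "0 = - Avg (\<delta>12 (seq3 (Pf (- j (B u))) (Qf v) (Qf w))) + Avg (\<delta>12 (seq3 (bracket (Pf v) (Qf v)) (Pf u) (Qf w)))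
      - Avg (\<delta>12 (seq3 (Pf (- j (B u))) (Pf v) (Qf w))) - Avg (\<delta>12 (seq3 (Qf (j (B w))) (Pf u) (Qf v)))
      + Avg (\<delta>12 (seq3 0 (Pf v) (Qf v))) - Avg (\<delta>12 (seq3 (Qf (- j (B w))) (Pf v) (Pf u)))" .
  have z1: "\<delta>12 (seq3 (bracket (Pf v) (Qf v)) (Pf u) (Qf w)) = \<delta>12 (seq3 (Qf (a *\<^sub>R j v)) (Pf u) (Qf w))"
    using \<delta>12_mixed[of "bracket (Pf v) (Qf v)" "Pf u" "Qf w"]
    by (simp only: PvQv isP_Pf isQ_Qf bracket_field PQ_vf)
  have z2: "Avg (\<delta>12 (seq3 (Pf (- j (B u))) (Pf v) (Qf w))) = 0" by (rule \<delta>12_two) (simp add: isP_Pf isQ_Qf)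
  have z3: "Avg (\<delta>12 (seq3 (Qf (- j (B w))) (Pf v) (Pf u))) = 0" by (rule \<delta>12_two) (simp add: isP_Pf isQ_Qf)
  have z4: "Avg (\<delta>12 (seq3 0 (Pf v) (Qf v))) = 0" by (rule \<delta>12_zero) (rule PQ_vf)+
  from eq0 have eq: "0 = - Avg (\<delta>12 (seq3 (Pf (- j (B u))) (Qf v) (Qf w))) + Avg (\<delta>12 (seq3 (Qf (a *\<^sub>R j v)) (Pf u) (Qf w)))
      - Avg (\<delta>12 (seq3 (Qf (j (B w))) (Pf u) (Qf v)))"
    by (simp only: z1 z2 z3 z4 add_0_right diff_0_right)
  \<comment> \<open>Each of the three remaining terms is a second Koszul expansion, now of the (1,
    1)-form. The bracket of its two fields over \<open>n1\<close> vanishes, which leaves two values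
    of \<open>\<omega>11\<close>.\<close>
  have t1: "Im (Avg (\<delta>12 (seq3 (Pf (- j (B u))) (Qf v) (Qf w)))) = 2 * (G (B (B u)) w + G (B u) (B w))"
    by (subst Avg_\<delta>12) (simp_all add: PQ_invariant isP_Pf isQ_Qf PQv n1s bracket_n1 w QvQ \<omega>11_zero PQ_vf
        Im_\<omega>11 B jB u j_simps G_simps G_j)
  have t2: "Im (Avg (\<delta>12 (seq3 (Qf (a *\<^sub>R j v)) (Pf u) (Qf w)))) = - 2 * a * (G (B u) w + G u (B w))"
    by (subst Avg_\<delta>12) (simp_all add: PQ_invariant isP_Pf isQ_Qf QaP QaQ u w bracket_n1 \<omega>11_zero PQ_vf
        Im_\<omega>11 G_simps G_scale algebra_simps)
  have t3: "Im (Avg (\<delta>12 (seq3 (Qf (j (B w))) (Pf u) (Qf v)))) = 2 * (G u (B (B w)) + G (B u) (B w))"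
    by (subst Avg_\<delta>12) (simp_all add: PQ_invariant isP_Pf isQ_Qf QQv n1s bracket_n1 u PQv \<omega>11_zero PQ_vf
        Im_\<omega>11 B jB w j_simps G_simps G_j)
  show ?thesis using arg_cong[OF eq, of Im] t1 t2 t3 by (simp add: algebra_simps)
qed

end


section \<open>Frame coefficients\<close>


lemma skew_algebra:
  fixes G :: "'e \<Rightarrow> 'e \<Rightarrow> real" and k :: nat
  assumes G: "\<And>x y z. G (x + y) z = G x z + G y z" "\<And>c x z. G (c *\<^sub>R x) z = c * G x z" "\<And>x y. G x y = G y x"
    and u: "\<And>i. i < k \<Longrightarrow> u i \<in> n1"
    and expand: "\<And>y. y \<in> n1 \<Longrightarrow> y = (\<Sum>l<k. G y (u l) *\<^sub>R u l)"
    and trace: "(\<Sum>i<k. G (B (u i)) (u i)) = 0"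
    and skt: "\<And>u w. u \<in> n1 \<Longrightarrow> w \<in> n1 \<Longrightarrow>
      G (B (B u)) w + 2 * G (B u) (B w) + G u (B (B w)) + a * (G (B u) w + G u (B w)) = 0"
    and x: "x \<in> n1" and y: "y \<in> n1"
  shows "G (B x) y + G x (B y) = 0"
proof -
  have lin: "linear (\<lambda>x. G x z)" for z by (intro linearI) (simp_all add: G(1,2))
  define A where "A i l = G (B (u i)) (u l)" for i l
  have GB: "G z (B (u i)) = (\<Sum>l<k. A i l * G (u l) z)" if "i < k" for i z
  proof -
    have "G (B (u i)) z = G (\<Sum>l<k. A i l *\<^sub>R u l) z" using expand[OF n1_B[OF u[OF that]]] by (simp add: A_def)
    also have "\<dots> = (\<Sum>l<k. A i l * G (u l) z)" using linear_sum[OF lin, of "\<lambda>l. A i l *\<^sub>R u l" "{..<k}" z] by (simp add: G(2))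
    finally show ?thesis by (simp add: G(3))
  qed
  have BB: "G (B (B (u i))) (u i) = (\<Sum>l<k. A i l * A l i)" if "i < k" for i
  proof -
    have "B (B (u i)) = B (\<Sum>l<k. A i l *\<^sub>R u l)" using expand[OF n1_B[OF u[OF that]]] by (simp add: A_def)
    also have "\<dots> = (\<Sum>l<k. A i l *\<^sub>R B (u l))" by (simp add: linear_sum[OF linear_B] linear_scale[OF linear_B])
    finally show ?thesis using linear_sum[OF lin, of "\<lambda>l. A i l *\<^sub>R B (u l)" "{..<k}" "u i"] by (simp add: G(2) A_def)
  qed
  have "2 * (\<Sum>l<k. A i l * A l i + (A i l)\<^sup>2) + 2 * a * A i i = 0" if "i < k" for i
  proof -
    have "G (B (u i)) (B (u i)) = (\<Sum>l<k. (A i l)\<^sup>2)"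
      by (subst GB[OF that]) (rule sum.cong[OF refl], simp only: A_def power2_eq_square G(3)[of "u l" "B (u i)" for l])
    then show ?thesis using skt[OF u[OF that] u[OF that]] BB[OF that] G(3)[of "u i"]
      by (simp add: sum.distrib A_def algebra_simps)
  qed
  then have "(\<Sum>i<k. 2 * (\<Sum>l<k. A i l * A l i + (A i l)\<^sup>2) + 2 * a * A i i) = 0" by (intro sum.neutral) auto
  \<comment> \<open>The linear terms add up to \<open>2 * a\<close> times the trace, which is 0; the
    rest is the sum of the squares \<open>(A i l + A l i)\<^sup>2\<close>, once the indices are
    exchanged in half of it.\<close>
  then have s: "(\<Sum>i<k. \<Sum>l<k. A i l * A l i + (A i l)\<^sup>2) = 0"
    using trace by (simp add: sum.distrib sum_distrib_left[symmetric] A_def)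
  have "(\<Sum>i<k. \<Sum>l<k. (A l i)\<^sup>2) = (\<Sum>i<k. \<Sum>l<k. (A i l)\<^sup>2)" by (rule sum.swap)
  then have "(\<Sum>i<k. \<Sum>l<k. (A i l + A l i)\<^sup>2) = 0"
    using s by (simp add: power2_sum sum.distrib sum_distrib_left[symmetric] mult.assoc)
  then have A: "A i l + A l i = 0" if "i < k" "l < k" for i l
    using sum_sum_nonneg_eq_0[of "\<lambda>i l. (A i l + A l i)\<^sup>2" "{..<k}" "{..<k}" i l, OF _ finite_lessThan finite_lessThan] that by simp
  define S where "S x y = G (B x) y + G x (B y)" for x y
  have Slin: "linear (\<lambda>x. S x y)" for y
    by (intro linearI) (simp_all add: S_def br_add_right br_scale_right G(1,2) algebra_simps)
  have Ssym: "S x y = S y x" for x y by (simp add: S_def G(3))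
  have Suy: "S (u i) y = 0" if "i < k" for i
  proof -
    have "S (\<Sum>l<k. G y (u l) *\<^sub>R u l) (u i) = (\<Sum>l<k. G y (u l) * S (u l) (u i))"
      using linear_sum[OF Slin, of "\<lambda>l. G y (u l) *\<^sub>R u l" "{..<k}" "u i"] linear_scale[OF Slin] by simp
    also have "\<dots> = 0" using A that by (intro sum.neutral) (auto simp: S_def A_def G(3)[of "u _" "B _"])
    finally show ?thesis using expand[OF y] Ssym by metis
  qed
  have "S (\<Sum>l<k. G x (u l) *\<^sub>R u l) y = (\<Sum>l<k. G x (u l) * S (u l) y)"
    using linear_sum[OF Slin, of "\<lambda>l. G x (u l) *\<^sub>R u l" "{..<k}" y] linear_scale[OF Slin] by simp
  also have "\<dots> = 0" by (intro sum.neutral) (auto simp: Suy)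
  finally show ?thesis using expand[OF x] by (simp add: S_def)
qed

definition co :: "'q vfield \<Rightarrow> 'e \<Rightarrow> 'q \<Rightarrow> complex" where
  "co X = (SOME h. (\<forall>b\<in>Basis. h b \<in> smooth_funs N) \<and> (\<forall>f\<in>smooth_funs N. X f = (\<Sum>b\<in>Basis. h b * E b f)))"

lemma co: assumes "X \<in> VF"
  shows "b \<in> Basis \<Longrightarrow> co X b \<in> smooth_funs N" "f \<in> smooth_funs N \<Longrightarrow> X f = (\<Sum>b\<in>Basis. co X b * E b f)"
  using someI_ex[OF frame[OF assms]] unfolding co_def[symmetric] by blast+

lemma co_at: "X \<in> VF \<Longrightarrow> f \<in> smooth_funs N \<Longrightarrow> X f q = (\<Sum>b\<in>Basis. co X b q * E b f q)"
  using co(2)[of X f] by (simp add: sum_fun_apply)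

lemma co_outside: "X \<in> VF \<Longrightarrow> b \<in> Basis \<Longrightarrow> q \<notin> points N \<Longrightarrow> co X b q = 0"
  using smooth_funsD(1)[OF co(1)] .

lemma co_unique:
  assumes X: "X \<in> VF" and q: "q \<in> points N" and b: "b \<in> Basis"
    and c: "\<And>f. f \<in> smooth_funs N \<Longrightarrow> X f q = (\<Sum>b\<in>Basis. c b * E b f q)"
  shows "co X b q = c b"
proof -
  have "co X b q - c b = 0"
    by (rule frame_unique[OF q _ b, of "\<lambda>b. co X b q - c b"])
      (simp add: left_diff_distrib sum_subtractf c[symmetric] co_at[OF X, symmetric])
  then show ?thesis by simp
qed

lemma co_add: assumes "X \<in> VF" "Y \<in> VF" "b \<in> Basis" shows "co (X + Y) b q = co X b q + co Y b q"
proof (cases "q \<in> points N")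
  case True
  show ?thesis
    by (rule co_unique[OF vf_add[OF assms(1,2)] True assms(3)])
      (simp add: distrib_right sum.distrib co_at[OF assms(1)] co_at[OF assms(2)])
qed (simp add: co_outside vf_add assms)

lemma co_fmult: assumes "h \<in> smooth_funs N" "X \<in> VF" "b \<in> Basis" shows "co (fmult h X) b q = h q * co X b q"
proof (cases "q \<in> points N")
  case True
  show ?thesis
    by (rule co_unique[OF vf_fmult[OF assms(1,2)] True assms(3)])
      (simp add: fmult_def mult.assoc sum_distrib_left[symmetric] co_at[OF assms(2)])
qed (simp add: co_outside vf_fmult assms)

lemma vf_sum: "(\<And>b. b \<in> A \<Longrightarrow> F b \<in> VF) \<Longrightarrow> (\<Sum>b\<in>A. F b) \<in> VF"
  by (induction A rule: infinite_finite_induct) (auto simp: vf_zero vf_add)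

lemma J_sum: "(\<And>b. b \<in> A \<Longrightarrow> F b \<in> VF) \<Longrightarrow> J (\<Sum>b\<in>A. F b) = (\<Sum>b\<in>A. J (F b))"
  by (induction A rule: infinite_finite_induct) (auto simp: J_zero J_add vf_sum)

lemma co_expand: assumes X: "X \<in> VF" shows "X = (\<Sum>b\<in>Basis. fmult (co X b) (E b))"
proof (intro ext)
  fix f q
  show "X f q = (\<Sum>b\<in>Basis. fmult (co X b) (E b)) f q"
    by (cases "f \<in> smooth_funs N")
      (simp_all add: sum_fun_apply fmult_def co_at[OF X] field_junk[OF X] field_junk[OF E_vf])
qed

lemma co_J: assumes X: "X \<in> VF" and b: "b \<in> Basis"
  shows "co (J X) b q = (\<Sum>c\<in>Basis. co X c q * of_real (j c \<bullet> b))"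
proof (cases "q \<in> points N")
  case True
  have "J X = (\<Sum>c\<in>Basis. J (fmult (co X c) (E c)))"
    by (subst co_expand[OF X]) (rule J_sum, rule vf_fmult[OF co(1)[OF X] E_vf])
  also have "\<dots> = (\<Sum>c\<in>Basis. fmult (co X c) (E (j c)))"
    by (rule sum.cong[OF refl]) (simp add: J_fmult co(1)[OF X] E_vf J_E)
  finally have JX: "J X = \<dots>" .
  show ?thesis
  proof (rule co_unique[OF J_vf[OF X] True b])
    fix f assume "f \<in> smooth_funs N"
    have "J X f q = (\<Sum>c\<in>Basis. co X c q * (\<Sum>d\<in>Basis. of_real (j c \<bullet> d) * E d f q))"
      by (simp add: JX sum_fun_apply fmult_def E_expand[symmetric])
    also have "\<dots> = (\<Sum>c\<in>Basis. \<Sum>d\<in>Basis. co X c q * of_real (j c \<bullet> d) * E d f q)"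
      by (simp add: sum_distrib_left mult.assoc)
    also have "\<dots> = (\<Sum>d\<in>Basis. \<Sum>c\<in>Basis. co X c q * of_real (j c \<bullet> d) * E d f q)" by (rule sum.swap)
    finally show "J X f q = (\<Sum>d\<in>Basis. (\<Sum>c\<in>Basis. co X c q * of_real (j c \<bullet> d)) * E d f q)"
      by (simp add: sum_distrib_right)
  qed
qed (simp add: co_outside J_vf X b)

text \<open>On real functions the imaginary parts of the coefficients form a relation among the
  frame fields; splitting \<open>f\<close> into real and imaginary part extends the relation to all
  functions, and the frame admits none.\<close>

lemma co_real: assumes X: "X \<in> real_fields N" and b: "b \<in> Basis" shows "co X b q \<in> \<real>"
proof (cases "q \<in> points N")
  case True
  have Xv: "X \<in> VF" using X by (simp add: real_fields_def)
  have real: "(\<Sum>b\<in>Basis. complex_of_real (Im (co X b q)) * E b f q) = 0" if f: "f \<in> smooth_funs N" "\<And>x. f x \<in> \<real>" for f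
  proof -
    have r: "E b f q = of_real (Re (E b f q))" for b
      using real_fieldsD[OF E_real_field f, of b q] by (simp add: of_real_Re)
    have "Im (X f q) = 0" using real_fieldsD[OF X f, of q] by (simp add: complex_is_Real_iff)
    moreover have "X f q = (\<Sum>b\<in>Basis. co X b q * of_real (Re (E b f q)))"
      unfolding co_at[OF Xv f(1)] by (rule sum.cong[OF refl]) (simp add: r[symmetric])
    ultimately have "(\<Sum>b\<in>Basis. Im (co X b q) * Re (E b f q)) = 0" by (simp add: Im_sum)
    then have "complex_of_real (\<Sum>b\<in>Basis. Im (co X b q) * Re (E b f q)) = 0" by simp
    then show ?thesis by (simp add: r[symmetric])
  qed
  have "complex_of_real (Im (co X b q)) = 0"
  proof (rule frame_unique[OF True _ b])
    fix f assume f: "f \<in> smooth_funs N"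
    let ?r = "\<lambda>x. complex_of_real (Re (f x))" and ?i = "\<lambda>x. complex_of_real (Im (f x))"
    have s: "?r \<in> smooth_funs N" "?i \<in> smooth_funs N"
      by (rule smooth_funs_real_linear[OF f bounded_linear_Re] smooth_funs_real_linear[OF f bounded_linear_Im])+
    have "f = ?r + (\<lambda>_. \<i>) * ?i" by (simp add: fun_eq_iff complex_eq)
    then have "E b f q = E b (?r + (\<lambda>_. \<i>) * ?i) q" for b by simp
    then have "E b f q = E b ?r q + \<i> * E b ?i q" for b
      by (simp only: field_add[OF E_vf s(1) smooth_funs_scale[OF s(2)]] field_scale[OF E_vf s(2)]) simp
    then show "(\<Sum>b\<in>Basis. complex_of_real (Im (co X b q)) * E b f q) = 0"
      using real[OF s(1)] real[OF s(2)]
      by (simp add: distrib_left sum.distrib mult.left_commute[of _ \<i>] sum_distrib_left[symmetric])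
  qed
  then show ?thesis by (simp add: complex_is_Real_iff)
qed (use X b in \<open>simp add: co_outside real_fields_def\<close>)

text \<open>When both fields are expanded, the second derivatives of \<open>f\<close> along frame
  fields combine to brackets of the frame, and these contribute the structure constants.\<close>

lemma co_bracket: assumes X: "X \<in> VF" and Y: "Y \<in> VF" and d: "d \<in> Basis" and q: "q \<in> points N"
  shows "co (bracket X Y) d q = X (co Y d) q - Y (co X d) q
    + (\<Sum>b\<in>Basis. \<Sum>c\<in>Basis. co X b q * co Y c q * of_real (br b c \<bullet> d))"
proof (rule co_unique[OF bracket_field[OF X Y] q d])
  fix f assume f: "f \<in> smooth_funs N"
  have XY: "X (Y f) q = (\<Sum>b\<in>Basis. X (co Y b) q * E b f q + co Y b q * (\<Sum>c\<in>Basis. co X c q * E c (E b f) q))"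
    if X: "X \<in> VF" and Y: "Y \<in> VF" for X Y
  proof -
    have "X (Y f) = (\<Sum>b\<in>Basis. X (co Y b * E b f))"
      unfolding co(2)[OF Y f] by (rule field_sum[OF X]) (auto intro: smooth_funs_mult co(1)[OF Y] field_smooth[OF E_vf] f)
    then show ?thesis
      by (simp add: sum_fun_apply field_mult[OF X] co(1)[OF Y] field_smooth[OF E_vf] f co_at[OF X])
  qed
  have "(\<Sum>b\<in>Basis. co X b q * (\<Sum>c\<in>Basis. co Y c q * E c (E b f) q)) = (\<Sum>b\<in>Basis. \<Sum>c\<in>Basis. co X b q * co Y c q * E c (E b f) q)"
    by (simp add: sum_distrib_left mult.assoc)
  moreover have "(\<Sum>b\<in>Basis. co Y b q * (\<Sum>c\<in>Basis. co X c q * E c (E b f) q)) = (\<Sum>b\<in>Basis. \<Sum>c\<in>Basis. co X b q * co Y c q * E b (E c f) q)"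
    by (subst sum.swap) (simp add: sum_distrib_left mult_ac)
  moreover have "(\<Sum>b\<in>Basis. \<Sum>c\<in>Basis. co X b q * co Y c q * E b (E c f) q) - (\<Sum>b\<in>Basis. \<Sum>c\<in>Basis. co X b q * co Y c q * E c (E b f) q)
    = (\<Sum>b\<in>Basis. \<Sum>c\<in>Basis. co X b q * co Y c q * bracket (E b) (E c) f q)"
    by (simp add: sum_subtractf[symmetric] bracket_def right_diff_distrib)
  moreover have "\<dots> = (\<Sum>b\<in>Basis. \<Sum>c\<in>Basis. \<Sum>d\<in>Basis. co X b q * co Y c q * of_real (br b c \<bullet> d) * E d f q)"
    by (simp add: bracket_E E_expand[of "br _ _"] sum_distrib_left mult.assoc)
  moreover have "\<dots> = (\<Sum>b\<in>Basis. \<Sum>d\<in>Basis. \<Sum>c\<in>Basis. co X b q * co Y c q * of_real (br b c \<bullet> d) * E d f q)"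
    by (rule sum.cong[OF refl]) (rule sum.swap)
  moreover have "\<dots> = (\<Sum>d\<in>Basis. \<Sum>b\<in>Basis. \<Sum>c\<in>Basis. co X b q * co Y c q * of_real (br b c \<bullet> d) * E d f q)"
    by (rule sum.swap)
  moreover have "bracket X Y f q = X (Y f) q - Y (X f) q" by (simp add: bracket_def)
  ultimately show "bracket X Y f q = (\<Sum>d\<in>Basis. (X (co Y d) q - Y (co X d) q
    + (\<Sum>b\<in>Basis. \<Sum>c\<in>Basis. co X b q * co Y c q * of_real (br b c \<bullet> d))) * E d f q)"
    unfolding XY[OF X Y] XY[OF Y X]
    by (simp add: distrib_right left_diff_distrib sum.distrib sum_subtractf sum_distrib_right)
qed


section \<open>Kaehler metrics from invariant data\<close>


text \<open>The complex bilinear extension of \<open>F\<close> in frame coefficients. It is formed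
  for an arbitrary \<open>F\<close>, so that it applies as well to the form twisted by
  \<open>j\<close>.\<close>

definition bil :: "('e \<Rightarrow> 'e \<Rightarrow> real) \<Rightarrow> ('e \<Rightarrow> complex) \<Rightarrow> ('e \<Rightarrow> complex) \<Rightarrow> complex" where
  "bil F p r = (\<Sum>b\<in>Basis. \<Sum>c\<in>Basis. of_real (F b c) * (p b * r c))"

lemma bil_cong: "(\<And>b. b \<in> Basis \<Longrightarrow> p b = p' b) \<Longrightarrow> (\<And>b. b \<in> Basis \<Longrightarrow> r b = r' b) \<Longrightarrow> bil F p r = bil F p' r'"
  by (simp add: bil_def)

lemma bil_linear: "bil F (\<lambda>b. p b + p' b) r = bil F p r + bil F p' r"
  "bil F (\<lambda>b. p b - p' b) r = bil F p r - bil F p' r"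
  "bil F p (\<lambda>b. r b + r' b) = bil F p r + bil F p r'"
  "bil F (\<lambda>b. z * p b) r = z * bil F p r"
  by (simp_all add: bil_def distrib_left distrib_right left_diff_distrib right_diff_distrib sum.distrib sum_subtractf
      sum_distrib_left mult_ac)

lemma bil_swap: "bil F p r = bil (\<lambda>x y. F y x) r p"
  unfolding bil_def by (subst sum.swap) (simp add: mult.commute)

context
  fixes F :: "'e \<Rightarrow> 'e \<Rightarrow> real"
  assumes F_add: "\<And>x y z. F (x + y) z = F x z + F y z" and F_scale: "\<And>c x z. F (c *\<^sub>R x) z = c * F x z"
begin

lemma F_linear: "linear (\<lambda>x. F x z)"
  by (intro linearI) (simp_all add: F_add F_scale)

lemma F_expand: "(\<Sum>d\<in>Basis. (x \<bullet> d) * F d z) = F x z"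
  using linear_sum[OF F_linear[of z], of "\<lambda>d. (x \<bullet> d) *\<^sub>R d" Basis]
  by (simp add: F_scale euclidean_representation)

text \<open>When the coefficients come from vectors \<open>A s\<close> of the Lie algebra, linearity
  moves their expansion inside \<open>F\<close>. Both the action of \<open>J\<close> and the
  structure constants have this shape.\<close>

lemma bil_lift: "bil F (\<lambda>d. \<Sum>s\<in>S. P s * of_real (A s \<bullet> d)) r = (\<Sum>s\<in>S. P s * (\<Sum>c\<in>Basis. of_real (F (A s) c) * r c))"
proof -
  have "bil F (\<lambda>d. \<Sum>s\<in>S. P s * of_real (A s \<bullet> d)) r
    = (\<Sum>d\<in>Basis. \<Sum>c\<in>Basis. \<Sum>s\<in>S. P s * (of_real ((A s \<bullet> d) * F d c) * r c))"
    by (simp add: bil_def sum_distrib_left sum_distrib_right mult_ac)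
  also have "\<dots> = (\<Sum>d\<in>Basis. \<Sum>s\<in>S. \<Sum>c\<in>Basis. P s * (of_real ((A s \<bullet> d) * F d c) * r c))"
    by (rule sum.cong[OF refl]) (rule sum.swap)
  also have "\<dots> = (\<Sum>s\<in>S. \<Sum>d\<in>Basis. \<Sum>c\<in>Basis. P s * (of_real ((A s \<bullet> d) * F d c) * r c))"
    by (rule sum.swap)
  also have "\<dots> = (\<Sum>s\<in>S. \<Sum>c\<in>Basis. \<Sum>d\<in>Basis. P s * (of_real ((A s \<bullet> d) * F d c) * r c))"
    by (rule sum.cong[OF refl]) (rule sum.swap)
  also have "\<dots> = (\<Sum>s\<in>S. P s * (\<Sum>c\<in>Basis. of_real (\<Sum>d\<in>Basis. (A s \<bullet> d) * F d c) * r c))"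
    by (simp add: sum_distrib_left sum_distrib_right)
  finally show ?thesis by (simp only: F_expand)
qed

lemma bil_J: assumes X: "X \<in> VF" shows "bil F (\<lambda>b. co (J X) b q) r = bil (\<lambda>x y. F (j x) y) (\<lambda>b. co X b q) r"
proof -
  have "bil F (\<lambda>b. co (J X) b q) r = bil F (\<lambda>b. \<Sum>c\<in>Basis. co X c q * of_real (j c \<bullet> b)) r"
    by (rule bil_cong) (simp_all add: co_J X)
  also have "\<dots> = (\<Sum>s\<in>Basis. co X s q * (\<Sum>c\<in>Basis. of_real (F (j s) c) * r c))"
    by (rule bil_lift)
  finally show ?thesis by (simp add: bil_def sum_distrib_left mult_ac)
qed

end

context
  fixes F :: "'e \<Rightarrow> 'e \<Rightarrow> real"
  assumes F: "\<And>x y z. F (x + y) z = F x z + F y z" "\<And>c x z. F (c *\<^sub>R x) z = c * F x z"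
    and F_sym: "\<And>x y. F x y = F y x" and F_pos: "\<And>x. x \<noteq> 0 \<Longrightarrow> F x x > 0" and F_j: "\<And>x y. F (j x) (j y) = F x y"
begin

text \<open>The metric with constant matrix \<open>F\<close> in the frame, hence the one induced by
  the left-invariant metric \<open>F\<close> on the group.\<close>

definition gF :: "'q vfield \<Rightarrow> 'q vfield \<Rightarrow> 'q \<Rightarrow> complex" where
  "gF X Y = (\<lambda>q. bil F (\<lambda>b. co X b q) (\<lambda>b. co Y b q))"

abbreviation W :: "'e \<Rightarrow> 'e \<Rightarrow> real" where "W x y \<equiv> F (j x) y"

lemma gF_smooth: assumes "X \<in> VF" "Y \<in> VF" shows "gF X Y \<in> smooth_funs N"
proof -
  have "(\<lambda>q. \<Sum>b\<in>Basis. \<Sum>c\<in>Basis. of_real (F b c) * (co X b * co Y c) q) \<in> smooth_funs N"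
    by (intro smooth_fun_sum smooth_fun_cmult smooth_funs_mult co(1)[OF assms(1)] co(1)[OF assms(2)] finite_Basis)
  then show ?thesis by (simp add: gF_def bil_def)
qed

lemma hermitian_gF: "hermitian_metric N J gF"
  unfolding hermitian_metric_def
proof (intro conjI ballI impI)
  fix X Y assume X: "X \<in> VF" and Y: "Y \<in> VF"
  show "gF X Y \<in> smooth_funs N" by (rule gF_smooth[OF X Y])
  show "gF X Y = gF Y X" unfolding gF_def by (subst bil_swap) (simp add: F_sym[of _ "_ :: 'e"] bil_def)
  fix Z assume "Z \<in> VF"
  show "gF (X + Y) Z = gF X Z + gF Y Z"
  proof
    fix q
    have "gF (X + Y) Z q = bil F (\<lambda>b. co X b q + co Y b q) (\<lambda>b. co Z b q)"
      unfolding gF_def by (rule bil_cong) (simp_all add: co_add X Y)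
    then show "gF (X + Y) Z q = (gF X Z + gF Y Z) q" by (simp add: bil_linear gF_def)
  qed
next
  fix X Y assume XY: "X \<in> real_fields N" "Y \<in> real_fields N"
  show "range (gF X Y) \<subseteq> \<real>"
    unfolding gF_def bil_def by (auto intro!: sum_in_Reals Reals_mult co_real XY)
next
  fix h X Y assume h: "h \<in> smooth_funs N" and X: "X \<in> VF" and Y: "Y \<in> VF"
  show "gF (fmult h X) Y = h * gF X Y"
  proof
    fix q
    have "gF (fmult h X) Y q = bil F (\<lambda>b. h q * co X b q) (\<lambda>b. co Y b q)"
      unfolding gF_def by (rule bil_cong) (simp_all add: co_fmult h X)
    then show "gF (fmult h X) Y q = (h * gF X Y) q" by (simp add: bil_linear gF_def)
  qed
next
  fix X x assume X: "X \<in> real_fields N" and nz: "\<exists>f\<in>smooth_funs N. X f x \<noteq> 0"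
  define y where "y = (\<Sum>b\<in>Basis. Re (co X b x) *\<^sub>R b)"
  have yb: "co X b x = of_real (y \<bullet> b)" if "b \<in> Basis" for b
    using co_real[OF X that, of x] that by (simp add: y_def of_real_Re inner_sum_left_Basis)
  have "y \<noteq> 0"
  proof
    assume "y = 0"
    then have "X f x = 0" if "f \<in> smooth_funs N" for f
      using co_at[of X f x] that X yb by (simp add: real_fields_def)
    then show False using nz by blast
  qed
  then have "F y y > 0" by (rule F_pos)
  moreover have "gF X X x = of_real (F y y)"
  proof -
    have "gF X X x = (\<Sum>b\<in>Basis. \<Sum>c\<in>Basis. of_real (F b c * ((y \<bullet> b) * (y \<bullet> c))))"
      by (simp add: gF_def bil_def yb)
    also have "\<dots> = of_real (\<Sum>c\<in>Basis. (y \<bullet> c) * (\<Sum>b\<in>Basis. (y \<bullet> b) * F b c))"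
      by (subst sum.swap) (simp add: sum_distrib_left mult_ac)
    also have "(\<Sum>c\<in>Basis. (y \<bullet> c) * (\<Sum>b\<in>Basis. (y \<bullet> b) * F b c)) = (\<Sum>c\<in>Basis. (y \<bullet> c) * F c y)"
      by (rule sum.cong[OF refl]) (subst F_expand[of F, OF F], subst F_sym, rule refl)
    also have "\<dots> = F y y" by (rule F_expand[of F, OF F])
    finally show ?thesis .
  qed
  ultimately show "Re (gF X X x) > 0" by simp
next
  fix X Y assume X: "X \<in> VF" and Y: "Y \<in> VF"
  show "gF (J X) (J Y) = gF X Y"
  proof
    fix q
    have F': "F z (x + y) = F z x + F z y" "F z (c *\<^sub>R x) = c * F z x" for x y z c
      by (simp_all only: F_sym[of z] F)
    have "gF (J X) (J Y) q = bil W (\<lambda>b. co X b q) (\<lambda>b. co (J Y) b q)"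
      unfolding gF_def by (rule bil_J[OF F X])
    also have "\<dots> = bil (\<lambda>x y. F (j y) x) (\<lambda>b. co (J Y) b q) (\<lambda>b. co X b q)" by (rule bil_swap)
    also have "\<dots> = bil (\<lambda>x y. F (j y) (j x)) (\<lambda>b. co Y b q) (\<lambda>b. co X b q)"
      by (rule bil_J[OF F' Y])
    also have "\<dots> = bil (\<lambda>x y. F (j x) (j y)) (\<lambda>b. co X b q) (\<lambda>b. co Y b q)" by (rule bil_swap)
    finally show "gF (J X) (J Y) q = gF X Y q" by (simp only: F_j gF_def)
  qed
qed

lemma gF_J: "X \<in> VF \<Longrightarrow> gF (J X) Y q = bil W (\<lambda>b. co X b q) (\<lambda>b. co Y b q)"
  unfolding gF_def by (rule bil_J[OF F])

lemma W_bilinear: "W (x + y) z = W x z + W y z" "W (c *\<^sub>R x) z = c * W x z"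
  by (simp_all add: j_simps F)

lemma W_swap: "bil W r p = - bil W p r"
proof -
  have "W y x = - W x y" for x y
  proof -
    have "W y x = F (j (j y)) (j x)" by (rule F_j[symmetric])
    also have "\<dots> = F ((-1) *\<^sub>R y) (j x)" by (simp add: jj)
    also have "\<dots> = - F y (j x)" by (simp only: F)
    finally show ?thesis by (simp only: F_sym[of y])
  qed
  then have "(\<lambda>x y. W y x) = (\<lambda>x y. - W x y)" by (intro ext)
  then have "bil W r p = bil (\<lambda>x y. - W x y) p r" by (subst bil_swap) (simp only:)
  then show ?thesis by (simp add: bil_def sum_negf)
qed

lemma field_W: assumes Z: "Z \<in> VF" and X: "X \<in> VF" and Y: "Y \<in> VF"
  shows "Z (gF (J X) Y) q = bil W (\<lambda>b. Z (co X b) q) (\<lambda>b. co Y b q) + bil W (\<lambda>b. co X b q) (\<lambda>b. Z (co Y b) q)"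
proof -
  have s: "(\<lambda>_. of_real (W b c)) * (co X b * co Y c) \<in> smooth_funs N" if "b \<in> Basis" "c \<in> Basis" for b c
    by (intro smooth_funs_scale smooth_funs_mult co(1)[OF X] co(1)[OF Y] that)
  have "gF (J X) Y = (\<Sum>b\<in>Basis. \<Sum>c\<in>Basis. (\<lambda>_. of_real (W b c)) * (co X b * co Y c))"
    by (simp add: fun_eq_iff gF_J[OF X] bil_def sum_fun_apply)
  then have "Z (gF (J X) Y) = (\<Sum>b\<in>Basis. Z (\<Sum>c\<in>Basis. (\<lambda>_. of_real (W b c)) * (co X b * co Y c)))"
    by (simp only: field_sum[OF Z finite_Basis] smooth_funs_sum s finite_Basis)
  also have "\<dots> = (\<Sum>b\<in>Basis. \<Sum>c\<in>Basis. Z ((\<lambda>_. of_real (W b c)) * (co X b * co Y c)))"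
    by (intro sum.cong refl field_sum[OF Z finite_Basis] s)
  also have "\<dots> = (\<Sum>b\<in>Basis. \<Sum>c\<in>Basis. (\<lambda>_. of_real (W b c)) * (Z (co X b) * co Y c + co X b * Z (co Y c)))"
    by (intro sum.cong refl)
      (simp only: field_scale[OF Z] field_mult[OF Z] smooth_funs_mult co(1)[OF X] co(1)[OF Y])
  finally show ?thesis by (simp add: sum_fun_apply bil_def distrib_left sum.distrib)
qed

definition tri :: "('e \<Rightarrow> complex) \<Rightarrow> ('e \<Rightarrow> complex) \<Rightarrow> ('e \<Rightarrow> complex) \<Rightarrow> complex" where
  "tri p p' r = (\<Sum>b\<in>Basis. \<Sum>c\<in>Basis. \<Sum>d\<in>Basis. of_real (W (br b c) d) * (p b * p' c * r d))"

lemma bracket_W: assumes X: "X \<in> VF" and Y: "Y \<in> VF" and Z: "Z \<in> VF" and q: "q \<in> points N"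
  shows "gF (J (bracket X Y)) Z q = bil W (\<lambda>b. X (co Y b) q) (\<lambda>b. co Z b q)
    - bil W (\<lambda>b. Y (co X b) q) (\<lambda>b. co Z b q) + tri (\<lambda>b. co X b q) (\<lambda>b. co Y b q) (\<lambda>b. co Z b q)"
proof -
  have "bil W (\<lambda>d. \<Sum>b\<in>Basis. \<Sum>c\<in>Basis. co X b q * co Y c q * of_real (br b c \<bullet> d)) r
     = tri (\<lambda>b. co X b q) (\<lambda>b. co Y b q) r" for r
    using bil_lift[of W, OF W_bilinear, where S = "Basis \<times> Basis" and P = "\<lambda>s. co X (fst s) q * co Y (snd s) q"
        and A = "\<lambda>s. br (fst s) (snd s)" and r = r]
    by (simp add: sum.cartesian_product' tri_def sum_distrib_left mult_ac)
  moreover have "gF (J (bracket X Y)) Z q = bil W (\<lambda>d. X (co Y d) q - Y (co X d) q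
    + (\<Sum>b\<in>Basis. \<Sum>c\<in>Basis. co X b q * co Y c q * of_real (br b c \<bullet> d))) (\<lambda>b. co Z b q)"
    unfolding gF_J[OF bracket_field[OF X Y]] by (rule bil_cong) (simp_all add: co_bracket[OF X Y _ q])
  ultimately show ?thesis by (simp add: bil_linear)
qed

text \<open>In the Koszul formula for arbitrary fields the derivatives of the coefficients cancel by
  antisymmetry of \<open>W\<close>. What is left is tensorial: the cyclic sum of the hypothesis,
  that is, closedness on the Lie algebra.\<close>

lemma kaehler_gF:
  assumes closed: "\<And>x y z. W (br x y) z + W (br z x) y + W (br y z) x = 0"
  shows "kaehler_metric N J gF"
  unfolding kaehler_metric_def
proof (intro conjI hermitian_gF)
  have tri: "- tri p p' r + tri p r p' - tri p' r p = 0" for p p' r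
  proof -
    have "tri p r p' = (\<Sum>b\<in>Basis. \<Sum>c\<in>Basis. \<Sum>d\<in>Basis. of_real (W (br b d) c) * (p b * p' c * r d))"
      unfolding tri_def by (rule sum.cong[OF refl], subst sum.swap) (simp add: mult_ac)
    moreover have "tri p' r p = (\<Sum>b\<in>Basis. \<Sum>c\<in>Basis. \<Sum>d\<in>Basis. of_real (W (br c d) b) * (p b * p' c * r d))"
    proof -
      have "tri p' r p = (\<Sum>c\<in>Basis. \<Sum>b\<in>Basis. \<Sum>d\<in>Basis. of_real (W (br c d) b) * (p' c * r d * p b))"
        unfolding tri_def by (rule sum.cong[OF refl]) (rule sum.swap)
      then show ?thesis by (subst sum.swap) (simp add: mult_ac)
    qed
    moreover have "- W (br b c) d + W (br b d) c - W (br c d) b = 0" for b c d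
    proof -
      have "W (br b d) c = - W (br d b) c" using W_bilinear(2)[of "-1" "br d b" c] br_swap[of b d] by simp
      then show ?thesis using closed[of b c d] by simp
    qed
    then have "(\<Sum>b\<in>Basis. \<Sum>c\<in>Basis. \<Sum>d\<in>Basis.
      complex_of_real (- W (br b c) d + W (br b d) c - W (br c d) b) * (p b * p' c * r d)) = 0" by simp
    ultimately show ?thesis
      by (simp add: tri_def[of p p'] left_diff_distrib distrib_right sum.distrib sum_subtractf sum_negf)
  qed
  show "vanishes N 3 (ext_d 2 (fundamental_form J gF))"
    unfolding vanishes_def
  proof (intro allI impI ext)
    fix X :: "nat \<Rightarrow> 'q vfield" and q assume X: "\<forall>i<3. X i \<in> VF"
    then have Xv: "X 0 \<in> VF" "X 1 \<in> VF" "X 2 \<in> VF" by auto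
    show "ext_d 2 (fundamental_form J gF) X q = 0 q"
    proof (cases "q \<in> points N")
      case True
      define D where "D a b = (\<lambda>d. X a (co (X b) d) q)" for a b
      define p where "p a = (\<lambda>d. co (X a) d q)" for a
      have s: "{..2::nat} = {0, 1, 2}" "{..<1::nat} = {0}" "{..<2::nat} = {0, 1}" by auto
      have "ext_d 2 (fundamental_form J gF) X q = X 0 (gF (J (X 1)) (X 2)) q - X 1 (gF (J (X 0)) (X 2)) q
        + X 2 (gF (J (X 0)) (X 1)) q - gF (J (bracket (X 0) (X 1))) (X 2) q
        + gF (J (bracket (X 0) (X 2))) (X 1) q - gF (J (bracket (X 1) (X 2))) (X 0) q"
        by (simp add: ext_d_def s omit_def fundamental_form_def numeral_2_eq_2)
      also have "\<dots> = - tri (p 0) (p 1) (p 2) + tri (p 0) (p 2) (p 1) - tri (p 1) (p 2) (p 0)"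
        unfolding field_W[OF Xv(1) Xv(2) Xv(3)] field_W[OF Xv(2) Xv(1) Xv(3)] field_W[OF Xv(3) Xv(1) Xv(2)]
          bracket_W[OF Xv(1) Xv(2) Xv(3) True] bracket_W[OF Xv(1) Xv(3) Xv(2) True] bracket_W[OF Xv(2) Xv(3) Xv(1) True]
          D_def[symmetric] p_def[symmetric]
        using W_swap[of "p 1" "D 0 2"] W_swap[of "p 0" "D 1 2"] W_swap[of "p 0" "D 2 1"] by simp
      also have "\<dots> = 0" by (rule tri)
      finally show ?thesis by simp
    next
      case False
      have "ext_d 2 (fundamental_form J gF) X \<in> smooth_funs N"
        by (rule vform_smooth[OF vform_ext_d[OF vform_fundamental_form[OF hermitian_gF]]]) (use X in auto)
      then show ?thesis using smooth_funsD(1) False by simp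
    qed
  qed
qed

end


lemma invariant_kaehler:
  fixes G :: "'e \<Rightarrow> 'e \<Rightarrow> real"
  assumes G: "\<And>x y z. G (x + y) z = G x z + G y z" "\<And>c x z. G (c *\<^sub>R x) z = c * G x z"
    and G_sym: "\<And>x y. G x y = G y x" and G_pos: "\<And>x. x \<noteq> 0 \<Longrightarrow> G x x > 0" and G_j: "\<And>x y. G (j x) (j y) = G x y"
    and v: "pi v = 0" "pi (j v) = 1" "B v = a *\<^sub>R v"
    and skew: "\<And>x y. x \<in> n1 \<Longrightarrow> y \<in> n1 \<Longrightarrow> G (B x) y + G x (B y) = 0"
  shows "\<exists>g. kaehler_metric N J g"
proof -
  have Gr: "G z (x + y) = G z x + G z y" "G z (c *\<^sub>R x) = c * G z x" for x y z c
    by (simp_all only: G_sym[of z] G)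
  have Gm: "G (- x) y = - G x y" "G x (- y) = - G x y" for x y
    using G(2)[of "-1" x y] Gr(2)[of x "-1" y] by simp_all
  \<comment> \<open>The projection onto \<open>n1\<close> along \<open>v\<close> and
    \<open>j v\<close>. It commutes with \<open>j\<close>, whence the invariance of \<open>K\<close>
    under \<open>j\<close>.\<close>
  define pr where "pr x = x - pi (j x) *\<^sub>R v - pi x *\<^sub>R j v" for x
  have pr_n1: "pr x \<in> n1" for x by (simp add: pr_def n1_def v j_simps)
  have pr_add: "pr (x + y) = pr x + pr y" and pr_scale: "pr (c *\<^sub>R x) = c *\<^sub>R pr x" and pr_j: "pr (j x) = j (pr x)"
    and pr_diff: "pr (x - y) = pr x - pr y" for x y c
    by (simp_all add: pr_def j_simps scaleR_add_left scaleR_diff_left algebra_simps)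
  define K where "K x y = pi (j x) * pi (j y) + pi x * pi y + G (pr x) (pr y)" for x y
  have split: "x = pr x + pi (j x) *\<^sub>R v + pi x *\<^sub>R j v" for x by (simp add: pr_def)
  have "kaehler_metric N J (gF K)"
  proof (rule kaehler_gF)
    show "K (x + y) z = K x z + K y z" "K (c *\<^sub>R x) z = c * K x z" for x y z c
      by (simp_all add: K_def j_simps pr_add pr_scale G algebra_simps)
    show "K x y = K y x" for x y using G_sym[of "pr x" "pr y"] by (simp add: K_def)
    show "K (j x) (j y) = K x y" for x y by (simp add: K_def jj pr_j G_j)
    show "K x x > 0" if "x \<noteq> 0" for x
    proof (cases "pr x = 0")
      case True
      then have "x = pi (j x) *\<^sub>R v + pi x *\<^sub>R j v" using split[of x] by simp
      then have "pi (j x) \<noteq> 0 \<or> pi x \<noteq> 0" using that by auto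
      moreover have "K x x = (pi (j x))\<^sup>2 + (pi x)\<^sup>2" using G(2)[of 0 0 0] by (simp add: K_def True power2_eq_square)
      ultimately show ?thesis by (simp add: sum_power2_gt_zero_iff)
    next
      case False
      then show ?thesis using G_pos[OF False] by (simp add: K_def add_nonneg_pos)
    qed
    have pi_pr: "pi (pr x) = 0" "pi (j (pr x)) = 0" for x using pr_n1[of x] by (auto simp: n1_def)
    have B_pr: "pr (B (pr x)) = B (pr x)" "pi (j (B (pr x))) = 0" for x
      using n1_B[OF pr_n1[of x]] by (auto simp: n1_def pr_def)
    \<comment> \<open>Splitting off \<open>j v\<close> from both arguments leaves vectors of the
      ideal, on which \<open>j v\<close> acts as \<open>B\<close>; the last term is due to
      \<open>B v = a v\<close>.\<close>
    have br_xy: "br x y = pi x *\<^sub>R B (pr y) - pi y *\<^sub>R B (pr x) + (a * (pi x * pi (j y) - pi y * pi (j x))) *\<^sub>R v" for x y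
    proof -
      define x0 y0 where "x0 = pr x + pi (j x) *\<^sub>R v" and "y0 = pr y + pi (j y) *\<^sub>R v"
      have x: "x = x0 + pi x *\<^sub>R j v" and y: "y = y0 + pi y *\<^sub>R j v" using split by (auto simp: x0_def y0_def)
      have p0: "pi x0 = 0" "pi y0 = 0" by (simp_all add: x0_def y0_def pi_pr v)
      have "br x y = br x y0 + pi y *\<^sub>R br x (j v)" by (subst y) (simp add: br_add_right br_scale_right)
      also have "br x y0 = pi x *\<^sub>R B y0" by (rule br_ideal[OF p0(2)])
      also have "br x (j v) = br x0 (j v) + pi x *\<^sub>R br (j v) (j v)" by (subst x) (simp add: br_add_left br_scale_left)
      also have "\<dots> = - B x0" using br_swap[of x0 "j v"] br_ideal[OF p0(1), of "j v"] br_self by (simp add: v)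
      finally show ?thesis
        by (simp add: x0_def y0_def br_add_right br_scale_right v algebra_simps)
    qed
    have pr_v: "pr v = 0" by (simp add: pr_def v)
    define s where "s x y = G (j (B (pr x))) (pr y)" for x y
    have pr_br: "pr (br x y) = pi x *\<^sub>R B (pr y) - pi y *\<^sub>R B (pr x)"
      and pij_br: "pi (j (br x y)) = a * (pi x * pi (j y) - pi y * pi (j x))" for x y
    proof -
      show "pr (br x y) = pi x *\<^sub>R B (pr y) - pi y *\<^sub>R B (pr x)"
        unfolding br_xy[of x y] by (simp add: pr_add pr_diff pr_scale pr_v B_pr)
      show "pi (j (br x y)) = a * (pi x * pi (j y) - pi y * pi (j x))"
        unfolding br_xy[of x y] by (simp add: j_simps B_pr v)
    qed
    \<comment> \<open>\<open>j\<close> and \<open>B\<close> commute on \<open>n1\<close> and are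
      both skew for \<open>G\<close>, so their product is symmetric.\<close>
    have s_sym: "s x y = s y x" for x y
    proof -
      have "s x y = - G (B (pr x)) (j (pr y))"
        using G_j[of "j (B (pr x))" "pr y"] by (simp add: s_def jj Gm)
      also have "\<dots> = G (pr x) (B (j (pr y)))" using skew[OF pr_n1[of x] n1_j[OF pr_n1[of y]]] by simp
      also have "\<dots> = s y x" unfolding s_def B_j[OF pr_n1] by (rule G_sym)
      finally show ?thesis .
    qed
    have KW: "K (j (br x y)) z = a * (pi x * pi (j y) - pi y * pi (j x)) * pi z + pi x * s y z - pi y * s x z" for x y z
      unfolding K_def jj pr_j pr_br pij_br
      by (simp add: j_simps G Gm s_def diff_conv_add_uminus del: add_uminus_conv_diff)
    \<comment> \<open>The terms with \<open>a\<close> cancel identically in the cyclic sum, and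
      those with \<open>s\<close> cancel in pairs by symmetry.\<close>
    show "K (j (br x y)) z + K (j (br z x)) y + K (j (br y z)) x = 0" for x y z
      unfolding KW using s_sym[of y x] s_sym[of z x] s_sym[of z y] by (simp add: algebra_simps)
  qed
  then show ?thesis by blast
qed

text \<open>The family \<open>u\<close> is orthonormal for the averaged SKT metric, whereas the
  alternating form \<open>Om\<close> comes from the balanced one. \<open>balanced_algebra\<close>
  asks only for an expansion in \<open>u\<close>, and so delivers the trace in the very basis in
  which the SKT identity is summed.\<close>

theorem kaehler_ex:
  assumes dim: "DIM('e) = 2 * n" and "SKT_metric N J g1" and "balanced_metric n N J g2"
  shows "\<exists>g. kaehler_metric N J g"
proof -
  define m where "m = n - 1"
  have h1: "hermitian_metric N J g1" and skt: "vanishes N 4 (del J 3 (delbar J 2 (fundamental_form J g1)))"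
    using assms(2) by (auto simp: SKT_metric_def)
  have h2: "hermitian_metric N J g2"
    and bal: "vanishes N (2 * m + 1) (ext_d (2 * m) (wedge_power N (fundamental_form J g2) m))"
    using assms(3) by (auto simp: balanced_metric_def m_def)
  have dm: "dim n1 = 2 * m" using dim_n1 dim by (simp add: m_def)
  note G = G_add[OF h1] G_scale[OF h1] G_sym[OF h1] G_pos[OF h1] G_j[OF h1]
  have "\<exists>u. (\<forall>i<2*m. u i \<in> n1) \<and> (\<forall>i<2*m. \<forall>l<2*m. G g1 (u i) (u l) = (if i = l then 1 else 0)) \<and>
    (\<forall>i<m. u (2 * i + 1) = j (u (2 * i))) \<and> (\<forall>y\<in>n1. y = (\<Sum>i<2*m. G g1 y (u i) *\<^sub>R u i))"
    by (rule adapted_basis[of "G g1" j n1 m, OF G linear_j jj n1_subspace n1_j dm])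
  then obtain u where u: "\<And>i. i < 2 * m \<Longrightarrow> u i \<in> n1"
    and expand: "\<And>y. y \<in> n1 \<Longrightarrow> y = (\<Sum>i<2*m. G g1 y (u i) *\<^sub>R u i)" by blast
  have nz: "Om g2 m u \<noteq> 0"
    by (rule Om_nonzero[OF h2 dm u], assumption) (rule exI, erule expand)
  note bal_alg = balanced_algebra[OF Om_alternating[OF h2] nz Om_closed[OF h2 bal] u expand]
  obtain v a where v: "pi v = 0" "pi (j v) = 1" "B v = a *\<^sub>R v" using bal_alg(2) by blast
  have skew: "G g1 (B x) y + G g1 x (B y) = 0" if "x \<in> n1" "y \<in> n1" for x y
    by (rule skew_algebra[OF G(1-3) u expand bal_alg(1) SKT_identity[OF h1 skt v] that])
  show ?thesis by (rule invariant_kaehler[OF G v skew])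
qed

end


section \<open>The theorem\<close>

context lie begin

text \<open>\<open>pi\<close> is the coordinate along \<open>Z\<close> modulo the ideal, unique
  because \<open>Z\<close> is not in the ideal. Every bracket lies in the ideal, since modulo it
  only the bracket of \<open>Z0\<close> with itself could remain.\<close>

lemma almost_abelian_functional:
  assumes "almost_abelian (lie_algebra G M)"
  obtains pi :: "'e \<Rightarrow> real" and Z0 where "linear pi" "pi Z0 = 1" "\<And>x y. pi (br x y) = 0"
    "\<And>x y. pi x = 0 \<Longrightarrow> pi y = 0 \<Longrightarrow> br x y = 0"
proof -
  obtain I where I': "I \<subseteq> lie_algebra G M" "0 \<in> I" "\<forall>X\<in>I. \<forall>Y\<in>I. X + Y \<in> I"
      "\<forall>c::real. \<forall>X\<in>I. cscale (of_real c) X \<in> I" "\<forall>X\<in>lie_algebra G M. \<forall>Y\<in>I. bracket X Y \<in> I"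
      "\<forall>X\<in>I. \<forall>Y\<in>I. bracket X Y = 0"
    and "\<exists>Z\<in>lie_algebra G M - I. \<forall>X\<in>lie_algebra G M. \<exists>c::real. X - cscale (of_real c) Z \<in> I"
    using assms unfolding almost_abelian_def by (elim exE conjE) (rule that)
  then obtain Z where Z: "Z \<in> lie_algebra G M" "Z \<notin> I"
    "\<forall>X\<in>lie_algebra G M. \<exists>c::real. X - cscale (of_real c) Z \<in> I" by auto
  note I = I'(1,2) I'(3-6)[rule_format]
  obtain Z0 where Z0: "Z = lv Z0" using lie_algebra_lv[OF Z(1)] by blast
  define n where "n = {v. lv v \<in> I}"
  have n_add: "x + y \<in> n" if "x \<in> n" "y \<in> n" for x y using that I(3) by (simp add: n_def lv_add)
  have n_scale: "r *\<^sub>R x \<in> n" if "x \<in> n" for r x using that I(4)[of "lv x" r] by (simp add: n_def lv_scale)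
  have n_diff: "x - y \<in> n" if "x \<in> n" "y \<in> n" for x y using n_add[OF that(1) n_scale[OF that(2), of "-1"]] by simp
  have n_br: "br x y \<in> n" if "y \<in> n" for x y using that I(5)[OF lv_lie_algebra, of "lv y" x] by (simp add: n_def bracket_lv)
  have n_abelian: "br x y = 0" if "x \<in> n" "y \<in> n" for x y
  proof -
    have "lv (br x y) = lv 0" using that I(6)[of "lv x" "lv y"] by (simp add: n_def bracket_lv lv_zero)
    then show ?thesis by (simp only: lv_eq_iff)
  qed
  have ex: "\<exists>c. x - c *\<^sub>R Z0 \<in> n" for x
  proof -
    obtain c :: real where c: "lv x - cscale (of_real c) Z \<in> I" using bspec[OF Z(3) lv_lie_algebra] by (rule exE)
    have "lv x = lv (x - c *\<^sub>R Z0) + lv (c *\<^sub>R Z0)" by (simp add: lv_add[symmetric])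
    then have "lv (x - c *\<^sub>R Z0) = lv x - cscale (of_real c) Z" by (simp add: Z0 lv_scale)
    then show ?thesis using c unfolding n_def by (intro exI[of _ c]) simp
  qed
  have Z0n: "Z0 \<notin> n" using Z(2) by (simp add: n_def Z0)
  have uniq: "c = d" if "x - c *\<^sub>R Z0 \<in> n" "x - d *\<^sub>R Z0 \<in> n" for x c d
  proof (rule ccontr)
    assume "c \<noteq> d"
    have "(d - c) *\<^sub>R Z0 \<in> n" using n_diff[OF that] by (simp add: scaleR_diff_left)
    then have "(1 / (d - c)) *\<^sub>R ((d - c) *\<^sub>R Z0) \<in> n" by (rule n_scale)
    then show False using Z0n \<open>c \<noteq> d\<close> by simp
  qed
  obtain pi where pi: "\<And>x. x - pi x *\<^sub>R Z0 \<in> n" using ex by metis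
  have pi_eq: "pi x = c" if "x - c *\<^sub>R Z0 \<in> n" for x c using uniq[OF pi that] .
  have n0: "0 \<in> n" using I(2) by (simp add: n_def lv_zero)
  have pi_n: "pi x = 0 \<longleftrightarrow> x \<in> n" for x using pi[of x] pi_eq[of x 0] by auto
  show ?thesis
  proof (rule that)
    show "linear pi"
    proof (rule linearI)
      show "pi (x + y) = pi x + pi y" for x y
        by (rule pi_eq) (use n_add[OF pi[of x] pi[of y]] in \<open>simp add: algebra_simps\<close>)
      show "pi (r *\<^sub>R x) = r *\<^sub>R pi x" for r x
        by (rule pi_eq) (use n_scale[OF pi[of x], of r] in \<open>simp add: algebra_simps\<close>)
    qed
    show "pi Z0 = 1" by (rule pi_eq) (simp add: n0)
    show "br x y = 0" if "pi x = 0" "pi y = 0" for x y using n_abelian that by (simp add: pi_n)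
    show "pi (br x y) = 0" for x y
    proof -
      have swap: "br Z0 x + br x Z0 = 0" "br Z0 Z0 = 0" for x
      proof -
        have "lv (br Z0 x + br x Z0) = lv 0"
          by (simp add: lv_add bracket_lv[symmetric] lv_zero bracket_def fun_eq_iff)
        moreover have "lv (br Z0 Z0) = lv 0"
          by (simp add: bracket_lv[symmetric] lv_zero bracket_def fun_eq_iff)
        ultimately show "br Z0 x + br x Z0 = 0" "br Z0 Z0 = 0" by (simp_all only: lv_eq_iff)
      qed
      have "br x y = br x (y - pi y *\<^sub>R Z0) + pi y *\<^sub>R br x Z0"
        using br_add_right[of x "y - pi y *\<^sub>R Z0" "pi y *\<^sub>R Z0"] by (simp add: br_scale_right)
      moreover have "br x Z0 \<in> n"
      proof -
        have "br x Z0 = br (x - pi x *\<^sub>R Z0) Z0"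
          using br_add_left[of "x - pi x *\<^sub>R Z0" "pi x *\<^sub>R Z0" Z0] by (simp add: br_scale_left swap)
        also have "\<dots> = - br Z0 (x - pi x *\<^sub>R Z0)" using swap(1)[of "x - pi x *\<^sub>R Z0"] by (simp add: add_eq_0_iff)
        finally show ?thesis using n_scale[OF n_br[OF pi], of "-1"] by simp
      qed
      ultimately show ?thesis unfolding pi_n using n_add[OF n_br[OF pi] n_scale] by metis
    qed
  qed
qed

end

text \<open>The homotopies in \<open>simply_connected\<close> are free homotopies of loops: two
  constant loops are homotopic, and the track of the base point is a path between their
  values.\<close>

lemma simply_connected_path_connected:
  fixes S :: "'a::topological_space set"
  assumes "simply_connected S" shows "path_connected S"
  unfolding path_connected_component
proof (intro ballI)
  fix x y assume "x \<in> S" "y \<in> S"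
  then have "homotopic_loops S (\<lambda>_. x) (\<lambda>_. y)"
    using assms[unfolded simply_connected_def, rule_format, of "\<lambda>_. x" "\<lambda>_. y"]
    by (auto simp: path_def path_image_def pathstart_def pathfinish_def)
  then show "path_component S x y" using homotopic_loops_imp_path_component_value[of S _ _ 0] by fastforce
qed

theorem corollary3p7:
  fixes G :: "'g::{t2_space, second_countable_topology} monoid"
    and M :: "('g, 'e::euclidean_space) charted"
    and \<Gamma> :: "'g set"
    and J :: "'g set vfield \<Rightarrow> 'g set vfield"
    and n :: nat
  assumes "lie_group G M"
    and "simply_connected (UNIV :: 'g set)"
    and "almost_abelian (lie_algebra G M)"
    and "uniform_lattice G M \<Gamma>"
    and "DIM('e) = 2 * n"
    and "invariant_complex_structure_on_quotient G \<Gamma> M J"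
    and "\<exists>g. SKT_metric (quotient_manifold G \<Gamma> M) J g"
    and "\<exists>g. balanced_metric n (quotient_manifold G \<Gamma> M) J g"
  shows "\<exists>g. kaehler_metric (quotient_manifold G \<Gamma> M) J g"
proof -
  interpret lie G M by unfold_locales (rule assms(1))
  obtain pi :: "'e \<Rightarrow> real" and Z0 where pi: "linear pi" "pi Z0 = 1" "\<And>x y. pi (br x y) = 0"
    "\<And>x y. pi x = 0 \<Longrightarrow> pi y = 0 \<Longrightarrow> br x y = 0"
    by (rule almost_abelian_functional[OF assms(3)]) (rule that)
  have conn: "connected (UNIV :: 'g set)"
    by (rule path_connected_imp_connected, rule simply_connected_path_connected) (rule assms(2))
  interpret lie_solv G M \<Gamma> pi Z0
    by unfold_locales (use assms(4) conn pi in \<open>auto simp: linear_add[OF pi(1)] linear_scale[OF pi(1)]\<close>)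
  obtain j where j: "\<And>v. J (E v) = E (j v)" using complex_structure_E[OF assms(6)] by metis
  have J: "complex_structure Q J" using assms(6) by (simp add: invariant_complex_structure_on_quotient_def)
  have "framed Q J E br j Avg pi Z0"
  proof unfold_locales
    show "points Q \<noteq> {}" by (simp add: points_Q)
    show "c b = 0" if "q \<in> points Q" "\<And>f. f \<in> smooth_funs Q \<Longrightarrow> (\<Sum>b\<in>Basis. c b * E b f q) = 0" "b \<in> Basis" for q c b
      using frame_unique[of c] that by (auto simp: points_Q)
    show "Re (Avg f) > 0" if "f \<in> smooth_funs Q" "\<And>q. q \<in> points Q \<Longrightarrow> Re (f q) > 0" for f
      using Avg_pos that by (auto simp: points_Q)
    show "Avg f \<noteq> 0" if "f \<in> smooth_funs Q" "\<And>q. f q \<in> \<real>" "\<And>q. q \<in> points Q \<Longrightarrow> f q \<noteq> 0" for f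
      using Avg_nonzero that by (auto simp: points_Q)
  qed (fact J E_real_field E_add E_scale bracket_E j frame Avg_add Avg_scale Avg_real Avg_E br_add_left br_scale_left | simp add: linear_add[OF pi(1)] linear_scale[OF pi(1)] pi)+
  then show ?thesis using framed.kaehler_ex[OF _ assms(5)] assms(7,8) by blast
qed

end
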